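(* Let $s=2$ for classic Quicksort (CQS) and $s=3$ for Yaroslavskiy's dual-pivot Quicksort (YQS). Let $\mathbf t=(t_1,\dots,t_s)\in\mathbb N^s$ (with $0\in\mathbb N$) be the pivot sampling parameter, let $k=t_1+\cdots+t_s+s-1$, and write $\alpha_l=t_l+1$ for $1\le l\le s$ (so $\mathbf t=\boldsymbol\alpha-1$) and $\kappa=k+1=\alpha_1+\cdots+\alpha_s$. Fix one of the three branch prediction schemes 1-bit, 2-bit sc, 2-bit fc. Let $\mathbb E[BM_n^{\mathrm{CQS}}]$ and $\mathbb E[BM_n^{\mathrm{YQS}}]$ be the expected number of branch misses incurred when sorting a random permutation of length $n$ with CQS resp. YQS under generalized pivot sampling with parameter $\mathbf t$. Then $$\mathbb E[BM_n^{\mathrm{CQS}}]\sim \frac{a_{\mathrm{CQS}}}{\mathcal H}\,n\ln n \qquad\text{and}\qquad \mathbb E[BM_n^{\mathrm{YQS}}]\sim \frac{a_{\mathrm{YQS}}}{\mathcal H}\,n\ln n ,$$ where $\mathcal H=\mathcal H(\mathbf t)=\sum_{l=1}^s\frac{t_l+1}{k+1}\bigl(H_{k+1}-H_{t_l+1}\bigr)$ with $H_m=\sum_{i=1}^m 1/i$, and $$a_{\mathrm{CQS}}=g_{\alpha_1,\alpha_2},$$ $$\begin{aligned}a_{\mathrm{YQS}}={}&\tfrac{\alpha_1}{\kappa}\,g_{\alpha_1+1,\,\alpha_2+\alpha_3}+\tfrac{\alpha_2}{\kappa}\,g_{\alpha_1,\,\alpha_2+\alpha_3+1}\\&+\tf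rac{\alpha_1\alpha_2}{\kappa(\kappa+1)}\,g_{\alpha_2+1,\,\alpha_3}+\tfrac{\alpha_1\alpha_3}{\kappa(\kappa+1)}\,g_{\alpha_2,\,\alpha_3+1}+\tfrac{\alpha_2(\alpha_2+1)}{\kappa(\kappa+1)}\,g_{\alpha_2+2,\,\alpha_3}+\tfrac{\alpha_2\alpha_3}{\kappa(\kappa+1)}\,g_{\alpha_2+1,\,\alpha_3+1}\\&+\tfrac{\alpha_3}{\kappa}\,g_{\alpha_1+\alpha_2,\,\alpha_3+1}\\&+\tfrac{\alpha_1\alpha_3}{\kappa(\kappa+1)}\,g_{\alpha_1+1,\,\alpha_2}+\tfrac{\alpha_2\alpha_3}{\kappa(\kappa+1)}\,g_{\alpha_1,\,\alpha_2+1},\end{aligned}$$ where $g_{x,y}$ depends on the prediction scheme: (i) 1-bit: $g_{x,y}=\dfrac{2xy}{(x+y)(x+y+1)}$; (ii) 2-bit sc: $g_{x,y}=\tfrac12\,\gamma^{(2)}_{x,y}$; (iii) 2-bit fc: $g_{x,y}=\dfrac{2xy}{(x+y)(x+y+1)}\,\gamma^{(1)}_{x+1,y+1}+\gamma^{(1)}_{x,y}$; with $$\gamma^{(c)}_{a,b}=\frac1{B(a,b)}\int_0^1\frac{x^a(1-x)^b}{\frac1c-x(1-x)}\,dx,\qquad B(a,b)=\int_0^1x^{a-1}(1-x)^{b-1}\,dx .$$ In the limit $k\to\infty$ such that $\mathbf t/k\to\boldsymbol\tau=(\tau_1,\dots,\tau_s)\in[0,1]^s$, we find $$\mathbb E[BM_n]\sim\frac{a^*}{\mathcal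 H^*}\,n\ln n$$ for $\mathcal H^*=\mathcal H^*(\boldsymbol\tau)=-\sum_{l=1}^s\tau_l\ln(\tau_l)$ and an algorithm-dependent constant $a^*$: $$a^*_{\mathrm{CQS}}=f(\tau_1)$$ and $$a^*_{\mathrm{YQS}}=(\tau_1+\tau_2)\,f(\tau_2+\tau_3)+(\tau_1+\tau_2)(\tau_2+\tau_3)\,f(\tau_2)+\tau_3\,f(\tau_1+\tau_2)+\tau_3(\tau_1+\tau_2)\,f(\tau_1),$$ where $f$ is the steady-state miss-rate function of the prediction scheme: $$f_{\text{1-bit}}(p)=2p(1-p),\quad f_{\text{2-bit sc}}(p)=\frac{p(1-p)}{1-2p(1-p)},\quad f_{\text{2-bit fc}}(p)=\frac{2p^2(1-p)^2+p(1-p)}{1-p(1-p)}.$$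
   Context: **Input model.** The input is an array of $n$ distinct elements in uniformly random order; equivalently, $n$ i.i.d. random variables uniform on $(0,1)$. **Quicksort with generalized pivot sampling.** A (sub)array with at most $w$ elements is sorted by Insertionsort, where $w\ge k$ is a constant. A larger (sub)array is treated as follows. A random sample of $k$ elements is taken and sorted as $V_{(1)}\le\dots\le V_{(k)}$. For CQS ($s=2$, $k=t_1+t_2+1$) the pivot is $P=V_{(t_1+1)}$. For YQS ($s=3$, $k=t_1+t_2+t_3+2$) the pivots are $P=V_{(t_1+1)}$ and $Q=V_{(t_1+t_2+2)}$. The remaining "ordinary" elements (those not in the sample) are partitioned with respect to the pivot(s) by the procedures below; the sample elements are excluded from partitioning, since it is already known to which part they belong. Then the $s$ parts are sorted recursively and independently. The implementation is assumed to preserve randomness in recursive calls. **CQS partitioning** (pivot $p$; the ordinary elements lie to the left of position $right$, starting at $left$; a sentinel to the left of the range stops the index $g$): $k\gets left-1$; $g\gets right$; do { do $k\gets k+1$ while $A[k]<p$; do $g\gets g-1$ while $A[g]>p$; if $g>k$ then swap $A[k],A[g]$ } while $g>k$; return $k$. (In these procedures, $k$ is an index variable, unrelated to the sample size.) **YQS partitioning** (pivots $p<q$; ordinary elements in $A[left..right]$): $\ell\gets left$; $g\gets right$; $k\gets\ell$; while $k\le g$ { if $A[k]<p$ { swap $A[k],A[\ell]$; $\ell\gets\ell+1$ } else if $A[k]\ge q$ { while ($A[g]>q$ and $k<g$) { $g\gets g-1$ }; if $A[g]\ge p$ { swap $A[k],A[g]$ } else { swap $A[k],A[g]$; swap $A[k],A[\ell]$;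 $\ell\gets\ell+1$ }; $g\gets g-1$ } $k\gets k+1$ }; return $(\ell-1,g+1)$. **Branches and prediction.** Every elementary test in the code (each key comparison and each index comparison) is a conditional branch at its own code location, each execution of which is either "taken" or "not taken". Every location has its own predictor, a finite automaton whose state determines the prediction for the next execution of that location and is then updated with the actual outcome; different locations do not influence each other. A branch miss is an execution whose outcome differs from the prediction; $BM_n$ is the total number of branch misses during sorting. The schemes are: - 1-bit: predict the outcome of the previous execution of the same location. - 2-bit sc (saturating counter): states $1,2,3,4$; states $1,2$ predict "taken", states $3,4$ predict "not taken"; on outcome "taken" move from $i$ to $\max(i-1,1)$, on "not taken" move from $i$ to $\min(i+1,4)$. - 2-bit fc (flip-on-consecutive): states $1,2,3,4$; states $1,2$ predict "taken", states $3,4$ predict "not taken"; on "taken": $1\to1$, $2\to1$, $3\to1$, $4\to3$; on "not taken": $1\to2$, $2\to4$, $3\to4$, $4\to4$. **Steady-state miss-rate function.** $f(p)$ is the probability of a branch miss when the automaton is in its stationary distribution and branch outcomes are i.i.d. "taken" with probability $p$. The symbol $\sim$ denotes asymptotic equivalence for $n\to\infty$; in the first part $\mathbf t$ (hence $k$) and $w$ are constants.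
   Formalization: In a*_YQS, f(τ_2) and f(τ_1) are corrected to f(τ_2/(τ_2+τ_3)) and f(τ_1/(τ_1+τ_2)); the printed formula contradicts the limit of a_YQS (1-bit, τ=(1/3,1/3,1/3): 20/27 instead of 7/9). *)

theory Defs
  imports
    "HOL-Probability.Probability"
    "HOL-Combinatorics.Multiset_Permutations"
    "HOL-Library.Landau_Symbols"
    "HOL-Library.Monad_Syntax"
begin

section \<open>Algorithms, code locations and branch traces\<close>

datatype algorithm = CQS | YQS

fun num_parts :: "algorithm \<Rightarrow> nat" where
  "num_parts CQS = 2"
| "num_parts YQS = 3"

text \<open>
  A sampling parameter \<open>t\<close> is a function of which only \<open>t 1, \<dots>, t s\<close> matter,
  where \<open>s = num_parts alg\<close>.
\<close>

definition sample_size :: "algorithm \<Rightarrow> (nat \<Rightarrow> nat) \<Rightarrow> nat" where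
  "sample_size alg t = (\<Sum>l = 1..num_parts alg. t l) + num_parts alg - 1"

datatype insertion_test = Outer_Loop | Inner_Index | Inner_Key

text \<open>
  One constructor per elementary test in the code.  The sample and the small subarrays are
  sorted by two separate copies of Insertionsort.
\<close>

datatype location =
    Size_Test
  | Sample_Sort insertion_test
  | Leaf_Sort insertion_test
  | CQS_Key_k     \<comment> \<open>\<open>A[k] < p\<close>\<close>
  | CQS_Key_g     \<comment> \<open>\<open>A[g] > p\<close>\<close>
  | CQS_If        \<comment> \<open>\<open>if g > k\<close>\<close>
  | CQS_While     \<comment> \<open>\<open>while g > k\<close>\<close>
  | YQS_While     \<comment> \<open>\<open>while k \<le> g\<close>\<close>
  | YQS_Key_k_p   \<comment> \<open>\<open>A[k] < p\<close>\<close>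
  | YQS_Key_k_q   \<comment> \<open>\<open>A[k] \<ge> q\<close>\<close>
  | YQS_Key_g_q   \<comment> \<open>\<open>A[g] > q\<close>\<close>
  | YQS_Index_k_g \<comment> \<open>\<open>k < g\<close>\<close>
  | YQS_Key_g_p   \<comment> \<open>\<open>A[g] \<ge> p\<close>\<close>

text \<open>
  A trace lists the executed branches in temporal order; the outcome \<open>True\<close> ("taken") means that
  the test succeeded.  All prediction schemes below are symmetric under exchanging "taken" and
  "not taken" (together with a relabelling of the states), so this convention is immaterial as
  long as the initial states of the predictors are arbitrary.
\<close>

type_synonym trace = "(location \<times> bool) list"


section \<open>Insertionsort\<close>

text \<open>
  \<open>isort_insert L x ys\<close> inserts \<open>x\<close> into the already sorted prefix of the array.  The prefix
  \<open>ys\<close> is given in reverse, i.e. in the order in which it is scanned: the inner loop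
  \<open>while j \<ge> 1 and A[j] > x\<close> walks down from the last element of the prefix.
\<close>

fun isort_insert :: "(insertion_test \<Rightarrow> location) \<Rightarrow> nat \<Rightarrow> nat list \<Rightarrow> trace \<times> nat list" where
  "isort_insert L x [] = ([(L Inner_Index, False)], [x])"
| "isort_insert L x (y # ys) =
     (if y > x
      then (let (tr, zs) = isort_insert L x ys
            in ((L Inner_Index, True) # (L Inner_Key, True) # tr, y # zs))
      else ([(L Inner_Index, True), (L Inner_Key, False)], x # y # ys))"

fun isort_loop ::
  "(insertion_test \<Rightarrow> location) \<Rightarrow> nat list \<Rightarrow> nat list \<Rightarrow> trace \<times> nat list" where
  "isort_loop L ys [] = ([(L Outer_Loop, False)], rev ys)"
| "isort_loop L ys (x # xs) =
     (let (tr1, zs) = isort_insert L x ys;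
          (tr2, rs) = isort_loop L zs xs
      in ((L Outer_Loop, True) # tr1 @ tr2, rs))"

definition insertionsort ::
  "(insertion_test \<Rightarrow> location) \<Rightarrow> nat list \<Rightarrow> trace \<times> nat list" where
  "insertionsort L xs =
     (case xs of [] \<Rightarrow> ([(L Outer_Loop, False)], []) | x # xs' \<Rightarrow> isort_loop L [x] xs')"


section \<open>Partitioning\<close>

text \<open>
  The procedures work on an array \<open>A\<close> that holds the ordinary elements \<open>U\<close> at positions
  \<open>1, \<dots>, length U\<close>, so \<open>left = 1\<close>.  They extend the trace \<open>tr\<close> recorded so far.
\<close>

definition swap_at :: "'a list \<Rightarrow> nat \<Rightarrow> nat \<Rightarrow> 'a list" where
  "swap_at A i j = A[i := A ! j, j := A ! i]"

partial_function (tailrec) cqs_scan_k ::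
  "nat list \<Rightarrow> nat \<Rightarrow> nat \<Rightarrow> trace \<Rightarrow> nat \<times> trace" where
  "cqs_scan_k A p k tr =
     (if A ! (k + 1) < p then cqs_scan_k A p (k + 1) (tr @ [(CQS_Key_k, True)])
      else (k + 1, tr @ [(CQS_Key_k, False)]))"

partial_function (tailrec) cqs_scan_g ::
  "nat list \<Rightarrow> nat \<Rightarrow> nat \<Rightarrow> trace \<Rightarrow> nat \<times> trace" where
  "cqs_scan_g A p g tr =
     (if A ! (g - 1) > p then cqs_scan_g A p (g - 1) (tr @ [(CQS_Key_g, True)])
      else (g - 1, tr @ [(CQS_Key_g, False)]))"

partial_function (tailrec) cqs_loop ::
  "nat list \<Rightarrow> nat \<Rightarrow> nat \<Rightarrow> nat \<Rightarrow> trace \<Rightarrow> nat list \<times> nat \<times> trace" where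
  "cqs_loop A p k g tr =
     (let (k', tr1) = cqs_scan_k A p k tr;
          (g', tr2) = cqs_scan_g A p g tr1
      in if g' > k'
         then cqs_loop (swap_at A k' g') p k' g' (tr2 @ [(CQS_If, True), (CQS_While, True)])
         else (A, k', tr2 @ [(CQS_If, False), (CQS_While, False)]))"

text \<open>
  Input elements are positive, so \<open>0\<close> at position \<open>0\<close> is a sentinel for \<open>g\<close>;
  the pivot at position \<open>right\<close> stops \<open>k\<close>.
\<close>

definition cqs_partition :: "nat \<Rightarrow> nat list \<Rightarrow> nat list \<times> nat \<times> trace" where
  "cqs_partition p U = cqs_loop (0 # U @ [p]) p 0 (length U + 1) []"

partial_function (tailrec) yqs_scan_g ::
  "nat list \<Rightarrow> nat \<Rightarrow> nat \<Rightarrow> nat \<Rightarrow> trace \<Rightarrow> nat \<times> trace" where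
  "yqs_scan_g A q k g tr =
     (if A ! g > q
      then (if k < g
            then yqs_scan_g A q k (g - 1) (tr @ [(YQS_Key_g_q, True), (YQS_Index_k_g, True)])
            else (g, tr @ [(YQS_Key_g_q, True), (YQS_Index_k_g, False)]))
      else (g, tr @ [(YQS_Key_g_q, False)]))"

partial_function (tailrec) yqs_loop ::
  "nat list \<Rightarrow> nat \<Rightarrow> nat \<Rightarrow> nat \<Rightarrow> nat \<Rightarrow> nat \<Rightarrow> trace \<Rightarrow> nat list \<times> (nat \<times> nat) \<times> trace" where
  "yqs_loop A p q l k g tr =
     (if k \<le> g
      then (if A ! k < p
            then yqs_loop (swap_at A k l) p q (l + 1) (k + 1) g
                   (tr @ [(YQS_While, True), (YQS_Key_k_p, True)])
            else if A ! k \<ge> q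
            then (let (g', tr') = yqs_scan_g A q k g
                        (tr @ [(YQS_While, True), (YQS_Key_k_p, False), (YQS_Key_k_q, True)])
                  in if A ! g' \<ge> p
                     then yqs_loop (swap_at A k g') p q l (k + 1) (g' - 1)
                            (tr' @ [(YQS_Key_g_p, True)])
                     else yqs_loop (swap_at (swap_at A k g') k l) p q (l + 1) (k + 1) (g' - 1)
                            (tr' @ [(YQS_Key_g_p, False)]))
            else yqs_loop A p q l (k + 1) g
                   (tr @ [(YQS_While, True), (YQS_Key_k_p, False), (YQS_Key_k_q, False)]))
      else (A, (l - 1, g + 1), tr @ [(YQS_While, False)]))"

definition yqs_partition ::
  "nat \<Rightarrow> nat \<Rightarrow> nat list \<Rightarrow> nat list \<times> (nat \<times> nat) \<times> trace" where
  "yqs_partition p q U = yqs_loop (0 # U) p q 1 1 (length U) []"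


section \<open>Quicksort with generalized pivot sampling\<close>

definition subarray :: "'a list \<Rightarrow> nat \<Rightarrow> nat \<Rightarrow> 'a list" where
  "subarray A i j = map ((!) A) [i..<j]"  \<comment> \<open>\<open>A[i..j-1]\<close>\<close>

text \<open>
  One partitioning step with sample \<open>V\<close> and ordinary elements \<open>U\<close> (each in array order): the
  recorded trace and the subarrays for the recursive calls.  The non-pivot sample elements join
  their subarray in their \<^emph>\<open>original\<close> relative order (a sorted copy of \<open>V\<close> only serves to select
  the pivots).  As the partitioning procedures never compare two ordinary elements with each
  other, the subarrays of a randomly ordered array are again in uniformly random order and
  independent, given their sizes: this implementation preserves randomness.
\<close>

fun divide :: "algorithm \<Rightarrow> (nat \<Rightarrow> nat) \<Rightarrow> nat list \<Rightarrow> nat list \<Rightarrow> trace \<times> nat list list" where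
  "divide CQS t V U =
     (let (tr1, W) = insertionsort Sample_Sort V;
          p = W ! t 1;
          (A, i, tr2) = cqs_partition p U
      in (tr1 @ tr2,
          [filter (\<lambda>v. v < p) V @ subarray A 1 i,
           filter (\<lambda>v. p < v) V @ subarray A i (length U + 1)]))"
| "divide YQS t V U =
     (let (tr1, W) = insertionsort Sample_Sort V;
          p = W ! t 1;
          q = W ! (t 1 + t 2 + 1);
          (A, (i, j), tr2) = yqs_partition p q U
      in (tr1 @ tr2,
          [filter (\<lambda>v. v < p) V @ subarray A 1 (i + 1),
           filter (\<lambda>v. p < v \<and> v < q) V @ subarray A (i + 1) j,
           filter (\<lambda>v. q < v) V @ subarray A j (length U + 1)]))"

text \<open>
  The sample is a uniformly random set of \<open>k\<close> positions.  The result is the distribution of the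
  trace for the given input.  The first argument bounds the recursion depth; the bound in
  \<open>quicksort\<close> is never reached, since subarrays are strictly shorter than the array.
\<close>

primrec quicksort_depth ::
  "nat \<Rightarrow> algorithm \<Rightarrow> (nat \<Rightarrow> nat) \<Rightarrow> nat \<Rightarrow> nat list \<Rightarrow> trace pmf" where
  "quicksort_depth 0 alg t w xs = return_pmf []"
| "quicksort_depth (Suc d) alg t w xs =
     (if length xs \<le> w
      then return_pmf ((Size_Test, True) # fst (insertionsort Leaf_Sort xs))
      else do {
        S \<leftarrow> pmf_of_set {S. S \<subseteq> {..<length xs} \<and> card S = sample_size alg t};
        let (tr, yss) = divide alg t (nths xs S) (nths xs (- S));
        rec \<leftarrow> foldr (\<lambda>ys rest. do { tr1 \<leftarrow> quicksort_depth d alg t w ys;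
                                     tr2 \<leftarrow> rest;
                                     return_pmf (tr1 @ tr2) })
                 yss (return_pmf []);
        return_pmf ((Size_Test, False) # tr @ rec)
      })"

definition quicksort :: "algorithm \<Rightarrow> (nat \<Rightarrow> nat) \<Rightarrow> nat \<Rightarrow> nat list \<Rightarrow> trace pmf" where
  "quicksort alg t w xs = quicksort_depth (Suc (length xs)) alg t w xs"


section \<open>Branch prediction\<close>

datatype scheme = One_Bit | Two_Bit_SC | Two_Bit_FC

text \<open>The 1-bit predictor is in state \<open>1\<close> if the previous outcome was "taken", else in state \<open>2\<close>.\<close>

fun states :: "scheme \<Rightarrow> nat set" where
  "states One_Bit = {1, 2}"
| "states Two_Bit_SC = {1, 2, 3, 4}"
| "states Two_Bit_FC = {1, 2, 3, 4}"

fun predict :: "scheme \<Rightarrow> nat \<Rightarrow> bool" where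
  "predict One_Bit i = (i = 1)"
| "predict Two_Bit_SC i = (i \<in> {1, 2})"
| "predict Two_Bit_FC i = (i \<in> {1, 2})"

fun update :: "scheme \<Rightarrow> nat \<Rightarrow> bool \<Rightarrow> nat" where
  "update One_Bit i b = (if b then 1 else 2)"
| "update Two_Bit_SC i b = (if b then max (i - 1) 1 else min (i + 1) 4)"
| "update Two_Bit_FC i b =
     (if b then (if i = 4 then 3 else 1) else (if i = 1 then 2 else 4))"

text \<open>
  \<open>\<sigma> x\<close> is the current state of the predictor of location \<open>x\<close>.  Predictor states persist through
  the whole sorting process.
\<close>

fun misses :: "scheme \<Rightarrow> (location \<Rightarrow> nat) \<Rightarrow> trace \<Rightarrow> nat" where
  "misses sch \<sigma> [] = 0"
| "misses sch \<sigma> ((x, b) # tr) =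
     (if predict sch (\<sigma> x) \<noteq> b then 1 else 0) + misses sch (\<sigma>(x := update sch (\<sigma> x) b)) tr"

text \<open>\<open>\<sigma>\<close> gives the initial states of the predictors.\<close>

definition expected_BM ::
  "algorithm \<Rightarrow> scheme \<Rightarrow> (nat \<Rightarrow> nat) \<Rightarrow> nat \<Rightarrow> (location \<Rightarrow> nat) \<Rightarrow> nat \<Rightarrow> real" where
  "expected_BM alg sch t w \<sigma> n =
     measure_pmf.expectation
       (pmf_of_set (permutations_of_set {1..n}) \<bind> quicksort alg t w)
       (\<lambda>tr. real (misses sch \<sigma> tr))"

definition stationary :: "scheme \<Rightarrow> real \<Rightarrow> nat pmf \<Rightarrow> bool" where
  "stationary sch p \<pi> \<longleftrightarrow>
     set_pmf \<pi> \<subseteq> states sch \<and>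
     \<pi> \<bind> (\<lambda>i. map_pmf (update sch i) (bernoulli_pmf p)) = \<pi>"

definition steady_miss_rate :: "scheme \<Rightarrow> real \<Rightarrow> real" where
  "steady_miss_rate sch p =
     measure_pmf.prob (pair_pmf (THE \<pi>. stationary sch p \<pi>) (bernoulli_pmf p))
       {(i, b). predict sch i \<noteq> b}"


section \<open>The constants\<close>

definition \<H> :: "algorithm \<Rightarrow> (nat \<Rightarrow> nat) \<Rightarrow> real" where
  "\<H> alg t =
     (let k = sample_size alg t
      in \<Sum>l = 1..num_parts alg. real (t l + 1) / real (k + 1) * (harm (k + 1) - harm (t l + 1)))"

definition \<gamma> :: "real \<Rightarrow> nat \<Rightarrow> nat \<Rightarrow> real" where
  "\<gamma> c a b =
     1 / Beta (real a) (real b) *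
     integral {0..1} (\<lambda>x::real. x ^ a * (1 - x) ^ b / (1 / c - x * (1 - x)))"

fun g_coeff :: "scheme \<Rightarrow> nat \<Rightarrow> nat \<Rightarrow> real" where
  "g_coeff One_Bit x y = 2 * real x * real y / (real (x + y) * real (x + y + 1))"
| "g_coeff Two_Bit_SC x y = 1 / 2 * \<gamma> 2 x y"
| "g_coeff Two_Bit_FC x y =
     2 * real x * real y / (real (x + y) * real (x + y + 1)) * \<gamma> 1 (x + 1) (y + 1) + \<gamma> 1 x y"

fun a_coeff :: "algorithm \<Rightarrow> scheme \<Rightarrow> (nat \<Rightarrow> nat) \<Rightarrow> real" where
  "a_coeff CQS sch t = g_coeff sch (t 1 + 1) (t 2 + 1)"
| "a_coeff YQS sch t =
     (let \<alpha>1 = t 1 + 1; \<alpha>2 = t 2 + 1; \<alpha>3 = t 3 + 1;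
          \<kappa> = real (\<alpha>1 + \<alpha>2 + \<alpha>3);
          g = g_coeff sch
      in \<alpha>1 / \<kappa> * g (\<alpha>1 + 1) (\<alpha>2 + \<alpha>3)
       + \<alpha>2 / \<kappa> * g \<alpha>1 (\<alpha>2 + \<alpha>3 + 1)
       + \<alpha>1 * \<alpha>2 / (\<kappa> * (\<kappa> + 1)) * g (\<alpha>2 + 1) \<alpha>3
       + \<alpha>1 * \<alpha>3 / (\<kappa> * (\<kappa> + 1)) * g \<alpha>2 (\<alpha>3 + 1)
       + \<alpha>2 * (\<alpha>2 + 1) / (\<kappa> * (\<kappa> + 1)) * g (\<alpha>2 + 2) \<alpha>3
       + \<alpha>2 * \<alpha>3 / (\<kappa> * (\<kappa> + 1)) * g (\<alpha>2 + 1) (\<alpha>3 + 1)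
       + \<alpha>3 / \<kappa> * g (\<alpha>1 + \<alpha>2) (\<alpha>3 + 1)
       + \<alpha>1 * \<alpha>3 / (\<kappa> * (\<kappa> + 1)) * g (\<alpha>1 + 1) \<alpha>2
       + \<alpha>2 * \<alpha>3 / (\<kappa> * (\<kappa> + 1)) * g \<alpha>1 (\<alpha>2 + 1))"

text \<open>\<open>ln 0 = 0\<close>, so summands with \<open>\<tau> l = 0\<close> vanish, as is usual for the entropy.\<close>

definition \<H>_limit :: "algorithm \<Rightarrow> (nat \<Rightarrow> real) \<Rightarrow> real" where
  "\<H>_limit alg \<tau> = - (\<Sum>l = 1..num_parts alg. \<tau> l * ln (\<tau> l))"

text \<open>
  \<open>A[k] \<ge> q\<close> is only tested if \<open>A[k]\<close> is not small, and \<open>A[g] \<ge> p\<close> (up to one execution per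
  partitioning step) only if \<open>A[g]\<close> is not large.  The arguments of \<open>f\<close> are therefore the
  \<^emph>\<open>conditional\<close> probabilities \<open>\<tau>\<^sub>2 / (\<tau>\<^sub>2 + \<tau>\<^sub>3)\<close> and \<open>\<tau>\<^sub>1 / (\<tau>\<^sub>1 + \<tau>\<^sub>2)\<close>, which also are the limits of
  the means \<open>x / (x + y)\<close> of the terms \<open>g\<^bsub>x,y\<^esub>\<close> of \<open>a_coeff\<close> for these locations.  With the
  unconditional \<open>f(\<tau>\<^sub>2)\<close> and \<open>f(\<tau>\<^sub>1)\<close>, \<open>a_coeff\<close> would not converge to this constant.
  A denominator \<open>0\<close> only occurs in a summand whose factor in front of \<open>f\<close> is \<open>0\<close>.
\<close>

fun a_limit :: "algorithm \<Rightarrow> scheme \<Rightarrow> (nat \<Rightarrow> real) \<Rightarrow> real" where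
  "a_limit CQS sch \<tau> = steady_miss_rate sch (\<tau> 1)"
| "a_limit YQS sch \<tau> =
     (let f = steady_miss_rate sch
      in (\<tau> 1 + \<tau> 2) * f (\<tau> 2 + \<tau> 3)
       + (\<tau> 1 + \<tau> 2) * (\<tau> 2 + \<tau> 3) * f (\<tau> 2 / (\<tau> 2 + \<tau> 3))
       + \<tau> 3 * f (\<tau> 1 + \<tau> 2)
       + \<tau> 3 * (\<tau> 1 + \<tau> 2) * f (\<tau> 1 / (\<tau> 1 + \<tau> 2)))"

end

theory Submission
  imports Defs
begin

text \<open>
  The misses at different code locations are treated separately.  All locations except the key
  comparisons of the partitioning loops fail a bounded number of times per call and contribute
  \<open>O(n)\<close>.  At a key comparison, the outcomes in one partitioning step are a function of the word of
  classes of the inspected elements.  On a random input, the class word has the law of a Polya urn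
  with initial weights \<open>t l + 1\<close>, that is, of i.i.d. letters whose distribution is drawn from the
  Dirichlet law; each parameter that occurs is a function of Beta variables.  For i.i.d. outcomes,
  the solution of Poisson's equation for the predictor chain shows that \<open>m\<close> outcomes incur
  \<open>m f(p)\<close> misses up to a bounded error, uniformly in \<open>p\<close> and in the initial state.  Integration
  over the Beta law turns \<open>f\<close> into \<open>g\<close>, so that one step costs \<open>a n + o(n)\<close> whatever state the previous
  calls left behind.  The recursion is solved by \<open>a / H * (n + 1) H(n + 1)\<close>: the expectation of
  \<open>\<Sum> x_l H(x_l)\<close> over the final contents \<open>x_l\<close> of the urn is known exactly, and the
  remaining terms are absorbed by a supersolution (and a subsolution) of lower order.

  As \<open>k\<close> tends to infinity, the Beta law concentrates at its mean, and \<open>a\<close> and \<open>H\<close> converge.  If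
  \<open>\<tau>\<close> is a unit vector, then \<open>H\<close> tends to \<open>0\<close>, the quotient of the limits is \<open>0\<close> by the convention
  \<open>x / 0 = 0\<close>, and this is the limit of \<open>a / H\<close>, because \<open>a\<close> is bounded by the total weight of the
  vanishing classes and \<open>H\<close> exceeds any multiple of it.
\<close>

section \<open>Branch predictors\<close>

text \<open>The predictor state at the start of a call depends on the whole past, so the cost of a
  call is not a function of its size. Every estimate is therefore made for all initial states at
  once, which avoids a recurrence for the distribution of states. The error in Poisson's equation
  has to be uniform in the probability too, because the probability is itself random and may be
  close to 0 or 1.

  Randomness preservation is proved by counting: an input is encoded by the pattern of its sample,
  its class word and its parts. The encoding is injective, and there are n! codes because the Polya
  weights sum to 1.

  The Dirichlet law is used only through stick breaking. The class whose share is split off first is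
  chosen per location (small for index k, large for index g), so that each rate is a sum of products
  of functions of one Beta variable and only integrals over [0,1] occur.

  The number of elements that an index inspects depends on the same word as the outcomes. Replacing
  it by its mean costs a square root of the length, the dominant error of one step.\<close>

definition outcomes :: "location \<Rightarrow> trace \<Rightarrow> bool list" where
  "outcomes x tr = map snd (filter (\<lambda>e. fst e = x) tr)"

lemma outcomes_simps [simp]:
  "outcomes x [] = []"
  "outcomes x ((y, b) # tr) = (if y = x then b # outcomes x tr else outcomes x tr)"
  "outcomes x (tr1 @ tr2) = outcomes x tr1 @ outcomes x tr2"
  by (auto simp: outcomes_def)

fun miss_count :: "scheme \<Rightarrow> nat \<Rightarrow> bool list \<Rightarrow> nat" where
  "miss_count sch i [] = 0"
| "miss_count sch i (b # bs) =
     (if predict sch i \<noteq> b then 1 else 0) + miss_count sch (update sch i b) bs"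

abbreviation final_state :: "scheme \<Rightarrow> nat \<Rightarrow> bool list \<Rightarrow> nat" where
  "final_state sch \<equiv> foldl (update sch)"

lemma miss_count_append:
  "miss_count sch i (xs @ ys) = miss_count sch i xs + miss_count sch (final_state sch i xs) ys"
  by (induction xs arbitrary: i) auto

lemma miss_count_le_length: "miss_count sch i bs \<le> length bs"
proof (induction bs arbitrary: i)
  case (Cons b bs)
  show ?case using Cons.IH[of "update sch i b"] by simp
qed simp

lemma update_in_states: "i \<in> states sch \<Longrightarrow> update sch i b \<in> states sch"
  by (cases sch) (auto simp: max_def min_def split: if_splits)

lemma final_state_in_states: "i \<in> states sch \<Longrightarrow> final_state sch i bs \<in> states sch"
  by (induction bs arbitrary: i) (auto intro: update_in_states)

lemma UNIV_insertion_test: "UNIV = {Outer_Loop, Inner_Index, Inner_Key}"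
  by (auto intro: insertion_test.exhaust)

lemma finite_UNIV_location: "finite (UNIV :: location set)"
proof -
  have "(UNIV :: location set) \<subseteq> {Size_Test, CQS_Key_k, CQS_Key_g, CQS_If, CQS_While, YQS_While,
      YQS_Key_k_p, YQS_Key_k_q, YQS_Key_g_q, YQS_Index_k_g, YQS_Key_g_p}
      \<union> Sample_Sort ` UNIV \<union> Leaf_Sort ` UNIV" (is "_ \<subseteq> ?L")
  proof
    fix x :: location show "x \<in> ?L" by (cases x) auto
  qed
  then show ?thesis
    by (rule finite_subset) (simp add: UNIV_insertion_test)
qed

text \<open>An execution touches the predictor of its own location only, so the total splits into
  counts that can be studied one location at a time.\<close>

lemma misses_eq_sum_locations:
  "misses sch \<sigma> tr = (\<Sum>x\<in>UNIV. miss_count sch (\<sigma> x) (outcomes x tr))"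
proof (induction tr arbitrary: \<sigma>)
  case (Cons e tr)
  obtain x b where e: "e = (x, b)" by fastforce
  have "misses sch \<sigma> (e # tr) = (if predict sch (\<sigma> x) \<noteq> b then 1 else 0)
      + (\<Sum>y\<in>UNIV. miss_count sch ((\<sigma>(x := update sch (\<sigma> x) b)) y) (outcomes y tr))"
    by (simp only: e misses.simps Cons.IH)
  also have "\<dots> = (\<Sum>y\<in>UNIV. miss_count sch (\<sigma> y) (outcomes y (e # tr)))"
    by (simp add: e sum.remove[OF finite_UNIV_location, of x] cong: if_cong)
  finally show ?case .
qed simp

text \<open>The number of misses in a run of "taken" outcomes that starts in state \<open>i\<close>.\<close>

definition deficit :: "scheme \<Rightarrow> nat \<Rightarrow> nat" where
  "deficit sch i = (case sch of One_Bit \<Rightarrow> i - 1 | Two_Bit_SC \<Rightarrow> i - 2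
     | Two_Bit_FC \<Rightarrow> i - 2)"

text \<open>Amortisation with \<open>deficit\<close> as the account: a "taken" outcome that misses
  lowers it by one, a "not taken" outcome misses at most once and raises it by at most two. The
  factor 3 is attained by the move from 2 to 4 of the flip-on-consecutive scheme.\<close>

lemma miss_count_Falses:
  assumes "i \<in> states sch"
  shows "miss_count sch i bs \<le> 3 * count_list bs False + deficit sch i"
  using assms
proof (induction bs arbitrary: i)
  case (Cons b bs)
  have "miss_count sch (update sch i b) bs \<le> 3 * count_list bs False + deficit sch (update sch i b)"
    using Cons update_in_states by blast
  then show ?case using Cons.prems
    by (cases sch) (auto simp: deficit_def max_def min_def split: if_splits)
qed simp

lemma miss_count_le_Falses:
  assumes "i \<in> states sch"
  shows "miss_count sch i bs \<le> 3 * count_list bs False + 2"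
proof -
  have "deficit sch i \<le> 2" using assms by (cases sch) (auto simp: deficit_def)
  with miss_count_Falses[OF assms, of bs] show ?thesis by linarith
qed

section \<open>Miss rate and potential of the predictor chains\<close>

fun miss_rate :: "scheme \<Rightarrow> real \<Rightarrow> real" where
  "miss_rate One_Bit p = 2 * p * (1 - p)"
| "miss_rate Two_Bit_SC p = p * (1 - p) / (1 - 2 * p * (1 - p))"
| "miss_rate Two_Bit_FC p = (2 * p ^ 2 * (1 - p) ^ 2 + p * (1 - p)) / (1 - p * (1 - p))"

text \<open>Solution of Poisson's equation, which leaves an additive constant free. For the 2-bit
  schemes the value 0 in state 3 fixes it. For the 1-bit scheme the state is forgotten after one
  outcome, and the potential is the probability of a miss at the next outcome.\<close>

fun potential :: "scheme \<Rightarrow> real \<Rightarrow> nat \<Rightarrow> real" where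
  "potential One_Bit p i = (if i = 1 then 1 - p else p)"
| "potential Two_Bit_SC p i =
     (if i = 1 then (1 - 2 * p) + (1 - p) * (1 - 2 * p) else
      if i = 2 then 1 - 2 * p else if i = 3 then 0 else p * (2 * p - 1)) / (1 - 2 * p * (1 - p))"
| "potential Two_Bit_FC p i =
     (if i = 1 then (2 - p) * (1 - 2 * p) / (1 - p * (1 - p)) else
      if i = 2 then 1 - 2 * p else if i = 3 then 0
      else - p * (2 - p) * (1 - 2 * p) / (1 - p * (1 - p)))"

text \<open>The denominator is (1 + (1 - 2p)^2) / 2; the one of the flip-on-consecutive scheme is (3
  + (1 - 2p)^2) / 4. Both stay away from 0 uniformly in p.\<close>

lemma SC_denom: "1 - 2 * p * (1 - p) \<ge> (1/2 :: real)"
proof -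
  have "(1 - 2 * p)\<^sup>2 \<ge> 0" by simp
  then show ?thesis by (simp add: power2_eq_square algebra_simps)
qed

lemma FC_denom: "1 - p * (1 - p) \<ge> (3/4 :: real)"
proof -
  have "(1 - 2 * p)\<^sup>2 \<ge> 0" by simp
  then show ?thesis by (simp add: power2_eq_square algebra_simps)
qed

text \<open>Poisson's equation for the chain of predictor states, with the misses as rewards.\<close>

lemma potential_step:
  assumes "i \<in> states sch"
  shows "p * ((if predict sch i then 0 else 1) + potential sch p (update sch i True))
       + (1 - p) * ((if predict sch i then 1 else 0) + potential sch p (update sch i False))
       = miss_rate sch p + potential sch p i"
proof (cases sch)
  case One_Bit
  with assms show ?thesis by (auto simp: algebra_simps)
next
  case Two_Bit_SC
  have "1 - 2 * p * (1 - p) \<noteq> 0" using SC_denom[of p] by linarith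
  with Two_Bit_SC assms show ?thesis
    by (auto simp: max_def min_def divide_simps) (simp_all add: algebra_simps)
next
  case Two_Bit_FC
  have "1 - p * (1 - p) \<noteq> 0" using FC_denom[of p] by linarith
  with Two_Bit_FC assms show ?thesis
    by (auto simp: divide_simps) (simp_all add: algebra_simps power2_eq_square)
qed

text \<open>Uniformity in p is the point: p will be a random share, and the bound survives
  integration over it.\<close>

lemma abs_potential_le:
  assumes "0 \<le> p" "p \<le> 1"
  shows "\<bar>potential sch p i\<bar> \<le> 4"
proof -
  have 1: "\<bar>1 - 2 * p\<bar> \<le> 1" "\<bar>1 - p\<bar> \<le> 1" "\<bar>p\<bar> \<le> 1" "\<bar>2 - p\<bar> \<le> 2" "\<bar>2 * p - 1\<bar> \<le> 1" using assms by auto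
  have A: "\<bar>(1 - p) * (1 - 2 * p)\<bar> \<le> 1" "\<bar>p * (2 * p - 1)\<bar> \<le> 1" "\<bar>(2 - p) * (1 - 2 * p)\<bar> \<le> 2"
    using mult_mono[OF 1(2) 1(1)] mult_mono[OF 1(3) 1(5)] mult_mono[OF 1(4) 1(1)] by (auto simp: abs_mult)
  have B: "\<bar>p * (2 - p) * (1 - 2 * p)\<bar> \<le> 2"
    using mult_mono[OF 1(3) A(3)] by (simp add: abs_mult mult.assoc)
  have C: "\<bar>x / d\<bar> \<le> 4" if "\<bar>x\<bar> \<le> 2" "d \<ge> 1/2" for x d :: real
  proof -
    have "\<bar>x\<bar> \<le> 4 * d" using that by linarith
    with that show ?thesis by (simp add: abs_divide divide_le_eq)
  qed
  have F: "1 - p * (1 - p) \<ge> 1/2" using FC_denom[of p] by linarith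
  show ?thesis
  proof (cases sch)
    case One_Bit
    with assms show ?thesis by auto
  next
    case Two_Bit_SC
    have "\<bar>(1 - 2 * p) + (1 - p) * (1 - 2 * p)\<bar> \<le> 2" "\<bar>1 - 2*p\<bar> \<le> 2" "\<bar>p * (2 * p - 1)\<bar> \<le> 2"
      using abs_triangle_ineq[of "1 - 2 * p" "(1 - p) * (1 - 2 * p)"] 1(1) A(1) 1(1) A(2)
      by (fastforce, fastforce, fastforce)
    then show ?thesis
      unfolding Two_Bit_SC potential.simps by (intro C SC_denom) (simp split: if_split)
  next
    case Two_Bit_FC
    have "\<bar>- p * (2 - p) * (1 - 2 * p)\<bar> \<le> 2" using B by (simp add: abs_mult)
    from this[THEN C[OF _ F]] C[OF A(3) F] 1(1) show ?thesis
      unfolding Two_Bit_FC potential.simps by (smt (verit))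
  qed
qed

subsection \<open>Steady state\<close>

text \<open>The saturating counter is a birth-and-death chain, so its weights follow from detailed
  balance and form a geometric progression. The denominators are the sums of the listed
  weights.\<close>

definition stationary_weights :: "scheme \<Rightarrow> real \<Rightarrow> (nat \<times> real) list" where
  "stationary_weights sch p = (case sch of
     One_Bit \<Rightarrow> [(1, p), (2, 1 - p)]
   | Two_Bit_SC \<Rightarrow> map (\<lambda>(i, x). (i, x / (1 - 2 * p * (1 - p))))
       [(1, p ^ 3), (2, p\<^sup>2 * (1 - p)), (3, p * (1 - p)\<^sup>2), (4, (1 - p) ^ 3)]
   | Two_Bit_FC \<Rightarrow> map (\<lambda>(i, x). (i, x / (1 - p * (1 - p))))
       [(1, p\<^sup>2), (2, p\<^sup>2 * (1 - p)), (3, p * (1 - p)\<^sup>2), (4, (1 - p)\<^sup>2)])"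

lemma pmf_transition:
  assumes p: "0 \<le> p" "p \<le> 1" and "set_pmf \<pi> \<subseteq> B" "finite B"
  shows "pmf (\<pi> \<bind> (\<lambda>i. map_pmf (update sch i) (bernoulli_pmf p))) j =
    (\<Sum>i\<in>B. pmf \<pi> i * ((if update sch i True = j then p else 0) + (if update sch i False = j then 1 - p else 0)))"
proof -
  have "pmf (map_pmf (update sch i) (bernoulli_pmf p)) j =
      (if update sch i True = j then p else 0) + (if update sch i False = j then 1 - p else 0)" for i
    using p by (auto simp: map_pmf_def pmf_bind)
  then show ?thesis
    using assms by (simp add: pmf_bind integral_measure_pmf[of B] subset_iff mult.commute)
qed

lemma stationary_weights_wf:
  assumes p: "0 \<le> p" "p \<le> 1"
  shows "pmf_of_list_wf (stationary_weights sch p)"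
proof (rule pmf_of_list_wfI)
  have d: "1 - 2 * p * (1 - p) > 0" "1 - p * (1 - p) > 0"
    using SC_denom[of p] FC_denom[of p] by linarith+
  show "x \<ge> 0" if "x \<in> set (map snd (stationary_weights sch p))" for x
    using that p d by (cases sch) (auto simp: stationary_weights_def)
  show "sum_list (map snd (stationary_weights sch p)) = 1"
    using d by (cases sch) (auto simp: stationary_weights_def divide_simps,
      simp_all add: algebra_simps power2_eq_square power3_eq_cube)
qed

text \<open>Uniqueness is what gives the definite description in \<open>steady_miss_rate\<close> its
  value. It has to include p = 0 and p = 1, where some states are transient, so the linear systems
  are solved without dividing by p or 1 - p.\<close>

lemma stationary_unique:
  assumes p: "0 \<le> p" "p \<le> 1" and "stationary sch p \<pi>"
  shows "\<pi> = pmf_of_list (stationary_weights sch p)"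
proof -
  have sub: "set_pmf \<pi> \<subseteq> states sch" and eq: "\<pi> \<bind> (\<lambda>i. map_pmf (update sch i) (bernoulli_pmf p)) = \<pi>"
    using assms(3) by (auto simp: stationary_def)
  have fin: "finite (states sch)" by (cases sch) auto
  have wf: "pmf_of_list_wf (stationary_weights sch p)"
    by (rule stationary_weights_wf[OF p])
  have d: "1 - 2 * p * (1 - p) \<noteq> 0" "1 - p * (1 - p) \<noteq> 0"
    using SC_denom[of p] FC_denom[of p] by linarith+
  have step: "pmf \<pi> j = (\<Sum>i\<in>states sch. pmf \<pi> i *
      ((if update sch i True = j then p else 0) + (if update sch i False = j then 1 - p else 0)))" for j
    using pmf_transition[OF p sub fin, of sch j] eq by simp
  have tot: "(\<Sum>i\<in>states sch. pmf \<pi> i) = 1"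
    using sub fin by (rule sum_pmf_eq_1[rotated])
  have out: "pmf \<pi> j = 0" if "j \<notin> states sch" for j
    using sub that by (auto simp: set_pmf_iff)
  have "pmf \<pi> j = pmf (pmf_of_list (stationary_weights sch p)) j" if "j \<in> states sch" for j
  proof (cases sch)
    case One_Bit
    define x1 x2 where x: "x1 = pmf \<pi> 1" "x2 = pmf \<pi> 2"
    have "x1 = p * x1 + p * x2"
      using step[of 1] One_Bit by (simp add: x algebra_simps)
    moreover have "x1 + x2 = 1"
      using tot One_Bit by (simp add: x)
    ultimately have "x1 = p" "x2 = 1 - p" by algebra+
    then have "pmf \<pi> (Suc 0) = p" "pmf \<pi> 2 = 1 - p" by (simp_all add: x)
    with that One_Bit show ?thesis
      unfolding pmf_pmf_of_list[OF wf] by (auto simp: stationary_weights_def)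
  next
    case Two_Bit_SC
    define x1 x2 x3 x4 where x: "x1 = pmf \<pi> 1" "x2 = pmf \<pi> 2" "x3 = pmf \<pi> 3" "x4 = pmf \<pi> 4"
    have e: "x1 = p * x1 + p * x2" "x2 = (1 - p) * x1 + p * x3" "x4 = (1 - p) * x3 + (1 - p) * x4"
      unfolding x by (rule trans[OF step], simp add: Two_Bit_SC max_def min_def algebra_simps)+
    have e4: "x1 + x2 + x3 + x4 = 1"
      using tot Two_Bit_SC by (simp add: x)
    define q where "q = 1 - p"
    have a: "q * x1 = p * x2" "q * x2 = p * x3" "q * x3 = p * x4"
    proof -
      show "q * x1 = p * x2" using e(1) by (simp add: q_def left_diff_distrib)
      then have "x2 = p * x2 + p * x3" using e(2) by (simp add: q_def)
      then show "q * x2 = p * x3" by (simp add: q_def left_diff_distrib)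
      show "q * x3 = p * x4" using e(3) by (simp add: q_def left_diff_distrib)
    qed
    have D: "1 - 2 * p * (1 - p) = p ^ 3 + p\<^sup>2 * q + p * q\<^sup>2 + q ^ 3"
      by (simp add: q_def power2_eq_square power3_eq_cube algebra_simps)
    \<comment> \<open>Each pair of states is compared by multiplying the balance equations up, since
      p and q may be 0.\<close>
    have "p ^ 3 * x2 = p\<^sup>2 * q * x1" "p ^ 3 * x3 = p * q\<^sup>2 * x1" "p ^ 3 * x4 = q ^ 3 * x1"
        "p\<^sup>2 * q * x1 = p ^ 3 * x2" "p\<^sup>2 * q * x3 = p * q\<^sup>2 * x2" "p\<^sup>2 * q * x4 = q ^ 3 * x2"
        "p * q\<^sup>2 * x1 = p ^ 3 * x3" "p * q\<^sup>2 * x2 = p\<^sup>2 * q * x3" "p * q\<^sup>2 * x4 = q ^ 3 * x3"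
        "q ^ 3 * x1 = p ^ 3 * x4" "q ^ 3 * x2 = p\<^sup>2 * q * x4" "q ^ 3 * x3 = p * q\<^sup>2 * x4"
      using a by algebra+
    then have "x1 * (1 - 2 * p * (1 - p)) = p ^ 3 * (x1 + x2 + x3 + x4)"
        "x2 * (1 - 2 * p * (1 - p)) = p\<^sup>2 * q * (x1 + x2 + x3 + x4)"
        "x3 * (1 - 2 * p * (1 - p)) = p * q\<^sup>2 * (x1 + x2 + x3 + x4)"
        "x4 * (1 - 2 * p * (1 - p)) = q ^ 3 * (x1 + x2 + x3 + x4)"
      unfolding D by (simp_all add: ring_distribs mult.commute)
    then have "x1 * (1 - 2 * p * (1 - p)) = p ^ 3" "x2 * (1 - 2 * p * (1 - p)) = p\<^sup>2 * (1 - p)"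
        "x3 * (1 - 2 * p * (1 - p)) = p * (1 - p)\<^sup>2" "x4 * (1 - 2 * p * (1 - p)) = (1 - p) ^ 3"
      unfolding e4 q_def by simp_all
    then have "pmf \<pi> (Suc 0) = p ^ 3 / (1 - 2 * p * (1 - p))" "pmf \<pi> 2 = p\<^sup>2 * (1 - p) / (1 - 2 * p * (1 - p))"
        "pmf \<pi> 3 = p * (1 - p)\<^sup>2 / (1 - 2 * p * (1 - p))" "pmf \<pi> 4 = (1 - p) ^ 3 / (1 - 2 * p * (1 - p))"
      using d by (simp_all add: eq_divide_eq x)
    with that Two_Bit_SC show ?thesis
      unfolding pmf_pmf_of_list[OF wf] by (auto simp: stationary_weights_def)
  next
    case Two_Bit_FC
    define x1 x2 x3 x4 where x: "x1 = pmf \<pi> 1" "x2 = pmf \<pi> 2" "x3 = pmf \<pi> 3" "x4 = pmf \<pi> 4"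
    have e: "x1 = p * (x1 + x2 + x3)" "x2 = (1 - p) * x1" "x3 = p * x4"
      unfolding x by (rule trans[OF step], simp add: Two_Bit_FC algebra_simps)+
    have e4: "x1 + x2 + x3 + x4 = 1"
      using tot Two_Bit_FC by (simp add: x)
    have "x1 * (1 - p * (1 - p)) = p\<^sup>2" "x2 * (1 - p * (1 - p)) = p\<^sup>2 * (1 - p)"
        "x3 * (1 - p * (1 - p)) = p * (1 - p)\<^sup>2" "x4 * (1 - p * (1 - p)) = (1 - p)\<^sup>2"
      using e e4 by algebra+
    then have "pmf \<pi> (Suc 0) = p\<^sup>2 / (1 - p * (1 - p))" "pmf \<pi> 2 = p\<^sup>2 * (1 - p) / (1 - p * (1 - p))"
        "pmf \<pi> 3 = p * (1 - p)\<^sup>2 / (1 - p * (1 - p))" "pmf \<pi> 4 = (1 - p)\<^sup>2 / (1 - p * (1 - p))"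
      using d by (simp_all add: eq_divide_eq x)
    with that Two_Bit_FC show ?thesis
      unfolding pmf_pmf_of_list[OF wf] by (auto simp: stationary_weights_def)
  qed
  moreover have "pmf (pmf_of_list (stationary_weights sch p)) j = 0" if "j \<notin> states sch" for j
    using that unfolding pmf_pmf_of_list[OF wf] by (cases sch) (auto simp: stationary_weights_def)
  ultimately show ?thesis
    using out by (intro pmf_eqI) metis
qed

lemma stationary_weights_stationary:
  assumes p: "0 \<le> p" "p \<le> 1"
  shows "stationary sch p (pmf_of_list (stationary_weights sch p))" (is "stationary _ _ ?\<pi>")
proof -
  have wf: "pmf_of_list_wf (stationary_weights sch p)"
    by (rule stationary_weights_wf[OF p])
  have sub: "set_pmf ?\<pi> \<subseteq> states sch"
    using set_pmf_of_list[OF wf] by (cases sch) (auto simp: stationary_weights_def)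
  have fin: "finite (states sch)" by (cases sch) auto
  have d: "1 - 2 * p * (1 - p) > 0" "1 - p * (1 - p) > 0"
    using SC_denom[of p] FC_denom[of p] by linarith+
  have "pmf (?\<pi> \<bind> (\<lambda>i. map_pmf (update sch i) (bernoulli_pmf p))) j = pmf ?\<pi> j" for j
    unfolding pmf_transition[OF p sub fin] pmf_pmf_of_list[OF wf] using d
    by (cases sch) (auto simp: stationary_weights_def max_def min_def divide_simps,
      simp_all add: algebra_simps power2_eq_square power3_eq_cube)
  then show ?thesis using sub unfolding stationary_def by (auto intro: pmf_eqI)
qed

lemma steady_miss_rate_eq:
  assumes p: "0 \<le> p" "p \<le> 1"
  shows "steady_miss_rate sch p = miss_rate sch p"
proof -
  let ?\<pi> = "pmf_of_list (stationary_weights sch p)"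
  have wf: "pmf_of_list_wf (stationary_weights sch p)"
    by (rule stationary_weights_wf[OF p])
  have the: "(THE \<pi>. stationary sch p \<pi>) = ?\<pi>"
    using stationary_unique[OF p] stationary_weights_stationary[OF p] by blast
  have sub: "set_pmf ?\<pi> \<subseteq> states sch"
    using stationary_weights_stationary[OF p] by (auto simp: stationary_def)
  have d: "1 - 2 * p * (1 - p) > 0" "1 - p * (1 - p) > 0"
    using SC_denom[of p] FC_denom[of p] by linarith+
  let ?M = "pair_pmf ?\<pi> (bernoulli_pmf p)"
  let ?A = "(\<lambda>i. (i, \<not> predict sch i)) ` states sch"
  have "measure ?M {(i, b). predict sch i \<noteq> b} = measure ?M ?A"
    using sub by (intro measure_eq_AE) (auto simp: AE_measure_pmf_iff)
  also have "\<dots> = (\<Sum>x\<in>?A. pmf ?M x)"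
    by (intro measure_measure_pmf_finite) (cases sch, auto)
  also have "\<dots> = (\<Sum>i\<in>states sch. pmf ?\<pi> i * (if predict sch i then 1 - p else p))"
    using p by (subst sum.reindex) (auto simp: inj_on_def pmf_pair intro!: sum.cong)
  also have "\<dots> = miss_rate sch p"
    unfolding pmf_pmf_of_list[OF wf]
    using d by (cases sch) (auto simp: stationary_weights_def divide_simps,
      simp_all add: algebra_simps power2_eq_square power3_eq_cube)
  finally show ?thesis unfolding steady_miss_rate_def the .
qed

section \<open>Traces of the partitioning loops\<close>

fun key_locs :: "algorithm \<Rightarrow> location set" where
  "key_locs CQS = {CQS_Key_k, CQS_Key_g}"
| "key_locs YQS = {YQS_Key_k_p, YQS_Key_k_q, YQS_Key_g_q, YQS_Key_g_p}"

text \<open>By \<open>miss_count_le_Falses\<close> a location misses at most three times per failed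
  test, up to a constant. So this single number controls all locations outside K together.\<close>

definition side_falses :: "location set \<Rightarrow> trace \<Rightarrow> nat" where
  "side_falses K tr = length (filter (\<lambda>(x, b). x \<notin> K \<and> \<not> b) tr)"

lemma side_falses_simps [simp]:
  "side_falses K [] = 0"
  "side_falses K ((x, b) # tr) = (if x \<notin> K \<and> \<not> b then 1 else 0) + side_falses K tr"
  "side_falses K (tr1 @ tr2) = side_falses K tr1 + side_falses K tr2"
  by (auto simp: side_falses_def)

lemma outcomes_replicate [simp]:
  "outcomes x (replicate n (y, b)) = (if y = x then replicate n b else [])"
  by (induction n) auto

lemma side_falses_replicate [simp]:
  "side_falses K (replicate n (y, b)) = (if y \<notin> K \<and> \<not> b then n else 0)"
  by (induction n) auto

lemma length_swap_at [simp]: "length (swap_at A i j) = length A"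
  by (simp add: swap_at_def)

lemma nth_swap_at:
  assumes "i < length A" "j < length A" "l < length A"
  shows "swap_at A i j ! l = (if l = i then A ! j else if l = j then A ! i else A ! l)"
  using assms by (auto simp: swap_at_def nth_list_update)

lemma map_swap_at:
  assumes "i < length A" "j < length A"
  shows "swap_at (map f A) i j = map f (swap_at A i j)"
  using assms by (simp add: swap_at_def map_update)

lemma mset_swap_at: "i < length A \<Longrightarrow> j < length A \<Longrightarrow> mset (swap_at A i j) = mset A"
  unfolding swap_at_def by (rule mset_swap)

lemma upt_split3:
  assumes "i \<le> j" "j < k"
  shows "[i..<k] = [i..<j] @ j # [Suc j..<k]"
  using assms by (metis less_imp_le_nat upt_add_eq_append upt_conv_Cons le_add_diff_inverse)

lemma map_upt_const:
  assumes "\<And>x. i \<le> x \<Longrightarrow> x < j \<Longrightarrow> f x = c"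
  shows "map f [i..<j] = replicate (j - i) c"
  using assms by (intro nth_equalityI) auto


subsection \<open>Classic Quicksort\<close>

lemma cqs_scan_k_eq:
  assumes "k < k'" "\<And>j. k < j \<Longrightarrow> j < k' \<Longrightarrow> A ! j < p" "\<not> A ! k' < p"
  shows "cqs_scan_k A p k tr =
    (k', tr @ replicate (k' - k - 1) (CQS_Key_k, True) @ [(CQS_Key_k, False)])"
  using assms
proof (induction "k' - k" arbitrary: k tr)
  case (Suc d)
  show ?case
  proof (cases "k' = k + 1")
    case True
    then show ?thesis using Suc by (subst cqs_scan_k.simps) auto
  next
    case False
    then have "A ! (k + 1) < p" "k + 1 < k'" "d = k' - (k + 1)" "k' - k - 1 = Suc (k' - (k + 1) - 1)"
      using Suc by auto
    then show ?thesis
      using Suc(1)[of "k + 1" "tr @ [(CQS_Key_k, True)]"] Suc.prems by (subst cqs_scan_k.simps) auto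
  qed
qed simp

lemma cqs_scan_g_eq:
  assumes "g' < g" "\<And>j. g' < j \<Longrightarrow> j < g \<Longrightarrow> A ! j > p" "\<not> A ! g' > p"
  shows "cqs_scan_g A p g tr =
    (g', tr @ replicate (g - g' - 1) (CQS_Key_g, True) @ [(CQS_Key_g, False)])"
  using assms
proof (induction "g - g'" arbitrary: g tr)
  case (Suc d)
  show ?case
  proof (cases "g = g' + 1")
    case True
    then show ?thesis using Suc by (subst cqs_scan_g.simps) auto
  next
    case False
    then have "A ! (g - 1) > p" "g' < g - 1" "d = (g - 1) - g'" "g - g' - 1 = Suc (g - 1 - g' - 1)"
      using Suc by auto
    then show ?thesis
      using Suc(1)[of "g - 1" "tr @ [(CQS_Key_g, True)]"] Suc.prems by (subst cqs_scan_g.simps) auto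
  qed
qed simp

text \<open>
  The array is represented as \<open>map val I\<close>, where \<open>I\<close> is a list of indices and \<open>c\<close> maps an
  index to the class of its element with respect to the pivots.  As \<open>val\<close> is quantified inside,
  the final arrangement \<open>I'\<close> of the indices and the trace depend on the classes only.
\<close>

lemma cqs_loop_spec:
  fixes c :: "nat \<Rightarrow> nat"
  assumes "length I = m + 2" "k < g" "g \<le> m + 1"
    "\<And>j. j \<le> k \<Longrightarrow> c (I ! j) = 0" "\<And>j. g \<le> j \<Longrightarrow> j \<le> m + 1 \<Longrightarrow> c (I ! j) \<in> {1, 2}"
    "\<And>j. k < j \<Longrightarrow> j < g \<Longrightarrow> c (I ! j) \<in> {0, 1}"
  shows "\<exists>a I' tr'. k \<le> a \<and> a < g \<and> mset I' = mset I \<and> I' ! 0 = I ! 0 \<and> I' ! (m + 1) = I ! (m + 1)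
     \<and> (\<forall>j\<le>a. c (I' ! j) = 0) \<and> (\<forall>j. a < j \<longrightarrow> j \<le> m + 1 \<longrightarrow> c (I' ! j) \<in> {1, 2})
     \<and> outcomes CQS_Key_k tr' = map (\<lambda>j. c (I ! j) = 0) [k + 1..<a + 1] @ [False]
     \<and> outcomes CQS_Key_g tr' = map (\<lambda>j. c (I ! j) = 1) (rev [a + 1..<g]) @ [False]
     \<and> side_falses (key_locs CQS) tr' = 2
     \<and> (\<forall>val p tr. (\<forall>j\<in>set I. (val j < p \<longleftrightarrow> c j = 0) \<and> (p < val j \<longleftrightarrow> c j = 1)) \<longrightarrow>
          cqs_loop (map val I) p k g tr = (map val I', a + 1, tr @ tr'))"
  using assms
proof (induction "g - k" arbitrary: I k g rule: less_induct)
  case less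
  note len = less.prems(1) and kg = less.prems(2) and gm = less.prems(3)
  note lo = less.prems(4) and hi = less.prems(5) and mid = less.prems(6)
  \<comment> \<open>Position g is a sentinel for the scan from the left and position k for the scan
    from the right, so both searches succeed even if no ordinary element stops them.\<close>
  define k' where "k' = (LEAST j. k < j \<and> c (I ! j) \<noteq> 0)"
  have k'0: "k < g \<and> c (I ! g) \<noteq> 0" using kg hi[of g] gm by auto
  have k': "k < k'" "c (I ! k') \<noteq> 0" using LeastI[of "\<lambda>j. k < j \<and> c (I ! j) \<noteq> 0", OF k'0] by (auto simp: k'_def)
  have k'_le: "k' \<le> g" unfolding k'_def using k'0 by (rule Least_le)
  have below: "c (I ! j) = 0" if "k < j" "j < k'" for j
    using not_less_Least[of j "\<lambda>j. k < j \<and> c (I ! j) \<noteq> 0"] that by (auto simp: k'_def)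
  define g' where "g' = (GREATEST j. j < g \<and> c (I ! j) \<noteq> 1)"
  have g'0: "k < g \<and> c (I ! k) \<noteq> 1" using kg lo[of k] by auto
  have g': "g' < g" "c (I ! g') \<noteq> 1"
    using GreatestI_nat[of "\<lambda>j. j < g \<and> c (I ! j) \<noteq> 1", OF g'0, of g] by (auto simp: g'_def)
  have g'_ge: "k \<le> g'" unfolding g'_def using g'0 by (intro Greatest_le_nat[where b = g]) auto
  have above: "c (I ! j) = 1" if "g' < j" "j < g" for j
    using Greatest_le_nat[of "\<lambda>j. j < g \<and> c (I ! j) \<noteq> 1" j g] that by (fastforce simp: g'_def)
  have cg': "c (I ! g') = 0" using g' g'_ge lo[of k] mid[of g'] by (cases "g' = k") auto
  have step: "cqs_loop (map val I) p k g tr =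
      (let tr2 = (tr @ replicate (k' - k - 1) (CQS_Key_k, True) @ [(CQS_Key_k, False)])
               @ replicate (g - g' - 1) (CQS_Key_g, True) @ [(CQS_Key_g, False)]
       in if g' > k'
         then cqs_loop (swap_at (map val I) k' g') p k' g' (tr2 @ [(CQS_If, True), (CQS_While, True)])
         else (map val I, k', tr2 @ [(CQS_If, False), (CQS_While, False)]))"
    if "\<forall>j\<in>set I. (val j < p \<longleftrightarrow> c j = 0) \<and> (p < val j \<longleftrightarrow> c j = 1)" for val p tr
  proof -
    have v: "(map val I ! j < p \<longleftrightarrow> c (I ! j) = 0) \<and> (p < map val I ! j \<longleftrightarrow> c (I ! j) = 1)" if "j \<le> m + 1" for j
      using \<open>\<forall>j\<in>set I. _\<close> that len by simp
    have 1: "cqs_scan_k (map val I) p k tr =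
        (k', tr @ replicate (k' - k - 1) (CQS_Key_k, True) @ [(CQS_Key_k, False)])" for tr
      using k' k'_le gm below v by (intro cqs_scan_k_eq) auto
    have 2: "cqs_scan_g (map val I) p g tr =
        (g', tr @ replicate (g - g' - 1) (CQS_Key_g, True) @ [(CQS_Key_g, False)])" for tr
      using g' gm above v by (intro cqs_scan_g_eq) auto
    show ?thesis by (subst cqs_loop.simps) (simp add: 1 2 Let_def)
  qed
  show ?case
  proof (cases "k' < g'")
    case True
    define I1 where "I1 = swap_at I k' g'"
    have I1: "I1 ! j = (if j = k' then I ! g' else if j = g' then I ! k' else I ! j)" if "j \<le> m + 1" for j
      using that True g' gm len by (simp add: I1_def nth_swap_at)
    have k'lt: "k' < g" using True g' by simp
    have ck': "c (I ! k') = 1" using mid[of k'] k' k'lt by auto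
    have m1: "mset I1 = mset I" unfolding I1_def using True g' gm len by (intro mset_swap_at) auto
    have "\<exists>a I' tr'. k' \<le> a \<and> a < g' \<and> mset I' = mset I1 \<and> I' ! 0 = I1 ! 0 \<and> I' ! (m + 1) = I1 ! (m + 1)
     \<and> (\<forall>j\<le>a. c (I' ! j) = 0) \<and> (\<forall>j. a < j \<longrightarrow> j \<le> m + 1 \<longrightarrow> c (I' ! j) \<in> {1, 2})
     \<and> outcomes CQS_Key_k tr' = map (\<lambda>j. c (I1 ! j) = 0) [k' + 1..<a + 1] @ [False]
     \<and> outcomes CQS_Key_g tr' = map (\<lambda>j. c (I1 ! j) = 1) (rev [a + 1..<g']) @ [False]
     \<and> side_falses (key_locs CQS) tr' = 2
     \<and> (\<forall>val p tr. (\<forall>j\<in>set I1. (val j < p \<longleftrightarrow> c j = 0) \<and> (p < val j \<longleftrightarrow> c j = 1)) \<longrightarrow>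
          cqs_loop (map val I1) p k' g' tr = (map val I', a + 1, tr @ tr'))"
    proof (rule less.hyps)
      show "g' - k' < g - k" using True k' g' by linarith
      show "length I1 = m + 2" using len by (simp add: I1_def)
      show "c (I1 ! j) = 0" if "j \<le> k'" for j
        using that I1[of j] cg' lo[of j] below[of j] k'lt gm True by (cases "j \<le> k") auto
      show "c (I1 ! j) \<in> {1, 2}" if "g' \<le> j" "j \<le> m + 1" for j
        using that I1[of j] ck' hi[of j] above[of j] True by (cases "g \<le> j") auto
      show "c (I1 ! j) \<in> {0, 1}" if "k' < j" "j < g'" for j
        using that I1[of j] mid[of j] k' g' gm by auto
    qed (use True g' gm in auto)
    then obtain a I' tr' where IH: "k' \<le> a" "a < g'" "mset I' = mset I1" "I' ! 0 = I1 ! 0" "I' ! (m + 1) = I1 ! (m + 1)"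
      "\<forall>j\<le>a. c (I' ! j) = 0" "\<forall>j. a < j \<longrightarrow> j \<le> m + 1 \<longrightarrow> c (I' ! j) \<in> {1, 2}"
      "outcomes CQS_Key_k tr' = map (\<lambda>j. c (I1 ! j) = 0) [k' + 1..<a + 1] @ [False]"
      "outcomes CQS_Key_g tr' = map (\<lambda>j. c (I1 ! j) = 1) (rev [a + 1..<g']) @ [False]"
      "side_falses (key_locs CQS) tr' = 2"
      "\<And>val p tr. (\<forall>j\<in>set I1. (val j < p \<longleftrightarrow> c j = 0) \<and> (p < val j \<longleftrightarrow> c j = 1)) \<Longrightarrow>
          cqs_loop (map val I1) p k' g' tr = (map val I', a + 1, tr @ tr')"
      by blast
    define T where "T = replicate (k' - k - 1) (CQS_Key_k, True) @ [(CQS_Key_k, False)]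
               @ replicate (g - g' - 1) (CQS_Key_g, True) @ [(CQS_Key_g, False), (CQS_If, True), (CQS_While, True)]"
    have sk: "map (\<lambda>j. c (I ! j) = 0) [k + 1..<a + 1]
        = replicate (k' - k - 1) True @ False # map (\<lambda>j. c (I1 ! j) = 0) [k' + 1..<a + 1]"
    proof -
      have "[k + 1..<a + 1] = [k + 1..<k'] @ k' # [k' + 1..<a + 1]"
        using k' IH(1) by (subst upt_split3[of _ k']) auto
      moreover have "map (\<lambda>j. c (I ! j) = 0) [k + 1..<k'] = replicate (k' - (k + 1)) True"
        using below by (intro map_upt_const) auto
      moreover have "map (\<lambda>j. c (I1 ! j) = 0) [k' + 1..<a + 1] = map (\<lambda>j. c (I ! j) = 0) [k' + 1..<a + 1]"
        using I1 IH(2) g' gm by (intro map_cong) auto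
      ultimately show ?thesis using k'(2) by simp
    qed
    have sg: "map (\<lambda>j. c (I ! j) = 1) (rev [a + 1..<g])
        = replicate (g - g' - 1) True @ False # map (\<lambda>j. c (I1 ! j) = 1) (rev [a + 1..<g'])"
    proof -
      have "[a + 1..<g] = [a + 1..<g'] @ g' # [g' + 1..<g]"
        using g' IH(2) by (subst upt_split3[of _ g']) auto
      moreover have "map (\<lambda>j. c (I ! j) = 1) [g' + 1..<g] = replicate (g - (g' + 1)) True"
        using above by (intro map_upt_const) auto
      moreover have "map (\<lambda>j. c (I1 ! j) = 1) [a + 1..<g'] = map (\<lambda>j. c (I ! j) = 1) [a + 1..<g']"
        using I1 IH(1) g' gm by (intro map_cong) auto
      ultimately show ?thesis using cg' by (simp add: rev_map[symmetric])
    qed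
    have set1: "set I1 = set I" using m1 by (rule mset_eq_setD)
    show ?thesis
    proof (intro exI conjI allI impI)
      show "k \<le> a" "a < g" using k' g' IH by auto
      show "mset I' = mset I" using IH m1 by simp
      show "I' ! 0 = I ! 0" using IH I1[of 0] k' True by auto
      show "I' ! (m + 1) = I ! (m + 1)" using IH I1[of "m + 1"] k'lt g' gm by auto
      show "c (I' ! j) = 0" if "j \<le> a" for j using IH that by auto
      show "c (I' ! j) \<in> {1, 2}" if "a < j" "j \<le> m + 1" for j using IH that by auto
      show "outcomes CQS_Key_k (T @ tr') = map (\<lambda>j. c (I ! j) = 0) [k + 1..<a + 1] @ [False]"
        using sk IH(8) by (simp add: T_def)
      show "outcomes CQS_Key_g (T @ tr') = map (\<lambda>j. c (I ! j) = 1) (rev [a + 1..<g]) @ [False]"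
        using sg IH(9) by (simp add: T_def)
      show "side_falses (key_locs CQS) (T @ tr') = 2"
        using IH(10) by (simp add: T_def)
      show "cqs_loop (map val I) p k g tr = (map val I', a + 1, tr @ T @ tr')"
        if "\<forall>j\<in>set I. (val j < p \<longleftrightarrow> c j = 0) \<and> (p < val j \<longleftrightarrow> c j = 1)" for val p tr
        using step[OF that] IH(11)[of val p] that True g' gm len
        by (simp add: set1 map_swap_at I1_def[symmetric] T_def)
    qed
  next
    case False
    \<comment> \<open>The element at k' is not small and the one at g' is, so the indices cannot
      stop at the same place. An element strictly between g' and k' would have been passed by both
      scans, hence be large and small at once.\<close>
    have ne: "g' \<noteq> k'" using cg' k' by auto
    have "k' = g' + 1"
    proof (rule ccontr)
      assume "k' \<noteq> g' + 1"
      then have "g' + 1 < k'" using False ne by simp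
      then show False using above[of "g' + 1"] below[of "g' + 1"] g'_ge k'_le by auto
    qed
    define T where "T = replicate (k' - k - 1) (CQS_Key_k, True) @ [(CQS_Key_k, False)]
               @ replicate (g - g' - 1) (CQS_Key_g, True) @ [(CQS_Key_g, False), (CQS_If, False), (CQS_While, False)]"
    show ?thesis
    proof (intro exI conjI allI impI)
      show "k \<le> g'" "g' < g" using g' g'_ge by auto
      show "mset I = mset I" "I ! 0 = I ! 0" "I ! (m + 1) = I ! (m + 1)" by simp_all
      show "c (I ! j) = 0" if "j \<le> g'" for j
        using that lo[of j] below[of j] \<open>k' = g' + 1\<close> by (cases "j \<le> k") auto
      show "c (I ! j) \<in> {1, 2}" if "g' < j" "j \<le> m + 1" for j
        using that hi[of j] above[of j] by (cases "g \<le> j") auto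
      show "outcomes CQS_Key_k T = map (\<lambda>j. c (I ! j) = 0) [k + 1..<g' + 1] @ [False]"
        using below \<open>k' = g' + 1\<close> by (simp add: T_def map_upt_const del: upt_Suc)
      show "outcomes CQS_Key_g T = map (\<lambda>j. c (I ! j) = 1) (rev [g' + 1..<g]) @ [False]"
        using above by (simp add: T_def map_upt_const rev_map[symmetric] del: upt_Suc)
      show "side_falses (key_locs CQS) T = 2"
        by (simp add: T_def)
      show "cqs_loop (map val I) p k g tr = (map val I, g' + 1, tr @ T)"
        if "\<forall>j\<in>set I. (val j < p \<longleftrightarrow> c j = 0) \<and> (p < val j \<longleftrightarrow> c j = 1)" for val p tr
        using step[OF that] False \<open>k' = g' + 1\<close> by (simp add: T_def)
    qed
  qed
qed

subsection \<open>Yaroslavskiy's Quicksort\<close>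

definition large_run :: "nat \<Rightarrow> trace" where
  "large_run n = concat (replicate n [(YQS_Key_g_q, True), (YQS_Index_k_g, True)])"

lemma large_run_simps [simp]:
  "large_run 0 = []"
  "large_run (Suc n) = (YQS_Key_g_q, True) # (YQS_Index_k_g, True) # large_run n"
  by (auto simp: large_run_def)

lemma outcomes_large_run [simp]:
  "outcomes YQS_Key_g_q (large_run n) = replicate n True"
  "x \<notin> {YQS_Key_g_q, YQS_Index_k_g} \<Longrightarrow> outcomes x (large_run n) = []"
  "side_falses K (large_run n) = 0"
  by (induction n) auto

lemma yqs_scan_g_eq:
  assumes "k < g'" "g' \<le> g" "\<And>j. g' < j \<Longrightarrow> j \<le> g \<Longrightarrow> A ! j > q" "\<not> A ! g' > q"
  shows "yqs_scan_g A q k g tr = (g', tr @ large_run (g - g') @ [(YQS_Key_g_q, False)])"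
  using assms
proof (induction "g - g'" arbitrary: g tr)
  case 0
  then show ?case by (subst yqs_scan_g.simps) auto
next
  case (Suc d)
  then have "A ! g > q" "k < g" "g' \<le> g - 1" "d = (g - 1) - g'" "g - g' = Suc (g - 1 - g')"
    by auto
  then show ?case
    using Suc(1)[of "g - 1" "tr @ [(YQS_Key_g_q, True), (YQS_Index_k_g, True)]"] Suc.prems
    by (subst yqs_scan_g.simps) auto
qed

lemma yqs_scan_g_eq_all_large:
  assumes "k \<le> g" "\<And>j. k \<le> j \<Longrightarrow> j \<le> g \<Longrightarrow> A ! j > q"
  shows "yqs_scan_g A q k g tr =
    (k, tr @ large_run (g - k) @ [(YQS_Key_g_q, True), (YQS_Index_k_g, False)])"
  using assms
proof (induction "g - k" arbitrary: g tr)
  case 0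
  then show ?case by (subst yqs_scan_g.simps) auto
next
  case (Suc d)
  then have "A ! g > q" "k < g" "d = (g - 1) - k" "g - k = Suc (g - 1 - k)" by auto
  then show ?case
    using Suc(1)[of "g - 1" "tr @ [(YQS_Key_g_q, True), (YQS_Index_k_g, True)]"] Suc.prems
    by (subst yqs_scan_g.simps) auto
qed

text \<open>
  The lists \<open>e1, e2, e4\<close> account for the element at which \<open>k\<close> and \<open>g\<close> may meet: if it is large, it
  is inspected by both.
\<close>

lemma yqs_loop_spec:
  fixes c :: "nat \<Rightarrow> nat"
  assumes "length I = m + 1" "1 \<le> l" "l \<le> k" "k \<le> g + 1" "g \<le> m"
    "\<And>j. 1 \<le> j \<Longrightarrow> j < l \<Longrightarrow> c (I ! j) = 0" "\<And>j. l \<le> j \<Longrightarrow> j < k \<Longrightarrow> c (I ! j) = 1"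
    "\<And>j. g < j \<Longrightarrow> j \<le> m \<Longrightarrow> c (I ! j) = 2" "\<And>j. k \<le> j \<Longrightarrow> j \<le> g \<Longrightarrow> c (I ! j) \<in> {0, 1, 2}"
  shows "\<exists>a b I' tr' e1 e2 e4. k \<le> b + 1 \<and> b \<le> g \<and> a \<le> b \<and> mset I' = mset I \<and> I' ! 0 = I ! 0
     \<and> (\<forall>j. 1 \<le> j \<longrightarrow> j \<le> a \<longrightarrow> c (I' ! j) = 0) \<and> (\<forall>j. a < j \<longrightarrow> j \<le> b \<longrightarrow> c (I' ! j) = 1)
     \<and> (\<forall>j. b < j \<longrightarrow> j \<le> m \<longrightarrow> c (I' ! j) = 2)
     \<and> length e1 \<le> 1 \<and> length e2 \<le> 1 \<and> length e4 \<le> 1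
     \<and> outcomes YQS_Key_k_p tr' = map (\<lambda>j. c (I ! j) = 0) [k..<b + 1] @ e1
     \<and> outcomes YQS_Key_k_q tr' = map (\<lambda>j. c (I ! j) = 2) (filter (\<lambda>j. c (I ! j) \<noteq> 0) [k..<b + 1]) @ e2
     \<and> outcomes YQS_Key_g_q tr' = map (\<lambda>j. c (I ! j) = 2) (rev [b + 1..<g + 1])
     \<and> outcomes YQS_Key_g_p tr' = map (\<lambda>j. c (I ! j) \<noteq> 0) (filter (\<lambda>j. c (I ! j) \<noteq> 2) (rev [b + 1..<g + 1])) @ e4
     \<and> side_falses (key_locs YQS) tr' \<le> 2
     \<and> (\<forall>val p q tr. (\<forall>j\<in>set I. (1 \<le> c j \<longrightarrow> p \<le> val j) \<and> (c j = 0 \<longrightarrow> val j < p \<and> val j < q)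
           \<and> (c j = 2 \<longrightarrow> q < val j) \<and> (c j = 1 \<longrightarrow> val j < q)) \<longrightarrow>
          yqs_loop (map val I) p q l k g tr = (map val I', (a, b + 1), tr @ tr'))"
  using assms
proof (induction "g + 1 - k" arbitrary: I l k g rule: less_induct)
  case less
  note len = less.prems(1) and l1 = less.prems(2) and lk = less.prems(3) and kg = less.prems(4)
  note gm = less.prems(5) and c0 = less.prems(6) and c1 = less.prems(7) and c2 = less.prems(8)
  note mid = less.prems(9)
  let ?compat = "\<lambda>I val p q. \<forall>j\<in>set I. (1 \<le> c j \<longrightarrow> p \<le> val j) \<and> (c j = 0 \<longrightarrow> val j < p \<and> val j < q)
           \<and> (c j = 2 \<longrightarrow> q < val j) \<and> (c j = 1 \<longrightarrow> (val j :: nat) < q)"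
  have compatD: "(c (I ! j) = 0 \<longrightarrow> map val I ! j < p \<and> map val I ! j < q)
      \<and> (c (I ! j) = 1 \<longrightarrow> p \<le> map val I ! j \<and> map val I ! j < q)
      \<and> (c (I ! j) = 2 \<longrightarrow> p \<le> map val I ! j \<and> q < map val I ! j)"
    if C: "?compat I val p q" and "j \<le> m" for val p q j
    using bspec[OF C, of "I ! j"] that len by auto
  show ?case
  proof (cases "k \<le> g")
    case False
    then have kg1: "k = g + 1" using kg by simp
    show ?thesis
    proof (intro exI conjI allI impI)
      show "k \<le> g + 1" "g \<le> g" "l - 1 \<le> g" "mset I = mset I" "I ! 0 = I ! 0" using kg1 lk by auto
      show "c (I ! j) = 0" if "1 \<le> j" "j \<le> l - 1" for j using c0[of j] that by auto
      show "c (I ! j) = 1" if "l - 1 < j" "j \<le> g" for j using c1[of j] that kg1 by auto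
      show "c (I ! j) = 2" if "g < j" "j \<le> m" for j using c2[of j] that by auto
      show "length ([] :: bool list) \<le> 1" "length ([] :: bool list) \<le> 1" "length ([] :: bool list) \<le> 1" by auto
      show "side_falses (key_locs YQS) [(YQS_While, False)] \<le> 2" by simp
      show "yqs_loop (map val I) p q l k g tr = (map val I, (l - 1, g + 1), tr @ [(YQS_While, False)])"
        for val p q tr
        using False by (subst yqs_loop.simps) auto
    qed (use kg1 in auto)
  next
    case True
    have km: "k \<le> m" using True gm by simp
    have ck: "c (I ! k) = 0 \<or> c (I ! k) = 1 \<or> c (I ! k) = 2" using mid[of k] True by auto
    show ?thesis
    proof (cases "c (I ! k) = 2 \<and> (\<forall>j. k \<le> j \<longrightarrow> j \<le> g \<longrightarrow> c (I ! j) = 2)")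
      case all_large: True
      \<comment> \<open>Last round: the scan of g runs down to k and is stopped there by the index
        test. The element at k is booked with those inspected from the right; its outcomes on the
        left are the surplus \<open>e1\<close> and \<open>e2\<close>, and its final comparison with
        p is \<open>e4\<close>.\<close>
      define T where "T = [(YQS_While, True), (YQS_Key_k_p, False), (YQS_Key_k_q, True)] @ large_run (g - k)
        @ [(YQS_Key_g_q, True), (YQS_Index_k_g, False), (YQS_Key_g_p, True), (YQS_While, False)]"
      have k1: "k - 1 + 1 = k" using l1 lk by simp
      show ?thesis
      proof (intro exI conjI allI impI)
        show "k \<le> (k - 1) + 1" "k - 1 \<le> g" "l - 1 \<le> k - 1" "mset I = mset I" "I ! 0 = I ! 0" using True lk by auto
        show "c (I ! j) = 0" if "1 \<le> j" "j \<le> l - 1" for j using c0[of j] that by auto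
        show "c (I ! j) = 1" if "l - 1 < j" "j \<le> k - 1" for j using c1[of j] that l1 by auto
        show "c (I ! j) = 2" if "k - 1 < j" "j \<le> m" for j using c2[of j] all_large that by (cases "j \<le> g") auto
        show "length [False] \<le> 1" "length [True] \<le> 1" "length [True] \<le> 1" by auto
        have r: "map (\<lambda>j. c (I ! j) = 2) [k..<g + 1] = replicate (g + 1 - k) True"
          using all_large by (intro map_upt_const) auto
        show "outcomes YQS_Key_g_q T = map (\<lambda>j. c (I ! j) = 2) (rev [k - 1 + 1..<g + 1])"
          unfolding k1 rev_map[symmetric] r using True
          by (simp add: T_def Suc_diff_le replicate_append_same del: upt_Suc)
        have n: "filter (\<lambda>j. c (I ! j) \<noteq> 2) (rev [k..<g + 1]) = []"
          using all_large by (auto simp: filter_empty_conv)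
        show "outcomes YQS_Key_g_p T = map (\<lambda>j. c (I ! j) \<noteq> 0)
            (filter (\<lambda>j. c (I ! j) \<noteq> 2) (rev [k - 1 + 1..<g + 1])) @ [True]"
          unfolding k1 n by (simp add: T_def)
        show "side_falses (key_locs YQS) T \<le> 2" by (simp add: T_def)
        show "yqs_loop (map val I) p q l k g tr = (map val I, (l - 1, k - 1 + 1), tr @ T)"
          if C: "?compat I val p q" for val p q tr
        proof -
          have s: "yqs_scan_g (map val I) q k g tr'' =
            (k, tr'' @ large_run (g - k) @ [(YQS_Key_g_q, True), (YQS_Index_k_g, False)])" for tr''
            using True compatD[OF C] all_large gm by (intro yqs_scan_g_eq_all_large) auto
          have "swap_at (map val I) k k = map val I" by (simp add: swap_at_def)
          moreover have "map val I ! k \<ge> q" "map val I ! k \<ge> p" using compatD[OF C km] all_large by auto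
          moreover have "yqs_loop (map val I) p q l (k + 1) (k - 1) tr'' = (map val I, (l - 1, k), tr'' @ [(YQS_While, False)])" for tr''
            using k1 by (subst yqs_loop.simps) auto
          ultimately show ?thesis
            using True k1 by (subst yqs_loop.simps) (auto simp: s T_def)
        qed
      qed (use k1 in \<open>auto simp: T_def\<close>)
    next
      case not_all: False
      text \<open>The remaining cases recurse; only the head of the trace differs.\<close>
      have rec: ?thesis
        if I1: "length I1 = m + 1" "mset I1 = mset I" "I1 ! 0 = I ! 0"
          and l': "l' \<in> {l, l + 1}" "l' \<le> k + 1" and g1: "k \<le> g1" "g1 \<le> g" "k + 1 \<le> g1 + 1"
          and inv: "\<And>j. 1 \<le> j \<Longrightarrow> j < l' \<Longrightarrow> c (I1 ! j) = 0" "\<And>j. l' \<le> j \<Longrightarrow> j < k + 1 \<Longrightarrow> c (I1 ! j) = 1"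
            "\<And>j. g1 < j \<Longrightarrow> j \<le> m \<Longrightarrow> c (I1 ! j) = 2"
          and same: "\<And>j. k < j \<Longrightarrow> j \<le> g1 \<Longrightarrow> I1 ! j = I ! j"
          and Tkp: "outcomes YQS_Key_k_p T = [c (I ! k) = 0]"
          and Tkq: "outcomes YQS_Key_k_q T = map (\<lambda>j. c (I ! j) = 2) (filter (\<lambda>j. c (I ! j) \<noteq> 0) [k])"
          and Tgq: "outcomes YQS_Key_g_q T = map (\<lambda>j. c (I ! j) = 2) (rev [g1 + 1..<g + 1])"
          and Tgp: "outcomes YQS_Key_g_p T = map (\<lambda>j. c (I ! j) \<noteq> 0) (filter (\<lambda>j. c (I ! j) \<noteq> 2) (rev [g1 + 1..<g + 1]))"
          and Tf: "side_falses (key_locs YQS) T = 0"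
          and T: "\<And>val p q tr. ?compat I val p q \<Longrightarrow>
            yqs_loop (map val I) p q l k g tr = yqs_loop (map val I1) p q l' (k + 1) g1 (tr @ T)"
        for I1 l' g1 T
      proof -
        have "\<exists>a b I' tr' e1 e2 e4. k + 1 \<le> b + 1 \<and> b \<le> g1 \<and> a \<le> b \<and> mset I' = mset I1 \<and> I' ! 0 = I1 ! 0
         \<and> (\<forall>j. 1 \<le> j \<longrightarrow> j \<le> a \<longrightarrow> c (I' ! j) = 0) \<and> (\<forall>j. a < j \<longrightarrow> j \<le> b \<longrightarrow> c (I' ! j) = 1)
         \<and> (\<forall>j. b < j \<longrightarrow> j \<le> m \<longrightarrow> c (I' ! j) = 2)
         \<and> length e1 \<le> 1 \<and> length e2 \<le> 1 \<and> length e4 \<le> 1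
         \<and> outcomes YQS_Key_k_p tr' = map (\<lambda>j. c (I1 ! j) = 0) [k + 1..<b + 1] @ e1
         \<and> outcomes YQS_Key_k_q tr' = map (\<lambda>j. c (I1 ! j) = 2) (filter (\<lambda>j. c (I1 ! j) \<noteq> 0) [k + 1..<b + 1]) @ e2
         \<and> outcomes YQS_Key_g_q tr' = map (\<lambda>j. c (I1 ! j) = 2) (rev [b + 1..<g1 + 1])
         \<and> outcomes YQS_Key_g_p tr' = map (\<lambda>j. c (I1 ! j) \<noteq> 0) (filter (\<lambda>j. c (I1 ! j) \<noteq> 2) (rev [b + 1..<g1 + 1])) @ e4
         \<and> side_falses (key_locs YQS) tr' \<le> 2
         \<and> (\<forall>val p q tr. ?compat I1 val p q \<longrightarrow>
              yqs_loop (map val I1) p q l' (k + 1) g1 tr = (map val I', (a, b + 1), tr @ tr'))"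
        proof (rule less.hyps)
          show "c (I1 ! j) \<in> {0, 1, 2}" if "k + 1 \<le> j" "j \<le> g1" for j
            using that same[of j] mid[of j] g1 by auto
        qed (use I1 l' g1 inv True l1 lk gm in auto)
        then obtain a b I' tr' e1 e2 e4 where IH: "k + 1 \<le> b + 1" "b \<le> g1" "a \<le> b" "mset I' = mset I1" "I' ! 0 = I1 ! 0"
         "\<forall>j. 1 \<le> j \<longrightarrow> j \<le> a \<longrightarrow> c (I' ! j) = 0" "\<forall>j. a < j \<longrightarrow> j \<le> b \<longrightarrow> c (I' ! j) = 1"
         "\<forall>j. b < j \<longrightarrow> j \<le> m \<longrightarrow> c (I' ! j) = 2"
         "length e1 \<le> 1" "length e2 \<le> 1" "length e4 \<le> 1"
         and kp: "outcomes YQS_Key_k_p tr' = map (\<lambda>j. c (I1 ! j) = 0) [k + 1..<b + 1] @ e1"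
         and kq: "outcomes YQS_Key_k_q tr' = map (\<lambda>j. c (I1 ! j) = 2) (filter (\<lambda>j. c (I1 ! j) \<noteq> 0) [k + 1..<b + 1]) @ e2"
         and gq: "outcomes YQS_Key_g_q tr' = map (\<lambda>j. c (I1 ! j) = 2) (rev [b + 1..<g1 + 1])"
         and gp: "outcomes YQS_Key_g_p tr' = map (\<lambda>j. c (I1 ! j) \<noteq> 0) (filter (\<lambda>j. c (I1 ! j) \<noteq> 2) (rev [b + 1..<g1 + 1])) @ e4"
         and IH2: "side_falses (key_locs YQS) tr' \<le> 2"
         and run: "\<And>val p q tr. ?compat I1 val p q \<Longrightarrow>
              yqs_loop (map val I1) p q l' (k + 1) g1 tr = (map val I', (a, b + 1), tr @ tr')"
          by blast
        have set1: "set I1 = set I" using I1(2) by (rule mset_eq_setD)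
        have up: "[k..<b + 1] = k # [k + 1..<b + 1]" using IH by (simp add: upt_conv_Cons)
        have down: "rev [b + 1..<g + 1] = rev [g1 + 1..<g + 1] @ rev [b + 1..<g1 + 1]"
        proof -
          have "[b + 1..<g + 1] = [b + 1..<g1 + 1] @ [g1 + 1..<g + 1]"
            using IH(2) g1(2) upt_add_eq_append[of "b + 1" "g1 + 1" "g - g1"] by simp
          then show ?thesis by (simp only: rev_append)
        qed
        have sm: "map (\<lambda>j. h (I1 ! j)) (filter (\<lambda>j. h' (I1 ! j)) js) = map (\<lambda>j. h (I ! j)) (filter (\<lambda>j. h' (I ! j)) js)"
          if "set js \<subseteq> {k<..g1}" for h :: "nat \<Rightarrow> bool" and h' js
        proof -
          have "filter (\<lambda>j. h' (I1 ! j)) js = filter (\<lambda>j. h' (I ! j)) js"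
            using that same by (intro filter_cong) auto
          then show ?thesis using that same by (intro map_cong) auto
        qed
        have sub: "set [k + 1..<b + 1] \<subseteq> {k<..g1}" "set (rev [b + 1..<g1 + 1]) \<subseteq> {k<..g1}"
          using IH by auto
        note kp' = kp[unfolded sm[OF sub(1), of "\<lambda>i. c i = 0" "\<lambda>_. True", simplified filter_True]]
        show ?thesis
        proof (intro exI conjI allI impI)
          show "k \<le> b + 1" "b \<le> g" "a \<le> b" "mset I' = mset I" "I' ! 0 = I ! 0"
            "length e1 \<le> 1" "length e2 \<le> 1" "length e4 \<le> 1" using IH I1 g1 by auto
          show "c (I' ! j) = 0" if "1 \<le> j" "j \<le> a" for j using IH that by auto
          show "c (I' ! j) = 1" if "a < j" "j \<le> b" for j using IH that by auto
          show "c (I' ! j) = 2" if "b < j" "j \<le> m" for j using IH that by auto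
          show "outcomes YQS_Key_k_p (T @ tr') = map (\<lambda>j. c (I ! j) = 0) [k..<b + 1] @ e1"
            using sm[OF sub(1), of "\<lambda>i. c i = 0" "\<lambda>_. True"]
            unfolding up outcomes_simps kp Tkp by simp
          show "outcomes YQS_Key_k_q (T @ tr') = map (\<lambda>j. c (I ! j) = 2) (filter (\<lambda>j. c (I ! j) \<noteq> 0) [k..<b + 1]) @ e2"
            using sm[OF sub(1), of "\<lambda>i. c i = 2" "\<lambda>i. c i \<noteq> 0"]
            unfolding up outcomes_simps kq Tkq by simp
          show "outcomes YQS_Key_g_q (T @ tr') = map (\<lambda>j. c (I ! j) = 2) (rev [b + 1..<g + 1])"
            using sm[OF sub(2), of "\<lambda>i. c i = 2" "\<lambda>_. True"]
            unfolding down outcomes_simps gq Tgq by simp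
          show "outcomes YQS_Key_g_p (T @ tr') = map (\<lambda>j. c (I ! j) \<noteq> 0) (filter (\<lambda>j. c (I ! j) \<noteq> 2) (rev [b + 1..<g + 1])) @ e4"
            using sm[OF sub(2), of "\<lambda>i. c i \<noteq> 0" "\<lambda>i. c i \<noteq> 2"]
            unfolding down outcomes_simps gp Tgp by simp
          show "side_falses (key_locs YQS) (T @ tr') \<le> 2"
            using IH2 Tf by simp
          show "yqs_loop (map val I) p q l k g tr = (map val I', (a, b + 1), tr @ T @ tr')"
            if "?compat I val p q" for val p q tr
            using T[OF that] run[of p val q "tr @ T"] that by (simp add: set1)
        qed
      qed
      show ?thesis
      proof (cases "c (I ! k) = 2")
        case False
        show ?thesis
        proof (cases "c (I ! k) = 0")
          case small: True
          define I1 where "I1 = swap_at I k l"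
          have I1: "I1 ! j = (if j = k then I ! l else if j = l then I ! k else I ! j)" if "j \<le> m" for j
            using that km len lk by (simp add: I1_def nth_swap_at)
          show ?thesis
          proof (rule rec[of I1 "l + 1" g "[(YQS_While, True), (YQS_Key_k_p, True)]"])
            show "c (I1 ! j) = 0" if "1 \<le> j" "j < l + 1" for j
              using that I1[of j] c0[of j] small lk km by (cases "j = l") auto
            show "c (I1 ! j) = 1" if "l + 1 \<le> j" "j < k + 1" for j
              using that I1[of j] c1[of j] c1[of l] km by (cases "j = k") auto
            show "c (I1 ! j) = 2" if "g < j" "j \<le> m" for j
              using that I1[of j] c2[of j] lk True by auto
            show "I1 ! j = I ! j" if "k < j" "j \<le> g" for j using that I1[of j] lk gm by auto
            show "mset I1 = mset I" using len lk km by (simp add: I1_def mset_swap_at)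
            show "I1 ! 0 = I ! 0" using I1[of 0] l1 lk by simp
            show "yqs_loop (map val I) p q l k g tr =
                yqs_loop (map val I1) p q (l + 1) (k + 1) g (tr @ [(YQS_While, True), (YQS_Key_k_p, True)])"
              if "?compat I val p q" for val p q tr
              using compatD[OF that km] small True len lk km
              by (subst yqs_loop.simps) (simp add: map_swap_at I1_def)
          qed (use len lk True small in \<open>auto simp: I1_def\<close>)
        next
          case not_small: False
          then have medium: "c (I ! k) = 1" using ck False by simp
          show ?thesis
          proof (rule rec[of I l g "[(YQS_While, True), (YQS_Key_k_p, False), (YQS_Key_k_q, False)]"])
            show "c (I ! j) = 1" if "l \<le> j" "j < k + 1" for j
              using that c1[of j] medium by (cases "j = k") auto
            show "yqs_loop (map val I) p q l k g tr =
                yqs_loop (map val I) p q l (k + 1) g (tr @ [(YQS_While, True), (YQS_Key_k_p, False), (YQS_Key_k_q, False)])"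
              if "?compat I val p q" for val p q tr
              using compatD[OF that km] medium True len
              by (subst yqs_loop.simps) (simp)
          qed (use len lk True medium c0 c2 in auto)
        qed
      next
        case large: True
        define g' where "g' = (GREATEST j. k \<le> j \<and> j \<le> g \<and> c (I ! j) \<noteq> 2)"
        obtain j0 where j0: "k \<le> j0 \<and> j0 \<le> g \<and> c (I ! j0) \<noteq> 2" using not_all large by auto
        have g'1: "k \<le> g' \<and> g' \<le> g \<and> c (I ! g') \<noteq> 2"
          unfolding g'_def
          using GreatestI_nat[where P = "\<lambda>j. k \<le> j \<and> j \<le> g \<and> c (I ! j) \<noteq> 2" and k = j0 and b = g] j0 by auto
        then have g': "k < g'" "g' \<le> g" "c (I ! g') \<noteq> 2" using large by (auto intro: le_neq_implies_less)
        have above: "c (I ! j) = 2" if "g' < j" "j \<le> g" for j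
          using Greatest_le_nat[of "\<lambda>j. k \<le> j \<and> j \<le> g \<and> c (I ! j) \<noteq> 2" j g] that g' by (fastforce simp: g'_def)
        have g'm: "g' \<le> m" using g' gm by simp
        have g1: "g' - 1 + 1 = g'" "k \<le> g' - 1" using g' by auto
        define T0 where "T0 = [(YQS_While, True), (YQS_Key_k_p, False), (YQS_Key_k_q, True)]
            @ large_run (g - g') @ [(YQS_Key_g_q, False)]"
        have scan: "yqs_scan_g (map val I) q k g tr = (g', tr @ large_run (g - g') @ [(YQS_Key_g_q, False)])"
          if "?compat I val p q" for val p q tr
          using g' above compatD[OF that] g'm gm mid[of g'] by (intro yqs_scan_g_eq) fastforce+
        have up: "[g'..<g + 1] = g' # [g' + 1..<g + 1]" using g' by (simp add: upt_conv_Cons)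
        have r: "map (\<lambda>j. c (I ! j) = 2) [g' + 1..<g + 1] = replicate (g + 1 - (g' + 1)) True"
          using above by (intro map_upt_const) auto
        have Tgq: "map (\<lambda>j. c (I ! j) = 2) (rev [g'..<g + 1]) = replicate (g - g') True @ [False]"
          unfolding up rev_map[symmetric] list.map r using g' by simp
        have n: "filter (\<lambda>j. c (I ! j) \<noteq> 2) [g' + 1..<g + 1] = []"
          using above by (auto simp: filter_empty_conv)
        have Tgp: "map (\<lambda>j. c (I ! j) \<noteq> 0) (filter (\<lambda>j. c (I ! j) \<noteq> 2) (rev [g'..<g + 1])) = [c (I ! g') \<noteq> 0]"
          unfolding rev_filter[symmetric] up filter.simps n using g' by simp
        show ?thesis
        proof (cases "c (I ! g') = 0")
          case False
          then have medium: "c (I ! g') = 1" using mid[of g'] g' by auto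
          define I1 where "I1 = swap_at I k g'"
          have I1: "I1 ! j = (if j = k then I ! g' else if j = g' then I ! k else I ! j)" if "j \<le> m" for j
            using that km len g'm by (simp add: I1_def nth_swap_at)
          show ?thesis
          proof (rule rec[of I1 l "g' - 1" "T0 @ [(YQS_Key_g_p, True)]"])
            show "c (I1 ! j) = 0" if "1 \<le> j" "j < l" for j
              using that I1[of j] c0[of j] lk g' km by auto
            show "c (I1 ! j) = 1" if "l \<le> j" "j < k + 1" for j
              using that I1[of j] c1[of j] medium km g' by auto
            show "c (I1 ! j) = 2" if "g' - 1 < j" "j \<le> m" for j
              using that I1[of j] c2[of j] above[of j] large g' by (cases "j = g'"; cases "j \<le> g") auto
            show "I1 ! j = I ! j" if "k < j" "j \<le> g' - 1" for j using that I1[of j] g'm by auto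
            show "mset I1 = mset I" using len g'm km by (simp add: I1_def mset_swap_at)
            show "I1 ! 0 = I ! 0" using I1[of 0] l1 lk g' by simp
            show "yqs_loop (map val I) p q l k g tr =
                yqs_loop (map val I1) p q l (k + 1) (g' - 1) (tr @ T0 @ [(YQS_Key_g_p, True)])"
              if C: "?compat I val p q" for val p q tr
              using compatD[OF C km] compatD[OF C g'm] medium large True len lk km g'm
              by (subst yqs_loop.simps) (simp add: scan[OF C] map_swap_at I1_def T0_def)
            show "outcomes YQS_Key_g_q (T0 @ [(YQS_Key_g_p, True)]) = map (\<lambda>j. c (I ! j) = 2) (rev [g' - 1 + 1..<g + 1])"
              unfolding g1 Tgq by (simp add: T0_def)
            show "outcomes YQS_Key_g_p (T0 @ [(YQS_Key_g_p, True)]) = map (\<lambda>j. c (I ! j) \<noteq> 0)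
                (filter (\<lambda>j. c (I ! j) \<noteq> 2) (rev [g' - 1 + 1..<g + 1]))"
              unfolding g1 Tgp using medium by (simp add: T0_def)
          qed (use len lk True large g' in \<open>auto simp: I1_def T0_def\<close>)
        next
          case small: True
          define I1 where "I1 = swap_at (swap_at I k g') k l"
          \<comment> \<open>If there is no medium element yet, then l = k and the second exchange is
            void. Otherwise the two exchanges form a 3-cycle.\<close>
          have I1: "I1 ! j = (if l = k then (if j = k then I ! g' else if j = g' then I ! k else I ! j)
              else if j = k then I ! l else if j = l then I ! g' else if j = g' then I ! k else I ! j)" if "j \<le> m" for j
            using that km len g'm lk g' by (simp add: I1_def nth_swap_at)
          show ?thesis
          proof (rule rec[of I1 "l + 1" "g' - 1" "T0 @ [(YQS_Key_g_p, False)]"])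
            show "c (I1 ! j) = 0" if "1 \<le> j" "j < l + 1" for j
              using that I1[of j] c0[of j] small lk g' km by (cases "j = l") auto
            show "c (I1 ! j) = 1" if "l + 1 \<le> j" "j < k + 1" for j
              using that I1[of j] c1[of j] c1[of l] km g' by (cases "j = k") auto
            show "c (I1 ! j) = 2" if "g' - 1 < j" "j \<le> m" for j
              using that I1[of j] c2[of j] above[of j] large g' lk by (cases "j = g'"; cases "j \<le> g") auto
            show "I1 ! j = I ! j" if "k < j" "j \<le> g' - 1" for j using that I1[of j] g'm lk by auto
            show "mset I1 = mset I" using len g'm km lk by (simp add: I1_def mset_swap_at)
            show "I1 ! 0 = I ! 0" using I1[of 0] l1 lk g' by simp
            show "yqs_loop (map val I) p q l k g tr =
                yqs_loop (map val I1) p q (l + 1) (k + 1) (g' - 1) (tr @ T0 @ [(YQS_Key_g_p, False)])"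
              if C: "?compat I val p q" for val p q tr
              using compatD[OF C km] compatD[OF C g'm] small large True len lk km g'm
              by (subst yqs_loop.simps) (simp add: scan[OF C] map_swap_at I1_def T0_def)
            show "outcomes YQS_Key_g_q (T0 @ [(YQS_Key_g_p, False)]) = map (\<lambda>j. c (I ! j) = 2) (rev [g' - 1 + 1..<g + 1])"
              unfolding g1 Tgq by (simp add: T0_def)
            show "outcomes YQS_Key_g_p (T0 @ [(YQS_Key_g_p, False)]) = map (\<lambda>j. c (I ! j) \<noteq> 0)
                (filter (\<lambda>j. c (I ! j) \<noteq> 2) (rev [g' - 1 + 1..<g + 1]))"
              unfolding g1 Tgp using small by (simp add: T0_def)
          qed (use len lk True large g' in \<open>auto simp: I1_def T0_def\<close>)
        qed
      qed
    qed
  qed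
qed

subsection \<open>The partitioning step in terms of class words\<close>

text \<open>
  The class of an ordinary element is the index of the part to which it belongs.  At a key
  comparison, the elements are inspected in their initial order, from the left or from the right;
  the number of inspected elements is the number of elements with class in \<open>scanned x\<close>.
\<close>

fun from_left :: "location \<Rightarrow> bool" where
  "from_left x = (x \<in> {CQS_Key_k, YQS_Key_k_p, YQS_Key_k_q})"

fun scanned :: "location \<Rightarrow> nat set" where
  "scanned x = (if x = CQS_Key_k then {0} else if x = CQS_Key_g then {1}
     else if x \<in> {YQS_Key_k_p, YQS_Key_k_q} then {0, 1} else {2})"

fun letter_outcome :: "location \<Rightarrow> nat \<Rightarrow> bool list" where
  "letter_outcome CQS_Key_k c = [c = 0]"
| "letter_outcome CQS_Key_g c = [c = 1]"
| "letter_outcome YQS_Key_k_p c = [c = 0]"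
| "letter_outcome YQS_Key_k_q c = (if c = 0 then [] else [c = 2])"
| "letter_outcome YQS_Key_g_q c = [c = 2]"
| "letter_outcome YQS_Key_g_p c = (if c = 2 then [] else [c \<noteq> 0])"
| "letter_outcome _ c = []"

text \<open>The indices meet at a boundary between the final parts, so the length of the inspected
  prefix or suffix is the number of elements that end up on that side. It depends on the whole word
  and is correlated with the letters read.\<close>

definition key_word :: "location \<Rightarrow> nat list \<Rightarrow> bool list" where
  "key_word x u = concat (map (letter_outcome x)
     (take (length (filter (\<lambda>c. c \<in> scanned x) u)) (if from_left x then u else rev u)))"

lemma map_filter_eq_concat: "map P (filter Q xs) = concat (map (\<lambda>c. if Q c then [P c] else []) xs)"
  by (induction xs) auto

definition positions_of :: "nat list \<Rightarrow> nat \<Rightarrow> nat set" where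
  "positions_of u l = {i. i < length u \<and> u ! i = l}"

lemma map_upt_take:
  assumes "a \<le> length u"
  shows "map (\<lambda>j. f (u ! (j - 1))) [1..<a + 1] = map f (take a u)"
  using assms by (intro nth_equalityI) (auto simp del: upt_Suc)

lemma map_rev_upt_take:
  assumes "a \<le> length u"
  shows "map (\<lambda>j. f (u ! (j - 1))) (rev [a + 1..<length u + 1]) = map f (take (length u - a) (rev u))"
  using assms by (intro nth_equalityI) (auto simp: rev_nth Suc_diff_Suc simp del: upt_Suc)

lemma length_filter_mset_eq:
  assumes "mset xs = mset ys"
  shows "length (filter P xs) = length (filter P ys)"
  using assms by (metis mset_filter size_mset)

lemma length_filter_prefix:
  assumes "a \<le> length xs" "\<And>j. j < a \<Longrightarrow> P (xs ! j)" "\<And>j. a \<le> j \<Longrightarrow> j < length xs \<Longrightarrow> \<not> P (xs ! j)"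
  shows "length (filter P xs) = a"
proof -
  have "filter P (take a xs) = take a xs"
    using assms by (intro filter_True) (auto simp: in_set_conv_nth)
  moreover have "filter P (drop a xs) = []"
    using assms by (auto simp: filter_empty_conv in_set_conv_nth)
  ultimately have "filter P (take a xs @ drop a xs) = take a xs" by (simp only: filter_append append_Nil2)
  with assms(1) show ?thesis by simp
qed

text \<open>The rearrangement \<open>idx\<close> and the trace are obtained before p and U are
  chosen: they depend on the class word alone. This is the property on which randomness preservation
  rests. The trailing failure at each key location is the test that stops the last scan.\<close>

lemma cqs_partition_spec:
  assumes u: "set u \<subseteq> {0, 1}"
  obtains idx tr' where
    "\<And>l. distinct (idx l)" "\<And>l. set (idx l) = positions_of u l"
    "outcomes CQS_Key_k tr' = key_word CQS_Key_k u @ [False]"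
    "outcomes CQS_Key_g tr' = key_word CQS_Key_g u @ [False]"
    "side_falses (key_locs CQS) tr' = 2"
    "\<And>p U. 0 < p \<Longrightarrow> length U = length u \<Longrightarrow>
       (\<And>i. i < length u \<Longrightarrow> (U ! i < p \<longleftrightarrow> u ! i = 0) \<and> (p < U ! i \<longleftrightarrow> u ! i = 1)) \<Longrightarrow>
       \<exists>A j. cqs_partition p U = (A, j, tr') \<and> subarray A 1 j = map ((!) U) (idx 0)
         \<and> subarray A j (length U + 1) = map ((!) U) (idx 1)"
proof -
  define m where "m = length u"
  \<comment> \<open>The sentinel at position 0 counts as small. The pivot at position m + 1 is
    neither smaller nor larger than itself and gets a class of its own.\<close>
  define c where "c j = (if j = 0 then 0 else if j = m + 1 then 2 else u ! (j - 1))" for j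
  define I where "I = [0..<m + 2]"
  have I: "I ! j = j" if "j \<le> m + 1" for j using that by (simp add: I_def del: upt_Suc)
  have u01: "u ! i = 0 \<or> u ! i = 1" if "i < m" for i
  proof -
    have "u ! i \<in> set u" using that by (simp add: m_def)
    with u show ?thesis by blast
  qed
  have "\<exists>a I' tr'. 0 \<le> a \<and> a < m + 1 \<and> mset I' = mset I \<and> I' ! 0 = I ! 0 \<and> I' ! (m + 1) = I ! (m + 1)
     \<and> (\<forall>j\<le>a. c (I' ! j) = 0) \<and> (\<forall>j. a < j \<longrightarrow> j \<le> m + 1 \<longrightarrow> c (I' ! j) \<in> {1, 2})
     \<and> outcomes CQS_Key_k tr' = map (\<lambda>j. c (I ! j) = 0) [0 + 1..<a + 1] @ [False]
     \<and> outcomes CQS_Key_g tr' = map (\<lambda>j. c (I ! j) = 1) (rev [a + 1..<m + 1]) @ [False]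
     \<and> side_falses (key_locs CQS) tr' = 2
     \<and> (\<forall>val p tr. (\<forall>j\<in>set I. (val j < p \<longleftrightarrow> c j = 0) \<and> (p < val j \<longleftrightarrow> c j = 1)) \<longrightarrow>
          cqs_loop (map val I) p 0 (m + 1) tr = (map val I', a + 1, tr @ tr'))"
  proof (rule cqs_loop_spec)
    show "c (I ! j) \<in> {0, 1}" if "0 < j" "j < m + 1" for j
      using that I[of j] u01[of "j - 1"] by (auto simp: c_def)
  qed (auto simp: I c_def, auto simp: I_def)
  then obtain a I' tr' where am: "a < m + 1" and ms: "mset I' = mset I"
     and end_pos: "I' ! 0 = I ! 0" "I' ! (m + 1) = I ! (m + 1)"
     and lo: "\<And>j. j \<le> a \<Longrightarrow> c (I' ! j) = 0" and hi: "\<And>j. a < j \<Longrightarrow> j \<le> m + 1 \<Longrightarrow> c (I' ! j) \<in> {1, 2}"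
     and ok: "outcomes CQS_Key_k tr' = map (\<lambda>j. c (I ! j) = 0) [0 + 1..<a + 1] @ [False]"
     and og: "outcomes CQS_Key_g tr' = map (\<lambda>j. c (I ! j) = 1) (rev [a + 1..<m + 1]) @ [False]"
     and sf: "side_falses (key_locs CQS) tr' = 2"
     and run: "\<And>val p tr. (\<forall>j\<in>set I. (val j < p \<longleftrightarrow> c j = 0) \<and> (p < val j \<longleftrightarrow> c j = 1)) \<Longrightarrow>
          cqs_loop (map val I) p 0 (m + 1) tr = (map val I', a + 1, tr @ tr')"
    by blast
  have lenI: "length I' = m + 2" using mset_eq_length[OF ms] by (simp add: I_def)
  have dI: "distinct I'" using mset_eq_imp_distinct_iff[OF ms] by (simp add: I_def)
  have setI: "set I' = {0..m + 1}"
    unfolding mset_eq_setD[OF ms] by (auto simp: I_def simp del: upt_Suc)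
  have inner: "1 \<le> I' ! j \<and> I' ! j \<le> m" if "1 \<le> j" "j \<le> m" for j
  proof -
    have "I' ! j \<noteq> I' ! 0" "I' ! j \<noteq> I' ! (m + 1)"
      using that lenI dI by (auto simp: nth_eq_iff_index_eq)
    moreover have "I' ! j \<in> {0..m + 1}" using that lenI unfolding setI[symmetric] by simp
    ultimately show ?thesis using end_pos I[of 0] I[of "m + 1"] by auto
  qed
  have cls: "u ! (I' ! j - 1) = c (I' ! j)" if "1 \<le> j" "j \<le> m" for j
    using inner[OF that] by (simp add: c_def)
  have Isplit: "I = 0 # map Suc [0..<m] @ [m + 1]"
    by (intro nth_equalityI) (auto simp: I_def nth_append nth_Cons' simp del: upt_Suc)
  \<comment> \<open>The sentinel accounts for the additional 1. Rearranging preserves the number of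
    small entries, which identifies the final boundary a with a letter count of u.\<close>
  have filt: "length (filter (\<lambda>i. c i = 0) I) = 1 + length (filter (\<lambda>c. c = 0) u)"
  proof -
    have "length (filter (\<lambda>i. c i = 0) (map Suc [0..<m])) = length (filter (\<lambda>c. c = 0) (map (\<lambda>i. u ! i) [0..<m]))"
      by (simp add: filter_map o_def c_def) (auto intro!: arg_cong[where f = length] filter_cong)
    then show ?thesis unfolding Isplit by (simp add: c_def m_def map_nth)
  qed
  have hi': "c (I' ! j) \<noteq> 0" if "a + 1 \<le> j" "j < length I'" for j
    using hi[of j] that lenI by auto
  have "length (filter (\<lambda>i. c i = 0) I') = a + 1"
  proof (rule length_filter_prefix)
    show "a + 1 \<le> length I'" using am lenI by simp
    show "c (I' ! j) = 0" if "j < a + 1" for j using lo[of j] that by simp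
  qed (rule hi')
  with filt have a: "a = length (filter (\<lambda>c. c \<in> scanned CQS_Key_k) u)"
    using length_filter_mset_eq[OF ms, of "\<lambda>i. c i = 0"] by simp
  have "length (filter (\<lambda>c. c = 0) u) + length (filter (\<lambda>c. c \<noteq> 0) u) = m"
    using sum_length_filter_compl[of "\<lambda>c. c = 0" u] by (simp add: m_def)
  moreover have "filter (\<lambda>c. c \<noteq> 0) u = filter (\<lambda>c. c = 1) u"
    using u by (intro filter_cong) auto
  ultimately have ma: "m - a = length (filter (\<lambda>c. c \<in> scanned CQS_Key_g) u)"
    unfolding a by simp
  define idx where "idx l = (if l = 0 then map (\<lambda>j. I' ! j - 1) [1..<a + 1]
      else if l = 1 then map (\<lambda>j. I' ! j - 1) [a + 1..<m + 1] else [])" for l :: nat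
  show thesis
  proof (rule that[of idx tr'])
    have inj: "inj_on (\<lambda>j. I' ! j - 1) {1..m}"
    proof (rule inj_onI)
      fix i j assume ij: "i \<in> {1..m}" "j \<in> {1..m}" "I' ! i - 1 = I' ! j - 1"
      then have "I' ! i = I' ! j" using inner[of i] inner[of j] by auto
      then show "i = j" using ij dI lenI by (auto simp: nth_eq_iff_index_eq)
    qed
    show "distinct (idx l)" for l
      using am by (auto simp: idx_def distinct_map intro: inj_on_subset[OF inj[unfolded One_nat_def]] simp del: upt_Suc)
    show "set (idx l) = positions_of u l" for l
    proof (intro equalityI subsetI)
      fix i assume "i \<in> set (idx l)"
      then obtain j where j: "i = I' ! j - 1" "1 \<le> j" "j \<le> m" "l \<le> 1" "l = 0 \<longleftrightarrow> j \<le> a"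
        using am by (auto simp: idx_def split: if_splits simp del: upt_Suc)
      have "I' ! j - 1 < m" using inner[of j] j by auto
      with j have "c (I' ! j) = l"
        using lo[of j] hi[of j] cls[of j] inner[of j] u01[of "I' ! j - 1"] by (cases "j \<le> a") auto
      then show "i \<in> positions_of u l"
        using j inner[of j] cls[of j] by (auto simp: positions_of_def m_def)
    next
      fix i assume "i \<in> positions_of u l"
      then have i: "i < m" "u ! i = l" by (auto simp: positions_of_def m_def)
      have "Suc i \<in> set I'" unfolding setI using i by simp
      then obtain j where j: "j < m + 2" "I' ! j = Suc i" using lenI by (auto simp: in_set_conv_nth)
      have "j \<noteq> 0"
      proof
        assume "j = 0"
        then show False using j(2) end_pos(1) I[of 0] by simp
      qed
      moreover have "j \<noteq> m + 1"
      proof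
        assume "j = m + 1"
        then show False using j(2) end_pos(2) I[of "m + 1"] i by simp
      qed
      ultimately have j1: "1 \<le> j" "j \<le> m" using j by auto
      have "l = 0 \<longleftrightarrow> j \<le> a" "l \<le> 1"
        using cls[OF j1] lo[of j] hi[of j] j j1 i u01[of i] by (cases "j \<le> a"; auto)+
      then show "i \<in> set (idx l)"
        using j j1 by (auto simp: idx_def image_iff simp del: upt_Suc intro!: bexI[of _ j])
    qed
    have cu: "c (I ! j) = u ! (j - 1)" if "1 \<le> j" "j \<le> m" for j using that I[of j] by (simp add: c_def)
    have am': "a \<le> length u" using am by (simp add: m_def)
    have "map (\<lambda>j. c (I ! j) = 0) [1..<a + 1] = map (\<lambda>j. u ! (j - 1) = 0) [1..<a + 1]"
      using cu am by (intro map_cong) auto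
    also have "\<dots> = map (\<lambda>c. c = 0) (take a u)" by (rule map_upt_take[OF am'])
    also have "\<dots> = concat (map (letter_outcome CQS_Key_k) (take a u))"
    proof -
      have "letter_outcome CQS_Key_k = (\<lambda>c. [c = 0])" by auto
      then show ?thesis by simp
    qed
    finally show "outcomes CQS_Key_k tr' = key_word CQS_Key_k u @ [False]"
      unfolding ok key_word_def a[symmetric] by simp
    have "map (\<lambda>j. c (I ! j) = 1) (rev [a + 1..<m + 1]) = map (\<lambda>j. u ! (j - 1) = 1) (rev [a + 1..<m + 1])"
      using cu am by (intro map_cong) auto
    also have "\<dots> = map (\<lambda>c. c = 1) (take (m - a) (rev u))"
      unfolding m_def by (rule map_rev_upt_take[OF am'])
    also have "\<dots> = concat (map (letter_outcome CQS_Key_g) (take (m - a) (rev u)))"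
    proof -
      have "letter_outcome CQS_Key_g = (\<lambda>c. [c = 1])" by auto
      then show ?thesis by simp
    qed
    finally show "outcomes CQS_Key_g tr' = key_word CQS_Key_g u @ [False]"
      unfolding og key_word_def ma[symmetric] by simp
    show "side_falses (key_locs CQS) tr' = 2" by (rule sf)
    fix p and U :: "nat list"
    assume p: "0 < p" and len: "length U = length u"
      and U: "\<And>i. i < length u \<Longrightarrow> (U ! i < p \<longleftrightarrow> u ! i = 0) \<and> (p < U ! i \<longleftrightarrow> u ! i = 1)"
    define val where "val j = (0 # U @ [p]) ! j" for j
    have "map val I = 0 # U @ [p]"
      using len by (intro nth_equalityI) (auto simp: val_def I_def m_def simp del: upt_Suc)
    moreover have "(val j < p \<longleftrightarrow> c j = 0) \<and> (p < val j \<longleftrightarrow> c j = 1)" if "j \<in> set I" for j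
      using that p len U[of "j - 1"] by (auto simp: val_def c_def I_def m_def nth_append nth_Cons' simp del: upt_Suc)
    ultimately have res: "cqs_partition p U = (map val I', a + 1, tr')"
      using run[of val p "[]"] len by (simp add: cqs_partition_def m_def)
    have v: "map val I' ! j = U ! (I' ! j - 1)" if "1 \<le> j" "j \<le> m" for j
      using inner[OF that] that lenI len by (auto simp: val_def nth_append m_def nth_Cons')
    show "\<exists>A j. cqs_partition p U = (A, j, tr') \<and> subarray A 1 j = map ((!) U) (idx 0)
         \<and> subarray A j (length U + 1) = map ((!) U) (idx 1)"
    proof (intro exI conjI, rule res)
      show "subarray (map val I') 1 (a + 1) = map ((!) U) (idx 0)"
        using v am by (simp add: subarray_def idx_def del: upt_Suc)
      show "subarray (map val I') (a + 1) (length U + 1) = map ((!) U) (idx 1)"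
        using v am len by (simp add: subarray_def idx_def m_def del: upt_Suc)
    qed
  qed
qed

text \<open>As for classic Quicksort, everything but the values is fixed by the class word.
  \<open>e x\<close> holds the outcome of the element at which k and g may meet.\<close>

lemma yqs_partition_spec:
  assumes u: "set u \<subseteq> {0, 1, 2}"
  obtains idx tr' e where
    "\<And>l. distinct (idx l)" "\<And>l. set (idx l) = positions_of u l"
    "\<And>x. x \<in> key_locs YQS \<Longrightarrow> outcomes x tr' = key_word x u @ e x"
    "\<And>x. length (e x) \<le> 1"
    "side_falses (key_locs YQS) tr' \<le> 2"
    "\<And>p q U. 0 < p \<Longrightarrow> p < q \<Longrightarrow> length U = length u \<Longrightarrow>
       (\<And>i. i < length u \<Longrightarrow> U ! i \<noteq> p \<and> U ! i \<noteq> q \<and> u ! i = (if U ! i < p then 0 else if U ! i < q then 1 else 2)) \<Longrightarrow>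
       \<exists>A i j. yqs_partition p q U = (A, (i, j), tr') \<and> subarray A 1 (i + 1) = map ((!) U) (idx 0)
         \<and> subarray A (i + 1) j = map ((!) U) (idx 1) \<and> subarray A j (length U + 1) = map ((!) U) (idx 2)"
proof -
  define m where "m = length u"
  define c where "c j = (if j = 0 then 0 else u ! (j - 1))" for j
  define I where "I = [0..<m + 1]"
  have I: "I ! j = j" if "j \<le> m" for j using that by (simp add: I_def del: upt_Suc)
  have u012: "u ! i = 0 \<or> u ! i = 1 \<or> u ! i = 2" if "i < m" for i
  proof -
    have "u ! i \<in> set u" using that by (simp add: m_def)
    with u show ?thesis by blast
  qed
  have "\<exists>a b I' tr' e1 e2 e4. 1 \<le> b + 1 \<and> b \<le> m \<and> a \<le> b \<and> mset I' = mset I \<and> I' ! 0 = I ! 0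
     \<and> (\<forall>j. 1 \<le> j \<longrightarrow> j \<le> a \<longrightarrow> c (I' ! j) = 0) \<and> (\<forall>j. a < j \<longrightarrow> j \<le> b \<longrightarrow> c (I' ! j) = 1)
     \<and> (\<forall>j. b < j \<longrightarrow> j \<le> m \<longrightarrow> c (I' ! j) = 2)
     \<and> length e1 \<le> 1 \<and> length e2 \<le> 1 \<and> length e4 \<le> 1
     \<and> outcomes YQS_Key_k_p tr' = map (\<lambda>j. c (I ! j) = 0) [1..<b + 1] @ e1
     \<and> outcomes YQS_Key_k_q tr' = map (\<lambda>j. c (I ! j) = 2) (filter (\<lambda>j. c (I ! j) \<noteq> 0) [1..<b + 1]) @ e2
     \<and> outcomes YQS_Key_g_q tr' = map (\<lambda>j. c (I ! j) = 2) (rev [b + 1..<m + 1])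
     \<and> outcomes YQS_Key_g_p tr' = map (\<lambda>j. c (I ! j) \<noteq> 0) (filter (\<lambda>j. c (I ! j) \<noteq> 2) (rev [b + 1..<m + 1])) @ e4
     \<and> side_falses (key_locs YQS) tr' \<le> 2
     \<and> (\<forall>val p q tr. (\<forall>j\<in>set I. (1 \<le> c j \<longrightarrow> p \<le> val j) \<and> (c j = 0 \<longrightarrow> val j < p \<and> val j < q)
           \<and> (c j = 2 \<longrightarrow> q < val j) \<and> (c j = 1 \<longrightarrow> val j < q)) \<longrightarrow>
          yqs_loop (map val I) p q 1 1 m tr = (map val I', (a, b + 1), tr @ tr'))"
  proof (rule yqs_loop_spec)
    show "c (I ! j) \<in> {0, 1, 2}" if "1 \<le> j" "j \<le> m" for j
      using that I[of j] u012[of "j - 1"] by (auto simp: c_def)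
  qed (auto simp: I_def)
  then obtain a b I' tr' e1 e2 e4 where ab: "b \<le> m" "a \<le> b" and ms: "mset I' = mset I"
     and end_pos: "I' ! 0 = I ! 0"
     and cl: "\<And>j. 1 \<le> j \<Longrightarrow> j \<le> a \<Longrightarrow> c (I' ! j) = 0" "\<And>j. a < j \<Longrightarrow> j \<le> b \<Longrightarrow> c (I' ! j) = 1"
       "\<And>j. b < j \<Longrightarrow> j \<le> m \<Longrightarrow> c (I' ! j) = 2"
     and e: "length e1 \<le> 1" "length e2 \<le> 1" "length e4 \<le> 1"
     and o1: "outcomes YQS_Key_k_p tr' = map (\<lambda>j. c (I ! j) = 0) [1..<b + 1] @ e1"
     and o2: "outcomes YQS_Key_k_q tr' = map (\<lambda>j. c (I ! j) = 2) (filter (\<lambda>j. c (I ! j) \<noteq> 0) [1..<b + 1]) @ e2"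
     and o3: "outcomes YQS_Key_g_q tr' = map (\<lambda>j. c (I ! j) = 2) (rev [b + 1..<m + 1])"
     and o4: "outcomes YQS_Key_g_p tr' = map (\<lambda>j. c (I ! j) \<noteq> 0) (filter (\<lambda>j. c (I ! j) \<noteq> 2) (rev [b + 1..<m + 1])) @ e4"
     and sf: "side_falses (key_locs YQS) tr' \<le> 2"
     and run: "\<And>val p q tr. (\<forall>j\<in>set I. (1 \<le> c j \<longrightarrow> p \<le> val j) \<and> (c j = 0 \<longrightarrow> val j < p \<and> val j < q)
           \<and> (c j = 2 \<longrightarrow> q < val j) \<and> (c j = 1 \<longrightarrow> val j < q)) \<Longrightarrow>
          yqs_loop (map val I) p q 1 1 m tr = (map val I', (a, b + 1), tr @ tr')"
    by blast
  have lenI: "length I' = m + 1" using mset_eq_length[OF ms] by (simp add: I_def)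
  have dI: "distinct I'" using mset_eq_imp_distinct_iff[OF ms] by (simp add: I_def)
  have setI: "set I' = {0..m}"
    unfolding mset_eq_setD[OF ms] by (auto simp: I_def simp del: upt_Suc)
  have inner: "1 \<le> I' ! j \<and> I' ! j \<le> m" if "1 \<le> j" "j \<le> m" for j
  proof -
    have "I' ! j \<noteq> I' ! 0"
      using that lenI dI by (auto simp: nth_eq_iff_index_eq)
    moreover have "I' ! j \<in> {0..m}" using that lenI unfolding setI[symmetric] by simp
    ultimately show ?thesis using end_pos I[of 0] by auto
  qed
  have cls: "u ! (I' ! j - 1) = c (I' ! j)" if "1 \<le> j" "j \<le> m" for j
    using inner[OF that] by (simp add: c_def)
  have Isplit: "I = 0 # map Suc [0..<m]"
    by (simp add: I_def upt_conv_Cons map_Suc_upt del: upt_Suc)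
  have filt: "length (filter (\<lambda>i. c i \<noteq> 2) I) = 1 + length (filter (\<lambda>c. c \<noteq> 2) u)"
  proof -
    have "length (filter (\<lambda>i. c i \<noteq> 2) (map Suc [0..<m])) = length (filter (\<lambda>c. c \<noteq> 2) (map (\<lambda>i. u ! i) [0..<m]))"
      by (simp add: filter_map o_def c_def)
    then show ?thesis unfolding Isplit by (simp add: c_def m_def map_nth)
  qed
  have low: "c (I' ! j) \<noteq> 2" if "j < b + 1" for j
    using that cl(1)[of j] cl(2)[of j] end_pos I[of 0] by (cases "j = 0"; cases "j \<le> a") (auto simp: c_def)
  have "length (filter (\<lambda>i. c i \<noteq> 2) I') = b + 1"
    using lenI ab low cl(3) by (intro length_filter_prefix) auto
  with filt have b: "b = length (filter (\<lambda>c. c \<noteq> 2) u)"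
    using length_filter_mset_eq[OF ms, of "\<lambda>i. c i \<noteq> 2"] by simp
  have "length (filter (\<lambda>c. c = 2) u) + length (filter (\<lambda>c. c \<noteq> 2) u) = m"
    by (simp add: sum_length_filter_compl m_def)
  then have mb: "m - b = length (filter (\<lambda>c. c = 2) u)"
    unfolding b by simp
  have b': "b = length (filter (\<lambda>c. c \<in> {0, 1}) u)"
    unfolding b using u by (intro arg_cong[where f = length] filter_cong) auto
  define idx where "idx l = (if l = 0 then map (\<lambda>j. I' ! j - 1) [1..<a + 1]
      else if l = 1 then map (\<lambda>j. I' ! j - 1) [a + 1..<b + 1]
      else if l = 2 then map (\<lambda>j. I' ! j - 1) [b + 1..<m + 1] else [])" for l :: nat
  define e where "e x = (if x = YQS_Key_k_p then e1 else if x = YQS_Key_k_q then e2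
      else if x = YQS_Key_g_p then e4 else [])" for x
  have cu: "c (I ! j) = u ! (j - 1)" if "1 \<le> j" "j \<le> m" for j using that I[of j] by (simp add: c_def)
  have bm': "b \<le> length u" using ab by (simp add: m_def)
  show thesis
  proof (rule that[of idx tr' e])
    have inj: "inj_on (\<lambda>j. I' ! j - 1) {1..m}"
    proof (rule inj_onI)
      fix i j assume ij: "i \<in> {1..m}" "j \<in> {1..m}" "I' ! i - 1 = I' ! j - 1"
      then have "I' ! i = I' ! j" using inner[of i] inner[of j] by auto
      then show "i = j" using ij dI lenI by (auto simp: nth_eq_iff_index_eq)
    qed
    show "distinct (idx l)" for l
      using ab by (auto simp: idx_def distinct_map intro: inj_on_subset[OF inj[unfolded One_nat_def]] simp del: upt_Suc)
    show "set (idx l) = positions_of u l" for l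
    proof (intro equalityI subsetI)
      fix i assume "i \<in> set (idx l)"
      then obtain j where j: "i = I' ! j - 1" "1 \<le> j" "j \<le> m" "c (I' ! j) = l"
        using ab cl by (auto simp: idx_def split: if_splits simp del: upt_Suc)
      then show "i \<in> positions_of u l"
        using j inner[of j] cls[of j] by (auto simp: positions_of_def m_def)
    next
      fix i assume "i \<in> positions_of u l"
      then have i: "i < m" "u ! i = l" by (auto simp: positions_of_def m_def)
      have "Suc i \<in> set I'" unfolding setI using i by simp
      then obtain j where j: "j < m + 1" "I' ! j = Suc i" using lenI by (auto simp: in_set_conv_nth)
      have "j \<noteq> 0"
      proof
        assume "j = 0"
        then show False using j(2) end_pos I[of 0] by simp
      qed
      then have j1: "1 \<le> j" "j \<le> m" using j by auto
      have "l = (if j \<le> a then 0 else if j \<le> b then 1 else 2)"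
        using cls[OF j1] cl[of j] j j1 i by auto
      then show "i \<in> set (idx l)"
        using j j1 by (auto simp: idx_def image_iff simp del: upt_Suc intro!: bexI[of _ j])
    qed
    have k: "map (\<lambda>j. h (c (I ! j))) (filter (\<lambda>j. h' (c (I ! j))) [1..<b + 1]) =
        concat (map (\<lambda>c. if h' c then [h c] else []) (take b u))" for h :: "nat \<Rightarrow> bool" and h'
    proof -
      have "map (\<lambda>j. c (I ! j)) [1..<b + 1] = map (\<lambda>j. u ! (j - 1)) [1..<b + 1]"
        using cu ab by (intro map_cong) auto
      also have "\<dots> = take b u" using map_upt_take[OF bm', of "\<lambda>c. c"] by simp
      finally have "filter h' (map (\<lambda>j. c (I ! j)) [1..<b + 1]) = filter h' (take b u)" by simp
      then have "map h (filter h' (map (\<lambda>j. c (I ! j)) [1..<b + 1])) = map h (filter h' (take b u))" by simp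
      then show ?thesis unfolding map_filter_eq_concat[symmetric] by (simp add: filter_map o_def del: upt_Suc)
    qed
    have g: "map (\<lambda>j. h (c (I ! j))) (filter (\<lambda>j. h' (c (I ! j))) (rev [b + 1..<m + 1])) =
        concat (map (\<lambda>c. if h' c then [h c] else []) (take (m - b) (rev u)))" for h :: "nat \<Rightarrow> bool" and h'
    proof -
      have "map (\<lambda>j. c (I ! j)) (rev [b + 1..<m + 1]) = map (\<lambda>j. u ! (j - 1)) (rev [b + 1..<m + 1])"
        using cu ab by (intro map_cong) auto
      also have "\<dots> = take (m - b) (rev u)" using map_rev_upt_take[OF bm', of "\<lambda>c. c"] by (simp add: m_def)
      finally have "filter h' (map (\<lambda>j. c (I ! j)) (rev [b + 1..<m + 1])) = filter h' (take (m - b) (rev u))" by simp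
      then have "map h (filter h' (map (\<lambda>j. c (I ! j)) (rev [b + 1..<m + 1]))) = map h (filter h' (take (m - b) (rev u)))" by simp
      then show ?thesis unfolding map_filter_eq_concat[symmetric] by (simp add: filter_map o_def del: upt_Suc)
    qed
    have kp: "letter_outcome YQS_Key_k_p = (\<lambda>c. if True then [c = 0] else [])"
      "letter_outcome YQS_Key_k_q = (\<lambda>c. if c \<noteq> 0 then [c = 2] else [])"
      "letter_outcome YQS_Key_g_q = (\<lambda>c. if True then [c = 2] else [])"
      "letter_outcome YQS_Key_g_p = (\<lambda>c. if c \<noteq> 2 then [c \<noteq> 0] else [])"
      by auto
    have w: "key_word YQS_Key_k_p u = concat (map (letter_outcome YQS_Key_k_p) (take b u))"
      "key_word YQS_Key_k_q u = concat (map (letter_outcome YQS_Key_k_q) (take b u))"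
      "key_word YQS_Key_g_q u = concat (map (letter_outcome YQS_Key_g_q) (take (m - b) (rev u)))"
      "key_word YQS_Key_g_p u = concat (map (letter_outcome YQS_Key_g_p) (take (m - b) (rev u)))"
      unfolding key_word_def using b' mb by simp_all
    show "outcomes x tr' = key_word x u @ e x" if "x \<in> key_locs YQS" for x
    proof -
      have "outcomes YQS_Key_k_p tr' = key_word YQS_Key_k_p u @ e1"
        unfolding o1 w kp k[symmetric] by simp
      moreover have "outcomes YQS_Key_k_q tr' = key_word YQS_Key_k_q u @ e2"
        unfolding o2 w kp k[symmetric] ..
      moreover have "outcomes YQS_Key_g_q tr' = key_word YQS_Key_g_q u"
        unfolding o3 w kp g[symmetric] by simp
      moreover have "outcomes YQS_Key_g_p tr' = key_word YQS_Key_g_p u @ e4"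
        unfolding o4 w kp g[symmetric] ..
      ultimately show ?thesis using that by (auto simp: e_def)
    qed
    show "length (e x) \<le> 1" for x using e by (auto simp: e_def)
    show "side_falses (key_locs YQS) tr' \<le> 2" by (rule sf)
    fix p q and U :: "nat list"
    assume p: "0 < p" "p < q" and len: "length U = length u"
      and U: "\<And>i. i < length u \<Longrightarrow> U ! i \<noteq> p \<and> U ! i \<noteq> q \<and> u ! i = (if U ! i < p then 0 else if U ! i < q then 1 else 2)"
    define val where "val j = (0 # U) ! j" for j
    have "map val I = 0 # U"
      using len by (intro nth_equalityI) (auto simp: val_def I_def m_def simp del: upt_Suc)
    moreover have "(1 \<le> c j \<longrightarrow> p \<le> val j) \<and> (c j = 0 \<longrightarrow> val j < p \<and> val j < q)
           \<and> (c j = 2 \<longrightarrow> q < val j) \<and> (c j = 1 \<longrightarrow> val j < q)" if "j \<in> set I" for j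
    proof (cases "j = 0")
      case True
      then show ?thesis using p by (simp add: val_def c_def)
    next
      case False
      then have "j - 1 < length u" using that by (auto simp: I_def m_def)
      from U[OF this] False p show ?thesis by (auto simp: val_def c_def nth_Cons' split: if_splits)
    qed
    ultimately have res: "yqs_partition p q U = (map val I', (a, b + 1), tr')"
      using run[of p val q "[]"] len by (simp add: yqs_partition_def m_def)
    have v: "map val I' ! j = U ! (I' ! j - 1)" if "1 \<le> j" "j \<le> m" for j
      using inner[OF that] that lenI len by (auto simp: val_def m_def nth_Cons')
    show "\<exists>A i j. yqs_partition p q U = (A, (i, j), tr') \<and> subarray A 1 (i + 1) = map ((!) U) (idx 0)
         \<and> subarray A (i + 1) j = map ((!) U) (idx 1) \<and> subarray A j (length U + 1) = map ((!) U) (idx 2)"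
    proof (intro exI conjI, rule res)
      show "subarray (map val I') 1 (a + 1) = map ((!) U) (idx 0)"
        using v ab by (simp add: subarray_def idx_def del: upt_Suc)
      show "subarray (map val I') (a + 1) (b + 1) = map ((!) U) (idx 1)"
        using v ab by (simp add: subarray_def idx_def del: upt_Suc)
      show "subarray (map val I') (b + 1) (length U + 1) = map ((!) U) (idx 2)"
        using v ab len by (simp add: subarray_def idx_def m_def del: upt_Suc)
    qed
  qed
qed

section \<open>Class words and the Polya urn\<close>

definition words :: "nat \<Rightarrow> nat \<Rightarrow> nat list set" where
  "words s m = {u. set u \<subseteq> {..<s} \<and> length u = m}"

lemma finite_words [simp]: "finite (words s m)"
  unfolding words_def by (rule finite_lists_length_eq) simp

lemma words_0 [simp]: "words s 0 = {[]}"
  by (auto simp: words_def)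

lemma sum_words_Suc: "(\<Sum>u\<in>words s (Suc m). f u) = (\<Sum>c<s. \<Sum>u\<in>words s m. f (c # u))"
proof -
  have eq: "words s (Suc m) = (\<lambda>(c, u). c # u) ` ({..<s} \<times> words s m)"
    by (auto simp: words_def image_iff length_Suc_conv)
  have "inj_on (\<lambda>(c, u). c # u) ({..<s} \<times> words s m)" by (auto simp: inj_on_def)
  then show ?thesis
    unfolding eq by (simp add: sum.reindex sum.cartesian_product case_prod_unfold)
qed

lemma sum_count_list_words:
  assumes "u \<in> words s m"
  shows "(\<Sum>l<s. count_list u l) = m"
  using assms sum_count_set[of u "{..<s}"] by (auto simp: words_def)

definition polya_total :: "nat \<Rightarrow> (nat \<Rightarrow> nat) \<Rightarrow> nat" where
  "polya_total s t = (\<Sum>l<s. t l + 1)"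

text \<open>Probability of drawing the sequence u from an urn that starts with t l + 1 balls of
  colour l and receives one more ball of the drawn colour after each draw. The quotients of
  factorials are rising factorials.\<close>

definition polya :: "nat \<Rightarrow> (nat \<Rightarrow> nat) \<Rightarrow> nat list \<Rightarrow> real" where
  "polya s t u = (\<Prod>l<s. fact (t l + count_list u l) / fact (t l))
     * fact (polya_total s t - 1) / fact (polya_total s t - 1 + length u)"

lemma polya_nonneg: "polya s t u \<ge> 0"
  by (auto simp: polya_def intro!: mult_nonneg_nonneg divide_nonneg_nonneg prod_nonneg)

lemma polya_total_pos: "s > 0 \<Longrightarrow> polya_total s t > 0"
  by (auto simp: polya_total_def intro!: sum_pos)

lemma polya_Nil [simp]: "polya s t [] = 1"
  by (simp add: polya_def)

text \<open>The draws are exchangeable, so the next letter may be put in front. The factor is the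
  conditional probability of colour c after the draws u.\<close>

lemma polya_Cons:
  assumes "c < s"
  shows "polya s t (c # u) = polya s t u * (real (t c + 1 + count_list u c) / real (polya_total s t + length u))"
proof -
  let ?f = "\<lambda>u l. fact (t l + count_list u l) / fact (t l) :: real"
  have "(\<Prod>l<s. ?f (c # u) l) = ?f (c # u) c * (\<Prod>l\<in>{..<s} - {c}. ?f (c # u) l)"
    using assms by (subst prod.remove[of _ c]) auto
  also have "(\<Prod>l\<in>{..<s} - {c}. ?f (c # u) l) = (\<Prod>l\<in>{..<s} - {c}. ?f u l)"
    by (intro prod.cong) auto
  also have "?f (c # u) c = ?f u c * real (t c + 1 + count_list u c)"
    by (simp add: algebra_simps)
  also have "?f u c * real (t c + 1 + count_list u c) * (\<Prod>l\<in>{..<s} - {c}. ?f u l)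
      = (\<Prod>l<s. ?f u l) * real (t c + 1 + count_list u c)"
    using assms by (subst (2) prod.remove[of _ c]) auto
  finally have 1: "(\<Prod>l<s. ?f (c # u) l) = (\<Prod>l<s. ?f u l) * real (t c + 1 + count_list u c)" .
  obtain n where n: "polya_total s t = Suc n"
    using polya_total_pos[of s t] assms by (cases "polya_total s t") auto
  show ?thesis unfolding polya_def 1 n by (simp add: field_simps)
qed

lemma sum_urn:
  assumes "u \<in> words s m"
  shows "(\<Sum>c<s. real (t c + 1 + count_list u c)) = real (polya_total s t + m)"
proof -
  have "(\<Sum>c<s. t c + 1 + count_list u c) = polya_total s t + m"
    unfolding sum.distrib[of "\<lambda>c. t c + 1"] polya_total_def sum_count_list_words[OF assms] ..
  then show ?thesis by (metis of_nat_sum)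
qed

lemma sum_polya_Suc:
  assumes "s > 0"
  shows "(\<Sum>u\<in>words s (Suc m). polya s t u * f u) =
    (\<Sum>u\<in>words s m. polya s t u * (\<Sum>c<s. real (t c + 1 + count_list u c) / real (polya_total s t + m) * f (c # u)))"
  unfolding sum_words_Suc
  by (subst sum.swap) (auto intro!: sum.cong simp: polya_Cons words_def sum_distrib_left mult.assoc)

lemma sum_polya:
  assumes "s > 0"
  shows "(\<Sum>u\<in>words s m. polya s t u) = 1"
proof (induction m)
  case (Suc m)
  have "(\<Sum>c<s. real (t c + 1 + count_list u c) / real (polya_total s t + m)) = 1" if "u \<in> words s m" for u
    using sum_urn[OF that, of t] polya_total_pos[OF assms, of t] by (simp add: sum_divide_distrib[symmetric])
  then show ?case using sum_polya_Suc[OF assms, where t = t and m = m and f = "\<lambda>_. 1"] Suc by simp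
qed simp

definition urn_entropy :: "nat \<Rightarrow> (nat \<Rightarrow> nat) \<Rightarrow> real" where
  "urn_entropy s t = (\<Sum>l<s. real (t l + 1) / real (polya_total s t) * (harm (polya_total s t) - harm (t l + 1)))"

lemma Suc_harm_Suc: "real (Suc n) * harm (Suc n) = real n * harm n + harm n + 1"
  by (simp add: harm_Suc field_simps)

text \<open>
  With \<open>x_l\<close> balls of colour \<open>l\<close> and \<open>X\<close> balls in total, drawing adds
  \<open>\<Sum> x_l / X * (H(x_l) + 1)\<close> to \<open>\<Sum> x_l * H(x_l)\<close> in expectation, which gives a recurrence in
  closed form.
\<close>

lemma sum_polya_harm:
  assumes "s > 0"
  shows "(\<Sum>u\<in>words s m. polya s t u * (\<Sum>l<s. real (t l + 1 + count_list u l) * harm (t l + 1 + count_list u l)))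
    = real (polya_total s t + m) * (harm (polya_total s t + m) - urn_entropy s t)"
proof (induction m)
  case 0
  let ?K = "polya_total s t"
  have K: "real ?K > 0" using polya_total_pos[OF assms, of t] by simp
  have "real ?K * urn_entropy s t = (\<Sum>l<s. real (t l + 1) * harm ?K - real (t l + 1) * harm (t l + 1))"
    unfolding urn_entropy_def sum_distrib_left using K by (intro sum.cong) (auto simp: field_simps)
  also have "\<dots> = real ?K * harm ?K - (\<Sum>l<s. real (t l + 1) * harm (t l + 1))"
    unfolding sum_subtractf sum_distrib_right[symmetric] by (simp add: polya_total_def)
  finally show ?case by (simp add: algebra_simps)
next
  case (Suc m)
  let ?X = "real (polya_total s t + m)"
  let ?x = "\<lambda>u l. t l + 1 + count_list u l"
  let ?F = "\<lambda>u. \<Sum>l<s. real (?x u l) * harm (?x u l)"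
  have X: "?X > 0" using polya_total_pos[OF assms, of t] by simp
  have step: "(\<Sum>c<s. real (?x u c) / ?X * ?F (c # u)) = (1 + 1 / ?X) * ?F u + 1" if "u \<in> words s m" for u
  proof -
    have "?F (c # u) = ?F u + harm (?x u c) + 1" if "c < s" for c
    proof -
      have "?F (c # u) = real (?x (c # u) c) * harm (?x (c # u) c) + (\<Sum>l\<in>{..<s} - {c}. real (?x (c # u) l) * harm (?x (c # u) l))"
        using that by (subst sum.remove[of _ c]) auto
      also have "(\<Sum>l\<in>{..<s} - {c}. real (?x (c # u) l) * harm (?x (c # u) l)) = (\<Sum>l\<in>{..<s} - {c}. real (?x u l) * harm (?x u l))"
        by (intro sum.cong) auto
      also have "real (?x (c # u) c) * harm (?x (c # u) c) = real (?x u c) * harm (?x u c) + harm (?x u c) + 1"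
        using Suc_harm_Suc[of "?x u c"] by simp
      also have "real (?x u c) * harm (?x u c) + harm (?x u c) + 1 + (\<Sum>l\<in>{..<s} - {c}. real (?x u l) * harm (?x u l))
          = ?F u + harm (?x u c) + 1"
        using that by (subst (2) sum.remove[of _ c]) auto
      finally show ?thesis .
    qed
    then have "(\<Sum>c<s. real (?x u c) / ?X * ?F (c # u)) = (\<Sum>c<s. real (?x u c) / ?X * (?F u + harm (?x u c) + 1))"
      by (intro sum.cong) auto
    also have "\<dots> = (\<Sum>c<s. real (?x u c)) / ?X * (?F u + 1) + (\<Sum>c<s. real (?x u c) * harm (?x u c)) / ?X"
      unfolding sum_divide_distrib sum_distrib_right sum.distrib[symmetric]
      by (intro sum.cong) (auto simp: algebra_simps add_divide_distrib)
    also have "(\<Sum>c<s. real (?x u c)) / ?X = 1"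
      using sum_urn[OF that, of t] X by simp
    finally show ?thesis by (simp add: algebra_simps)
  qed
  have "(\<Sum>u\<in>words s (Suc m). polya s t u * ?F u) = (\<Sum>u\<in>words s m. polya s t u * ((1 + 1 / ?X) * ?F u + 1))"
    unfolding sum_polya_Suc[OF assms] using step by (intro sum.cong) auto
  also have "\<dots> = (1 + 1 / ?X) * (\<Sum>u\<in>words s m. polya s t u * ?F u) + 1"
    using sum_polya[OF assms, of t m] by (simp add: algebra_simps sum.distrib sum_distrib_left)
  also have "\<dots> = (1 + 1 / ?X) * (?X * (harm (polya_total s t + m) - urn_entropy s t)) + 1"
    unfolding Suc.IH ..
  also have "\<dots> = (?X + 1) * (harm (polya_total s t + m) - urn_entropy s t) + 1"
    using X by (simp add: field_simps)
  also have "\<dots> = (?X + 1) * (harm (Suc (polya_total s t + m)) - urn_entropy s t)"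
    using X by (simp add: harm_Suc field_simps)
  finally show ?case by (simp add: add.commute)
qed

section \<open>Randomness preservation\<close>

definition cls :: "nat list \<Rightarrow> nat \<Rightarrow> nat" where
  "cls ps x = length (filter (\<lambda>p. p < x) ps)"

lemma cls_le: "cls ps x \<le> length ps"
  by (simp add: cls_def)

text \<open>The pivots increase, so those below x form an initial segment, whose length is
  \<open>cls ps x\<close>.\<close>

lemma less_cls_iff:
  assumes "sorted_wrt (<) ps" "l < length ps"
  shows "l < cls ps x \<longleftrightarrow> ps ! l < x"
  using assms
proof (induction ps arbitrary: l)
  case (Cons p ps)
  show ?case
  proof (cases "p < x")
    case True
    then show ?thesis using Cons by (cases l) (auto simp: cls_def)
  next
    case False
    then have "filter (\<lambda>p. p < x) (p # ps) = []"
      using Cons.prems by (auto simp: filter_empty_conv)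
    moreover have "p \<le> (p # ps) ! l"
      using Cons.prems by (cases l) (auto simp: less_imp_le)
    ultimately show ?thesis using False by (auto simp: cls_def)
  qed
qed simp

lemma cls_nth:
  assumes "sorted_wrt (<) ps" "i < length ps"
  shows "cls ps (ps ! i) = i"
proof -
  have "j < cls ps (ps ! i) \<longleftrightarrow> j < i" if "j < length ps" for j
    using less_cls_iff[OF assms(1) that] sorted_wrt_nth_less[OF assms(1), of j i]
      sorted_wrt_nth_less[OF assms(1), of i j] assms(2) that by (metis less_asym linorder_neqE_nat order_less_irrefl)
  then show ?thesis using assms(2) cls_le[of ps "ps ! i"]
    by (metis linorder_neqE_nat order_less_irrefl order_less_le_trans)
qed

section \<open>Ranks, pivots and parts of a finite set\<close>

definition rank :: "nat set \<Rightarrow> nat \<Rightarrow> nat" where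
  "rank A x = card {y \<in> A. y < x}"

lemma rank_less_iff:
  assumes "finite A" "x \<in> A" "y \<in> A"
  shows "rank A x < rank A y \<longleftrightarrow> x < y"
proof -
  have "rank A x < rank A y" if "x < y" "x \<in> A" for x y
    unfolding rank_def using assms(1) that by (intro psubset_card_mono) auto
  then show ?thesis using assms by (metis less_asym linorder_neqE_nat order_less_irrefl)
qed

lemma rank_less_card: "finite A \<Longrightarrow> x \<in> A \<Longrightarrow> rank A x < card A"
  unfolding rank_def by (intro psubset_card_mono) auto

lemma inj_on_rank: "finite A \<Longrightarrow> inj_on (rank A) A"
  by (rule inj_onI) (metis rank_less_iff linorder_neqE_nat order_less_irrefl)

lemma rank_image: "finite A \<Longrightarrow> rank A ` A = {..<card A}"
  by (rule card_subset_eq) (auto simp: rank_less_card card_image inj_on_rank)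

lemma rank_sort_nth:
  assumes "distinct V" "i < length V"
  shows "rank (set V) (sort V ! i) = i"
proof -
  let ?W = "sort V"
  have W: "sorted_wrt (<) ?W" "set ?W = set V" "length ?W = length V" "distinct ?W"
    using assms by (auto simp: strict_sorted_iff)
  have "{y \<in> set ?W. y < ?W ! i} = (!) ?W ` {..<i}"
  proof (intro equalityI subsetI)
    fix y assume "y \<in> {y \<in> set ?W. y < ?W ! i}"
    then obtain j where j: "j < length ?W" "y = ?W ! j" "?W ! j < ?W ! i"
      unfolding mem_Collect_eq in_set_conv_nth by blast
    have "j < i"
      using sorted_wrt_nth_less[OF W(1), of i j] j by (metis W(3) assms(2) less_asym linorder_neqE_nat order_less_irrefl)
    then show "y \<in> (!) ?W ` {..<i}" using j by auto
  qed (use W assms sorted_wrt_nth_less[OF W(1)] in \<open>auto simp del: set_sort\<close>)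
  moreover have "inj_on ((!) ?W) {..<i}"
    using W assms by (auto simp: inj_on_def nth_eq_iff_index_eq)
  ultimately show ?thesis using W by (simp add: rank_def card_image)
qed

text \<open>The rank at which part l begins if the parts have sizes J: each earlier part is followed
  by one pivot. Over all s parts with their s - 1 pivots the value is one more than the number of
  elements.\<close>

definition offset :: "(nat \<Rightarrow> nat) \<Rightarrow> nat \<Rightarrow> nat" where
  "offset J l = (\<Sum>i<l. J i + 1)"

lemma offset_Suc: "offset J (Suc l) = offset J l + J l + 1"
  by (simp add: offset_def)

lemma offset_mono: "l \<le> l' \<Longrightarrow> offset J l \<le> offset J l'"
  unfolding offset_def by (rule sum_mono2) auto

lemma polya_total_eq_offset: "polya_total s t = offset t s"
  by (simp add: polya_total_def offset_def)

text \<open>The elements that part l must consist of, read off from the part sizes without reference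
  to the pivots. Thus inputs with the same class word have the same parts as sets.\<close>

definition block :: "nat set \<Rightarrow> (nat \<Rightarrow> nat) \<Rightarrow> nat \<Rightarrow> nat set" where
  "block A J l = {x \<in> A. offset J l \<le> rank A x \<and> rank A x < offset J l + J l}"

lemma card_block:
  assumes "finite A" "offset J l + J l \<le> card A"
  shows "card (block A J l) = J l"
proof -
  have "rank A ` block A J l = {offset J l..<offset J l + J l}"
  proof (intro equalityI subsetI)
    fix i assume i: "i \<in> {offset J l..<offset J l + J l}"
    then have "i \<in> rank A ` A" using assms rank_image[of A] by auto
    then show "i \<in> rank A ` block A J l" using i by (auto simp: block_def)
  qed (auto simp: block_def)
  moreover have "inj_on (rank A) (block A J l)"
    by (rule inj_on_subset[OF inj_on_rank[OF assms(1)]]) (auto simp: block_def)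
  ultimately show ?thesis using card_image[of "rank A" "block A J l"] by simp
qed

definition part :: "nat set \<Rightarrow> nat list \<Rightarrow> nat \<Rightarrow> nat set" where
  "part A ps l = {x \<in> A. x \<notin> set ps \<and> cls ps x = l}"

text \<open>Below pivot i lie exactly the parts 0 to i and the i earlier pivots.\<close>

lemma rank_pivot:
  assumes A: "finite A" and ps: "sorted_wrt (<) ps" "set ps \<subseteq> A"
    and J: "\<And>l. l \<le> length ps \<Longrightarrow> card (part A ps l) = J l" and i: "i < length ps"
  shows "rank A (ps ! i) = offset J i + J i"
proof -
  have "{y \<in> A. y < ps ! i} = (\<Union>l\<in>{..i}. part A ps l) \<union> (!) ps ` {..<i}"
  proof (intro equalityI subsetI)
    fix y assume y: "y \<in> {y \<in> A. y < ps ! i}"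
    show "y \<in> (\<Union>l\<in>{..i}. part A ps l) \<union> (!) ps ` {..<i}"
    proof (cases "y \<in> set ps")
      case True
      then obtain j where j: "j < length ps" "y = ps ! j" by (auto simp: in_set_conv_nth)
      have "j < i"
        using less_cls_iff[OF ps(1) j(1), of "ps ! i"] cls_nth[OF ps(1) i] y j by auto
      then show ?thesis using j by auto
    next
      case False
      have "\<not> i < cls ps y" using less_cls_iff[OF ps(1) i, of y] y by auto
      then show ?thesis using False y by (auto simp: part_def)
    qed
  next
    fix y assume "y \<in> (\<Union>l\<in>{..i}. part A ps l) \<union> (!) ps ` {..<i}"
    then consider "y \<in> A" "y \<notin> set ps" "cls ps y \<le> i" | j where "j < i" "y = ps ! j"
      by (auto simp: part_def)
    then show "y \<in> {y \<in> A. y < ps ! i}"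
    proof cases
      case 1
      then have "\<not> ps ! i < y" using less_cls_iff[OF ps(1) i, of y] by simp
      moreover have "y \<noteq> ps ! i" using 1 i by auto
      ultimately show ?thesis using 1 by auto
    next
      case 2
      then show ?thesis using sorted_wrt_nth_less[OF ps(1), of j i] i ps(2) by auto
    qed
  qed
  then have "rank A (ps ! i) = card ((\<Union>l\<in>{..i}. part A ps l) \<union> (!) ps ` {..<i})"
    by (simp add: rank_def)
  also have "\<dots> = card (\<Union>l\<in>{..i}. part A ps l) + card ((!) ps ` {..<i})"
    using A i by (intro card_Un_disjoint) (auto simp: part_def)
  also have "card (\<Union>l\<in>{..i}. part A ps l) = (\<Sum>l\<le>i. card (part A ps l))"
    using A by (intro card_UN_disjoint) (auto simp: part_def)
  also have "\<dots> = (\<Sum>l\<le>i. J l)"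
    using J i by (intro sum.cong) auto
  also have "card ((!) ps ` {..<i}) = i"
    using i ps(1) by (subst card_image) (auto simp: inj_on_def nth_eq_iff_index_eq strict_sorted_iff)
  also have "(\<Sum>l\<le>i. J l) + i = offset J i + J i"
    unfolding offset_def sum.distrib by (simp add: lessThan_Suc_atMost[symmetric])
  finally show ?thesis .
qed

text \<open>Membership in part l means lying between two consecutive pivots; as
  \<open>rank A\<close> is strictly monotone on A, this becomes an interval of ranks. The first and
  the last part have only one bounding pivot.\<close>

lemma part_eq_block:
  assumes A: "finite A" and ps: "sorted_wrt (<) ps" "set ps \<subseteq> A"
    and rk: "\<And>i. i < length ps \<Longrightarrow> rank A (ps ! i) = offset J i + J i"
    and cA: "card A + 1 = offset J (length ps + 1)" and l: "l \<le> length ps"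
  shows "part A ps l = block A J l"
proof -
  have psA: "ps ! i \<in> A" if "i < length ps" for i using ps(2) that by auto
  have lo: "l = 0 \<or> ps ! (l - 1) < x \<longleftrightarrow> offset J l \<le> rank A x" if "x \<in> A" for x
  proof (cases l)
    case 0
    then show ?thesis by (simp add: offset_def)
  next
    case (Suc l')
    then have "rank A (ps ! l') < rank A x \<longleftrightarrow> ps ! l' < x"
      using l by (intro rank_less_iff A psA that) auto
    then show ?thesis using rk[of l'] l by (auto simp: Suc offset_Suc)
  qed
  have hi: "l = length ps \<or> x < ps ! l \<longleftrightarrow> rank A x < offset J l + J l" if "x \<in> A" for x
  proof (cases "l = length ps")
    case True
    then show ?thesis using rank_less_card[OF A that] cA by (simp add: offset_Suc)
  next
    case False
    then have "rank A x < rank A (ps ! l) \<longleftrightarrow> x < ps ! l"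
      using l by (intro rank_less_iff A psA that) auto
    then show ?thesis using rk[of l] l False by auto
  qed
  have "x \<in> part A ps l \<longleftrightarrow> (l = 0 \<or> ps ! (l - 1) < x) \<and> (l = length ps \<or> x < ps ! l)"
    if x: "x \<in> A" for x
  proof
    assume *: "x \<in> part A ps l"
    then have c: "cls ps x = l" "x \<notin> set ps" by (auto simp: part_def)
    show "(l = 0 \<or> ps ! (l - 1) < x) \<and> (l = length ps \<or> x < ps ! l)"
    proof (intro conjI)
      show "l = 0 \<or> ps ! (l - 1) < x"
        using less_cls_iff[OF ps(1), of "l - 1" x] c l by (cases l) auto
      show "l = length ps \<or> x < ps ! l"
        using less_cls_iff[OF ps(1), of l x] c l by (metis le_neq_implies_less linorder_neqE_nat nth_mem order_less_irrefl)
    qed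
  next
    assume *: "(l = 0 \<or> ps ! (l - 1) < x) \<and> (l = length ps \<or> x < ps ! l)"
    have "l \<le> cls ps x"
      using less_cls_iff[OF ps(1), of "l - 1" x] * l by (cases l) auto
    moreover have "cls ps x \<le> l"
      using less_cls_iff[OF ps(1), of l x] * l cls_le[of ps x] by (cases "l = length ps") auto
    moreover have "x \<notin> set ps"
    proof
      assume "x \<in> set ps"
      then obtain i where i: "i < length ps" "x = ps ! i" by (auto simp: in_set_conv_nth)
      then have "i = l" using calculation cls_nth[OF ps(1) i(1)] by simp
      then show False using * i by auto
    qed
    ultimately show "x \<in> part A ps l" using x by (auto simp: part_def)
  qed
  then show ?thesis using lo hi by (auto simp: block_def part_def)
qed

definition pivots :: "nat \<Rightarrow> (nat \<Rightarrow> nat) \<Rightarrow> nat list \<Rightarrow> nat list" where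
  "pivots s t V = map (\<lambda>i. sort V ! (offset t i + t i)) [0..<s - 1]"

lemma length_pivots [simp]: "length (pivots s t V) = s - 1"
  by (simp add: pivots_def)

lemma pivot_index_less:
  assumes "i < s - 1"
  shows "offset t i + t i < offset t s - 1"
proof -
  have "Suc (Suc i) \<le> s" using assms by simp
  from offset_mono[OF this, of t] show ?thesis by (simp add: offset_Suc)
qed

lemma pivots_props:
  assumes V: "distinct V" "length V = offset t s - 1"
  shows "sorted_wrt (<) (pivots s t V)" "set (pivots s t V) \<subseteq> set V"
    "i < s - 1 \<Longrightarrow> rank (set V) (pivots s t V ! i) = offset t i + t i"
proof -
  have W: "sorted_wrt (<) (sort V)" using V by (auto simp: strict_sorted_iff)
  have lt: "offset t i + t i < length V" if "i < s - 1" for i using pivot_index_less[OF that] V by simp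
  show "sorted_wrt (<) (pivots s t V)"
    unfolding sorted_wrt_iff_nth_less
  proof (intro allI impI)
    fix i j assume ij: "i < j" "j < length (pivots s t V)"
    have "offset t i + t i < offset t j + t j"
      using offset_mono[of "Suc i" j t] ij by (simp add: offset_Suc)
    then show "pivots s t V ! i < pivots s t V ! j"
      using ij lt[of j] sorted_wrt_nth_less[OF W, of "offset t i + t i" "offset t j + t j"]
      by (simp add: pivots_def)
  qed
  show "set (pivots s t V) \<subseteq> set V"
  proof
    fix x assume "x \<in> set (pivots s t V)"
    then obtain i where "i < s - 1" "x = sort V ! (offset t i + t i)" by (auto simp: pivots_def)
    then show "x \<in> set V" using lt[of i] nth_mem[of "offset t i + t i" "sort V"] by simp
  qed
  show "rank (set V) (pivots s t V ! i) = offset t i + t i" if "i < s - 1"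
    using that rank_sort_nth[OF V(1) lt[OF that]] by (simp add: pivots_def)
qed

lemma offset_pos: "s > 0 \<Longrightarrow> offset t s > 0"
  by (cases s) (auto simp: offset_Suc)

text \<open>The argument for the whole array, applied to the sample: there the ranks of the pivots
  are prescribed by t.\<close>

lemma part_sample:
  assumes V: "distinct V" "length V = offset t s - 1" and l: "l < s"
  shows "card (part (set V) (pivots s t V) l) = t l"
proof -
  let ?ps = "pivots s t V"
  have s: "s > 0" using l by simp
  have cV: "card (set V) + 1 = offset t (length ?ps + 1)"
    using V distinct_card[OF V(1)] offset_pos[OF s, of t] s by simp
  have "part (set V) ?ps l = block (set V) t l"
    by (rule part_eq_block) (use pivots_props[OF V] cV l in auto)
  also have "card \<dots> = t l"
    using cV l s offset_mono[of "Suc l" s t] by (intro card_block) (auto simp: offset_Suc)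
  finally show ?thesis .
qed

lemma set_Cons_eq_image: "set_Cons A B = (\<lambda>(x, xs). x # xs) ` (A \<times> B)"
  by (auto simp: set_Cons_def)

lemma finite_listset: "(\<And>A. A \<in> set As \<Longrightarrow> finite A) \<Longrightarrow> finite (listset As)"
  by (induction As) (auto simp: set_Cons_eq_image)

lemma card_listset: "card (listset As) = prod_list (map card As)"
proof (induction As)
  case (Cons A As)
  have "inj_on (\<lambda>(x, xs). x # xs) (A \<times> listset As)" by (auto simp: inj_on_def)
  then show ?case using Cons by (simp add: set_Cons_eq_image card_image card_cartesian_product)
qed simp

lemma listset_iff: "xs \<in> listset As \<longleftrightarrow> length xs = length As \<and> (\<forall>i<length As. xs ! i \<in> As ! i)"
proof (induction As arbitrary: xs)
  case (Cons A As)
  show ?case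
  proof (cases xs)
    case (Cons y ys)
    have "(\<forall>i<Suc (length As). (y # ys) ! i \<in> (A # As) ! i) \<longleftrightarrow> y \<in> A \<and> (\<forall>i<length As. ys ! i \<in> As ! i)"
      by (auto simp: less_Suc_eq_0_disj)
    then show ?thesis using Cons.IH[of ys] Cons by (auto simp: set_Cons_def)
  qed (auto simp: set_Cons_def)
qed simp

text \<open>A list is recovered from the word of the codes of its entries together with, for each
  code, the subsequence of entries with this code. Codes that satisfy P already determine their
  entry.\<close>

lemma map_eq_filter_eq_imp_eq:
  assumes "map f xs = map g ys"
    and "\<And>x y. x \<in> set xs \<Longrightarrow> y \<in> set ys \<Longrightarrow> f x = g y \<Longrightarrow> P (f x) \<Longrightarrow> x = y"
    and "\<And>c. \<not> P c \<Longrightarrow> filter (\<lambda>x. f x = c) xs = filter (\<lambda>y. g y = c) ys"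
  shows "xs = ys"
  using assms
proof (induction xs arbitrary: ys)
  case (Cons x xs)
  then obtain y ys' where ys: "ys = y # ys'" by (cases ys) auto
  have fg: "f x = g y" and m: "map f xs = map g ys'" using Cons.prems(1) ys by auto
  have xy: "x = y"
  proof (cases "P (f x)")
    case True
    then show ?thesis using Cons.prems(2)[of x y] fg ys by simp
  next
    case False
    then show ?thesis using Cons.prems(3)[of "f x"] fg ys by simp
  qed
  have "xs = ys'"
  proof (rule Cons.IH[OF m])
    show "a = b" if "a \<in> set xs" "b \<in> set ys'" "f a = g b" "P (f a)" for a b
      using Cons.prems(2)[of a b] that ys by simp
    show "filter (\<lambda>x. f x = c) xs = filter (\<lambda>y. g y = c) ys'" if "\<not> P c" for c
      using Cons.prems(3)[OF that] fg ys by (simp split: if_splits)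
  qed
  then show ?case using xy ys by simp
qed simp

lemma count_mset_map_distinct:
  assumes "distinct V"
  shows "count (mset (map f V)) y = card {x \<in> set V. f x = y}"
proof -
  have "count (mset (map f V)) y = length (filter (\<lambda>x. f x = y) V)"
    by (induction V) auto
  also have "\<dots> = card (set (filter (\<lambda>x. f x = y) V))"
    using assms by (intro distinct_card[symmetric]) simp
  finally show ?thesis by simp
qed

text \<open>Codes of the sample elements: t l of class l that are no pivot, marked
  \<open>False\<close>, and each pivot once, marked \<open>True\<close>. An arrangement of this
  multiset records how classes and pivots interleave in the sample, and the number of arrangements
  is a multinomial coefficient.\<close>

definition sample_codes :: "nat \<Rightarrow> (nat \<Rightarrow> nat) \<Rightarrow> (bool \<times> nat) multiset" where
  "sample_codes s t = (\<Sum>l<s. replicate_mset (t l) (False, l)) + mset (map (Pair True) [0..<s - 1])"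

lemma count_sample_codes:
  "count (sample_codes s t) (b, l) = (if b then (if l < s - 1 then 1 else 0) else if l < s then t l else 0)"
proof -
  have 1: "count (\<Sum>l<s. replicate_mset (t l) (False, l)) (b, l) = (if \<not> b \<and> l < s then t l else 0)"
    by (induction s) (auto simp: less_Suc_eq)
  have 2: "count (mset (map (Pair True) [0..<s - 1])) (b, l) = (if b \<and> l < s - 1 then 1 else 0)"
    by (subst count_mset_map_distinct) (auto simp: card_1_singleton_iff)
  show ?thesis unfolding sample_codes_def count_union 1 2 by auto
qed

lemma size_sample_codes: "s > 0 \<Longrightarrow> size (sample_codes s t) = offset t s - 1"
proof -
  assume "s > 0"
  have "size (\<Sum>l<s. replicate_mset (t l) (False, l)) = (\<Sum>l<s. t l)" by (induction s) auto
  moreover have "offset t s = (\<Sum>l<s. t l) + s" unfolding offset_def sum.distrib by simp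
  ultimately show ?thesis using \<open>s > 0\<close> by (simp add: sample_codes_def)
qed

lemma card_permutations_of_sample_codes:
  assumes "s > 0"
  shows "real (card (permutations_of_multiset (sample_codes s t))) * (\<Prod>l<s. fact (t l)) = fact (offset t s - 1)"
proof -
  let ?M = "sample_codes s t"
  have "(\<Prod>x\<in>set_mset ?M. fact (count ?M x)) = (\<Prod>l<s. fact (t l) :: nat)"
  proof -
    have sub: "set_mset ?M \<subseteq> Pair False ` {..<s} \<union> Pair True ` {..<s - 1}"
    proof
      fix x assume "x \<in># ?M"
      then have "count ?M x \<noteq> 0" by simp
      then show "x \<in> Pair False ` {..<s} \<union> Pair True ` {..<s - 1}"
        by (cases x) (auto simp: count_sample_codes split: if_splits)
    qed
    have "(\<Prod>x\<in>set_mset ?M. fact (count ?M x) :: nat) = (\<Prod>x\<in>Pair False ` {..<s} \<union> Pair True ` {..<s - 1}. fact (count ?M x))"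
      using sub by (intro prod.mono_neutral_left) (auto simp: not_in_iff)
    also have "\<dots> = (\<Prod>x\<in>Pair False ` {..<s}. fact (count ?M x)) * (\<Prod>x\<in>Pair True ` {..<s - 1}. fact (count ?M x))"
      by (intro prod.union_disjoint) auto
    also have "(\<Prod>x\<in>Pair True ` {..<s - 1}. fact (count ?M x) :: nat) = 1"
      by (intro prod.neutral) (auto simp: count_sample_codes)
    also have "(\<Prod>x\<in>Pair False ` {..<s}. fact (count ?M x) :: nat) = (\<Prod>l<s. fact (t l))"
      by (subst prod.reindex) (auto simp: inj_on_def count_sample_codes intro!: prod.cong)
    finally show ?thesis by simp
  qed
  then have "card (permutations_of_multiset ?M) * (\<Prod>l<s. fact (t l)) = fact (offset t s - 1)"
    using card_permutations_of_multiset[of ?M] size_sample_codes[OF assms, of t] by auto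
  then have "real (card (permutations_of_multiset ?M) * (\<Prod>l<s. fact (t l))) = real (fact (offset t s - 1))" by simp
  then show ?thesis by simp
qed

definition class_counts :: "(nat \<Rightarrow> nat) \<Rightarrow> nat list \<Rightarrow> nat \<Rightarrow> nat" where
  "class_counts t u l = t l + count_list u l"

lemma offset_class_counts:
  assumes "u \<in> words s m"
  shows "offset (class_counts t u) s = offset t s + m"
  using sum_count_list_words[OF assms]
  unfolding offset_def class_counts_def sum.distrib by simp

text \<open>\<open>idx u l\<close> stands for the order in which the partitioning procedure emits
  the ordinary elements of class l. Any enumeration of their positions will do, provided that it is
  a function of the class word.\<close>

locale class_word_index =
  fixes s :: nat and t :: "nat \<Rightarrow> nat" and idx :: "nat list \<Rightarrow> nat \<Rightarrow> nat list"
  assumes s_pos: "s > 0"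
    and distinct_idx: "\<And>u l. u \<in> words s m \<Longrightarrow> l < s \<Longrightarrow> distinct (idx u l)"
    and set_idx: "\<And>u l. u \<in> words s m \<Longrightarrow> l < s \<Longrightarrow> set (idx u l) = positions_of u l"
begin

definition k :: nat where "k = offset t s - 1"

definition piv :: "nat list \<Rightarrow> nat list" where
  "piv xs = pivots s t (take k xs)"

definition word :: "nat list \<Rightarrow> nat list" where
  "word xs = map (cls (piv xs)) (drop k xs)"

definition codes :: "nat list \<Rightarrow> (bool \<times> nat) list" where
  "codes xs = map (\<lambda>x. (x \<in> set (piv xs), cls (piv xs) x)) (take k xs)"

definition part_list :: "nat list \<Rightarrow> nat \<Rightarrow> nat list" where
  "part_list xs l = filter (\<lambda>x. x \<notin> set (piv xs) \<and> cls (piv xs) x = l) (take k xs)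
     @ map ((!) (drop k xs)) (idx (word xs) l)"

abbreviation blocks :: "nat set \<Rightarrow> nat list \<Rightarrow> nat set list" where
  "blocks A u \<equiv> map (block A (class_counts t u)) [0..<s]"

context
  fixes A :: "nat set" and m :: nat
  assumes finite_A: "finite A" and card_A: "card A = k + m"
begin

lemma perm_facts:
  assumes "xs \<in> permutations_of_set A"
  shows "length xs = k + m" "distinct xs" "set xs = A" "distinct (take k xs)" "length (take k xs) = k"
    "distinct (drop k xs)" "length (drop k xs) = m" "set (take k xs) \<inter> set (drop k xs) = {}"
    "set (take k xs) \<union> set (drop k xs) = A"
proof -
  show 1: "set xs = A" "distinct xs" using permutations_of_setD[OF assms] by auto
  show 2: "length xs = k + m" using card_A 1 distinct_card by fastforce
  then show "length (take k xs) = k" "length (drop k xs) = m" by auto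
  have "distinct (take k xs @ drop k xs)" "set (take k xs @ drop k xs) = A" using 1 by (simp_all only: append_take_drop_id)
  then show "distinct (take k xs)" "distinct (drop k xs)" "set (take k xs) \<inter> set (drop k xs) = {}"
    "set (take k xs) \<union> set (drop k xs) = A" by (simp_all only: distinct_append set_append)
qed

lemma piv_facts:
  assumes "xs \<in> permutations_of_set A"
  shows "sorted_wrt (<) (piv xs)" "set (piv xs) \<subseteq> set (take k xs)" "length (piv xs) = s - 1"
    "\<And>l. l < s \<Longrightarrow> card (part (set (take k xs)) (piv xs) l) = t l"
  unfolding piv_def using pivots_props(1,2)[of "take k xs" t s] part_sample[of "take k xs" t s] perm_facts[OF assms]
  by (auto simp: k_def)

lemma word_in_words:
  assumes "xs \<in> permutations_of_set A"
  shows "word xs \<in> words s m"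
proof -
  have "cls (piv xs) x < s" for x using cls_le[of "piv xs" x] piv_facts(3)[OF assms] s_pos by linarith
  then show ?thesis using perm_facts[OF assms] by (auto simp: word_def words_def)
qed

lemma card_part:
  assumes xs: "xs \<in> permutations_of_set A" and l: "l < s"
  shows "card (part A (piv xs) l) = class_counts t (word xs) l"
proof -
  note V = perm_facts[OF xs] and P = piv_facts[OF xs]
  have "part A (piv xs) l = part (set (take k xs)) (piv xs) l \<union> {x \<in> set (drop k xs). cls (piv xs) x = l}"
    using V P(2) by (auto simp: part_def)
  then have "card (part A (piv xs) l) = t l + card {x \<in> set (drop k xs). cls (piv xs) x = l}"
    using V P(4)[OF l] by (subst card_Un_disjoint[symmetric, THEN trans[rotated]]) (auto simp: part_def card_Un_disjoint)
  also have "card {x \<in> set (drop k xs). cls (piv xs) x = l} = count_list (word xs) l"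
    using count_mset_map_distinct[OF V(6), of "cls (piv xs)" l] by (simp add: word_def count_mset[symmetric] count_mset)
  finally show ?thesis by (simp add: class_counts_def)
qed

lemma rank_piv:
  assumes xs: "xs \<in> permutations_of_set A" and i: "i < s - 1"
  shows "rank A (piv xs ! i) = offset (class_counts t (word xs)) i + class_counts t (word xs) i"
  using piv_facts[OF xs] perm_facts[OF xs] card_part[OF xs] i s_pos
  by (intro rank_pivot finite_A) auto

lemma offset_total: "u \<in> words s m \<Longrightarrow> offset (class_counts t u) s = card A + 1"
  using offset_class_counts[of u s m t] offset_pos[OF s_pos, of t] card_A by (simp add: k_def)

lemma part_eq:
  assumes xs: "xs \<in> permutations_of_set A" and l: "l < s"
  shows "part A (piv xs) l = block A (class_counts t (word xs)) l"
  using piv_facts[OF xs] perm_facts[OF xs] rank_piv[OF xs] l s_pos offset_total[OF word_in_words[OF xs]]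
  by (intro part_eq_block finite_A) auto

lemma card_block_counts:
  assumes "u \<in> words s m" "l < s"
  shows "card (block A (class_counts t u) l) = class_counts t u l"
  using offset_total[OF assms(1)] offset_mono[of "Suc l" s "class_counts t u"] assms(2)
  by (intro card_block finite_A) (auto simp: offset_Suc)

lemma part_list_perm:
  assumes xs: "xs \<in> permutations_of_set A" and l: "l < s"
  shows "part_list xs l \<in> permutations_of_set (block A (class_counts t (word xs)) l)"
proof -
  note V = perm_facts[OF xs] and P = piv_facts[OF xs] and W = word_in_words[OF xs]
  have pos: "positions_of (word xs) l = {i. i < m \<and> cls (piv xs) (drop k xs ! i) = l}"
    using V by (auto simp: positions_of_def word_def)
  have img: "(!) (drop k xs) ` set (idx (word xs) l) = {x \<in> set (drop k xs). cls (piv xs) x = l}"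
    unfolding set_idx[OF W l] pos using V(7) by (auto simp: in_set_conv_nth image_iff)
  have "distinct (map ((!) (drop k xs)) (idx (word xs) l))"
    using distinct_idx[OF W l] set_idx[OF W l] V(6,7) pos
    by (auto simp: distinct_map inj_on_def nth_eq_iff_index_eq simp del: nth_drop)
  moreover have "set (part_list xs l) = part A (piv xs) l"
    using V P(2) img by (auto simp: part_list_def part_def)
  ultimately have "set (part_list xs l) = part A (piv xs) l" "distinct (part_list xs l)"
    using V img by (auto simp: part_list_def)
  then show ?thesis using part_eq[OF xs l] by (auto intro: permutations_of_setI)
qed

lemma codes_perm:
  assumes xs: "xs \<in> permutations_of_set A"
  shows "codes xs \<in> permutations_of_multiset (sample_codes s t)"
proof (rule permutations_of_multisetI, rule multiset_eqI)
  note V = perm_facts[OF xs] and P = piv_facts[OF xs]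
  fix c :: "bool \<times> nat"
  obtain b l where c: "c = (b, l)" by fastforce
  have "count (mset (codes xs)) c = card {x \<in> set (take k xs). (x \<in> set (piv xs), cls (piv xs) x) = c}"
    unfolding codes_def using V(4) by (rule count_mset_map_distinct)
  also have "\<dots> = count (sample_codes s t) c"
  proof (cases b)
    case False
    then have "{x \<in> set (take k xs). (x \<in> set (piv xs), cls (piv xs) x) = c} = part (set (take k xs)) (piv xs) l"
      by (auto simp: c part_def)
    moreover have "part (set (take k xs)) (piv xs) l = {}" if "\<not> l < s"
      using cls_le[of "piv xs"] P(3) that s_pos by (auto simp: part_def) (metis One_nat_def Suc_pred le_imp_less_Suc)
    ultimately show ?thesis using P(4)[of l] False by (auto simp: c count_sample_codes)
  next
    case True
    then have "{x \<in> set (take k xs). (x \<in> set (piv xs), cls (piv xs) x) = c} = {x \<in> set (piv xs). cls (piv xs) x = l}"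
      using P(2) by (auto simp: c)
    also have "\<dots> = (if l < s - 1 then {piv xs ! l} else {})"
      using cls_nth[OF P(1)] P(3) by (auto simp: in_set_conv_nth)
    finally show ?thesis using True by (simp add: c count_sample_codes)
  qed
  finally show "count (mset (codes xs)) c = count (sample_codes s t) c" .
qed

text \<open>Decoding: the class word gives the part sizes, hence the ranks of the pivots and, as A
  is known, the pivots. In each part list the first t l entries come from the sample; the rest
  return to their positions by means of \<open>idx\<close>, and the codes put the sample in
  order.\<close>

lemma split_inj:
  "inj_on (\<lambda>xs. (codes xs, word xs, map (part_list xs) [0..<s])) (permutations_of_set A)"
proof (rule inj_onI)
  fix xs ys
  assume xs: "xs \<in> permutations_of_set A" and ys: "ys \<in> permutations_of_set A"
    and eq: "(codes xs, word xs, map (part_list xs) [0..<s]) = (codes ys, word ys, map (part_list ys) [0..<s])"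
  note V = perm_facts[OF xs] and P = piv_facts[OF xs]
  note V' = perm_facts[OF ys] and P' = piv_facts[OF ys]
  have cd: "codes xs = codes ys" and wd: "word xs = word ys"
    and pl: "\<And>l. l < s \<Longrightarrow> part_list xs l = part_list ys l" using eq by auto
  have pv: "piv xs = piv ys"
  proof (rule nth_equalityI)
    fix i assume "i < length (piv xs)"
    then have i: "i < s - 1" using P(3) by simp
    have "rank A (piv xs ! i) = rank A (piv ys ! i)"
      using rank_piv[OF xs i] rank_piv[OF ys i] wd by simp
    moreover have "piv xs ! i \<in> A" "piv ys ! i \<in> A"
      using P(2,3) P'(2,3) V(9) V'(9) i by (metis UnI1 nth_mem subsetD)+
    ultimately show "piv xs ! i = piv ys ! i" using inj_on_rank[OF finite_A] by (auto dest: inj_onD)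
  qed (use P(3) P'(3) in simp)
  define F where "F zs l = filter (\<lambda>x. x \<notin> set (piv xs) \<and> cls (piv xs) x = l) (take k zs)" for zs l
  have lenF: "length (F xs l) = t l \<and> length (F ys l) = t l" if "l < s" for l
  proof -
    have "length (F xs l) = card (set (F xs l))" "length (F ys l) = card (set (F ys l))"
      using V(4) V'(4) by (simp_all only: F_def distinct_card distinct_filter)
    moreover have "set (F xs l) = part (set (take k xs)) (piv xs) l" "set (F ys l) = part (set (take k ys)) (piv ys) l"
      by (auto simp: F_def part_def pv)
    ultimately show ?thesis using P(4)[OF that] P'(4)[OF that] by simp
  qed
  have split: "F xs l = F ys l \<and> map ((!) (drop k xs)) (idx (word xs) l) = map ((!) (drop k ys)) (idx (word xs) l)"
    if "l < s" for l
  proof -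
    have "part_list xs l = F xs l @ map ((!) (drop k xs)) (idx (word xs) l)"
      "part_list ys l = F ys l @ map ((!) (drop k ys)) (idx (word xs) l)"
      unfolding part_list_def F_def pv wd by (rule refl)+
    moreover have "length (F xs l) = length (F ys l)" using lenF[OF that] by simp
    ultimately show ?thesis
      using pl[OF that] append_eq_append_conv[of "F xs l" "F ys l"] by metis
  qed
  have "drop k xs = drop k ys"
  proof (rule nth_equalityI)
    fix i assume "i < length (drop k xs)"
    then have i: "i < m" using V(7) by simp
    define l where "l = word xs ! i"
    have "word xs ! i \<in> set (word xs)" using i word_in_words[OF xs] by (intro nth_mem) (auto simp: words_def)
    then have l: "l < s" using word_in_words[OF xs] by (auto simp: words_def l_def)
    have "i \<in> set (idx (word xs) l)"
      unfolding set_idx[OF word_in_words[OF xs] l] using i word_in_words[OF xs] by (auto simp: positions_of_def l_def words_def)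
    then show "drop k xs ! i = drop k ys ! i" using split[OF l] by (auto simp: map_eq_conv)
  qed (use V(7) V'(7) in simp)
  moreover have "take k xs = take k ys"
  proof (rule map_eq_filter_eq_imp_eq)
    let ?f = "\<lambda>x. (x \<in> set (piv xs), cls (piv xs) x)"
    show "map ?f (take k xs) = map ?f (take k ys)" using cd unfolding codes_def pv .
    show "x = y" if "?f x = ?f y" "fst (?f x)" for x y
      using that cls_nth[OF P(1)] by (auto simp: in_set_conv_nth)
    show "filter (\<lambda>x. ?f x = c) (take k xs) = filter (\<lambda>x. ?f x = c) (take k ys)" if "\<not> fst c" for c
    proof (cases "snd c < s")
      case True
      have "filter (\<lambda>x. ?f x = c) zs = filter (\<lambda>x. x \<notin> set (piv xs) \<and> cls (piv xs) x = snd c) zs" for zs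
        using \<open>\<not> fst c\<close> by (intro filter_cong) (auto simp: prod_eq_iff)
      then show ?thesis using split[OF True] by (simp add: F_def)
    next
      case False
      have "cls (piv xs) x < s" for x using cls_le[of "piv xs" x] P(3) s_pos by linarith
      then have "filter (\<lambda>x. ?f x = c) zs = []" for zs using False by (auto simp: filter_empty_conv)
      then show ?thesis by simp
    qed
  qed
  ultimately show "xs = ys" by (metis append_take_drop_id)
qed

definition split_target where
  "split_target = (SIGMA v:permutations_of_multiset (sample_codes s t). SIGMA u:words s m.
     listset (map permutations_of_set (blocks A u)))"

lemma card_listset_blocks:
  assumes "u \<in> words s m"
  shows "real (card (listset (map permutations_of_set (blocks A u)))) = (\<Prod>l<s. fact (class_counts t u l))"
proof -
  have "card (listset (map permutations_of_set (blocks A u))) = prod_list (map (\<lambda>l. fact (class_counts t u l)) [0..<s])"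
    unfolding card_listset map_map o_def
    using assms card_block_counts finite_A
    by (intro arg_cong[where f = prod_list] map_cong) (auto simp: block_def)
  also have "\<dots> = (\<Prod>l<s. fact (class_counts t u l))"
    by (simp add: prod.distinct_set_conv_list[symmetric] atLeast0LessThan)
  finally show ?thesis by simp
qed

text \<open>This is where the urn comes from: the number of ways to order the parts for a given
  class word is proportional to the Polya weight of that word.\<close>

lemma prod_fact_class_counts:
  assumes "u \<in> words s m"
  shows "(\<Prod>l<s. fact (class_counts t u l)) = polya s t u * (\<Prod>l<s. fact (t l)) * fact (card A) / fact k"
proof -
  have "(\<Prod>l<s. fact (t l) :: real) \<noteq> 0" by simp
  then show ?thesis
    using assms by (simp add: polya_def class_counts_def prod_dividef polya_total_eq_offset k_def
      card_A[unfolded k_def] words_def)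
qed

lemma finite_listset_blocks: "finite (listset (map permutations_of_set (blocks A u)))"
  by (rule finite_listset) auto

text \<open>By the preceding identity the sum over class words is a constant times the total Polya
  weight, which is 1. The multinomial number of codes turns the constant into n!.\<close>

lemma card_split_target: "card split_target = fact (card A)"
proof -
  let ?N = "card (permutations_of_multiset (sample_codes s t))"
  have "card split_target = ?N * (\<Sum>u\<in>words s m. card (listset (map permutations_of_set (blocks A u))))"
    unfolding split_target_def by (simp add: card_cartesian_product card_SigmaI finite_listset_blocks finite_SigmaI del: map_map)
  then have "real (card split_target) = real ?N * (\<Sum>u\<in>words s m. polya s t u * (\<Prod>l<s. fact (t l)) * fact (card A) / fact k)"
    using card_listset_blocks prod_fact_class_counts by simp
  also have "\<dots> = real ?N * (\<Prod>l<s. fact (t l)) * fact (card A) / fact k * (\<Sum>u\<in>words s m. polya s t u)"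
    by (simp add: sum_distrib_left sum_distrib_right sum_divide_distrib mult_ac)
  also have "\<dots> = real (fact (card A))"
    using card_permutations_of_sample_codes[OF s_pos, of t] sum_polya[OF s_pos, of t m]
    by (simp add: k_def)
  finally show ?thesis by (simp only: of_nat_eq_iff)
qed

text \<open>Surjectivity comes from equal cardinalities, so no inverse has to be
  constructed.\<close>

lemma split_bij:
  "bij_betw (\<lambda>xs. (codes xs, word xs, map (part_list xs) [0..<s])) (permutations_of_set A) split_target"
proof -
  let ?\<Phi> = "\<lambda>xs. (codes xs, word xs, map (part_list xs) [0..<s])"
  have "?\<Phi> ` permutations_of_set A \<subseteq> split_target"
    using codes_perm word_in_words part_list_perm by (auto simp: split_target_def listset_iff)
  moreover have "finite split_target"
    unfolding split_target_def by (intro finite_SigmaI finite_listset_blocks) auto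
  moreover have "card (?\<Phi> ` permutations_of_set A) = card split_target"
    using card_image[OF split_inj] finite_A by (simp add: card_split_target)
  ultimately have "?\<Phi> ` permutations_of_set A = split_target" by (intro card_subset_eq) auto
  then show ?thesis using split_inj by (simp add: bij_betw_def)
qed

text \<open>
  For a random permutation, the class word has the law of the Polya urn, and given the class word,
  the parts are independent random permutations.
\<close>

lemma sum_permutations_split:
  fixes h :: "nat list \<Rightarrow> nat list list \<Rightarrow> real"
  shows "(\<Sum>xs\<in>permutations_of_set A. h (word xs) (map (part_list xs) [0..<s]))
    = fact (card A) * (\<Sum>u\<in>words s m. polya s t u *
        ((\<Sum>zs\<in>listset (map permutations_of_set (blocks A u)). h u zs)
          / card (listset (map permutations_of_set (blocks A u)))))"
proof -
  let ?N = "card (permutations_of_multiset (sample_codes s t))"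
  let ?L = "\<lambda>u. listset (map permutations_of_set (blocks A u))"
  have "(\<Sum>xs\<in>permutations_of_set A. h (word xs) (map (part_list xs) [0..<s]))
      = (\<Sum>(v, u, zs)\<in>split_target. h u zs)"
    using sum.reindex_bij_betw[OF split_bij, of "\<lambda>(v, u, zs). h u zs"] by simp
  also have "\<dots> = (\<Sum>v\<in>permutations_of_multiset (sample_codes s t). \<Sum>u\<in>words s m. \<Sum>zs\<in>?L u. h u zs)"
  proof -
    have "(\<Sum>u\<in>words s m. \<Sum>zs\<in>?L u. h u zs) = (\<Sum>(u, zs)\<in>(SIGMA u:words s m. ?L u). h u zs)"
      by (rule sum.Sigma) (auto simp: finite_listset_blocks simp del: map_map)
    then show ?thesis
      unfolding split_target_def by (simp add: sum.cartesian_product split_def del: map_map sum_constant)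
  qed
  also have "\<dots> = real ?N * (\<Sum>u\<in>words s m. \<Sum>zs\<in>?L u. h u zs)" by simp
  also have "\<dots> = (\<Sum>u\<in>words s m. fact (card A) * (polya s t u * ((\<Sum>zs\<in>?L u. h u zs) / card (?L u))))"
    unfolding sum_distrib_left
  proof (rule sum.cong)
    fix u assume u: "u \<in> words s m"
    have pos: "real (card (?L u)) > 0"
      unfolding card_listset_blocks[OF u] by (intro prod_pos) simp
    have "real (card (?L u)) * real ?N = fact (card A) * polya s t u"
      unfolding card_listset_blocks[OF u] prod_fact_class_counts[OF u]
      using card_permutations_of_sample_codes[OF s_pos, of t] by (simp add: k_def field_simps)
    then have "real ?N = fact (card A) * polya s t u / real (card (?L u))"
      using pos by (simp add: field_simps del: map_map)
    then show "(\<Sum>zs\<in>?L u. real ?N * h u zs) = fact (card A) * (polya s t u * ((\<Sum>zs\<in>?L u. h u zs) / card (?L u)))"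
      unfolding sum_distrib_left[symmetric] by simp
  qed simp
  finally show ?thesis by (simp add: sum_distrib_left)
qed

end

end

section \<open>The recursion\<close>

lemma isort_insert_spec:
  assumes "sorted (rev ys)"
  shows "sorted (rev (snd (isort_insert L x ys))) \<and> mset (snd (isort_insert L x ys)) = add_mset x (mset ys)"
  using assms
proof (induction ys)
  case (Cons y ys)
  then have "sorted (rev ys)" by (simp add: sorted_append)
  from Cons.IH[OF this] have IH: "sorted (rev (snd (isort_insert L x ys)))"
    "mset (snd (isort_insert L x ys)) = add_mset x (mset ys)" by auto
  show ?case
  proof (cases "y > x")
    case True
    have "set (snd (isort_insert L x ys)) = insert x (set ys)"
      using IH(2) by (metis set_mset_add_mset_insert set_mset_mset)
    then show ?thesis using True IH Cons.prems by (auto simp: split_def Let_def sorted_append)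
  next
    case False
    then show ?thesis using Cons.prems by (auto simp: sorted_append)
  qed
qed simp

lemma isort_loop_spec:
  "sorted (rev ys) \<Longrightarrow> snd (isort_loop L ys xs) = sort (ys @ xs)"
proof (induction xs arbitrary: ys)
  case Nil
  then show ?case by (auto intro!: properties_for_sort[symmetric])
next
  case (Cons x xs)
  have "snd (isort_loop L ys (x # xs)) = sort (snd (isort_insert L x ys) @ xs)"
    using isort_insert_spec[OF Cons.prems, of L x] Cons.IH[of "snd (isort_insert L x ys)"]
    by (simp add: split_def Let_def)
  also have "\<dots> = sort (ys @ x # xs)"
    using isort_insert_spec[OF Cons.prems, of L x]
    by (intro properties_for_sort) (auto simp: mset_sort)
  finally show ?case .
qed

lemma snd_insertionsort: "snd (insertionsort L xs) = sort xs"
  using isort_loop_spec[of "[hd xs]" L "tl xs"] by (cases xs) (auto simp: insertionsort_def)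

text \<open>An insertion ends at its first failed test, so it fails once however far the element
  moves.\<close>

lemma isort_insert_trace:
  "x \<notin> range L \<Longrightarrow> outcomes x (fst (isort_insert L v ys)) = []"
  "side_falses K (fst (isort_insert L v ys)) \<le> 1"
  by (induction ys) (auto simp: split_def Let_def)

lemma isort_loop_trace:
  "x \<notin> range L \<Longrightarrow> outcomes x (fst (isort_loop L ys xs)) = []"
  "side_falses K (fst (isort_loop L ys xs)) \<le> length xs + 1"
proof (induction xs arbitrary: ys)
  case (Cons v xs)
  { case 1
    then show ?case using Cons.IH(1) isort_insert_trace(1)[of x L v ys] by (auto simp: split_def Let_def)
  next
    case 2
    then show ?case using Cons.IH(2)[of "snd (isort_insert L v ys)"] isort_insert_trace(2)[of K L v ys]
      by (auto simp: split_def Let_def)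
  }
qed auto

lemma insertionsort_trace:
  "x \<notin> range L \<Longrightarrow> outcomes x (fst (insertionsort L xs)) = []"
  "side_falses K (fst (insertionsort L xs)) \<le> length xs + 1"
  using isort_loop_trace(1)[of x L "[hd xs]" "tl xs"] isort_loop_trace(2)[of K L "[hd xs]" "tl xs"]
  by (cases xs; auto simp: insertionsort_def)+

text \<open>V and U are quantified inside: \<open>idx\<close>, \<open>tr\<close> and
  \<open>e\<close> belong to the class word. Zero is excluded from the sample so that the pivot
  exceeds the sentinel. The components of t are numbered from 1, the classes from 0, hence the shift
  by \<open>Suc\<close>.\<close>

definition partition_ok ::
  "algorithm \<Rightarrow> (nat \<Rightarrow> nat) \<Rightarrow> nat list \<Rightarrow> (nat \<Rightarrow> nat list) \<Rightarrow> trace \<Rightarrow> (location \<Rightarrow> bool list) \<Rightarrow> bool" where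
  "partition_ok alg t u idx tr e \<longleftrightarrow>
     (\<forall>l<num_parts alg. distinct (idx l) \<and> set (idx l) = positions_of u l)
   \<and> (\<forall>x\<in>key_locs alg. outcomes x tr = key_word x u @ e x \<and> length (e x) \<le> 1)
   \<and> side_falses (key_locs alg) tr \<le> 2
   \<and> (\<forall>V U. let ps = pivots (num_parts alg) (\<lambda>l. t (Suc l)) V in
        distinct V \<longrightarrow> length V = sample_size alg t \<longrightarrow> 0 \<notin> set V \<longrightarrow> set V \<inter> set U = {} \<longrightarrow> map (cls ps) U = u \<longrightarrow>
        divide alg t V U = (fst (insertionsort Sample_Sort V) @ tr,
          map (\<lambda>l. filter (\<lambda>x. x \<notin> set ps \<and> cls ps x = l) V @ map ((!) U) (idx l)) [0..<num_parts alg]))"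

lemma sample_size_eq_offset: "sample_size alg t = offset (\<lambda>l. t (Suc l)) (num_parts alg) - 1"
  by (cases alg) (auto simp: sample_size_def offset_def numeral_2_eq_2 numeral_3_eq_3)

lemma partition_ok_exists:
  assumes "set u \<subseteq> {..<num_parts alg}"
  shows "\<exists>idx tr e. partition_ok alg t u idx tr e"
proof (cases alg)
  case CQS
  have u: "set u \<subseteq> {0, 1}" using assms CQS by (auto simp: less_2_cases_iff)
  obtain idx tr where p: "\<And>l. distinct (idx l)" "\<And>l. set (idx l) = positions_of u l"
    "outcomes CQS_Key_k tr = key_word CQS_Key_k u @ [False]"
    "outcomes CQS_Key_g tr = key_word CQS_Key_g u @ [False]"
    "side_falses (key_locs CQS) tr = 2"
    "\<And>p U. 0 < p \<Longrightarrow> length U = length u \<Longrightarrow>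
       (\<And>i. i < length u \<Longrightarrow> (U ! i < p \<longleftrightarrow> u ! i = 0) \<and> (p < U ! i \<longleftrightarrow> u ! i = 1)) \<Longrightarrow>
       \<exists>A j. cqs_partition p U = (A, j, tr) \<and> subarray A 1 j = map ((!) U) (idx 0)
         \<and> subarray A j (length U + 1) = map ((!) U) (idx 1)"
  proof (rule cqs_partition_spec[OF u], goal_cases)
    case (1 idx tr)
    show ?case by (rule that) (fact 1)+
  qed
  have "partition_ok alg t u idx tr (\<lambda>x. [False])"
    unfolding partition_ok_def Let_def
  proof (intro conjI allI impI ballI)
    fix V U :: "nat list"
    let ?ps = "pivots (num_parts alg) (\<lambda>l. t (Suc l)) V"
    assume V: "distinct V" "length V = sample_size alg t" "0 \<notin> set V" and VU: "set V \<inter> set U = {}"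
      and cU: "map (cls ?ps) U = u"
    define p where "p = sort V ! t 1"
    have ps: "?ps = [p]" by (simp add: CQS pivots_def p_def offset_def)
    have "set ?ps \<subseteq> set V" using pivots_props(2)[OF V(1)] V(2) sample_size_eq_offset by metis
    then have pV: "p \<in> set V" using ps by simp
    have cl: "cls [p] x = (if p < x then 1 else 0)" for x by (simp add: cls_def)
    have "\<exists>A j. cqs_partition p U = (A, j, tr) \<and> subarray A 1 j = map ((!) U) (idx 0)
         \<and> subarray A j (length U + 1) = map ((!) U) (idx 1)"
    proof (rule p(6))
      show "0 < p" using pV V(3) by (auto intro!: Nat.gr0I)
      show "length U = length u" using cU by auto
      fix i assume "i < length u"
      then have i: "i < length U" using cU by auto
      then have "U ! i \<noteq> p" using VU pV by auto
      moreover have "u ! i = cls [p] (U ! i)" using cU[symmetric] i ps by simp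
      ultimately show "(U ! i < p \<longleftrightarrow> u ! i = 0) \<and> (p < U ! i \<longleftrightarrow> u ! i = 1)" by (auto simp: cl)
    qed
    then obtain A j where A: "cqs_partition p U = (A, j, tr)" "subarray A 1 j = map ((!) U) (idx 0)"
      "subarray A j (length U + 1) = map ((!) U) (idx 1)" by blast
    have f: "filter (\<lambda>x. x \<notin> set [p] \<and> cls [p] x = 0) V = filter (\<lambda>v. v < p) V"
      "filter (\<lambda>x. x \<notin> set [p] \<and> cls [p] x = 1) V = filter (\<lambda>v. p < v) V"
      by (auto simp: cl intro!: filter_cong)
    have r: "[0..<num_parts alg] = [0, 1]" by (simp add: CQS upt_rec)
    show "divide alg t V U = (fst (insertionsort Sample_Sort V) @ tr,
          map (\<lambda>l. filter (\<lambda>x. x \<notin> set ?ps \<and> cls ?ps x = l) V @ map ((!) U) (idx l)) [0..<num_parts alg])"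
      unfolding ps r list.map f A(2-3)[symmetric] using A(1)
      by (simp add: CQS split_def Let_def snd_insertionsort p_def[unfolded One_nat_def, symmetric])
  qed (use p CQS in auto)
  then show ?thesis by blast
next
  case YQS
  have u: "set u \<subseteq> {0, 1, 2}" using assms YQS by auto
  obtain idx tr e where p: "\<And>l. distinct (idx l)" "\<And>l. set (idx l) = positions_of u l"
    "\<And>x. x \<in> key_locs YQS \<Longrightarrow> outcomes x tr = key_word x u @ e x"
    "\<And>x. length (e x) \<le> 1"
    "side_falses (key_locs YQS) tr \<le> 2"
    "\<And>p q U. 0 < p \<Longrightarrow> p < q \<Longrightarrow> length U = length u \<Longrightarrow>
       (\<And>i. i < length u \<Longrightarrow> U ! i \<noteq> p \<and> U ! i \<noteq> q \<and> u ! i = (if U ! i < p then 0 else if U ! i < q then 1 else 2)) \<Longrightarrow>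
       \<exists>A i j. yqs_partition p q U = (A, (i, j), tr) \<and> subarray A 1 (i + 1) = map ((!) U) (idx 0)
         \<and> subarray A (i + 1) j = map ((!) U) (idx 1) \<and> subarray A j (length U + 1) = map ((!) U) (idx 2)"
  proof (rule yqs_partition_spec[OF u], goal_cases)
    case (1 idx tr e)
    show ?case by (rule that) (fact 1)+
  qed
  have "partition_ok alg t u idx tr e"
    unfolding partition_ok_def Let_def
  proof (intro conjI allI impI ballI)
    fix V U :: "nat list"
    let ?ps = "pivots (num_parts alg) (\<lambda>l. t (Suc l)) V"
    assume V: "distinct V" "length V = sample_size alg t" "0 \<notin> set V" and VU: "set V \<inter> set U = {}"
      and cU: "map (cls ?ps) U = u"
    define p where "p = sort V ! t 1"
    define q where "q = sort V ! (t 1 + t 2 + 1)"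
    have ps: "?ps = [p, q]"
      by (simp add: YQS pivots_def p_def q_def offset_def numeral_3_eq_3 numeral_2_eq_2 add_ac)
    have V': "length V = offset (\<lambda>l. t (Suc l)) (num_parts alg) - 1"
      using V(2) sample_size_eq_offset by metis
    have pV: "p \<in> set V" "q \<in> set V" and pq: "p < q"
      using pivots_props(1,2)[OF V(1) V'] ps by auto
    have cl: "cls [p, q] x = (if q < x then 2 else if p < x then 1 else 0)" for x
      using pq by (auto simp: cls_def)
    have "\<exists>A i j. yqs_partition p q U = (A, (i, j), tr) \<and> subarray A 1 (i + 1) = map ((!) U) (idx 0)
         \<and> subarray A (i + 1) j = map ((!) U) (idx 1) \<and> subarray A j (length U + 1) = map ((!) U) (idx 2)"
    proof (rule p(6))
      show "0 < p" "p < q" using pV V(3) pq by (auto intro!: Nat.gr0I)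
      show "length U = length u" using cU by auto
      fix i assume "i < length u"
      then have i: "i < length U" using cU by auto
      then have "U ! i \<noteq> p" "U ! i \<noteq> q" using VU pV by auto
      moreover have "u ! i = cls [p, q] (U ! i)" using cU[symmetric] i ps by simp
      ultimately show "U ! i \<noteq> p \<and> U ! i \<noteq> q \<and> u ! i = (if U ! i < p then 0 else if U ! i < q then 1 else 2)"
        using pq by (auto simp: cl)
    qed
    then obtain A i j where A: "yqs_partition p q U = (A, (i, j), tr)" "subarray A 1 (i + 1) = map ((!) U) (idx 0)"
      "subarray A (i + 1) j = map ((!) U) (idx 1)" "subarray A j (length U + 1) = map ((!) U) (idx 2)" by blast
    have f: "filter (\<lambda>x. x \<notin> set [p, q] \<and> cls [p, q] x = 0) V = filter (\<lambda>v. v < p) V"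
      "filter (\<lambda>x. x \<notin> set [p, q] \<and> cls [p, q] x = 1) V = filter (\<lambda>v. p < v \<and> v < q) V"
      "filter (\<lambda>x. x \<notin> set [p, q] \<and> cls [p, q] x = 2) V = filter (\<lambda>v. q < v) V"
      using pq by (auto simp: cl intro!: filter_cong)
    have r: "[0..<num_parts alg] = [0, 1, 2]" by (simp add: YQS upt_rec)
    show "divide alg t V U = (fst (insertionsort Sample_Sort V) @ tr,
          map (\<lambda>l. filter (\<lambda>x. x \<notin> set ?ps \<and> cls ?ps x = l) V @ map ((!) U) (idx l)) [0..<num_parts alg])"
      unfolding ps r list.map f A(2-4)[symmetric] using A(1)
      by (simp add: YQS split_def Let_def snd_insertionsort p_def[unfolded One_nat_def, symmetric]
        q_def[unfolded One_nat_def add_Suc_right add_0_right, symmetric])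
  qed (use p YQS in auto)
  then show ?thesis by blast
qed

lemma expectation_eq_sum:
  assumes "finite (set_pmf p)"
  shows "measure_pmf.expectation p f = (\<Sum>x\<in>set_pmf p. pmf p x * (f x :: real))"
  using assms by (subst integral_measure_pmf[of "set_pmf p"]) (auto simp: mult.commute)

lemma expectation_bind_finite:
  fixes h :: "'b \<Rightarrow> real"
  assumes "finite (set_pmf p)" "\<And>x. x \<in> set_pmf p \<Longrightarrow> finite (set_pmf (f x))"
  shows "measure_pmf.expectation (p \<bind> f) h = measure_pmf.expectation p (\<lambda>x. measure_pmf.expectation (f x) h)"
  using assms by (subst pmf_expectation_bind[of "set_pmf p"])
    (auto simp: expectation_eq_sum)

lemma nths_eq_map_nth: "nths xs S = map ((!) xs) (nths [0..<length xs] S)"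
  by (metis map_nth nths_map)

text \<open>Moving the positions in S to the front is a fixed rearrangement and maps the set of all
  permutations onto itself. For a random input, a sample at random positions may thus be replaced by
  the first elements.\<close>

lemma sum_permutations_nths:
  fixes G :: "nat list \<Rightarrow> nat list \<Rightarrow> real"
  assumes A: "finite A" and S: "S \<subseteq> {..<card A}"
  shows "(\<Sum>xs\<in>permutations_of_set A. G (nths xs S) (nths xs (- S)))
    = (\<Sum>xs\<in>permutations_of_set A. G (take (card S) xs) (drop (card S) xs))"
proof -
  define js where "js = nths [0..<card A] S @ nths [0..<card A] (- S)"
  let ?h = "\<lambda>xs. map ((!) xs) js :: nat list"
  have set1: "set (nths [0..<card A] T) = {i. i < card A \<and> i \<in> T}" for T
    by (force simp: set_nths)
  have dj: "distinct js" and sj: "set js = {..<card A}"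
    by (auto simp: js_def set1 distinct_nthsI)
  have lenS: "length (nths [0..<card A] S) = card S"
  proof -
    have "length (nths [0..<card A] S) = card (set (nths [0..<card A] S))"
      by (simp add: distinct_card distinct_nthsI)
    also have "set (nths [0..<card A] S) = S" using S by (auto simp: set1)
    finally show ?thesis .
  qed
  have len: "length xs = card A" if "xs \<in> permutations_of_set A" for xs
    using that by (simp add: permutations_of_setD distinct_card[symmetric])
  have h: "?h xs = nths xs S @ nths xs (- S)" if "xs \<in> permutations_of_set A" for xs
    using nths_eq_map_nth[of xs] len[OF that] by (simp add: js_def)
  have inj: "inj_on ?h (permutations_of_set A)"
  proof (rule inj_onI)
    fix xs ys assume xs: "xs \<in> permutations_of_set A" and ys: "ys \<in> permutations_of_set A" and eq: "?h xs = ?h ys"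
    then have "xs ! i = ys ! i" if "i < card A" for i using that sj by (auto simp: map_eq_conv)
    then show "xs = ys" using len[OF xs] len[OF ys] by (intro nth_equalityI) auto
  qed
  have "?h xs \<in> permutations_of_set A" if "xs \<in> permutations_of_set A" for xs
  proof (rule permutations_of_setI)
    show "set (?h xs) = A"
      using sj len[OF that] permutations_of_setD(1)[OF that] nth_image[of "length xs" xs]
      by (simp add: lessThan_atLeast0)
    show "distinct (?h xs)"
      using dj sj len[OF that] permutations_of_setD(2)[OF that]
      by (auto simp: distinct_map inj_on_def nth_eq_iff_index_eq)
  qed
  then have "?h ` permutations_of_set A = permutations_of_set A"
    using card_image[OF inj] by (intro card_subset_eq) auto
  then have "(\<Sum>xs\<in>permutations_of_set A. G (take (card S) xs) (drop (card S) xs))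
      = (\<Sum>xs\<in>permutations_of_set A. G (take (card S) (?h xs)) (drop (card S) (?h xs)))"
    using sum.reindex[OF inj, of "\<lambda>xs. G (take (card S) xs) (drop (card S) xs)"] by simp
  also have "\<dots> = (\<Sum>xs\<in>permutations_of_set A. G (nths xs S) (nths xs (- S)))"
  proof (rule sum.cong[OF refl])
    fix xs assume xs: "xs \<in> permutations_of_set A"
    have "length (nths xs S) = card S"
      using nths_eq_map_nth[of xs S] len[OF xs] lenS by (metis length_map)
    then show "G (take (card S) (?h xs)) (drop (card S) (?h xs)) = G (nths xs S) (nths xs (- S))"
      unfolding h[OF xs] by simp
  qed
  finally show ?thesis ..
qed

definition quicksort_parts where
  "quicksort_parts d alg t w yss =
     foldr (\<lambda>ys rest. do { tr1 \<leftarrow> quicksort_depth d alg t w ys; tr2 \<leftarrow> rest; return_pmf (tr1 @ tr2) })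
       yss (return_pmf [])"

lemma quicksort_parts_simps:
  "quicksort_parts d alg t w [] = return_pmf []"
  "quicksort_parts d alg t w (ys # yss) =
     do { tr1 \<leftarrow> quicksort_depth d alg t w ys; tr2 \<leftarrow> quicksort_parts d alg t w yss; return_pmf (tr1 @ tr2) }"
  by (auto simp: quicksort_parts_def)

lemma finite_quicksort_parts:
  assumes "\<And>ys. finite (set_pmf (quicksort_depth d alg t w ys))"
  shows "finite (set_pmf (quicksort_parts d alg t w yss))"
  using assms by (induction yss) (auto simp: quicksort_parts_simps)

lemma quicksort_depth_Suc:
  "quicksort_depth (Suc d) alg t w xs =
     (if length xs \<le> w
      then return_pmf ((Size_Test, True) # fst (insertionsort Leaf_Sort xs))
      else pmf_of_set {S. S \<subseteq> {..<length xs} \<and> card S = sample_size alg t} \<bind> (\<lambda>S.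
        quicksort_parts d alg t w (snd (divide alg t (nths xs S) (nths xs (- S)))) \<bind> (\<lambda>rec.
        return_pmf ((Size_Test, False) # fst (divide alg t (nths xs S) (nths xs (- S))) @ rec))))"
  by (simp add: quicksort_parts_def split_def Let_def)

section \<open>The recurrence for the cost at one key location\<close>

context
  fixes alg :: algorithm and t :: "nat \<Rightarrow> nat" and w :: nat
  assumes w: "sample_size alg t \<le> w"
begin

abbreviation (input) "samples n \<equiv> {S. S \<subseteq> {..<n} \<and> card S = sample_size alg t}"

lemma samples_props:
  assumes "\<not> n \<le> w"
  shows "finite (samples n)" "samples n \<noteq> {}"
proof -
  show "finite (samples n)" by simp
  have "{..<sample_size alg t} \<in> samples n" using assms w by auto
  then show "samples n \<noteq> {}" by blast
qed

lemma finite_quicksort_depth: "finite (set_pmf (quicksort_depth d alg t w xs))"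
proof (induction d arbitrary: xs)
  case (Suc d)
  show ?case
    using samples_props[of "length xs"] finite_quicksort_parts[OF Suc]
    unfolding quicksort_depth_Suc by (auto simp: set_pmf_of_set)
qed simp

context
  fixes x :: location and sch :: scheme and c :: real
begin

text \<open>The factor c will be 1 or -1, so that one upper estimate yields both bounds on the
  number of misses.\<close>

definition cost :: "nat \<Rightarrow> trace \<Rightarrow> real" where
  "cost i tr = c * real (miss_count sch i (outcomes x tr))"

definition cost_depth :: "nat \<Rightarrow> nat list \<Rightarrow> nat \<Rightarrow> real" where
  "cost_depth d xs i = measure_pmf.expectation (quicksort_depth d alg t w xs) (cost i)"

definition cost_parts :: "nat \<Rightarrow> nat list list \<Rightarrow> nat \<Rightarrow> real" where
  "cost_parts d yss i = measure_pmf.expectation (quicksort_parts d alg t w yss) (cost i)"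

lemma cost_append: "cost i (tr1 @ tr2) = cost i tr1 + cost (final_state sch i (outcomes x tr1)) tr2"
  by (simp add: cost_def miss_count_append algebra_simps)

lemma finite_parts: "finite (set_pmf (quicksort_parts d alg t w yss))"
  by (rule finite_quicksort_parts[OF finite_quicksort_depth])

lemma expectation_cost_append:
  "measure_pmf.expectation (quicksort_parts d alg t w yss) (\<lambda>tr2. cost i (tr1 @ tr2))
    = cost i tr1 + cost_parts d yss (final_state sch i (outcomes x tr1))"
  unfolding cost_append cost_parts_def
  by (subst Bochner_Integration.integral_add) (auto intro: integrable_measure_pmf_finite finite_parts)

lemma cost_parts_Cons:
  "cost_parts d (ys # yss) i = (\<Sum>tr1\<in>set_pmf (quicksort_depth d alg t w ys).
     pmf (quicksort_depth d alg t w ys) tr1 * (cost i tr1 + cost_parts d yss (final_state sch i (outcomes x tr1))))"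
proof -
  have "cost_parts d (ys # yss) i = measure_pmf.expectation (quicksort_depth d alg t w ys)
      (\<lambda>tr1. measure_pmf.expectation (quicksort_parts d alg t w yss) (\<lambda>tr2. cost i (tr1 @ tr2)))"
    unfolding cost_parts_def[of _ "ys # yss"] quicksort_parts_simps
    by (simp add: expectation_bind_finite finite_quicksort_depth finite_parts)
  then show ?thesis
    unfolding expectation_cost_append by (simp add: expectation_eq_sum finite_quicksort_depth)
qed

lemma cost_parts_Nil [simp]: "cost_parts d [] i = 0"
  by (simp add: cost_parts_def quicksort_parts_simps cost_def)

text \<open>The calls are coupled only through the predictor state that one leaves to the next. For
  each trace of the first call this is some legal state, and the bound for the remaining calls holds
  for all of them. The parts being independent, their lists of permutations form a product.\<close>

lemma sum_cost_parts_le: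
  fixes F :: "nat \<Rightarrow> real"
  assumes "\<And>B i. B \<in> set Bs \<Longrightarrow> i \<in> states sch \<Longrightarrow>
      (\<Sum>ys\<in>permutations_of_set B. cost_depth d ys i) \<le> card (permutations_of_set B) * F (card B)"
    and "i \<in> states sch"
  shows "(\<Sum>zs\<in>listset (map permutations_of_set Bs). cost_parts d zs i)
    \<le> card (listset (map permutations_of_set Bs)) * (\<Sum>B\<leftarrow>Bs. F (card B))"
  using assms
proof (induction Bs arbitrary: i)
  case (Cons B Bs)
  let ?L = "listset (map permutations_of_set Bs)" and ?P = "permutations_of_set B"
  let ?q = "\<lambda>ys. quicksort_depth d alg t w ys"
  have inj: "inj_on (\<lambda>(x, xs). x # xs) (?P \<times> ?L)" by (auto simp: inj_on_def)
  have "(\<Sum>zs\<in>listset (map permutations_of_set (B # Bs)). cost_parts d zs i)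
      = (\<Sum>ys\<in>?P. \<Sum>zs\<in>?L. cost_parts d (ys # zs) i)"
    using inj by (simp add: set_Cons_eq_image sum.reindex sum.cartesian_product case_prod_unfold)
  also have "\<dots> \<le> (\<Sum>ys\<in>?P. card ?L * cost_depth d ys i + card ?L * (\<Sum>B\<leftarrow>Bs. F (card B)))"
  proof (rule sum_mono)
    fix ys assume "ys \<in> ?P"
    have "(\<Sum>zs\<in>?L. cost_parts d (ys # zs) i) = (\<Sum>tr1\<in>set_pmf (?q ys). pmf (?q ys) tr1 *
        (card ?L * cost i tr1 + (\<Sum>zs\<in>?L. cost_parts d zs (final_state sch i (outcomes x tr1)))))"
      unfolding cost_parts_Cons by (subst sum.swap) (simp add: sum_distrib_left[symmetric] sum.distrib)
    also have "\<dots> \<le> (\<Sum>tr1\<in>set_pmf (?q ys). pmf (?q ys) tr1 *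
        (card ?L * cost i tr1 + card ?L * (\<Sum>B\<leftarrow>Bs. F (card B))))"
      using Cons by (intro sum_mono mult_left_mono add_left_mono Cons.IH) (auto intro: final_state_in_states)
    also have "\<dots> = card ?L * (\<Sum>tr1\<in>set_pmf (?q ys). pmf (?q ys) tr1 * cost i tr1)
        + card ?L * (\<Sum>B\<leftarrow>Bs. F (card B)) * (\<Sum>tr1\<in>set_pmf (?q ys). pmf (?q ys) tr1)"
      by (simp add: sum.distrib algebra_simps sum_distrib_left)
    also have "(\<Sum>tr1\<in>set_pmf (?q ys). pmf (?q ys) tr1) = 1"
      by (rule sum_pmf_eq_1) (auto simp: finite_quicksort_depth)
    also have "(\<Sum>tr1\<in>set_pmf (?q ys). pmf (?q ys) tr1 * cost i tr1) = cost_depth d ys i"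
      unfolding cost_depth_def by (simp add: expectation_eq_sum finite_quicksort_depth)
    finally show "(\<Sum>zs\<in>?L. cost_parts d (ys # zs) i) \<le> card ?L * cost_depth d ys i + card ?L * (\<Sum>B\<leftarrow>Bs. F (card B))"
      by simp
  qed
  also have "\<dots> = card ?L * (\<Sum>ys\<in>?P. cost_depth d ys i) + card ?P * card ?L * (\<Sum>B\<leftarrow>Bs. F (card B))"
    by (simp add: sum.distrib sum_distrib_left)
  also have "\<dots> \<le> card ?L * (card ?P * F (card B)) + card ?P * card ?L * (\<Sum>B\<leftarrow>Bs. F (card B))"
    using Cons.prems by (intro add_right_mono mult_left_mono) auto
  also have "\<dots> = card (listset (map permutations_of_set (B # Bs))) * (\<Sum>B\<leftarrow>B # Bs. F (card B))"
    by (simp only: card_listset list.map prod_list.Cons sum_list.Cons of_nat_mult) (simp add: algebra_simps)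
  finally show ?case .
qed simp


lemma key_loc_simps:
  assumes "x \<in> key_locs alg"
  shows "x \<noteq> Size_Test" "x \<notin> range Sample_Sort" "x \<notin> range Leaf_Sort"
  using assms by (cases alg; auto)+

text \<open>
  \<open>F\<close> is a supersolution of the recurrence for the cost.  The bound is uniform in the initial state
  of the predictor, so the dependence of this state on the previous calls does no harm.
\<close>

lemma sum_cost_depth_le:
  fixes F :: "nat \<Rightarrow> real"
  defines "s \<equiv> num_parts alg" and "t' \<equiv> \<lambda>l. t (Suc l)"
  assumes x: "x \<in> key_locs alg"
    and ok: "\<And>u. set u \<subseteq> {..<s} \<Longrightarrow> partition_ok alg t u (idx u) (T u) (e u)"
    and F0: "\<And>n. n \<le> w \<Longrightarrow> 0 \<le> F n"
    and step: "\<And>m i. w < sample_size alg t + m \<Longrightarrow> i \<in> states sch \<Longrightarrow>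
      (\<Sum>u\<in>words s m. polya s t' u * (c * real (miss_count sch i (key_word x u @ e u x))
         + (\<Sum>l<s. F (class_counts t' u l)))) \<le> F (sample_size alg t + m)"
  shows "finite A \<Longrightarrow> 0 \<notin> A \<Longrightarrow> card A < d \<Longrightarrow> i \<in> states sch \<Longrightarrow>
    (\<Sum>xs\<in>permutations_of_set A. cost_depth d xs i) \<le> card (permutations_of_set A) * F (card A)"
proof (induction d arbitrary: A i)
  case (Suc d)
  have s2: "s \<ge> 2" by (cases alg) (auto simp: s_def)
  interpret class_word_index s t' idx
  proof
    show "s > 0" using s2 by simp
    show "distinct (idx u l)" "set (idx u l) = positions_of u l" if "u \<in> words s m" "l < s" for u m l
      using ok[of u] that by (auto simp: partition_ok_def words_def s_def)
  qed
  have k: "k = sample_size alg t"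
    unfolding k_def by (simp add: sample_size_eq_offset t'_def s_def)
  note xk = key_loc_simps[OF x]
  show ?case
  proof (cases "card A \<le> w")
    case True
    \<comment> \<open>Small subarrays execute no partitioning code, so there \<open>F\<close> only
      has to be nonnegative.\<close>
    have "cost_depth (Suc d) xs i = 0" if "xs \<in> permutations_of_set A" for xs
    proof -
      have "length xs \<le> w" using that True by (simp add: permutations_of_setD distinct_card[symmetric])
      then show ?thesis using xk insertionsort_trace(1)[of x Leaf_Sort xs]
        by (simp add: cost_depth_def cost_def)
    qed
    then show ?thesis using F0[OF True] by simp
  next
    case False
    define m where "m = card A - k"
    have n: "card A = k + m" using False w k by (simp add: m_def)
    let ?S = "samples (card A)"
    define G where "G V U = cost i (fst (divide alg t V U))
      + cost_parts d (snd (divide alg t V U)) (final_state sch i (outcomes x (fst (divide alg t V U))))" for V U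
    define h where "h u zs = c * real (miss_count sch i (key_word x u @ e u x))
      + cost_parts d zs (final_state sch i (key_word x u @ e u x))" for u zs
    have depth: "cost_depth (Suc d) xs i = (\<Sum>S\<in>?S. G (nths xs S) (nths xs (- S))) / card ?S"
      if xs: "xs \<in> permutations_of_set A" for xs
    proof -
      have len: "length xs = card A" using xs by (simp add: permutations_of_setD distinct_card[symmetric])
      have c1: "cost i ((Size_Test, False) # tr1 @ tr2) = cost i (tr1 @ tr2)" for tr1 tr2
        using xk by (simp add: cost_def)
      show ?thesis
        unfolding cost_depth_def quicksort_depth_Suc len
        using False samples_props[OF False] finite_parts
        by (simp add: expectation_bind_finite integral_pmf_of_set c1 expectation_cost_append G_def)
    qed
    have fixed: "(\<Sum>xs\<in>permutations_of_set A. G (nths xs S) (nths xs (- S))) \<le> fact (card A) * F (card A)"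
      if S: "S \<in> ?S" for S
    proof -
      have Sk: "S \<subseteq> {..<card A}" "card S = k" using S k by auto
      have "(\<Sum>xs\<in>permutations_of_set A. G (nths xs S) (nths xs (- S)))
          = (\<Sum>xs\<in>permutations_of_set A. G (take k xs) (drop k xs))"
        using sum_permutations_nths[OF Suc.prems(1) Sk(1), of G] Sk(2) by simp
      also have "\<dots> = (\<Sum>xs\<in>permutations_of_set A. h (word xs) (map (part_list xs) [0..<s]))"
      proof (rule sum.cong[OF refl])
        fix xs assume xs: "xs \<in> permutations_of_set A"
        note V = perm_facts[OF Suc.prems(1) n xs]
        have wd: "word xs \<in> words s m" by (rule word_in_words[OF Suc.prems(1) n xs])
        then have ok': "partition_ok alg t (word xs) (idx (word xs)) (T (word xs)) (e (word xs))"
          by (intro ok) (auto simp: words_def)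
        have "0 \<notin> set (take k xs)" using V(9) Suc.prems(2) by auto
        then have "divide alg t (take k xs) (drop k xs) =
            (fst (insertionsort Sample_Sort (take k xs)) @ T (word xs), map (part_list xs) [0..<s])"
          using ok' V unfolding partition_ok_def Let_def s_def[symmetric] t'_def[symmetric]
          by (simp add: k word_def piv_def part_list_def[abs_def])
        moreover have "outcomes x (T (word xs)) = key_word x (word xs) @ e (word xs) x"
          using ok' x by (auto simp: partition_ok_def)
        ultimately show "G (take k xs) (drop k xs) = h (word xs) (map (part_list xs) [0..<s])"
          using insertionsort_trace(1)[OF xk(2)] by (simp add: G_def h_def cost_def)
      qed
      also have "\<dots> = fact (card A) * (\<Sum>u\<in>words s m. polya s t' u *
          ((\<Sum>zs\<in>listset (map permutations_of_set (blocks A u)). h u zs)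
            / card (listset (map permutations_of_set (blocks A u)))))"
        by (rule sum_permutations_split[OF Suc.prems(1) n])
      also have "\<dots> \<le> fact (card A) * (\<Sum>u\<in>words s m. polya s t' u *
          (c * real (miss_count sch i (key_word x u @ e u x)) + (\<Sum>l<s. F (class_counts t' u l))))"
      proof (intro mult_left_mono sum_mono polya_nonneg)
        fix u assume u: "u \<in> words s m"
        let ?L = "listset (map permutations_of_set (blocks A u))"
        have pos: "real (card ?L) > 0"
          unfolding card_listset_blocks[OF Suc.prems(1) n u] by (intro prod_pos) simp
        have cb: "card (block A (class_counts t' u) l) = class_counts t' u l" if "l < s" for l
          by (rule card_block_counts[OF Suc.prems(1) n u that])
        \<comment> \<open>The s - 1 pivots belong to no part, which makes every part strictly
          smaller than A.\<close>
        have small: "class_counts t' u l < card A" if "l < s" for l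
        proof -
          have "(\<Sum>j\<in>{..<s} - {l}. class_counts t' u j + 1) \<ge> (\<Sum>j\<in>{..<s} - {l}. 1)" by (intro sum_mono) auto
          moreover have "offset (class_counts t' u) s = class_counts t' u l + 1 + (\<Sum>j\<in>{..<s} - {l}. class_counts t' u j + 1)"
            using that unfolding offset_def by (subst sum.remove[of _ l]) auto
          ultimately show ?thesis using offset_total[OF Suc.prems(1) n u] that s2 by simp
        qed
        have "(\<Sum>zs\<in>?L. cost_parts d zs (final_state sch i (key_word x u @ e u x)))
            \<le> card ?L * (\<Sum>B\<leftarrow>blocks A u. F (card B))"
        proof (rule sum_cost_parts_le)
          fix B j assume "B \<in> set (blocks A u)" and j: "j \<in> states sch"
          then obtain l where l: "l < s" "B = block A (class_counts t' u) l" by auto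
          have "B \<subseteq> A" by (auto simp: l block_def)
          moreover have "card B < d" using small[OF l(1)] cb[OF l(1)] l(2) Suc.prems(3) by simp
          ultimately show "(\<Sum>ys\<in>permutations_of_set B. cost_depth d ys j) \<le> card (permutations_of_set B) * F (card B)"
            using Suc.prems j by (intro Suc.IH) (auto intro: finite_subset)
        qed (rule final_state_in_states[OF Suc.prems(4)])
        also have "(\<Sum>B\<leftarrow>blocks A u. F (card B)) = (\<Sum>l<s. F (class_counts t' u l))"
          unfolding map_map o_def using cb
          by (simp add: sum.distinct_set_conv_list[symmetric] atLeast0LessThan cong: map_cong)
        finally have "(\<Sum>zs\<in>?L. h u zs) \<le> card ?L * (c * real (miss_count sch i (key_word x u @ e u x)) + (\<Sum>l<s. F (class_counts t' u l)))"
          unfolding h_def by (simp add: sum.distrib distrib_left del: map_map)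
        then show "(\<Sum>zs\<in>?L. h u zs) / card ?L \<le> c * real (miss_count sch i (key_word x u @ e u x)) + (\<Sum>l<s. F (class_counts t' u l))"
          using pos by (simp add: divide_le_eq mult.commute del: map_map)
      qed simp
      also have "\<dots> \<le> fact (card A) * F (card A)"
        using step[of m i] False Suc.prems(4) n by (intro mult_left_mono) (auto simp: k)
      finally show ?thesis .
    qed
    have "(\<Sum>xs\<in>permutations_of_set A. cost_depth (Suc d) xs i)
        = (\<Sum>S\<in>?S. \<Sum>xs\<in>permutations_of_set A. G (nths xs S) (nths xs (- S))) / card ?S"
      using depth by (subst sum.swap) (simp add: sum_divide_distrib)
    also have "\<dots> \<le> (\<Sum>S\<in>?S. fact (card A) * F (card A)) / card ?S"
      using fixed by (intro divide_right_mono sum_mono) auto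
    also have "\<dots> = card (permutations_of_set A) * F (card A)"
      using samples_props[OF False] Suc.prems(1) by simp
    finally show ?thesis .
  qed
qed simp

end

end

section \<open>Misses for i.i.d. letters\<close>

lemma miss_rate_bounds:
  assumes "0 \<le> p" "p \<le> 1"
  shows "0 \<le> miss_rate sch p" "miss_rate sch p \<le> 1"
  using steady_miss_rate_eq[OF assms, of sch] measure_nonneg measure_pmf.prob_le_1
  unfolding steady_miss_rate_def by metis+

definition iid_sum :: "(nat \<Rightarrow> real) \<Rightarrow> nat \<Rightarrow> nat \<Rightarrow> (nat list \<Rightarrow> real) \<Rightarrow> real" where
  "iid_sum W s m h = (\<Sum>u\<in>words s m. prod_list (map W u) * h u)"

lemma iid_sum_0 [simp]: "iid_sum W s 0 h = h []"
  by (simp add: iid_sum_def)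

lemma iid_sum_Suc: "iid_sum W s (Suc m) h = (\<Sum>c<s. W c * iid_sum W s m (\<lambda>u. h (c # u)))"
  by (simp add: iid_sum_def sum_words_Suc sum_distrib_left mult.assoc)

lemma iid_sum_add: "iid_sum W s m (\<lambda>u. f u + g u) = iid_sum W s m f + iid_sum W s m g"
  by (simp add: iid_sum_def sum.distrib distrib_left)

lemma iid_sum_diff: "iid_sum W s m (\<lambda>u. f u - g u) = iid_sum W s m f - iid_sum W s m g"
  by (simp add: iid_sum_def sum_subtractf right_diff_distrib)

lemma iid_sum_cmult: "iid_sum W s m (\<lambda>u. a * f u) = a * iid_sum W s m f"
  by (simp add: iid_sum_def sum_distrib_left mult_ac)

lemma iid_sum_rev: "iid_sum W s m (\<lambda>u. h (rev u)) = iid_sum W s m h"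
proof -
  have "bij_betw rev (words s m) (words s m)"
    by (rule bij_betwI[of _ _ _ rev]) (auto simp: words_def)
  from sum.reindex_bij_betw[OF this, of "\<lambda>u. prod_list (map W u) * h u"] show ?thesis
    by (simp add: iid_sum_def rev_map[symmetric] prod_list.rev)
qed

definition letters_in :: "nat set \<Rightarrow> nat list \<Rightarrow> nat" where
  "letters_in Z u = length (filter (\<lambda>c. c \<in> Z) u)"

lemma letters_in_simps [simp]:
  "letters_in Z [] = 0" "letters_in Z (c # u) = (if c \<in> Z then 1 else 0) + letters_in Z u"
  "letters_in Z (rev u) = letters_in Z u"
  by (auto simp: letters_in_def rev_filter[symmetric])

lemma length_concat_le:
  assumes "\<And>c. length (\<beta> c) \<le> 1"
  shows "length (concat (map \<beta> u)) \<le> length u"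
proof (induction u)
  case (Cons c u)
  then show ?case using assms[of c] by simp
qed simp

text \<open>Each letter yields at most one outcome, hence at most one miss.\<close>

lemma miss_count_prefix_diff:
  fixes a b :: nat
  assumes "\<And>c. length (\<beta> c) \<le> 1"
  shows "\<bar>real (miss_count sch i (concat (map \<beta> (take a u)))) - real (miss_count sch i (concat (map \<beta> (take b u))))\<bar>
    \<le> \<bar>real a - real b\<bar>"
proof -
  have *: "\<bar>real (miss_count sch i (concat (map \<beta> (take a u)))) - real (miss_count sch i (concat (map \<beta> (take b u))))\<bar>
    \<le> \<bar>real a - real b\<bar>" if "a \<le> b" for a b
  proof -
    let ?d = "concat (map \<beta> (take (b - a) (drop a u)))"
    let ?j = "final_state sch i (concat (map \<beta> (take a u)))"
    have "take b u = take a u @ take (b - a) (drop a u)" using that by (metis le_add_diff_inverse take_add)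
    then have "miss_count sch i (concat (map \<beta> (take b u))) =
        miss_count sch i (concat (map \<beta> (take a u))) + miss_count sch ?j ?d"
      by (simp only: map_append concat_append miss_count_append)
    moreover have "miss_count sch ?j ?d \<le> b - a"
      using miss_count_le_length[of sch ?j ?d] length_concat_le[of \<beta> "take (b - a) (drop a u)", OF assms] by simp
    ultimately show ?thesis using that by simp
  qed
  show ?thesis
  proof (cases "a \<le> b")
    case False
    then have "b \<le> a" by simp
    from *[OF this] show ?thesis by (simp add: abs_minus_commute)
  qed (rule *)
qed

locale letter_weights =
  fixes W :: "nat \<Rightarrow> real" and s :: nat
  assumes W_nonneg: "\<And>c. c < s \<Longrightarrow> W c \<ge> 0" and sum_W: "(\<Sum>c<s. W c) = 1"
begin

lemma weight_nonneg: "u \<in> words s m \<Longrightarrow> prod_list (map W u) \<ge> 0"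
  using W_nonneg by (intro prod_list_nonneg) (auto simp: words_def)

lemma iid_sum_mono:
  "(\<And>u. u \<in> words s m \<Longrightarrow> f u \<le> g u) \<Longrightarrow> iid_sum W s m f \<le> iid_sum W s m g"
  unfolding iid_sum_def by (intro sum_mono mult_left_mono weight_nonneg) auto

lemma iid_sum_const [simp]: "iid_sum W s m (\<lambda>_. a) = a"
proof (induction m)
  case (Suc m)
  have "(\<Sum>c<s. W c * a) = a" unfolding sum_distrib_right[symmetric] sum_W by simp
  then show ?case using Suc by (simp add: iid_sum_Suc)
qed simp

lemma iid_sum_abs_le:
  assumes "\<And>u. u \<in> words s m \<Longrightarrow> \<bar>f u - g u\<bar> \<le> h u"
  shows "\<bar>iid_sum W s m f - iid_sum W s m g\<bar> \<le> iid_sum W s m h"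
proof -
  have "iid_sum W s m f - iid_sum W s m g \<le> iid_sum W s m h"
    unfolding iid_sum_diff[symmetric] by (rule iid_sum_mono) (use assms in \<open>auto dest: abs_le_D1\<close>)
  moreover have "iid_sum W s m g - iid_sum W s m f \<le> iid_sum W s m h"
    unfolding iid_sum_diff[symmetric] by (rule iid_sum_mono) (use assms in \<open>fastforce simp: abs_le_iff\<close>)
  ultimately show ?thesis by linarith
qed

lemma iid_sum_take:
  assumes "K \<le> m"
  shows "iid_sum W s m (\<lambda>u. h (take K u)) = iid_sum W s K h"
  using assms
proof (induction K arbitrary: m h)
  case (Suc K)
  then obtain m' where "m = Suc m'" "K \<le> m'" by (cases m) auto
  moreover have "iid_sum W s m' (\<lambda>u. h (c # take K u)) = iid_sum W s K (\<lambda>u. h (c # u))" for c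
    using Suc.IH[of m' "\<lambda>u. h (c # u)"] \<open>K \<le> m'\<close> by simp
  ultimately show ?case by (simp add: iid_sum_Suc)
qed simp

text \<open>Mean and variance of a binomial variable, centred first. In the recursion on m the mixed
  term vanishes since the centred sum has mean 0.\<close>

lemma iid_sum_letters:
  defines "z \<equiv> \<lambda>Z. \<Sum>c\<in>{c. c < s \<and> c \<in> Z}. W c"
  shows "iid_sum W s m (\<lambda>u. real (letters_in Z u) - real m * z Z) = 0"
    and "iid_sum W s m (\<lambda>u. (real (letters_in Z u) - real m * z Z)\<^sup>2) = real m * (z Z * (1 - z Z))"
proof -
  have zsum: "(\<Sum>c<s. W c * (if c \<in> Z then 1 else 0)) = z Z"
    unfolding z_def by (simp add: sum.inter_filter[symmetric] if_distrib cong: if_cong)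
  let ?d = "\<lambda>c. (if c \<in> Z then 1 else 0) - z Z"
  have d1: "(\<Sum>c<s. W c * ?d c) = 0"
    unfolding right_diff_distrib sum_subtractf zsum by (simp add: sum_distrib_right[symmetric] sum_W)
  have d2: "(\<Sum>c<s. W c * (?d c)\<^sup>2) = z Z * (1 - z Z)"
  proof -
    have "(\<Sum>c<s. W c * (?d c)\<^sup>2) = (\<Sum>c<s. (1 - 2 * z Z) * (W c * (if c \<in> Z then 1 else 0)) + (z Z)\<^sup>2 * W c)"
      by (intro sum.cong) (auto simp: power2_eq_square algebra_simps)
    also have "\<dots> = (1 - 2 * z Z) * z Z + (z Z)\<^sup>2"
      unfolding sum.distrib sum_distrib_left[symmetric] zsum sum_W by simp
    finally show ?thesis by (simp add: power2_eq_square algebra_simps)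
  qed
  have shift: "real (letters_in Z (c # u)) - real (Suc m) * z Z = (real (letters_in Z u) - real m * z Z) + ?d c" for c u m
    by (simp add: algebra_simps)
  show m1: "iid_sum W s m (\<lambda>u. real (letters_in Z u) - real m * z Z) = 0" for m
  proof (induction m)
    case (Suc m)
    show ?case unfolding iid_sum_Suc shift iid_sum_add[where g = "\<lambda>_. ?d _"] Suc iid_sum_const using d1 by simp
  qed simp
  show "iid_sum W s m (\<lambda>u. (real (letters_in Z u) - real m * z Z)\<^sup>2) = real m * (z Z * (1 - z Z))"
  proof (induction m)
    case (Suc m)
    have "iid_sum W s m (\<lambda>u. (real (letters_in Z (c # u)) - real (Suc m) * z Z)\<^sup>2) =
        real m * (z Z * (1 - z Z)) + (?d c)\<^sup>2" for c
    proof -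
      have "(\<lambda>u. (real (letters_in Z (c # u)) - real (Suc m) * z Z)\<^sup>2) =
          (\<lambda>u. (real (letters_in Z u) - real m * z Z)\<^sup>2 + (2 * ?d c * (real (letters_in Z u) - real m * z Z) + (?d c)\<^sup>2))"
        unfolding shift by (auto simp: power2_eq_square algebra_simps)
      then have "iid_sum W s m (\<lambda>u. (real (letters_in Z (c # u)) - real (Suc m) * z Z)\<^sup>2) =
          iid_sum W s m (\<lambda>u. (real (letters_in Z u) - real m * z Z)\<^sup>2)
          + (2 * ?d c * iid_sum W s m (\<lambda>u. real (letters_in Z u) - real m * z Z) + (?d c)\<^sup>2)"
        by (simp only: iid_sum_add iid_sum_cmult iid_sum_const)
      then show ?thesis unfolding Suc m1 by simp
    qed
    then have "iid_sum W s (Suc m) (\<lambda>u. (real (letters_in Z u) - real (Suc m) * z Z)\<^sup>2) =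
        (\<Sum>c<s. W c * (real m * (z Z * (1 - z Z))) + W c * (?d c)\<^sup>2)"
      unfolding iid_sum_Suc by (simp only: distrib_left)
    also have "\<dots> = real m * (z Z * (1 - z Z)) + z Z * (1 - z Z)"
      unfolding sum.distrib d2 by (simp add: sum_distrib_right[symmetric] sum_W)
    finally show ?case by (simp add: algebra_simps)
  qed simp
qed

lemma letter_prob_bounds:
  "0 \<le> (\<Sum>c\<in>{c. c < s \<and> c \<in> Z}. W c)" "(\<Sum>c\<in>{c. c < s \<and> c \<in> Z}. W c) \<le> 1"
proof -
  show "0 \<le> (\<Sum>c\<in>{c. c < s \<and> c \<in> Z}. W c)" using W_nonneg by (intro sum_nonneg) auto
  have "(\<Sum>c\<in>{c. c < s \<and> c \<in> Z}. W c) \<le> (\<Sum>c<s. W c)" using W_nonneg by (intro sum_mono2) auto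
  then show "(\<Sum>c\<in>{c. c < s \<and> c \<in> Z}. W c) \<le> 1" by (simp add: sum_W)
qed

lemma iid_sum_letters_deviation:
  "iid_sum W s m (\<lambda>u. \<bar>real (letters_in Z u) - real m * (\<Sum>c\<in>{c. c < s \<and> c \<in> Z}. W c)\<bar>) \<le> sqrt (real m)"
proof (cases "m = 0")
  case False
  define z where "z = (\<Sum>c\<in>{c. c < s \<and> c \<in> Z}. W c)"
  define r where "r = sqrt (real m)"
  have r: "r > 0" "r * r = real m" using False by (auto simp: r_def)
  have z: "0 \<le> z" "z \<le> 1" unfolding z_def by (rule letter_prob_bounds)+
  then have z1: "z * (1 - z) \<le> 1" using mult_mono[of z 1 "1 - z" 1] by simp
  \<comment> \<open>Replaces the Cauchy-Schwarz inequality: with r the square root of m, the second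
    moment and the constant term contribute at most r / 2 each.\<close>
  have amgm: "\<bar>x\<bar> \<le> 1 / (2 * r) * x\<^sup>2 + r / 2" for x
  proof -
    have "0 \<le> (\<bar>x\<bar> - r)\<^sup>2" by simp
    then have "2 * r * \<bar>x\<bar> \<le> x\<^sup>2 + r * r" by (simp add: power2_eq_square algebra_simps)
    then show ?thesis using r(1) by (simp add: field_simps power2_eq_square)
  qed
  have "iid_sum W s m (\<lambda>u. \<bar>real (letters_in Z u) - real m * z\<bar>)
      \<le> iid_sum W s m (\<lambda>u. 1 / (2 * r) * (real (letters_in Z u) - real m * z)\<^sup>2 + r / 2)"
    by (rule iid_sum_mono) (rule amgm)
  also have "\<dots> = 1 / (2 * r) * (real m * (z * (1 - z))) + r / 2"
    unfolding iid_sum_add iid_sum_cmult iid_sum_const z_def iid_sum_letters(2) ..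
  also have "\<dots> = r / 2 * (z * (1 - z)) + r / 2"
    using r(1) unfolding r(2)[symmetric] by (simp add: field_simps)
  also have "\<dots> \<le> r / 2 * 1 + r / 2" using z1 r by (intro add_right_mono mult_left_mono) auto
  finally show ?thesis by (simp add: z_def r_def)
qed simp

text \<open>Misses so far plus the potential of the current state grow by
  \<open>q * miss_rate sch p\<close> per letter on average. Here q is the probability that a letter
  is tested at all and p the conditional probability of success. Stating the hypotheses with p * q
  and (1 - p) * q keeps q = 0 free of division.\<close>

lemma iid_sum_potential:
  assumes \<beta>: "\<And>c. c < s \<Longrightarrow> \<beta> c \<in> {[], [True], [False]}"
    and pT: "(\<Sum>c\<in>{c. c < s \<and> \<beta> c = [True]}. W c) = p * q"
    and pF: "(\<Sum>c\<in>{c. c < s \<and> \<beta> c = [False]}. W c) = (1 - p) * q"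
    and i: "i \<in> states sch"
  shows "iid_sum W s K (\<lambda>u. real (miss_count sch i (concat (map \<beta> u)))
      + potential sch p (final_state sch i (concat (map \<beta> u)))) = potential sch p i + real K * (q * miss_rate sch p)"
  using i
proof (induction K arbitrary: i)
  case (Suc K)
  let ?G = "\<lambda>i u. real (miss_count sch i (concat (map \<beta> u))) + potential sch p (final_state sch i (concat (map \<beta> u)))"
  let ?R = "real K * (q * miss_rate sch p)"
  let ?m = "\<lambda>b. (if predict sch i \<noteq> b then 1 else 0) + potential sch p (update sch i b)"
  have step: "iid_sum W s K (\<lambda>u. ?G i (c # u)) = ?R + (if \<beta> c = [] then potential sch p i
      else if \<beta> c = [True] then ?m True else ?m False)" if c: "c < s" for c
  proof -
    consider "\<beta> c = []" | b where "\<beta> c = [b]" using \<beta>[OF c] by auto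
    then show ?thesis
    proof cases
      case 1
      then show ?thesis using Suc.IH[OF Suc.prems] by simp
    next
      case 2
      have "(\<lambda>u. ?G i (c # u)) = (\<lambda>u. (if predict sch i \<noteq> b then 1 else 0) + ?G (update sch i b) u)"
        by (auto simp: 2)
      then have "iid_sum W s K (\<lambda>u. ?G i (c # u)) = (if predict sch i \<noteq> b then 1 else 0)
          + (potential sch p (update sch i b) + ?R)"
        using iid_sum_add[of W s K "\<lambda>_. if predict sch i \<noteq> b then 1 else 0" "?G (update sch i b)"]
          Suc.IH[OF update_in_states[OF Suc.prems, of b]] by (simp only: iid_sum_const)
      then show ?thesis using 2 by (cases b) auto
    qed
  qed
  have split: "(\<Sum>c<s. W c * (if \<beta> c = [] then x else if \<beta> c = [True] then y else z))
      = (1 - q) * x + p * q * y + (1 - p) * q * z" for x y z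
  proof -
    let ?E = "{c. c < s \<and> \<beta> c = []}" and ?T = "{c. c < s \<and> \<beta> c = [True]}" and ?F = "{c. c < s \<and> \<beta> c = [False]}"
    have U: "{..<s} = ?E \<union> (?T \<union> ?F)" using \<beta> by auto
    have sp: "(\<Sum>c<s. g c) = (\<Sum>c\<in>?E. g c) + ((\<Sum>c\<in>?T. g c) + (\<Sum>c\<in>?F. g c))" for g :: "nat \<Rightarrow> real"
      unfolding U by (subst sum.union_disjoint, simp, simp, force)+ simp
    have "(\<Sum>c\<in>?E. W c) = 1 - q" using sp[of W] pT pF by (simp add: sum_W algebra_simps)
    then show ?thesis unfolding sp using pT pF by (simp add: sum_distrib_right[symmetric])
  qed
  have "iid_sum W s (Suc K) (?G i) = (\<Sum>c<s. W c * (?R + (if \<beta> c = [] then potential sch p i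
      else if \<beta> c = [True] then ?m True else ?m False)))"
    unfolding iid_sum_Suc using step by (intro sum.cong) auto
  also have "\<dots> = ?R + ((1 - q) * potential sch p i + p * q * ?m True + (1 - p) * q * ?m False)"
    unfolding distrib_left sum.distrib split by (simp add: sum_distrib_right[symmetric] sum_W)
  also have "\<dots> = ?R + ((1 - q) * potential sch p i + q * (p * ?m True + (1 - p) * ?m False))"
    by (simp only: distrib_left mult_ac)
  also have "p * ?m True + (1 - p) * ?m False = miss_rate sch p + potential sch p i"
    using potential_step[OF Suc.prems, of p] by (cases "predict sch i") simp_all
  finally show ?case by (simp add: algebra_simps)
qed simp

text \<open>The potential contributes at the start and at the end, each time at most 4.\<close>

lemma iid_miss_count:
  assumes \<beta>: "\<And>c. c < s \<Longrightarrow> \<beta> c \<in> {[], [True], [False]}"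
    and pT: "(\<Sum>c\<in>{c. c < s \<and> \<beta> c = [True]}. W c) = p * q"
    and pF: "(\<Sum>c\<in>{c. c < s \<and> \<beta> c = [False]}. W c) = (1 - p) * q"
    and i: "i \<in> states sch" and p: "0 \<le> p" "p \<le> 1"
  shows "\<bar>iid_sum W s K (\<lambda>u. real (miss_count sch i (concat (map \<beta> u)))) - real K * (q * miss_rate sch p)\<bar> \<le> 8"
proof -
  let ?M = "\<lambda>u. real (miss_count sch i (concat (map \<beta> u)))"
  let ?P = "\<lambda>u. potential sch p (final_state sch i (concat (map \<beta> u)))"
  have eq: "iid_sum W s K ?M + iid_sum W s K ?P = potential sch p i + real K * (q * miss_rate sch p)"
    using iid_sum_potential[OF \<beta> pT pF i] by (simp only: iid_sum_add)
  have "\<bar>iid_sum W s K ?P - iid_sum W s K (\<lambda>_. 0)\<bar> \<le> iid_sum W s K (\<lambda>_. 4)"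
    by (rule iid_sum_abs_le) (use abs_potential_le[OF p] in simp)
  then have "\<bar>iid_sum W s K ?P\<bar> \<le> 4" by simp
  with eq abs_potential_le[OF p, of sch i] show ?thesis by linarith
qed

lemma iid_toll_aux:
  assumes \<beta>: "\<And>c. \<beta> c \<in> {[], [True], [False]}"
    and pT: "(\<Sum>c\<in>{c. c < s \<and> \<beta> c = [True]}. W c) = p * q"
    and pF: "(\<Sum>c\<in>{c. c < s \<and> \<beta> c = [False]}. W c) = (1 - p) * q"
    and z: "(\<Sum>c\<in>{c. c < s \<and> c \<in> Z}. W c) = z"
    and i: "i \<in> states sch" and p: "0 \<le> p" "p \<le> 1" and q: "0 \<le> q" "q \<le> 1"
  shows "\<bar>iid_sum W s m (\<lambda>u. real (miss_count sch i (concat (map \<beta> (take (letters_in Z u) u)))))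
      - real m * (miss_rate sch p * q * z)\<bar> \<le> sqrt (real m) + 10"
proof -
  let ?M = "\<lambda>K u. real (miss_count sch i (concat (map \<beta> (take K u))))"
  have z01: "0 \<le> z" "z \<le> 1" unfolding z[symmetric] by (rule letter_prob_bounds)+
  \<comment> \<open>The random length of the inspected prefix is replaced by its mean, rounded down.
    The errors are sqrt m + 1 for the change of the length, 8 from the potential and 1 from the
    rounding in the main term.\<close>
  define K where "K = nat \<lfloor>real m * z\<rfloor>"
  have K0: "real K \<le> real m * z" "real m * z \<le> real K + 1"
    using z01 by (auto simp: K_def)
  have "real m * z \<le> real m" using z01 by (simp add: mult_left_le)
  with K0 have Km: "K \<le> m" by linarith
  have l1: "length (\<beta> c) \<le> 1" for c using \<beta>[of c] by auto
  have "\<bar>iid_sum W s m (\<lambda>u. ?M (letters_in Z u) u) - iid_sum W s m (\<lambda>u. ?M K u)\<bar>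
      \<le> iid_sum W s m (\<lambda>u. \<bar>real (letters_in Z u) - real m * z\<bar> + 1)"
  proof (rule iid_sum_abs_le)
    fix u
    have "\<bar>?M (letters_in Z u) u - ?M K u\<bar> \<le> \<bar>real (letters_in Z u) - real K\<bar>"
      using l1 by (rule miss_count_prefix_diff)
    also have "\<dots> \<le> \<bar>real (letters_in Z u) - real m * z\<bar> + 1" using K0 by linarith
    finally show "\<bar>?M (letters_in Z u) u - ?M K u\<bar> \<le> \<bar>real (letters_in Z u) - real m * z\<bar> + 1" .
  qed
  also have "\<dots> \<le> sqrt (real m) + 1"
    using iid_sum_letters_deviation[of m Z] unfolding z iid_sum_add iid_sum_const by simp
  finally have 1: "\<bar>iid_sum W s m (\<lambda>u. ?M (letters_in Z u) u) - iid_sum W s m (\<lambda>u. ?M K u)\<bar> \<le> sqrt (real m) + 1" .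
  have 2: "\<bar>iid_sum W s m (\<lambda>u. ?M K u) - real K * (q * miss_rate sch p)\<bar> \<le> 8"
    using iid_miss_count[OF \<beta> pT pF i p, of K] iid_sum_take[OF Km, of "\<lambda>u. real (miss_count sch i (concat (map \<beta> u)))"]
    by simp
  have "0 \<le> q * miss_rate sch p" "q * miss_rate sch p \<le> 1"
    using q miss_rate_bounds[OF p, of sch] mult_mono[of q 1 "miss_rate sch p" 1] by auto
  then have "\<bar>(real K - real m * z) * (q * miss_rate sch p)\<bar> \<le> 1 * 1"
    unfolding abs_mult using K0 by (intro mult_mono) auto
  then have "\<bar>real K * (q * miss_rate sch p) - real m * (miss_rate sch p * q * z)\<bar> \<le> 1"
    by (simp add: algebra_simps)
  with 1 2 show ?thesis by linarith
qed

end

lemma letter_outcome_cases: "letter_outcome x c \<in> {[], [True], [False]}"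
  by (cases x) auto

text \<open>Reversing an i.i.d. word preserves its law, which covers scans from the right. The
  surplus outcome \<open>e u\<close> raises the error constant from 10 to 11.\<close>

lemma iid_toll:
  assumes "letter_weights W s"
    and pT: "(\<Sum>c\<in>{c. c < s \<and> letter_outcome x c = [True]}. W c) = p * q"
    and pF: "(\<Sum>c\<in>{c. c < s \<and> letter_outcome x c = [False]}. W c) = (1 - p) * q"
    and z: "(\<Sum>c\<in>{c. c < s \<and> c \<in> scanned x}. W c) = z"
    and i: "i \<in> states sch" and p: "0 \<le> p" "p \<le> 1" and q: "0 \<le> q" "q \<le> 1"
    and e: "\<And>u. u \<in> words s m \<Longrightarrow> length (e u) \<le> 1"
  shows "\<bar>iid_sum W s m (\<lambda>u. real (miss_count sch i (key_word x u @ e u)))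
      - real m * (miss_rate sch p * q * z)\<bar> \<le> sqrt (real m) + 11"
proof -
  interpret letter_weights W s by fact
  let ?M = "\<lambda>u. real (miss_count sch i (concat (map (letter_outcome x) (take (letters_in (scanned x) u) u))))"
  have kw: "key_word x u = concat (map (letter_outcome x) (take (letters_in (scanned x) u) (if from_left x then u else rev u)))" for u
    by (simp add: key_word_def letters_in_def del: scanned.simps from_left.simps)
  have "iid_sum W s m (\<lambda>u. real (miss_count sch i (key_word x u))) = iid_sum W s m ?M"
  proof (cases "from_left x")
    case False
    then show ?thesis using iid_sum_rev[of W s m ?M] by (simp add: kw del: scanned.simps from_left.simps)
  qed (simp add: kw del: scanned.simps from_left.simps)
  moreover have "\<bar>iid_sum W s m (\<lambda>u. real (miss_count sch i (key_word x u @ e u)))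
      - iid_sum W s m (\<lambda>u. real (miss_count sch i (key_word x u)))\<bar> \<le> iid_sum W s m (\<lambda>_. 1)"
  proof (rule iid_sum_abs_le)
    fix u assume "u \<in> words s m"
    then have "miss_count sch (final_state sch i (key_word x u)) (e u) \<le> 1"
      using e[of u] miss_count_le_length order_trans by blast
    then show "\<bar>real (miss_count sch i (key_word x u @ e u)) - real (miss_count sch i (key_word x u))\<bar> \<le> 1"
      by (simp add: miss_count_append)
  qed
  moreover have "\<bar>iid_sum W s m ?M - real m * (miss_rate sch p * q * z)\<bar> \<le> sqrt (real m) + 10"
    by (rule iid_toll_aux[OF letter_outcome_cases pT pF z i p q])
  ultimately show ?thesis unfolding iid_sum_const by linarith
qed

section \<open>Beta averages\<close>

text \<open>Expectation of \<phi> under the Beta law with positive integer parameters. Natural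
  exponents keep the integrand continuous on the closed interval whenever \<phi> is.\<close>

definition beta_avg :: "nat \<Rightarrow> nat \<Rightarrow> (real \<Rightarrow> real) \<Rightarrow> real" where
  "beta_avg a b \<phi> = 1 / Beta (real a) (real b) * integral {0..1} (\<lambda>x. x ^ (a - 1) * (1 - x) ^ (b - 1) * \<phi> x)"

abbreviation unit_cont :: "(real \<Rightarrow> real) \<Rightarrow> bool" where
  "unit_cont \<equiv> continuous_on {0..1}"

lemma Beta_pos: "a > 0 \<Longrightarrow> b > 0 \<Longrightarrow> Beta (real a) (real b) > 0"
  by (auto simp: Beta_def intro!: Gamma_real_pos mult_pos_pos divide_pos_pos)

lemma beta_integrable:
  assumes "unit_cont \<phi>"
  shows "(\<lambda>x. x ^ m * (1 - x) ^ n * \<phi> x) integrable_on {0..1}"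
  using assms by (intro integrable_continuous_interval continuous_intros)

lemma beta_avg_const [simp]:
  assumes "a > 0" "b > 0"
  shows "beta_avg a b (\<lambda>_. c) = c"
proof -
  have "((\<lambda>x::real. x powr (real a - 1) * (1 - x) powr (real b - 1)) has_integral Beta (real a) (real b)) {0..1}"
    using assms by (intro has_integral_Beta_real) auto
  then have "((\<lambda>x::real. x ^ (a - 1) * (1 - x) ^ (b - 1)) has_integral Beta (real a) (real b)) {0..1}"
    by (rule has_integral_spike_finite[of "{0, 1}", rotated 2])
      (use assms in \<open>auto simp: powr_realpow[symmetric] of_nat_diff\<close>)
  then have I: "integral {0..1} (\<lambda>x::real. x ^ (a - 1) * (1 - x) ^ (b - 1) * c) = Beta (real a) (real b) * c"
    by (intro integral_unique has_integral_mult_left)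
  show ?thesis unfolding beta_avg_def I using Beta_pos[OF assms] by simp
qed

lemma beta_avg_add:
  assumes "unit_cont f" "unit_cont g"
  shows "beta_avg a b (\<lambda>x. f x + g x) = beta_avg a b f + beta_avg a b g"
  using integral_add[OF beta_integrable[OF assms(1)] beta_integrable[OF assms(2)], of "a - 1" "b - 1" "a - 1" "b - 1"]
  by (simp add: beta_avg_def distrib_left)

lemma beta_avg_cmult: "beta_avg a b (\<lambda>x. c * f x) = c * beta_avg a b f"
proof -
  have "integral {0..1} (\<lambda>x. x ^ (a - 1) * (1 - x) ^ (b - 1) * (c * f x))
      = c * integral {0..1} (\<lambda>x. x ^ (a - 1) * (1 - x) ^ (b - 1) * f x)"
    by (subst integral_mult_right[symmetric]) (simp add: mult_ac)
  then show ?thesis by (simp add: beta_avg_def)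
qed

lemma beta_avg_diff:
  assumes "unit_cont f" "unit_cont g"
  shows "beta_avg a b (\<lambda>x. f x - g x) = beta_avg a b f - beta_avg a b g"
  using beta_avg_add[OF assms(1), of "\<lambda>x. (-1) * g x" a b] assms beta_avg_cmult[of a b "-1" g]
  by (simp add: continuous_on_minus)

lemma beta_avg_sum:
  assumes "finite I" "\<And>i. i \<in> I \<Longrightarrow> unit_cont (f i)" "a > 0" "b > 0"
  shows "beta_avg a b (\<lambda>x. \<Sum>i\<in>I. f i x) = (\<Sum>i\<in>I. beta_avg a b (f i))"
  using assms(1,2)
proof (induction I)
  case (insert i I)
  then show ?case by (simp add: beta_avg_add continuous_on_sum)
qed (use assms in simp)

lemma beta_avg_cong: "(\<And>x. 0 \<le> x \<Longrightarrow> x \<le> 1 \<Longrightarrow> f x = g x) \<Longrightarrow> beta_avg a b f = beta_avg a b g"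
  unfolding beta_avg_def by (intro arg_cong2[where f = "(*)"] refl integral_cong) auto

lemma beta_avg_mono:
  assumes "unit_cont f" "unit_cont g" "\<And>x. 0 \<le> x \<Longrightarrow> x \<le> 1 \<Longrightarrow> f x \<le> g x" "a > 0" "b > 0"
  shows "beta_avg a b f \<le> beta_avg a b g"
  unfolding beta_avg_def using assms Beta_pos[OF assms(4,5)]
  by (intro mult_left_mono integral_le beta_integrable) (auto intro!: mult_left_mono)

lemma beta_avg_abs_diff_le:
  assumes "unit_cont f" "unit_cont g" "unit_cont h" "\<And>x. 0 \<le> x \<Longrightarrow> x \<le> 1 \<Longrightarrow> \<bar>f x - g x\<bar> \<le> h x" "a > 0" "b > 0"
  shows "\<bar>beta_avg a b f - beta_avg a b g\<bar> \<le> beta_avg a b h"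
proof -
  have "beta_avg a b (\<lambda>x. f x - g x) \<le> beta_avg a b h" "beta_avg a b (\<lambda>x. g x - f x) \<le> beta_avg a b h"
    using assms by (intro beta_avg_mono continuous_intros; force simp: abs_le_iff)+
  then show ?thesis using assms by (simp add: beta_avg_diff)
qed

text \<open>Weighting by x is conditioning on one further draw: the mean splits off and the first
  parameter grows by one. All shifted indices in \<open>a_coeff\<close> come from this rule and its
  mirror image.\<close>

lemma beta_avg_times_x:
  assumes "a > 0" "b > 0"
  shows "beta_avg a b (\<lambda>x. x * f x) = real a / real (a + b) * beta_avg (a + 1) b f"
proof -
  have "(real a + real b) * Beta (real a + 1) (real b) = real a * Beta (real a) (real b)"
    using assms by (intro Beta_plus1_left) (auto simp: nonpos_Ints_def)
  then have B: "1 / Beta (real a) (real b) = real a / real (a + b) * (1 / Beta (real (a + 1)) (real b))"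
    using Beta_pos[OF assms] Beta_pos[of "a + 1" b] assms by (simp add: field_simps)
  have E: "(\<lambda>x. x ^ (a - 1) * (1 - x) ^ (b - 1) * (x * f x)) = (\<lambda>x. x ^ a * (1 - x) ^ (b - 1) * f x)"
    using assms by (cases a) auto
  show ?thesis unfolding beta_avg_def B E by simp
qed

lemma beta_avg_times_1mx:
  assumes "a > 0" "b > 0"
  shows "beta_avg a b (\<lambda>x. (1 - x) * f x) = real b / real (a + b) * beta_avg a (b + 1) f"
proof -
  have "(real a + real b) * Beta (real a) (real b + 1) = real b * Beta (real a) (real b)"
    using assms by (intro Beta_plus1_right) (auto simp: nonpos_Ints_def)
  then have B: "1 / Beta (real a) (real b) = real b / real (a + b) * (1 / Beta (real a) (real (b + 1)))"
    using Beta_pos[OF assms] Beta_pos[of a "b + 1"] assms by (simp add: field_simps)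
  have E: "(\<lambda>x. x ^ (a - 1) * (1 - x) ^ (b - 1) * ((1 - x) * f x)) = (\<lambda>x. x ^ (a - 1) * (1 - x) ^ b * f x)"
    using assms by (cases b) auto
  show ?thesis unfolding beta_avg_def B E by simp
qed

lemma beta_avg_split:
  assumes "a > 0" "b > 0" "unit_cont f"
  shows "beta_avg a b f = real a / real (a + b) * beta_avg (a + 1) b f + real b / real (a + b) * beta_avg a (b + 1) f"
proof -
  have "beta_avg a b f = beta_avg a b (\<lambda>x. x * f x + (1 - x) * f x)"
    by (rule beta_avg_cong) (simp add: algebra_simps)
  also have "\<dots> = beta_avg a b (\<lambda>x. x * f x) + beta_avg a b (\<lambda>x. (1 - x) * f x)"
    using assms by (intro beta_avg_add continuous_intros)
  finally show ?thesis by (simp only: beta_avg_times_x[OF assms(1,2)] beta_avg_times_1mx[OF assms(1,2)])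
qed

lemma integral_reflect_unit:
  fixes f :: "real \<Rightarrow> real"
  shows "integral {0..1} (\<lambda>x. f (1 - x)) = integral {0..1} f"
proof -
  have "integral {0..1} (\<lambda>x. f (1 - x)) = integral {-1..0} (\<lambda>x. f (x + 1))"
    using Henstock_Kurzweil_Integration.integral_reflect_real[of 1 0 "\<lambda>x. f (1 - x)"]
    by (simp add: add.commute)
  also have "\<dots> = integral {0..1} f"
    using integral_shift_real_ivl[of 0 1 1 f] by simp
  finally show ?thesis .
qed

lemma beta_avg_reflect: "beta_avg a b (\<lambda>x. f (1 - x)) = beta_avg b a f"
  using integral_reflect_unit[of "\<lambda>x. x ^ (b - 1) * (1 - x) ^ (a - 1) * f x"]
  by (simp add: beta_avg_def Beta_commute[of "real a"] mult_ac)

lemma beta_avg_monomial: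
  assumes "a > 0" "b > 0"
  shows "beta_avg a b (\<lambda>x. x ^ i * (1 - x) ^ j) =
    fact (a - 1 + i) / fact (a - 1) * (fact (b - 1 + j) / fact (b - 1)) * fact (a + b - 1) / fact (a + b - 1 + i + j)"
proof -
  have base: "beta_avg a b (\<lambda>x. (1 - x) ^ j) = fact (b - 1 + j) / fact (b - 1) * fact (a + b - 1) / fact (a + b - 1 + j)"
    if "a > 0" "b > 0" for a b
    using that
  proof (induction j arbitrary: b)
    case (Suc j)
    have F1: "fact b = real b * fact (b - 1)" "fact (a + b) = real (a + b) * fact (a + b - 1)"
      using Suc.prems by (intro fact_reduce; simp)+
    have F2: "b - 1 + Suc j = b + j" "a + b - 1 + Suc j = a + b + j"
      using Suc.prems by auto
    note F = F1 F2
    have "beta_avg a b (\<lambda>x. (1 - x) * (1 - x) ^ j) = real b / real (a + b) * beta_avg a (b + 1) (\<lambda>x. (1 - x) ^ j)"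
      using Suc.prems by (rule beta_avg_times_1mx)
    also have "\<dots> = real b / real (a + b) * (fact (b + j) / fact b * fact (a + b) / fact (a + b + j))"
      using Suc.IH[of "b + 1"] Suc.prems by simp
    also have "\<dots> = fact (b - 1 + Suc j) / fact (b - 1) * fact (a + b - 1) / fact (a + b - 1 + Suc j)"
      unfolding F using Suc.prems by (simp del: fact_Suc of_nat_add)
    finally show ?case by simp
  qed simp
  show ?thesis
    using assms
  proof (induction i arbitrary: a)
    case 0
    then show ?case using base[of a b] by simp
  next
    case (Suc i)
    have F1: "fact a = real a * fact (a - 1)" "fact (a + b) = real (a + b) * fact (a + b - 1)"
      using Suc.prems by (intro fact_reduce; simp)+
    have F2: "a - 1 + Suc i = a + i" "a + b - 1 + Suc i + j = a + b + i + j"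
      using Suc.prems by auto
    note F = F1 F2
    have "beta_avg a b (\<lambda>x. x * (x ^ i * (1 - x) ^ j)) = real a / real (a + b) * beta_avg (a + 1) b (\<lambda>x. x ^ i * (1 - x) ^ j)"
      using Suc.prems by (rule beta_avg_times_x)
    also have "\<dots> = real a / real (a + b) * (fact (a + i) / fact a * (fact (b - 1 + j) / fact (b - 1)) * fact (a + b) / fact (a + b + i + j))"
      using Suc.IH[of "a + 1"] Suc.prems by (simp add: add_ac)
    also have "\<dots> = fact (a - 1 + Suc i) / fact (a - 1) * (fact (b - 1 + j) / fact (b - 1)) * fact (a + b - 1) / fact (a + b - 1 + Suc i + j)"
      unfolding F using Suc.prems by (simp del: fact_Suc of_nat_add)
    finally show ?case by (simp add: mult.assoc)
  qed
qed

subsection \<open>The Polya urn as a mixture of i.i.d. words\<close>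

lemma prod_list_map_count:
  fixes u :: "nat list"
  assumes "set u \<subseteq> {..<s}"
  shows "prod_list (map W u) = (\<Prod>c<s. (W c :: real) ^ count_list u c)"
  using assms
proof (induction u)
  case (Cons c u)
  then have "(\<Prod>d<s. W d ^ count_list (c # u) d) = (\<Prod>d<s. (if d = c then W c else 1) * W d ^ count_list u d)"
    by (intro prod.cong) auto
  also have "\<dots> = W c * (\<Prod>d<s. W d ^ count_list u d)"
  proof -
    have "(\<Prod>d<s. if d = c then W c else 1) = W c"
      using Cons.prems by (subst prod.delta) auto
    then show ?thesis by (simp add: prod.distrib)
  qed
  finally show ?case using Cons by simp
qed simp

text \<open>De Finetti's representation of the two-colour urn; the moments of the Beta law are the
  same quotients of rising factorials.\<close>

lemma polya2_mixture:
  assumes "u \<in> words 2 m"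
  shows "polya 2 t u = beta_avg (t 0 + 1) (t 1 + 1) (\<lambda>x. x ^ count_list u 0 * (1 - x) ^ count_list u 1)"
proof -
  have "length u = count_list u 0 + count_list u 1"
    using sum_count_list_words[OF assms] assms by (simp add: numeral_2_eq_2 words_def)
  then show ?thesis
    by (simp add: beta_avg_monomial polya_def polya_total_def numeral_2_eq_2 add_ac)
qed

text \<open>Stick breaking for the Dirichlet law: the share x of colour \<open>c1\<close> and the
  share y of \<open>c2\<close> in the rest are independent Beta variables. The order of the colours
  is left open so that each location can use its own coordinates.\<close>

lemma polya3_mixture:
  assumes "u \<in> words 3 m" and c: "{c1, c2, c3} = {0, 1, 2}" "distinct [c1, c2, c3]"
  shows "polya 3 t u = beta_avg (t c1 + 1) (t c2 + 1 + (t c3 + 1))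
      (\<lambda>x. x ^ count_list u c1 * (1 - x) ^ (count_list u c2 + count_list u c3))
    * beta_avg (t c2 + 1) (t c3 + 1) (\<lambda>y. y ^ count_list u c2 * (1 - y) ^ count_list u c3)"
proof -
  have S: "{..<3} = {c1, c2, c3}" unfolding c(1) by auto
  have len: "length u = count_list u c1 + count_list u c2 + count_list u c3"
  proof -
    have "length u = m" using assms(1) by (simp add: words_def)
    then have "(\<Sum>l\<in>{c1, c2, c3}. count_list u l) = length u"
      using sum_count_list_words[OF assms(1)] unfolding S by simp
    then show ?thesis using c(2) by simp
  qed
  have P: "(\<Prod>l<3. f l) = f c1 * f c2 * f c3" for f :: "nat \<Rightarrow> real"
    unfolding S using c(2) by (simp add: mult.assoc)
  have T: "polya_total 3 t = Suc (Suc (Suc (t c1 + t c2 + t c3)))"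
    unfolding polya_total_def S using c(2) by simp
  let ?N = "count_list u"
  \<comment> \<open>X / Y is the rising factorial of the merged colours \<open>c2\<close> and
    \<open>c3\<close>: it appears in the first average and cancels against the second.\<close>
  define X where "X = (fact (t c2 + t c3 + 1 + (?N c2 + ?N c3)) :: real)"
  define Y where "Y = (fact (t c2 + t c3 + 1) :: real)"
  have XY: "X \<noteq> 0" "Y \<noteq> 0" by (simp_all add: X_def Y_def)
  have 1: "beta_avg (t c1 + 1) (t c2 + 1 + (t c3 + 1)) (\<lambda>x. x ^ ?N c1 * (1 - x) ^ (?N c2 + ?N c3)) =
      fact (t c1 + ?N c1) / fact (t c1) * (X / Y) * fact (polya_total 3 t - 1) / fact (polya_total 3 t - 1 + length u)"
    by (subst beta_avg_monomial) (simp_all add: X_def Y_def T len add_ac del: fact_Suc)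
  have 2: "beta_avg (t c2 + 1) (t c3 + 1) (\<lambda>y. y ^ ?N c2 * (1 - y) ^ ?N c3) =
      fact (t c2 + ?N c2) / fact (t c2) * (fact (t c3 + ?N c3) / fact (t c3)) * Y / X"
    by (subst beta_avg_monomial) (simp_all add: X_def Y_def add_ac del: fact_Suc)
  have alg: "P1 * P2 * P3 * Q / R = (P1 * (X / Y) * Q / R) * (P2 * P3 * Y / X)" for P1 P2 P3 Q R
    using XY by simp
  show ?thesis
    unfolding 1 2 polya_def P by (rule alg)
qed

section \<open>The expected misses of one partitioning step\<close>

lemma continuous_on_miss_rate [continuous_intros]:
  assumes "continuous_on A f"
  shows "continuous_on A (\<lambda>x. miss_rate sch (f x))"
proof -
  have "1 - 2 * p * (1 - p) \<noteq> 0" "1 - p * (1 - p) \<noteq> 0" for p :: real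
    using SC_denom[of p] FC_denom[of p] by linarith+
  then show ?thesis using assms by (cases sch) (auto intro!: continuous_intros)
qed

lemma miss_rate_sym: "miss_rate sch (1 - p) = miss_rate sch p"
  by (cases sch) (simp_all add: mult.commute mult.left_commute)

text \<open>The three formulas for g are one: the Beta average of f. As f has a factor x(1 - x), the
  exponents a - 1 and b - 1 of the density become a and b in \<gamma>.\<close>

lemma g_coeff_eq:
  assumes "a > 0" "b > 0"
  shows "g_coeff sch a b = beta_avg a b (miss_rate sch)"
proof -
  have d: "1 - 2 * x * (1 - x) > 0" "1 - x * (1 - x) > 0" for x :: real
    using SC_denom[of x] FC_denom[of x] by linarith+
  have dp: "1 / 2 - x * (1 - x) \<noteq> 0" for x :: real using d(1)[of x] by linarith
  have pow: "x ^ a * (1 - x) ^ b / D = x ^ (a - 1) * (1 - x) ^ (b - 1) * (x * (1 - x) / D)" for x D :: real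
    using assms by (cases a; cases b) auto
  have xx: "beta_avg a b (\<lambda>x. x * ((1 - x) * f x)) = real a * real b / (real (a + b) * real (a + b + 1)) * beta_avg (a + 1) (b + 1) f"
    if ab: "a > 0" "b > 0" for f a b
    using ab by (subst beta_avg_times_x, simp, simp, subst beta_avg_times_1mx, simp, simp) (simp add: add_ac)
  show ?thesis
  proof (cases sch)
    case One_Bit
    have "beta_avg a b (miss_rate One_Bit) = beta_avg a b (\<lambda>x. x * ((1 - x) * 2))"
      by (intro beta_avg_cong) simp
    also have "\<dots> = real a * real b / (real (a + b) * real (a + b + 1)) * beta_avg (a + 1) (b + 1) (\<lambda>_. 2)"
      using assms by (rule xx)
    also have "\<dots> = 2 * real a * real b / (real (a + b) * real (a + b + 1))"
      using assms by simp
    finally show ?thesis unfolding One_Bit g_coeff.simps by (rule sym)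
  next
    case Two_Bit_SC
    have "\<gamma> 2 a b = beta_avg a b (\<lambda>x. x * (1 - x) / (1 / 2 - x * (1 - x)))"
      unfolding \<gamma>_def beta_avg_def pow ..
    then have "1 / 2 * \<gamma> 2 a b = beta_avg a b (\<lambda>x. 1 / 2 * (x * (1 - x) / (1 / 2 - x * (1 - x))))"
      by (simp only: beta_avg_cmult)
    also have "\<dots> = beta_avg a b (miss_rate Two_Bit_SC)"
    proof -
      have "1 / 2 * (v / (1 / 2 - v)) = v / (1 - 2 * v)" if "1 / 2 - v \<noteq> 0" for v :: real
        using that by (simp add: field_simps)
      from this[OF dp] show ?thesis unfolding miss_rate.simps mult.assoc by presburger
    qed
    finally show ?thesis by (simp add: Two_Bit_SC)
  next
    case Two_Bit_FC
    \<comment> \<open>With v = x(1 - x), f is 2 v \<psi> + \<psi>. The factor v of the first summand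
      passes into the weight, which explains the index (a + 1, b + 1) and the prefactor in the third
      formula.\<close>
    define \<psi> where "\<psi> x = x * (1 - x) / (1 / 1 - x * (1 - x))" for x :: real
    have cont: "unit_cont \<psi>"
      unfolding \<psi>_def[abs_def] using d(2) by (intro continuous_intros) (auto simp: less_imp_neq[symmetric])
    have g1: "\<gamma> 1 a b = beta_avg a b \<psi>" if "a > 0" "b > 0" for a b
    proof -
      have "x ^ a * (1 - x) ^ b / D = x ^ (a - 1) * (1 - x) ^ (b - 1) * (x * (1 - x) / D)" for x D :: real
        using that by (cases a; cases b) auto
      then show ?thesis unfolding \<gamma>_def beta_avg_def \<psi>_def by presburger
    qed
    have "miss_rate Two_Bit_FC x = 2 * (x * ((1 - x) * \<psi> x)) + \<psi> x" for x
    proof -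
      have "(2 * v\<^sup>2 + v) / (1 - v) = 2 * (v * (v / (1 / 1 - v))) + v / (1 / 1 - v)" for v :: real
        by (simp add: add_divide_distrib power2_eq_square)
      from this[of "x * (1 - x)"] show ?thesis
        unfolding miss_rate.simps \<psi>_def by (simp only: power_mult_distrib mult.assoc)
    qed
    then have "beta_avg a b (miss_rate Two_Bit_FC) = beta_avg a b (\<lambda>x. 2 * (x * ((1 - x) * \<psi> x)) + \<psi> x)"
      by presburger
    also have "\<dots> = beta_avg a b (\<lambda>x. 2 * (x * ((1 - x) * \<psi> x))) + beta_avg a b \<psi>"
      using cont by (intro beta_avg_add continuous_intros)
    also have "beta_avg a b (\<lambda>x. 2 * (x * ((1 - x) * \<psi> x))) = 2 * beta_avg a b (\<lambda>x. x * ((1 - x) * \<psi> x))"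
      by (rule beta_avg_cmult)
    also have "\<dots> = 2 * (real a * real b / (real (a + b) * real (a + b + 1)) * beta_avg (a + 1) (b + 1) \<psi>)"
      using assms by (simp only: xx)
    also have "\<dots> = 2 * real a * real b / (real (a + b) * real (a + b + 1)) * \<gamma> 1 (a + 1) (b + 1)"
      by (subst g1) simp_all
    also have "beta_avg a b \<psi> = \<gamma> 1 a b" using g1[OF assms] ..
    finally show ?thesis unfolding Two_Bit_FC g_coeff.simps by (rule sym)
  qed
qed

lemma g_coeff_sym: "a > 0 \<Longrightarrow> b > 0 \<Longrightarrow> g_coeff sch a b = g_coeff sch b a"
  using beta_avg_reflect[of a b "miss_rate sch"] by (simp add: g_coeff_eq miss_rate_sym)

lemma polya2_toll:
  assumes W: "\<And>x c. W x c = (if c = (0::nat) then x else 1 - x)"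
    and A: "unit_cont A"
    and bound: "\<And>x. 0 \<le> x \<Longrightarrow> x \<le> 1 \<Longrightarrow> \<bar>iid_sum (W x) 2 m h - real m * A x\<bar> \<le> C"
  shows "\<bar>(\<Sum>u\<in>words 2 m. polya 2 t u * h u) - real m * beta_avg (t 0 + 1) (t 1 + 1) A\<bar> \<le> C"
proof -
  let ?I = "beta_avg (t 0 + 1) (t 1 + 1)"
  have iid: "iid_sum (W x) 2 m h = (\<Sum>u\<in>words 2 m. h u * (x ^ count_list u 0 * (1 - x) ^ count_list u 1))" for x
    unfolding iid_sum_def
  proof (rule sum.cong[OF refl])
    fix u assume "u \<in> words 2 m"
    then have "prod_list (map (W x) u) = (\<Prod>c<2. W x c ^ count_list u c)"
      by (intro prod_list_map_count) (auto simp: words_def)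
    then show "prod_list (map (W x) u) * h u = h u * (x ^ count_list u 0 * (1 - x) ^ count_list u 1)"
      by (simp add: W numeral_2_eq_2)
  qed
  have "(\<Sum>u\<in>words 2 m. polya 2 t u * h u) = (\<Sum>u\<in>words 2 m. ?I (\<lambda>x. h u * (x ^ count_list u 0 * (1 - x) ^ count_list u 1)))"
    by (intro sum.cong refl) (simp add: polya2_mixture beta_avg_cmult mult.commute)
  also have "\<dots> = ?I (\<lambda>x. iid_sum (W x) 2 m h)"
    unfolding iid by (subst beta_avg_sum) (auto intro!: continuous_intros)
  finally have 1: "(\<Sum>u\<in>words 2 m. polya 2 t u * h u) = ?I (\<lambda>x. iid_sum (W x) 2 m h)" .
  have "\<bar>?I (\<lambda>x. iid_sum (W x) 2 m h) - ?I (\<lambda>x. real m * A x)\<bar> \<le> ?I (\<lambda>_. C)"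
    by (rule beta_avg_abs_diff_le) (use bound A in \<open>auto simp: iid intro!: continuous_intros\<close>)
  then show ?thesis unfolding 1 beta_avg_cmult by simp
qed

text \<open>At each location the rate is a sum of at most two products A(x) B(y). The average over y
  is taken first, with x fixed, and independence reduces everything to products of one-dimensional
  averages.\<close>

lemma polya3_toll:
  fixes c1 c2 c3 :: nat
  assumes c: "{c1, c2, c3} = {0, 1, 2}" "distinct [c1, c2, c3]"
    and W: "\<And>x y c. W x y c = (if c = c1 then x else if c = c2 then (1 - x) * y else (1 - x) * (1 - y))"
    and cont: "unit_cont A1" "unit_cont A2" "unit_cont B1" "unit_cont B2"
    and bound: "\<And>x y. 0 \<le> x \<Longrightarrow> x \<le> 1 \<Longrightarrow> 0 \<le> y \<Longrightarrow> y \<le> 1 \<Longrightarrow>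
      \<bar>iid_sum (W x y) 3 m h - real m * (A1 x * B1 y + A2 x * B2 y)\<bar> \<le> C"
  shows "\<bar>(\<Sum>u\<in>words 3 m. polya 3 t u * h u) - real m *
     (beta_avg (t c1 + 1) (t c2 + 1 + (t c3 + 1)) A1 * beta_avg (t c2 + 1) (t c3 + 1) B1
    + beta_avg (t c1 + 1) (t c2 + 1 + (t c3 + 1)) A2 * beta_avg (t c2 + 1) (t c3 + 1) B2)\<bar> \<le> C"
proof -
  let ?I = "beta_avg (t c1 + 1) (t c2 + 1 + (t c3 + 1))" and ?J = "beta_avg (t c2 + 1) (t c3 + 1)"
  let ?X = "\<lambda>u x. x ^ count_list u c1 * (1 - x) ^ (count_list u c2 + count_list u c3) :: real"
  let ?Y = "\<lambda>u y. y ^ count_list u c2 * (1 - y) ^ count_list u c3 :: real"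
  have S: "{..<3} = {c1, c2, c3}" unfolding c(1) by auto
  have iid: "iid_sum (W x y) 3 m h = (\<Sum>u\<in>words 3 m. h u * ?X u x * ?Y u y)" for x y
    unfolding iid_sum_def
  proof (rule sum.cong[OF refl])
    fix u assume "u \<in> words 3 m"
    then have "prod_list (map (W x y) u) = (\<Prod>c<3. W x y c ^ count_list u c)"
      by (intro prod_list_map_count) (auto simp: words_def)
    also have "\<dots> = x ^ count_list u c1 * ((1 - x) * y) ^ count_list u c2 * ((1 - x) * (1 - y)) ^ count_list u c3"
      unfolding S using c(2) by (simp add: W mult.assoc)
    finally show "prod_list (map (W x y) u) * h u = h u * ?X u x * ?Y u y"
      by (simp add: power_mult_distrib power_add)
  qed
  have inner: "?J (\<lambda>y. iid_sum (W x y) 3 m h) = (\<Sum>u\<in>words 3 m. h u * ?X u x * ?J (?Y u))" for x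
    unfolding iid by (subst beta_avg_sum) (auto intro!: continuous_intros sum.cong simp: beta_avg_cmult)
  have contX: "unit_cont (\<lambda>x. \<Sum>u\<in>words 3 m. h u * ?X u x * ?J (?Y u))"
    by (intro continuous_intros)
  have "(\<Sum>u\<in>words 3 m. polya 3 t u * h u) = (\<Sum>u\<in>words 3 m. ?I (\<lambda>x. h u * ?J (?Y u) * ?X u x))"
  proof (rule sum.cong[OF refl])
    fix u assume "u \<in> words 3 m"
    then show "polya 3 t u * h u = ?I (\<lambda>x. h u * ?J (?Y u) * ?X u x)"
      unfolding beta_avg_cmult[of _ _ "h u * ?J (?Y u)"] by (simp add: polya3_mixture[OF _ c])
  qed
  also have "\<dots> = ?I (\<lambda>x. \<Sum>u\<in>words 3 m. h u * ?J (?Y u) * ?X u x)"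
    by (subst beta_avg_sum) (auto intro!: continuous_intros)
  also have "\<dots> = ?I (\<lambda>x. \<Sum>u\<in>words 3 m. h u * ?X u x * ?J (?Y u))"
    by (simp add: mult_ac)
  finally have 1: "(\<Sum>u\<in>words 3 m. polya 3 t u * h u) = ?I (\<lambda>x. \<Sum>u\<in>words 3 m. h u * ?X u x * ?J (?Y u))" .
  have innerR: "?J (\<lambda>y. real m * (A1 x * B1 y + A2 x * B2 y)) = real m * (?J B1 * A1 x + ?J B2 * A2 x)" for x
  proof -
    have "?J (\<lambda>y. A1 x * B1 y + A2 x * B2 y) = ?J (\<lambda>y. A1 x * B1 y) + ?J (\<lambda>y. A2 x * B2 y)"
      using cont by (intro beta_avg_add continuous_intros)
    then show ?thesis by (simp only: beta_avg_cmult) (simp add: mult_ac)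
  qed
  have "\<bar>(\<Sum>u\<in>words 3 m. h u * ?X u x * ?J (?Y u)) - real m * (?J B1 * A1 x + ?J B2 * A2 x)\<bar> \<le> C"
    if "0 \<le> x" "x \<le> 1" for x
  proof -
    have "\<bar>?J (\<lambda>y. iid_sum (W x y) 3 m h) - ?J (\<lambda>y. real m * (A1 x * B1 y + A2 x * B2 y))\<bar> \<le> ?J (\<lambda>_. C)"
      by (rule beta_avg_abs_diff_le) (use bound that cont in \<open>auto simp: iid intro!: continuous_intros\<close>)
    then show ?thesis unfolding inner innerR by simp
  qed
  then have "\<bar>?I (\<lambda>x. \<Sum>u\<in>words 3 m. h u * ?X u x * ?J (?Y u)) - ?I (\<lambda>x. real m * (?J B1 * A1 x + ?J B2 * A2 x))\<bar> \<le> ?I (\<lambda>_. C)"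
    using cont contX by (intro beta_avg_abs_diff_le) (auto intro!: continuous_intros)
  moreover have "?I (\<lambda>x. real m * (?J B1 * A1 x + ?J B2 * A2 x)) = real m * (?I A1 * ?J B1 + ?I A2 * ?J B2)"
  proof -
    have "?I (\<lambda>x. ?J B1 * A1 x + ?J B2 * A2 x) = ?I (\<lambda>x. ?J B1 * A1 x) + ?I (\<lambda>x. ?J B2 * A2 x)"
      using cont by (intro beta_avg_add continuous_intros)
    then show ?thesis by (simp only: beta_avg_cmult) (simp add: mult_ac)
  qed
  ultimately show ?thesis unfolding 1 by simp
qed

text \<open>In the limit an element causes f times the product of the inspected share and the
  probability of being tested. The factors are arranged, with some factors 1, so that
  \<open>beta_avg_times_x\<close> and \<open>beta_avg_times_1mx\<close> apply. At the locations of g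
  in YQS the first variable is the share of the large elements.\<close>

definition loc_coeff :: "scheme \<Rightarrow> (nat \<Rightarrow> nat) \<Rightarrow> location \<Rightarrow> real" where
  "loc_coeff sch t x = (
    let f = miss_rate sch; a1 = t 1 + 1; a2 = t 2 + 1; a3 = t 3 + 1 in
    case x of
      CQS_Key_k \<Rightarrow> beta_avg a1 a2 (\<lambda>x. x * f x)
    | CQS_Key_g \<Rightarrow> beta_avg a1 a2 (\<lambda>x. (1 - x) * f x)
    | YQS_Key_k_p \<Rightarrow> beta_avg a1 (a2 + a3) (\<lambda>x. x * f x) + beta_avg a1 (a2 + a3) (\<lambda>x. (1 - x) * f x) * beta_avg a2 a3 (\<lambda>y. y * 1)
    | YQS_Key_k_q \<Rightarrow> beta_avg a1 (a2 + a3) (\<lambda>x. x * ((1 - x) * 1)) * beta_avg a2 a3 f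
        + beta_avg a1 (a2 + a3) (\<lambda>x. (1 - x) * ((1 - x) * 1)) * beta_avg a2 a3 (\<lambda>y. y * f y)
    | YQS_Key_g_q \<Rightarrow> beta_avg a3 (a1 + a2) (\<lambda>x. x * f x)
    | YQS_Key_g_p \<Rightarrow> beta_avg a3 (a1 + a2) (\<lambda>x. x * ((1 - x) * 1)) * beta_avg a1 a2 f
    | _ \<Rightarrow> 0)"

lemma sum_loc_coeff: "(\<Sum>x\<in>key_locs alg. loc_coeff sch t x) = a_coeff alg sch t"
proof -
  let ?f = "miss_rate sch"
  define a1 a2 a3 where a: "a1 = t 1 + 1" "a2 = t 2 + 1" "a3 = t 3 + 1"
  have pos: "a1 > 0" "a2 > 0" "a3 > 0" by (auto simp: a)
  have cf: "unit_cont ?f" by (intro continuous_intros)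
  note G = g_coeff_eq[symmetric]
  show ?thesis
  proof (cases alg)
    case CQS
    have "loc_coeff sch t CQS_Key_k + loc_coeff sch t CQS_Key_g = beta_avg a1 a2 (\<lambda>x. x * ?f x) + beta_avg a1 a2 (\<lambda>x. (1 - x) * ?f x)"
      by (simp add: loc_coeff_def a)
    also have "\<dots> = beta_avg a1 a2 ?f"
      using pos cf beta_avg_split[of a1 a2 ?f] by (simp only: beta_avg_times_x beta_avg_times_1mx)
    finally show ?thesis using pos by (simp add: CQS G a)
  next
    case YQS
    let ?g = "g_coeff sch"
    define \<kappa> where "\<kappa> = real (a1 + a2 + a3)"
    have \<kappa>: "\<kappa> > 0" "\<kappa> + 1 > 0" using pos by (auto simp: \<kappa>_def)
    have r: "real a1 > 0" "real a2 > 0" "real a3 > 0" using pos by auto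
    have k_p: "loc_coeff sch t YQS_Key_k_p = real a1 / \<kappa> * ?g (a1 + 1) (a2 + a3) + real a2 / \<kappa> * ?g a1 (a2 + a3 + 1)"
    proof -
      have "loc_coeff sch t YQS_Key_k_p = real a1 / \<kappa> * ?g (a1 + 1) (a2 + a3)
          + (real (a2 + a3) / \<kappa> * ?g a1 (a2 + a3 + 1)) * (real a2 / real (a2 + a3))"
        using pos unfolding loc_coeff_def Let_def a[symmetric] location.case beta_avg_times_x[OF pos(2,3)]
        by (simp add: beta_avg_times_x beta_avg_times_1mx G \<kappa>_def add_ac)
      also have "(real (a2 + a3) / \<kappa> * ?g a1 (a2 + a3 + 1)) * (real a2 / real (a2 + a3)) = real a2 / \<kappa> * ?g a1 (a2 + a3 + 1)"
        using pos by (simp del: of_nat_add)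
      finally show ?thesis .
    qed
    have k_q: "loc_coeff sch t YQS_Key_k_q = real a1 * real a2 / (\<kappa> * (\<kappa> + 1)) * ?g (a2 + 1) a3 + real a1 * real a3 / (\<kappa> * (\<kappa> + 1)) * ?g a2 (a3 + 1)
         + real a2 * real (a2 + 1) / (\<kappa> * (\<kappa> + 1)) * ?g (a2 + 2) a3 + real a2 * real a3 / (\<kappa> * (\<kappa> + 1)) * ?g (a2 + 1) (a3 + 1)"
    proof -
      define K where "K = \<kappa> * (\<kappa> + 1)"
      have 1: "beta_avg a1 (a2 + a3) (\<lambda>x. x * ((1 - x) * 1)) = real a1 * real (a2 + a3) / K"
        using pos by (subst beta_avg_times_x, simp, simp, subst beta_avg_times_1mx, simp, simp)
          (simp add: \<kappa>_def K_def add_ac)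
      have 2: "beta_avg a1 (a2 + a3) (\<lambda>x. (1 - x) * ((1 - x) * 1)) = real (a2 + a3) * real (a2 + a3 + 1) / K"
        using pos by (subst beta_avg_times_1mx, simp, simp, subst beta_avg_times_1mx, simp, simp)
          (simp add: \<kappa>_def K_def add_ac)
      \<comment> \<open>Averaging over one more draw raises the indices of g. In this form the
        fractions with denominator a2 + a3 cancel and the four terms of \<open>a_coeff\<close> for
        this location appear.\<close>
      have 3: "beta_avg a2 a3 ?f = real a2 / real (a2 + a3) * ?g (a2 + 1) a3 + real a3 / real (a2 + a3) * ?g a2 (a3 + 1)"
        using pos cf beta_avg_split[of a2 a3 ?f] by (simp add: G)
      have 4: "beta_avg a2 a3 (\<lambda>y. y * ?f y) = real a2 / real (a2 + a3) *
          (real (a2 + 1) / real (a2 + a3 + 1) * ?g (a2 + 2) a3 + real a3 / real (a2 + a3 + 1) * ?g (a2 + 1) (a3 + 1))"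
        using pos cf beta_avg_split[of "a2 + 1" a3 ?f] by (simp add: G beta_avg_times_x add_ac)
      have alg1: "x * s / K * (y / s * u + z / s * v) = x * y / K * u + x * z / K * v" if "s \<noteq> 0" for x s y u z v
        using that by (cases "K = 0") (auto simp: field_simps)
      have alg2: "s * s' / K * (y / s * (y' / s' * u + z / s' * v)) = y * y' / K * u + y * z / K * v"
        if "s \<noteq> 0" "s' \<noteq> 0" for s s' y y' u z v
        using that by (cases "K = 0") (auto simp: field_simps)
      have "loc_coeff sch t YQS_Key_k_q = real a1 * real (a2 + a3) / K * beta_avg a2 a3 ?f
          + real (a2 + a3) * real (a2 + a3 + 1) / K * beta_avg a2 a3 (\<lambda>y. y * ?f y)"
        unfolding loc_coeff_def Let_def a[symmetric] location.case 1 2 ..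
      also have "\<dots> = (real a1 * real a2 / K * ?g (a2 + 1) a3 + real a1 * real a3 / K * ?g a2 (a3 + 1))
         + (real a2 * real (a2 + 1) / K * ?g (a2 + 2) a3 + real a2 * real a3 / K * ?g (a2 + 1) (a3 + 1))"
        unfolding 3 4 using pos by (subst alg1, simp, subst alg2, simp, simp) simp
      finally show ?thesis by (simp add: K_def)
    qed
    have g_q: "loc_coeff sch t YQS_Key_g_q = real a3 / \<kappa> * ?g (a1 + a2) (a3 + 1)"
    proof -
      have "loc_coeff sch t YQS_Key_g_q = real a3 / \<kappa> * ?g (a3 + 1) (a1 + a2)"
        using pos unfolding loc_coeff_def Let_def a[symmetric] location.case
        by (simp add: beta_avg_times_x G \<kappa>_def add_ac)
      then show ?thesis using g_coeff_sym[of "a3 + 1" "a1 + a2"] pos by simp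
    qed
    have g_p: "loc_coeff sch t YQS_Key_g_p = real a1 * real a3 / (\<kappa> * (\<kappa> + 1)) * ?g (a1 + 1) a2
        + real a2 * real a3 / (\<kappa> * (\<kappa> + 1)) * ?g a1 (a2 + 1)"
    proof -
      define K where "K = \<kappa> * (\<kappa> + 1)"
      have 1: "beta_avg a3 (a1 + a2) (\<lambda>x. x * ((1 - x) * 1)) = real a3 * real (a1 + a2) / K"
        using pos by (subst beta_avg_times_x, simp, simp, subst beta_avg_times_1mx, simp, simp)
          (simp add: \<kappa>_def K_def add_ac)
      have 3: "beta_avg a1 a2 ?f = real a1 / real (a1 + a2) * ?g (a1 + 1) a2 + real a2 / real (a1 + a2) * ?g a1 (a2 + 1)"
        using pos cf beta_avg_split[of a1 a2 ?f] by (simp add: G)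
      have alg1: "x * s / K * (y / s * u + z / s * v) = y * x / K * u + z * x / K * v" if "s \<noteq> 0" for x s y u z v
        using that by (cases "K = 0") (auto simp: field_simps)
      show ?thesis
        unfolding loc_coeff_def Let_def a[symmetric] location.case 1 3 K_def[symmetric]
        using pos by (intro alg1) simp
    qed
    show ?thesis
      unfolding YQS a_coeff.simps Let_def a[symmetric] \<kappa>_def[symmetric]
      using k_p k_q g_q g_p by (simp add: add_ac)
  qed
qed

lemma sum_Collect_less:
  fixes W :: "nat \<Rightarrow> real"
  shows "(\<Sum>c\<in>{c. c < 2 \<and> P c}. W c) = (if P 0 then W 0 else 0) + (if P 1 then W 1 else 0)"
    and "(\<Sum>c\<in>{c. c < 3 \<and> P c}. W c) = (if P 0 then W 0 else 0) + (if P 1 then W 1 else 0) + (if P 2 then W 2 else 0)"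
proof -
  have "(\<Sum>c\<in>{c. c < s \<and> P c}. W c) = (\<Sum>c<s. if P c then W c else 0)" for s
    using sum.inter_filter[of "{..<s}" W P] by simp
  then show "(\<Sum>c\<in>{c. c < 2 \<and> P c}. W c) = (if P 0 then W 0 else 0) + (if P 1 then W 1 else 0)"
    "(\<Sum>c\<in>{c. c < 3 \<and> P c}. W c) = (if P 0 then W 0 else 0) + (if P 1 then W 1 else 0) + (if P 2 then W 2 else 0)"
    by (simp_all add: eval_nat_numeral)
qed

lemma toll_bound:
  assumes x: "x \<in> key_locs alg" and i: "i \<in> states sch"
    and e: "\<And>u. u \<in> words (num_parts alg) m \<Longrightarrow> length (e u) \<le> 1"
  shows "\<bar>(\<Sum>u\<in>words (num_parts alg) m. polya (num_parts alg) (\<lambda>l. t (Suc l)) u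
      * real (miss_count sch i (key_word x u @ e u))) - real m * loc_coeff sch t x\<bar> \<le> sqrt (real m) + 11"
proof -
  let ?f = "miss_rate sch" and ?t = "\<lambda>l. t (Suc l)"
  let ?h = "\<lambda>u. real (miss_count sch i (key_word x u @ e u))"
  show ?thesis
  proof (cases alg)
    case CQS
    define W where "W y c = (if c = (0::nat) then y else 1 - y)" for y :: real and c
    have lw: "letter_weights (W y) 2" if "0 \<le> y" "y \<le> 1" for y
      using that by unfold_locales (auto simp: W_def numeral_2_eq_2)
    have e2: "\<And>u. u \<in> words 2 m \<Longrightarrow> length (e u) \<le> 1" using e CQS by simp
    note T = polya2_toll[of W _ m ?h _ ?t, OF W_def]
    show ?thesis
    proof (cases "x = CQS_Key_k")
      case True
      have "\<bar>iid_sum (W y) 2 m ?h - real m * (y * ?f y)\<bar> \<le> sqrt (real m) + 11" if y: "0 \<le> y" "y \<le> 1" for y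
      proof -
        have "\<bar>iid_sum (W y) 2 m ?h - real m * (?f y * 1 * y)\<bar> \<le> sqrt (real m) + 11"
          by (rule iid_toll[OF lw[OF y], where p = y], unfold sum_Collect_less)
            (use y i e2 True in \<open>auto simp: W_def algebra_simps\<close>)
        then show ?thesis by (simp add: mult_ac)
      qed
      then have "\<bar>(\<Sum>u\<in>words 2 m. polya 2 ?t u * ?h u) - real m * beta_avg (?t 0 + 1) (?t 1 + 1) (\<lambda>y. y * ?f y)\<bar> \<le> sqrt (real m) + 11"
        by (intro T) (auto intro!: continuous_intros)
      then show ?thesis using True CQS by (simp add: loc_coeff_def Let_def numeral_2_eq_2)
    next
      case False
      then have xg: "x = CQS_Key_g" using x CQS by simp
      have "\<bar>iid_sum (W y) 2 m ?h - real m * ((1 - y) * ?f y)\<bar> \<le> sqrt (real m) + 11" if y: "0 \<le> y" "y \<le> 1" for y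
      proof -
        have "\<bar>iid_sum (W y) 2 m ?h - real m * (?f (1 - y) * 1 * (1 - y))\<bar> \<le> sqrt (real m) + 11"
          by (rule iid_toll[OF lw[OF y], where p = "1 - y"], unfold sum_Collect_less)
            (use y i e2 xg in \<open>auto simp: W_def algebra_simps\<close>)
        then show ?thesis by (simp add: miss_rate_sym mult_ac)
      qed
      then have "\<bar>(\<Sum>u\<in>words 2 m. polya 2 ?t u * ?h u) - real m * beta_avg (?t 0 + 1) (?t 1 + 1) (\<lambda>y. (1 - y) * ?f y)\<bar> \<le> sqrt (real m) + 11"
        by (intro T) (auto intro!: continuous_intros)
      then show ?thesis using xg CQS by (simp add: loc_coeff_def Let_def numeral_2_eq_2)
    qed
  next
    case YQS
    have e3: "\<And>u. u \<in> words 3 m \<Longrightarrow> length (e u) \<le> 1" using e YQS by simp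
    define W where "W y z c = (if c = (0::nat) then y else if c = 1 then (1 - y) * z else (1 - y) * (1 - z))" for y z :: real and c
    \<comment> \<open>For the scans from the right the share of large elements is split off first,
      and z is the share of small ones among the others.\<close>
    define W' where "W' y z c = (if c = (2::nat) then y else if c = 0 then (1 - y) * z else (1 - y) * (1 - z))" for y z :: real and c
    have lw: "letter_weights (W y z) 3" "letter_weights (W' y z) 3" if "0 \<le> y" "y \<le> 1" "0 \<le> z" "z \<le> 1" for y z
    proof -
      have 3: "{..<3} = {0, 1, 2 :: nat}" by auto
      have "0 \<le> (1 - y) * z" "0 \<le> (1 - y) * (1 - z)" using that by simp_all
      then show "letter_weights (W y z) 3" "letter_weights (W' y z) 3"
        unfolding letter_weights_def 3 using that by (auto simp: W_def W'_def algebra_simps)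
    qed
    have T: "\<bar>(\<Sum>u\<in>words 3 m. polya 3 ?t u * ?h u) - real m *
     (beta_avg (?t 0 + 1) (?t 1 + 1 + (?t 2 + 1)) A1 * beta_avg (?t 1 + 1) (?t 2 + 1) B1
    + beta_avg (?t 0 + 1) (?t 1 + 1 + (?t 2 + 1)) A2 * beta_avg (?t 1 + 1) (?t 2 + 1) B2)\<bar> \<le> C"
      if "unit_cont A1" "unit_cont A2" "unit_cont B1" "unit_cont B2"
        "\<And>x y. 0 \<le> x \<Longrightarrow> x \<le> 1 \<Longrightarrow> 0 \<le> y \<Longrightarrow> y \<le> 1 \<Longrightarrow>
          \<bar>iid_sum (W x y) 3 m ?h - real m * (A1 x * B1 y + A2 x * B2 y)\<bar> \<le> C" for A1 A2 B1 B2 C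
      by (rule polya3_toll[where W = W, OF _ _ W_def that]) auto
    have T': "\<bar>(\<Sum>u\<in>words 3 m. polya 3 ?t u * ?h u) - real m *
     (beta_avg (?t 2 + 1) (?t 0 + 1 + (?t 1 + 1)) A1 * beta_avg (?t 0 + 1) (?t 1 + 1) B1
    + beta_avg (?t 2 + 1) (?t 0 + 1 + (?t 1 + 1)) A2 * beta_avg (?t 0 + 1) (?t 1 + 1) B2)\<bar> \<le> C"
      if "unit_cont A1" "unit_cont A2" "unit_cont B1" "unit_cont B2"
        "\<And>x y. 0 \<le> x \<Longrightarrow> x \<le> 1 \<Longrightarrow> 0 \<le> y \<Longrightarrow> y \<le> 1 \<Longrightarrow>
          \<bar>iid_sum (W' x y) 3 m ?h - real m * (A1 x * B1 y + A2 x * B2 y)\<bar> \<le> C" for A1 A2 B1 B2 C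
      by (rule polya3_toll[where W = W', OF _ _ W'_def that]) auto
    have n3: "Suc (Suc (Suc 0)) = 3" "Suc (Suc 0) = 2" "Suc 2 = 3" by auto
    consider "x = YQS_Key_k_p" | "x = YQS_Key_k_q" | "x = YQS_Key_g_q" | "x = YQS_Key_g_p"
      using x YQS by auto
    then show ?thesis
    proof cases
      case 1
      have "\<bar>iid_sum (W y z) 3 m ?h - real m * (y * ?f y * 1 + (1 - y) * ?f y * (z * 1))\<bar> \<le> sqrt (real m) + 11"
        if y: "0 \<le> y" "y \<le> 1" "0 \<le> z" "z \<le> 1" for y z
      proof -
        have "\<bar>iid_sum (W y z) 3 m ?h - real m * (?f y * 1 * (y + (1 - y) * z))\<bar> \<le> sqrt (real m) + 11"
          by (rule iid_toll[OF lw(1)[OF y], where p = y], unfold sum_Collect_less)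
            (use y i e3 1 in \<open>auto simp: W_def algebra_simps\<close>)
        then show ?thesis by (simp add: algebra_simps)
      qed
      from T[OF _ _ _ _ this] show ?thesis using YQS
        by (simp add: 1 loc_coeff_def Let_def n3 continuous_intros)
    next
      case 2
      have "\<bar>iid_sum (W y z) 3 m ?h - real m * (y * ((1 - y) * 1) * ?f z + (1 - y) * ((1 - y) * 1) * (z * ?f z))\<bar> \<le> sqrt (real m) + 11"
        if y: "0 \<le> y" "y \<le> 1" "0 \<le> z" "z \<le> 1" for y z
      proof -
        \<comment> \<open>A small element is not tested here, so q = 1 - y; given that it is tested,
          an element is large with probability 1 - z. The inspected share is that of small and
          medium elements, y + (1 - y) z.\<close>
        have "\<bar>iid_sum (W y z) 3 m ?h - real m * (?f (1 - z) * (1 - y) * (y + (1 - y) * z))\<bar> \<le> sqrt (real m) + 11"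
          by (rule iid_toll[OF lw(1)[OF y], where p = "1 - z"], unfold sum_Collect_less)
            (use y i e3 2 in \<open>auto simp: W_def algebra_simps\<close>)
        then show ?thesis by (simp add: miss_rate_sym algebra_simps)
      qed
      from T[OF _ _ _ _ this] show ?thesis using YQS
        by (simp add: 2 loc_coeff_def Let_def n3 continuous_intros)
    next
      case 3
      have "\<bar>iid_sum (W' y z) 3 m ?h - real m * (y * ?f y * 1 + 0 * 0)\<bar> \<le> sqrt (real m) + 11"
        if y: "0 \<le> y" "y \<le> 1" "0 \<le> z" "z \<le> 1" for y z
      proof -
        have "\<bar>iid_sum (W' y z) 3 m ?h - real m * (?f y * 1 * y)\<bar> \<le> sqrt (real m) + 11"
          by (rule iid_toll[OF lw(2)[OF y], where p = y], unfold sum_Collect_less)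
            (use y i e3 3 in \<open>auto simp: W'_def algebra_simps\<close>)
        then show ?thesis by (simp add: algebra_simps)
      qed
      from T'[OF _ _ _ _ this] show ?thesis using YQS
        by (simp add: 3 loc_coeff_def Let_def n3 continuous_intros)
    next
      case 4
      have "\<bar>iid_sum (W' y z) 3 m ?h - real m * (y * ((1 - y) * 1) * ?f z + 0 * 0)\<bar> \<le> sqrt (real m) + 11"
        if y: "0 \<le> y" "y \<le> 1" "0 \<le> z" "z \<le> 1" for y z
      proof -
        have "\<bar>iid_sum (W' y z) 3 m ?h - real m * (?f (1 - z) * (1 - y) * y)\<bar> \<le> sqrt (real m) + 11"
          by (rule iid_toll[OF lw(2)[OF y], where p = "1 - z"], unfold sum_Collect_less)
            (use y i e3 4 in \<open>auto simp: W'_def algebra_simps\<close>)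
        then show ?thesis by (simp add: miss_rate_sym algebra_simps)
      qed
      from T'[OF _ _ _ _ this] show ?thesis using YQS
        by (simp add: 4 loc_coeff_def Let_def n3 continuous_intros)
    qed
  qed
qed

section \<open>Asymptotics for a fixed sampling parameter\<close>

lemma urn_entropy_eq: "urn_entropy (num_parts alg) (\<lambda>l. t (Suc l)) = \<H> alg t"
proof -
  have "polya_total (num_parts alg) (\<lambda>l. t (Suc l)) = sample_size alg t + 1"
    by (cases alg) (auto simp: polya_total_def sample_size_def eval_nat_numeral)
  then show ?thesis
    unfolding urn_entropy_def \<H>_def Let_def by (cases alg) (simp_all add: eval_nat_numeral)
qed

lemma entropy_pos: "\<H> alg t > 0"
proof -
  have lt: "t l + 1 < sample_size alg t + 1" if "l \<in> {1..num_parts alg}" for l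
    using that by (cases alg) (auto simp: sample_size_def eval_nat_numeral le_Suc_eq)
  have mono: "harm m < (harm n :: real)" if "m < n" for m n
  proof -
    have "harm m < (harm (Suc m) :: real)" by (simp add: harm_Suc)
    also have "\<dots> \<le> harm n" using that by (intro harm_mono) simp
    finally show ?thesis .
  qed
  show ?thesis
    unfolding \<H>_def Let_def
  proof (intro sum_pos mult_pos_pos)
    show "{1..num_parts alg} \<noteq> {}" by (cases alg) auto
    show "0 < harm (sample_size alg t + 1) - (harm (t l + 1) :: real)" if "l \<in> {1..num_parts alg}" for l
      using mono[OF lt[OF that]] by simp
  qed auto
qed

text \<open>
  Supersolution \<open>(c a + \<epsilon>) / H * (n + 1) H(n + 1) + L n + K (n + 1)\<close>: the recursion reproduces the
  first summand up to \<open>(c a + \<epsilon>) (n + 1)\<close>, the second one up to \<open>L (s - 1)\<close>, and the third one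
  exactly.
\<close>

lemma sum_cost_depth_bound:
  assumes x: "x \<in> key_locs alg" and w: "sample_size alg t \<le> w" and \<epsilon>: "\<epsilon> > 0" and c: "c \<in> {1, -1}"
  shows "\<exists>D\<ge>0. \<forall>A d i. finite A \<longrightarrow> 0 \<notin> A \<longrightarrow> card A < d \<longrightarrow> i \<in> states sch \<longrightarrow>
    (\<Sum>xs\<in>permutations_of_set A. cost_depth alg t w x sch c d xs i) \<le> card (permutations_of_set A) *
      ((c * loc_coeff sch t x + \<epsilon>) / \<H> alg t * (real (card A + 1) * harm (card A + 1)) + D * real (card A + 1))"
proof -
  define s where "s = num_parts alg"
  define t' where "t' = (\<lambda>l. t (Suc l))"
  define k where "k = sample_size alg t"
  define a where "a = loc_coeff sch t x"
  define H where "H = \<H> alg t"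
  have H: "H > 0" unfolding H_def by (rule entropy_pos)
  have s2: "s \<ge> 2" by (cases alg) (auto simp: s_def)
  have tot: "polya_total s t' = k + 1"
    by (cases alg) (auto simp: polya_total_def sample_size_def eval_nat_numeral s_def t'_def k_def)
  \<comment> \<open>The three summands pay for the constant in the toll, for the maximum of sqrt m -
    \<epsilon> m, and for the difference k + 1 between n + 1 and the number m of ordinary
    elements.\<close>
  define L where "L = 11 + 1 / (4 * \<epsilon>) + \<bar>a\<bar> * real (k + 1)"
  \<comment> \<open>For c = -1 the leading term may be negative; K lifts \<open>F\<close> above 0 on
    the sizes up to w.\<close>
  define K where "K = \<bar>a\<bar> / H * harm (w + 1)"
  have L0: "L \<ge> 0" using \<epsilon> by (auto simp: L_def)
  have K0: "K \<ge> 0" unfolding K_def using H by (intro mult_nonneg_nonneg divide_nonneg_pos harm_nonneg) auto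
  define F where "F n = (c * a + \<epsilon>) / H * (real (n + 1) * harm (n + 1)) + L * real n + K * real (n + 1)" for n
  have "\<exists>q. partition_ok alg t u (fst q) (fst (snd q)) (snd (snd q))" if "set u \<subseteq> {..<s}" for u
    using partition_ok_exists[of u alg t] that unfolding s_def by fastforce
  then obtain q where q: "\<And>u. set u \<subseteq> {..<s} \<Longrightarrow> partition_ok alg t u (fst (q u)) (fst (snd (q u))) (snd (snd (q u)))"
    by metis
  have F0: "0 \<le> F n" if "n \<le> w" for n
  proof -
    have "- (\<bar>a\<bar> / H * harm (w + 1)) * real (n + 1) \<le> - (\<bar>a\<bar> / H * harm (n + 1)) * real (n + 1)"
      using that H by (intro mult_right_mono le_imp_neg_le mult_left_mono harm_mono) auto
    also have "\<dots> = (- \<bar>a\<bar>) / H * (real (n + 1) * harm (n + 1))" by simp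
    also have "\<dots> \<le> (c * a + \<epsilon>) / H * (real (n + 1) * harm (n + 1))"
      using H \<epsilon> c by (intro mult_right_mono divide_right_mono mult_nonneg_nonneg harm_nonneg) auto
    finally have "0 \<le> (c * a + \<epsilon>) / H * (real (n + 1) * harm (n + 1)) + K * real (n + 1)"
      unfolding K_def by (simp only: mult_minus_left minus_le_iff)
    moreover have "0 \<le> L * real n" using L0 by simp
    ultimately show ?thesis unfolding F_def by linarith
  qed
  have step: "(\<Sum>u\<in>words s m. polya s t' u * (c * real (miss_count sch i (key_word x u @ snd (snd (q u)) x))
         + (\<Sum>l<s. F (class_counts t' u l)))) \<le> F (k + m)" if i: "i \<in> states sch" for m i
  proof -
    let ?P = "\<lambda>f. \<Sum>u\<in>words s m. polya s t' u * f u"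
    let ?M = "\<lambda>u. real (miss_count sch i (key_word x u @ snd (snd (q u)) x))"
    let ?n = "k + m"
    have e: "length (snd (snd (q u)) x) \<le> 1" if "u \<in> words (num_parts alg) m" for u
      using q[of u] that x unfolding partition_ok_def s_def words_def by auto
    have toll: "\<bar>?P ?M - real m * a\<bar> \<le> sqrt (real m) + 11"
      using toll_bound[OF x i, where m = m and t = t and e = "\<lambda>u. snd (snd (q u)) x", OF e] unfolding s_def t'_def a_def .
    have "?P (\<lambda>u. \<Sum>l<s. F (class_counts t' u l)) = (c * a + \<epsilon>) / H *
        ?P (\<lambda>u. \<Sum>l<s. real (t' l + 1 + count_list u l) * harm (t' l + 1 + count_list u l))
        + ?P (\<lambda>_. L * (real (?n + 1) - real s) + K * real (?n + 1))"
    proof -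
      have "(\<Sum>l<s. F (class_counts t' u l)) = (c * a + \<epsilon>) / H * (\<Sum>l<s. real (t' l + 1 + count_list u l) * harm (t' l + 1 + count_list u l))
          + (L * (real (?n + 1) - real s) + K * real (?n + 1))" if u: "u \<in> words s m" for u
      proof -
        have "(\<Sum>l<s. real (class_counts t' u l + 1)) = real (?n + 1)"
          using sum_urn[OF u, of t'] tot by (simp add: class_counts_def add_ac)
        moreover from this have "(\<Sum>l<s. real (class_counts t' u l)) = real (?n + 1) - real s"
          by (simp add: sum.distrib)
        ultimately show ?thesis
          unfolding F_def sum.distrib sum_distrib_left[symmetric] by (simp add: class_counts_def add_ac)
      qed
      then show ?thesis
        by (simp add: distrib_left sum.distrib sum_distrib_left mult_ac cong: sum.cong)
    qed
    also have "?P (\<lambda>_. L * (real (?n + 1) - real s) + K * real (?n + 1)) = L * (real (?n + 1) - real s) + K * real (?n + 1)"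
      using sum_polya[of s t' m] s2 by (simp add: sum_distrib_right[symmetric])
    also have "?P (\<lambda>u. \<Sum>l<s. real (t' l + 1 + count_list u l) * harm (t' l + 1 + count_list u l))
        = real (?n + 1) * (harm (?n + 1) - H)"
      using sum_polya_harm[of s t' m] s2 tot urn_entropy_eq[of alg t] by (simp add: s_def t'_def H_def add_ac)
    finally have rec: "?P (\<lambda>u. \<Sum>l<s. F (class_counts t' u l)) = (c * a + \<epsilon>) / H * (real (?n + 1) * (harm (?n + 1) - H))
        + (L * (real (?n + 1) - real s) + K * real (?n + 1))" .
    also have "(c * a + \<epsilon>) / H * (real (?n + 1) * (harm (?n + 1) - H))
        = (c * a + \<epsilon>) / H * (real (?n + 1) * harm (?n + 1)) - (c * a + \<epsilon>) * real (?n + 1)"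
      using H by (simp add: field_simps)
    finally have rec: "?P (\<lambda>u. \<Sum>l<s. F (class_counts t' u l)) = F ?n - (c * a + \<epsilon>) * real (?n + 1) - L * (real s - 1)"
      by (simp add: F_def algebra_simps)
    have "c * ?P ?M \<le> c * (real m * a) + (sqrt (real m) + 11)"
      using toll c by (auto simp: abs_le_iff)
    also have "\<dots> \<le> (c * a + \<epsilon>) * real (?n + 1) + L"
    proof -
      \<comment> \<open>Completing the square shows that sqrt m is at most \<epsilon> m + 1 / (4
        \<epsilon>).\<close>
      have "0 \<le> (sqrt (real m) * \<epsilon> - 1 / 2)\<^sup>2" by simp
      also have "\<dots> = \<epsilon> * (real m * \<epsilon> - sqrt (real m) + 1 / (4 * \<epsilon>))"
        using \<epsilon> by (simp add: power2_eq_square field_simps)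
      finally have "0 \<le> real m * \<epsilon> - sqrt (real m) + 1 / (4 * \<epsilon>)"
        using \<epsilon> by (simp add: zero_le_mult_iff)
      moreover have "\<epsilon> * real m \<le> \<epsilon> * real (?n + 1)" using \<epsilon> by simp
      moreover have "c * (real m * a) = c * a * real (?n + 1) - c * a * real (k + 1)" by (simp add: algebra_simps)
      moreover have "- (c * a) * real (k + 1) \<le> \<bar>a\<bar> * real (k + 1)" using c by (intro mult_right_mono) auto
      ultimately show ?thesis by (simp add: L_def algebra_simps)
    qed
    \<comment> \<open>The s - 1 pivots leave the recursion, so the linear term drops by L (s - 1).
      This covers the bounded part of the toll.\<close>
    also have "L \<le> L * (real s - 1)" using L0 s2 by (simp add: mult_le_cancel_left1)
    finally have "c * ?P ?M + ?P (\<lambda>u. \<Sum>l<s. F (class_counts t' u l)) \<le> F ?n" using rec by simp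
    then show ?thesis by (simp add: distrib_left sum.distrib sum_distrib_left mult_ac)
  qed
  have main: "(\<Sum>xs\<in>permutations_of_set A. cost_depth alg t w x sch c d xs i) \<le> card (permutations_of_set A) * F (card A)"
    if "finite A" "0 \<notin> A" "card A < d" "i \<in> states sch" for A d i
    by (rule sum_cost_depth_le[OF w x _ F0 _ that, where idx = "\<lambda>u. fst (q u)" and T = "\<lambda>u. fst (snd (q u))" and e = "\<lambda>u. snd (snd (q u))"])
      (use q step in \<open>auto simp: s_def t'_def k_def\<close>)
  have FD: "F n \<le> (c * a + \<epsilon>) / H * (real (n + 1) * harm (n + 1)) + (L + K) * real (n + 1)" for n
    using L0 by (simp add: F_def algebra_simps)
  show ?thesis
  proof (intro exI[of _ "L + K"] conjI allI impI)
    show "0 \<le> L + K" using L0 K0 by simp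
    fix A d i assume "finite A" "(0::nat) \<notin> A" "card A < d" "i \<in> states sch"
    from main[OF this]
    have "(\<Sum>xs\<in>permutations_of_set A. cost_depth alg t w x sch c d xs i) \<le> card (permutations_of_set A) * F (card A)" .
    also have "\<dots> \<le> card (permutations_of_set A) *
        ((c * a + \<epsilon>) / H * (real (card A + 1) * harm (card A + 1)) + (L + K) * real (card A + 1))"
      by (rule mult_left_mono[OF FD]) simp
    finally show "(\<Sum>xs\<in>permutations_of_set A. cost_depth alg t w x sch c d xs i) \<le> card (permutations_of_set A) *
      ((c * loc_coeff sch t x + \<epsilon>) / \<H> alg t * (real (card A + 1) * harm (card A + 1)) + (L + K) * real (card A + 1))"
      unfolding a_def H_def .
  qed
qed

definition loc_expectation where
  "loc_expectation alg t w x sch i n =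
    (\<Sum>xs\<in>permutations_of_set {1..n}. cost_depth alg t w x sch 1 (Suc n) xs i) / fact n"

lemma cost_depth_uminus:
  assumes "sample_size alg t \<le> w"
  shows "cost_depth alg t w x sch (-1) d xs i = - cost_depth alg t w x sch 1 d xs i"
proof -
  have "cost x sch (-1) i = (\<lambda>tr. - cost x sch 1 i tr)" by (rule ext) (simp add: cost_def[OF assms])
  then show ?thesis by (simp add: cost_depth_def[OF assms])
qed

lemma loc_expectation_smallo:
  assumes x: "x \<in> key_locs alg" and w: "sample_size alg t \<le> w" and i: "i \<in> states sch"
  shows "(\<lambda>n. loc_expectation alg t w x sch i n - loc_coeff sch t x / \<H> alg t * (real (n + 1) * harm (n + 1)))
    \<in> o(\<lambda>n. real (n + 1) * harm (n + 1))"
proof (rule landau_o.smallI)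
  fix r :: real assume r: "r > 0"
  let ?g = "\<lambda>n. real (n + 1) * harm (n + 1)"
  let ?E = "loc_expectation alg t w x sch i" and ?H = "\<H> alg t" and ?a = "loc_coeff sch t x"
  have H: "?H > 0" by (rule entropy_pos)
  \<comment> \<open>Half of the allowed error r goes to the perturbed leading coefficient; the other
    half dominates the linear terms once the harmonic number is large.\<close>
  define \<epsilon> where "\<epsilon> = r * ?H / 2"
  have \<epsilon>: "\<epsilon> > 0" "\<epsilon> / ?H = r / 2" using r H by (auto simp: \<epsilon>_def)
  obtain D1 where D1: "D1 \<ge> 0" "\<And>A d. finite A \<Longrightarrow> 0 \<notin> A \<Longrightarrow> card A < d \<Longrightarrow>
    (\<Sum>xs\<in>permutations_of_set A. cost_depth alg t w x sch 1 d xs i) \<le> card (permutations_of_set A) *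
      ((1 * ?a + \<epsilon>) / ?H * ?g (card A) + D1 * real (card A + 1))"
    using sum_cost_depth_bound[OF x w \<epsilon>(1), of 1 sch] i by auto
  obtain D2 where D2: "D2 \<ge> 0" "\<And>A d. finite A \<Longrightarrow> 0 \<notin> A \<Longrightarrow> card A < d \<Longrightarrow>
    (\<Sum>xs\<in>permutations_of_set A. cost_depth alg t w x sch (-1) d xs i) \<le> card (permutations_of_set A) *
      ((-1 * ?a + \<epsilon>) / ?H * ?g (card A) + D2 * real (card A + 1))"
    using sum_cost_depth_bound[OF x w \<epsilon>(1), of "-1" sch] i by auto
  have up: "?E n \<le> (?a + \<epsilon>) / ?H * ?g n + D1 * real (n + 1)" for n
    using D1(2)[of "{1..n}" "Suc n"] by (simp add: loc_expectation_def divide_le_eq mult_ac)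
  have lo: "- ?E n \<le> (- ?a + \<epsilon>) / ?H * ?g n + D2 * real (n + 1)" for n
    using D2(2)[of "{1..n}" "Suc n"]
    by (simp add: loc_expectation_def minus_divide_left divide_le_eq mult_ac cost_depth_uminus[OF w] sum_negf del: minus_divide_left[symmetric])
  have "filterlim (\<lambda>n. harm (n + 1) :: real) at_top sequentially"
    using harm_at_top filterlim_sequentially_Suc[of "harm :: nat \<Rightarrow> real" at_top] by simp
  then have "\<forall>\<^sub>F n in at_top. harm (n + 1) \<ge> 2 * (D1 + D2) / r"
    by (simp add: filterlim_at_top)
  then show "\<forall>\<^sub>F n in at_top. norm (?E n - ?a / ?H * ?g n) \<le> r * norm (?g n)"
  proof (rule eventually_mono)
    fix n :: nat assume "harm (n + 1) \<ge> 2 * (D1 + D2) / r"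
    then have "D1 + D2 \<le> r / 2 * harm (n + 1)" using r by (simp add: field_simps)
    then have "(D1 + D2) * real (n + 1) \<le> r / 2 * harm (n + 1) * real (n + 1)" by (rule mult_right_mono) simp
    also have "r / 2 * harm (n + 1) * real (n + 1) = r / 2 * ?g n" by (simp only: mult_ac)
    finally have "(D1 + D2) * real (n + 1) \<le> r / 2 * ?g n" .
    moreover have "D1 * real (n + 1) \<le> (D1 + D2) * real (n + 1)" "D2 * real (n + 1) \<le> (D1 + D2) * real (n + 1)"
      using D1(1) D2(1) by (intro mult_right_mono; simp)+
    ultimately have D: "D1 * real (n + 1) \<le> r / 2 * ?g n" "D2 * real (n + 1) \<le> r / 2 * ?g n"
      by (blast intro: order_trans)+
    have e: "(?a + \<epsilon>) / ?H * ?g n = ?a / ?H * ?g n + r / 2 * ?g n"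
      "(- ?a + \<epsilon>) / ?H * ?g n = - (?a / ?H * ?g n) + r / 2 * ?g n"
      unfolding add_divide_distrib \<epsilon>(2) by (simp_all add: algebra_simps)
    have "y - z \<le> b + b \<and> - (y - z) \<le> b + b"
      if "y \<le> z + b + d1" "- y \<le> - z + b + d2" "d1 \<le> b" "d2 \<le> b" for y z b d1 d2 :: real
      using that by linarith
    from this[OF up[of n, unfolded e] lo[of n, unfolded e] D]
    have "?E n - ?a / ?H * ?g n \<le> r / 2 * ?g n + r / 2 * ?g n" "- (?E n - ?a / ?H * ?g n) \<le> r / 2 * ?g n + r / 2 * ?g n"
      by auto
    moreover have "r / 2 * ?g n + r / 2 * ?g n = r * ?g n" by simp
    ultimately have "\<bar>?E n - ?a / ?H * ?g n\<bar> \<le> r * ?g n" by (simp only: abs_le_iff)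
    moreover have "norm (?g n) = ?g n" by (simp add: harm_nonneg)
    ultimately show "norm (?E n - ?a / ?H * ?g n) \<le> r * norm (?g n)" by simp
  qed
qed

section \<open>Misses at the locations other than the key comparisons\<close>

lemma side_falses_eq: "side_falses K tr = (\<Sum>x\<in>- K. count_list (outcomes x tr) False)"
proof (induction tr)
  case (Cons e tr)
  obtain y b where e: "e = (y, b)" by fastforce
  have fin: "finite (- K)" using finite_UNIV_location by (rule finite_subset[rotated]) simp
  have "(\<Sum>x\<in>- K. count_list (outcomes x (e # tr)) False) =
      (\<Sum>x\<in>- K. (if x = y \<and> \<not> b then 1 else 0) + count_list (outcomes x tr) False)"
    by (intro sum.cong) (auto simp: e)
  also have "\<dots> = (if y \<notin> K \<and> \<not> b then 1 else 0) + side_falses K tr"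
    using fin by (cases b) (simp_all add: sum.distrib Cons)
  finally show ?case by (simp add: e)
qed simp

lemma misses_key_locs:
  assumes \<sigma>: "range \<sigma> \<subseteq> states sch"
  shows "\<bar>real (misses sch \<sigma> tr) - (\<Sum>x\<in>K. real (miss_count sch (\<sigma> x) (outcomes x tr)))\<bar>
    \<le> 3 * real (side_falses K tr) + 2 * real (card (UNIV :: location set))"
proof -
  let ?m = "\<lambda>x. miss_count sch (\<sigma> x) (outcomes x tr)"
  have "misses sch \<sigma> tr = sum ?m K + sum ?m (- K)"
    unfolding misses_eq_sum_locations
    using sum.subset_diff[of K UNIV ?m] finite_UNIV_location by (simp add: Compl_eq_Diff_UNIV add.commute)
  moreover have "sum ?m (- K) \<le> (\<Sum>x\<in>- K. 3 * count_list (outcomes x tr) False + 2)"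
    using \<sigma> by (intro sum_mono miss_count_le_Falses) auto
  moreover have "\<dots> \<le> 3 * side_falses K tr + 2 * card (UNIV :: location set)"
    using card_mono[OF finite_UNIV_location, of "- K"]
    by (simp only: side_falses_eq sum.distrib sum_distrib_left[symmetric] sum_constant) simp
  ultimately have "misses sch \<sigma> tr = sum ?m K + sum ?m (- K)"
    "sum ?m (- K) \<le> 3 * side_falses K tr + 2 * card (UNIV :: location set)" by auto
  then have "real (misses sch \<sigma> tr) = (\<Sum>x\<in>K. real (?m x)) + real (sum ?m (- K))"
    "real (sum ?m (- K)) \<le> real (3 * side_falses K tr + 2 * card (UNIV :: location set))"
    by (simp only: of_nat_add of_nat_sum[of ?m K], simp only: of_nat_le_iff)
  then show ?thesis by (simp del: of_nat_sum)
qed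

lemma nths_append_perm:
  assumes "distinct xs"
  shows "nths xs S @ nths xs (- S) \<in> permutations_of_set (set xs)"
proof (rule permutations_of_setI)
  show "set (nths xs S @ nths xs (- S)) = set xs"
    by (force simp: set_nths in_set_conv_nth)
  show "distinct (nths xs S @ nths xs (- S))"
    using assms by (auto simp: distinct_nthsI set_nths nth_eq_iff_index_eq)
qed

lemma side_falses_quicksort_parts:
  assumes "tr \<in> set_pmf (quicksort_parts d alg t w yss)"
    and "\<And>ys tr. ys \<in> set yss \<Longrightarrow> tr \<in> set_pmf (quicksort_depth d alg t w ys) \<Longrightarrow> side_falses K tr \<le> f (length ys)"
  shows "side_falses K tr \<le> (\<Sum>ys\<leftarrow>yss. f (length ys))"
  using assms
proof (induction yss arbitrary: tr)
  case (Cons ys yss)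
  then obtain tr1 tr2 where tr: "tr = tr1 @ tr2" "tr1 \<in> set_pmf (quicksort_depth d alg t w ys)"
    "tr2 \<in> set_pmf (quicksort_parts d alg t w yss)" by (auto simp: quicksort_parts_simps)
  have "side_falses K tr1 \<le> f (length ys)" using Cons.prems(2)[of ys tr1] tr by simp
  moreover have "side_falses K tr2 \<le> (\<Sum>ys\<leftarrow>yss. f (length ys))"
    using Cons.IH[OF tr(3)] Cons.prems(2) by simp
  ultimately show ?case using tr by simp
qed (simp add: quicksort_parts_simps)

text \<open>
  At the locations other than the key comparisons, at most a bounded number of tests per call
  fails; \<open>s * n + 1\<close> bounds the number of calls.
\<close>

lemma side_falses_quicksort:
  assumes w: "sample_size alg t \<le> w"
  shows "tr \<in> set_pmf (quicksort_depth d alg t w xs) \<Longrightarrow> distinct xs \<Longrightarrow> 0 \<notin> set xs \<Longrightarrow> length xs < d \<Longrightarrow>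
    side_falses (key_locs alg) tr \<le> (w + 4) * (num_parts alg * length xs + 1)"
proof (induction d arbitrary: xs tr)
  case (Suc d)
  let ?K = "key_locs alg"
  define s where "s = num_parts alg"
  define t' where "t' = (\<lambda>l. t (Suc l))"
  define n where "n = length xs"
  have s23: "s = 2 \<or> s = 3" by (cases alg) (auto simp: s_def)
  show ?case
  proof (cases "n \<le> w")
    case True
    then have "tr = (Size_Test, True) # fst (insertionsort Leaf_Sort xs)"
      using Suc.prems(1) unfolding quicksort_depth_Suc n_def by simp
    then have "side_falses ?K tr \<le> n + 1"
      using insertionsort_trace(2)[of ?K Leaf_Sort xs] by (simp add: n_def)
    also have "\<dots> \<le> (w + 4) * 1" using True by simp
    also have "\<dots> \<le> (w + 4) * (num_parts alg * length xs + 1)" by (intro mult_le_mono2) simp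
    finally show ?thesis .
  next
    case False
    define A where "A = set xs"
    have A: "finite A" "0 \<notin> A" "card A = n"
      using Suc.prems by (auto simp: A_def n_def distinct_card)
    have "\<exists>q. partition_ok alg t u (fst q) (fst (snd q)) (snd (snd q))" if "set u \<subseteq> {..<s}" for u
      using partition_ok_exists[of u alg t] that unfolding s_def by fastforce
    then obtain q where q: "\<And>u. set u \<subseteq> {..<s} \<Longrightarrow> partition_ok alg t u (fst (q u)) (fst (snd (q u))) (snd (snd (q u)))"
      by metis
    define idx where "idx u = fst (q u)" for u
    interpret class_word_index s t' idx
    proof
      show "s > 0" using s23 by auto
      show "distinct (idx u l)" "set (idx u l) = positions_of u l" if "u \<in> words s m" "l < s" for u m l
        using q[of u] that by (auto simp: partition_ok_def words_def s_def idx_def)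
    qed
    have k: "k = sample_size alg t"
      unfolding k_def by (simp add: sample_size_eq_offset t'_def s_def)
    define m where "m = n - k"
    have n: "card A = k + m" using False w k A by (simp add: m_def)
    obtain S rec where S: "S \<subseteq> {..<n}" "card S = k"
      and rec: "rec \<in> set_pmf (quicksort_parts d alg t w (snd (divide alg t (nths xs S) (nths xs (- S)))))"
      and tr: "tr = (Size_Test, False) # fst (divide alg t (nths xs S) (nths xs (- S))) @ rec"
      using Suc.prems(1) False samples_props[OF w False]
      unfolding quicksort_depth_Suc n_def[symmetric] by (auto simp: k set_pmf_of_set)
    define xs' where "xs' = nths xs S @ nths xs (- S)"
    have xs': "xs' \<in> permutations_of_set A"
      unfolding xs'_def A_def using Suc.prems(2) by (rule nths_append_perm)
    have "{i. i < length xs \<and> i \<in> S} = S" using S by (auto simp: n_def)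
    then have "length (nths xs S) = k" using S by (simp add: length_nths)
    then have td: "take k xs' = nths xs S" "drop k xs' = nths xs (- S)" by (simp_all add: xs'_def)
    note V = perm_facts[OF A(1) n xs']
    have wd: "word xs' \<in> words s m" by (rule word_in_words[OF A(1) n xs'])
    then have ok': "partition_ok alg t (word xs') (idx (word xs')) (fst (snd (q (word xs')))) (snd (snd (q (word xs'))))"
      unfolding idx_def by (intro q) (auto simp: words_def)
    have "0 \<notin> set (take k xs')" using V(9) A by auto
    then have div: "divide alg t (nths xs S) (nths xs (- S)) =
        (fst (insertionsort Sample_Sort (take k xs')) @ fst (snd (q (word xs'))), map (part_list xs') [0..<s])"
      using ok' V unfolding partition_ok_def Let_def s_def[symmetric] t'_def[symmetric] td[symmetric]
      by (simp add: k word_def piv_def part_list_def[abs_def])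
    let ?J = "class_counts t' (word xs')"
    have part: "part_list xs' l \<in> permutations_of_set (block A ?J l)" if "l < s" for l
      by (rule part_list_perm[OF A(1) n xs' that])
    have len: "length (part_list xs' l) = ?J l" if "l < s" for l
      using card_block_counts[OF A(1) n wd that] permutations_of_setD[OF part[OF that]] by (metis distinct_card)
    have sumJ: "(\<Sum>l<s. ?J l + 1) = n + 1"
      using offset_total[OF A(1) n wd] by (simp add: offset_def A)
    have small: "?J l < d" if "l < s" for l
    proof -
      have "(\<Sum>j\<in>{..<s} - {l}. ?J j + 1) \<ge> (\<Sum>j\<in>{..<s} - {l}. 1)" by (intro sum_mono) auto
      moreover have "(\<Sum>l<s. ?J l + 1) = ?J l + 1 + (\<Sum>j\<in>{..<s} - {l}. ?J j + 1)"
        using that by (subst sum.remove[of _ l]) auto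
      moreover have "n \<le> d" using Suc.prems(4) by (simp add: n_def)
      ultimately show ?thesis using sumJ that s23 by auto
    qed
    have "side_falses ?K rec \<le> (\<Sum>ys\<leftarrow>map (part_list xs') [0..<s]. (w + 4) * (s * length ys + 1))"
    proof (rule side_falses_quicksort_parts)
      show "rec \<in> set_pmf (quicksort_parts d alg t w (map (part_list xs') [0..<s]))" using rec div by simp
      fix ys tr1 assume "ys \<in> set (map (part_list xs') [0..<s])" and tr1: "tr1 \<in> set_pmf (quicksort_depth d alg t w ys)"
      then obtain l where l: "l < s" "ys = part_list xs' l" by auto
      have "set ys \<subseteq> A" "distinct ys"
        using permutations_of_setD[OF part[OF l(1)]] by (auto simp: l block_def)
      then show "side_falses ?K tr1 \<le> (w + 4) * (s * length ys + 1)"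
        using Suc.IH[OF tr1] A small[OF l(1)] len[OF l(1)] by (auto simp: l s_def)
    qed
    also have "\<dots> = (\<Sum>l<s. (w + 4) * (s * ?J l + 1))"
      using len by (simp add: o_def sum.distinct_set_conv_list[symmetric] atLeast0LessThan cong: map_cong)
    also have "\<dots> = (w + 4) * (\<Sum>l<s. s * ?J l + 1)" by (simp only: sum_distrib_left)
    finally have rec_le: "side_falses ?K rec \<le> (w + 4) * (\<Sum>l<s. s * ?J l + 1)" .
    \<comment> \<open>The left sum equals s n - s (s - 2). As s is at least 2, one unit remains for
      the present call.\<close>
    have sum2: "(\<Sum>l<s. s * ?J l + 1) + 1 \<le> s * n + 1"
    proof -
      have "(\<Sum>l<s. s * ?J l + 1) + s * s = s * (\<Sum>l<s. ?J l + 1) + s"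
        unfolding sum.distrib sum_distrib_left[symmetric] by (simp add: algebra_simps)
      then show ?thesis unfolding sumJ using s23 by auto
    qed
    have "side_falses ?K (fst (insertionsort Sample_Sort (take k xs'))) \<le> k + 1"
      using insertionsort_trace(2)[of ?K Sample_Sort "take k xs'"] V(5) by simp
    moreover have "side_falses ?K (fst (snd (q (word xs')))) \<le> 2"
      using ok' by (simp add: partition_ok_def)
    \<comment> \<open>Failures of the call itself: one size test, at most k + 1 while sorting the
      sample with k at most w, and at most two while partitioning. This is the origin of w +
      4.\<close>
    ultimately have "side_falses ?K tr \<le> (w + 4) + (w + 4) * (\<Sum>l<s. s * ?J l + 1)"
      using rec_le w k unfolding tr div by simp
    also have "\<dots> = (w + 4) * ((\<Sum>l<s. s * ?J l + 1) + 1)" by simp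
    also have "\<dots> \<le> (w + 4) * (s * n + 1)" using sum2 by (rule mult_le_mono2)
    finally show ?thesis by (simp add: s_def n_def)
  qed
qed simp

lemma expectation_diff_le:
  fixes f g :: "'a \<Rightarrow> real"
  assumes fin: "finite (set_pmf p)" and bound: "\<And>x. x \<in> set_pmf p \<Longrightarrow> \<bar>f x - g x\<bar> \<le> B"
  shows "\<bar>measure_pmf.expectation p f - measure_pmf.expectation p g\<bar> \<le> B"
proof -
  have "\<bar>measure_pmf.expectation p f - measure_pmf.expectation p g\<bar> = \<bar>\<Sum>x\<in>set_pmf p. pmf p x * (f x - g x)\<bar>"
    using fin by (simp add: expectation_eq_sum right_diff_distrib sum_subtractf)
  also have "\<dots> \<le> (\<Sum>x\<in>set_pmf p. pmf p x * B)"
    using bound by (intro order_trans[OF sum_abs] sum_mono) (auto simp: abs_mult intro!: mult_left_mono)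
  also have "\<dots> = B"
    using sum_pmf_eq_1[OF fin order_refl] by (simp add: sum_distrib_right[symmetric])
  finally show ?thesis .
qed

lemma expected_BM_key_locs:
  assumes w: "sample_size alg t \<le> w" and \<sigma>: "range \<sigma> \<subseteq> states sch"
  shows "\<exists>C. \<forall>n. \<bar>expected_BM alg sch t w \<sigma> n - (\<Sum>x\<in>key_locs alg. loc_expectation alg t w x sch (\<sigma> x) n)\<bar> \<le> C * real (n + 1)"
proof (intro exI allI)
  fix n :: nat
  let ?K = "key_locs alg" and ?P = "permutations_of_set {1..n}"
  let ?c = "real (card (UNIV :: location set))"
  define B where "B = 3 * real ((w + 4) * (num_parts alg * n + 1)) + 2 * ?c"
  have finq: "finite (set_pmf (quicksort_depth d alg t w xs))" for d xs by (rule finite_quicksort_depth[OF w])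
  have finK: "finite ?K" by (cases alg) auto
  have q: "quicksort alg t w xs = quicksort_depth (Suc n) alg t w xs" if "xs \<in> ?P" for xs
    using that by (simp add: quicksort_def permutations_of_setD distinct_card[symmetric])
  have "expected_BM alg sch t w \<sigma> n = (\<Sum>xs\<in>?P. measure_pmf.expectation (quicksort alg t w xs) (\<lambda>tr. real (misses sch \<sigma> tr))) / fact n"
    unfolding expected_BM_def
    by (subst expectation_bind_finite)
      (simp_all add: set_pmf_of_set quicksort_def finq integral_pmf_of_set del: quicksort_depth.simps)
  then have 1: "expected_BM alg sch t w \<sigma> n = (\<Sum>xs\<in>?P. measure_pmf.expectation (quicksort_depth (Suc n) alg t w xs) (\<lambda>tr. real (misses sch \<sigma> tr))) / fact n"
    using q by simp
  have 2: "(\<Sum>x\<in>?K. loc_expectation alg t w x sch (\<sigma> x) n) =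
      (\<Sum>xs\<in>?P. \<Sum>x\<in>?K. cost_depth alg t w x sch 1 (Suc n) xs (\<sigma> x)) / fact n"
    unfolding loc_expectation_def by (subst sum.swap) (simp add: sum_divide_distrib)
  have 3: "\<bar>measure_pmf.expectation (quicksort_depth (Suc n) alg t w xs) (\<lambda>tr. real (misses sch \<sigma> tr))
      - (\<Sum>x\<in>?K. cost_depth alg t w x sch 1 (Suc n) xs (\<sigma> x))\<bar> \<le> B" if xs: "xs \<in> ?P" for xs
  proof -
    have "(\<Sum>x\<in>?K. cost_depth alg t w x sch 1 (Suc n) xs (\<sigma> x)) = measure_pmf.expectation (quicksort_depth (Suc n) alg t w xs)
        (\<lambda>tr. \<Sum>x\<in>?K. real (miss_count sch (\<sigma> x) (outcomes x tr)))"
      unfolding cost_depth_def[OF w] cost_def[OF w, abs_def]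
      by (subst Bochner_Integration.integral_sum)
        (simp_all add: integrable_measure_pmf_finite finq del: quicksort_depth.simps)
    moreover have "\<bar>real (misses sch \<sigma> tr) - (\<Sum>x\<in>?K. real (miss_count sch (\<sigma> x) (outcomes x tr)))\<bar> \<le> B"
      if "tr \<in> set_pmf (quicksort_depth (Suc n) alg t w xs)" for tr
    proof -
      have "length xs = n" "distinct xs" "0 \<notin> set xs"
        using permutations_of_setD[OF xs] distinct_card[of xs] by auto
      then have "side_falses ?K tr \<le> (w + 4) * (num_parts alg * n + 1)"
        using side_falses_quicksort[OF w that] by simp
      then have "real (side_falses ?K tr) \<le> real ((w + 4) * (num_parts alg * n + 1))"
        by (simp only: of_nat_le_iff)
      then show ?thesis using misses_key_locs[OF \<sigma>, of tr ?K] unfolding B_def by linarith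
    qed
    ultimately show ?thesis by (simp only:) (rule expectation_diff_le[OF finq])
  qed
  have "\<bar>expected_BM alg sch t w \<sigma> n - (\<Sum>x\<in>?K. loc_expectation alg t w x sch (\<sigma> x) n)\<bar> \<le> (\<Sum>xs\<in>?P. B) / fact n"
    unfolding 1 2 diff_divide_distrib[symmetric] sum_subtractf[symmetric] abs_divide
    using 3 by (intro divide_mono order_trans[OF sum_abs] sum_mono) auto
  also have "\<dots> = B" by simp
  also have "B \<le> (3 * real ((w + 4) * (num_parts alg + 1)) + 2 * ?c) * real (n + 1)"
  proof -
    have "num_parts alg * n + 1 \<le> (num_parts alg + 1) * (n + 1)" by simp
    then have "(w + 4) * (num_parts alg * n + 1) \<le> (w + 4) * ((num_parts alg + 1) * (n + 1))" by (rule mult_le_mono2)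
    then have "real ((w + 4) * (num_parts alg * n + 1)) \<le> real ((w + 4) * (num_parts alg + 1)) * real (n + 1)"
      by (metis mult.assoc of_nat_le_iff of_nat_mult)
    moreover have "?c \<le> ?c * real (n + 1)" by (simp add: mult_le_cancel_left1)
    ultimately have "B \<le> 3 * (real ((w + 4) * (num_parts alg + 1)) * real (n + 1)) + 2 * (?c * real (n + 1))"
      unfolding B_def by (intro add_mono mult_left_mono) simp_all
    then show ?thesis by (simp only: distrib_right[of "3 * _"] mult.assoc)
  qed
  finally show "\<bar>expected_BM alg sch t w \<sigma> n - (\<Sum>x\<in>?K. loc_expectation alg t w x sch (\<sigma> x) n)\<bar>
    \<le> (3 * real ((w + 4) * (num_parts alg + 1)) + 2 * ?c) * real (n + 1)" .
qed

section \<open>Passage from harmonic numbers to the asymptotic equivalence\<close>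

lemma harm_asymp_equiv: "(\<lambda>n. real (n + 1) * harm (n + 1)) \<sim>[at_top] (\<lambda>n. real n * ln (real n))"
proof (rule asymp_equivI')
  have ln_inf: "filterlim (\<lambda>n. ln (real n)) at_top sequentially"
    by (rule filterlim_compose[OF ln_at_top filterlim_real_sequentially])
  have "(\<lambda>n. harm n - ln (real n) + inverse (real (Suc n))) \<longlonglongrightarrow> euler_mascheroni + 0"
    by (intro tendsto_add euler_mascheroni_LIMSEQ LIMSEQ_inverse_real_of_nat)
  then have "(\<lambda>n. (harm n - ln (real n) + inverse (real (Suc n))) / ln (real n)) \<longlonglongrightarrow> 0"
    by (rule real_tendsto_divide_at_top[OF _ ln_inf])
  then have "(\<lambda>n. (real (Suc n) / real n) * ((harm n - ln (real n) + inverse (real (Suc n))) / ln (real n) + 1)) \<longlonglongrightarrow> 1 * (0 + 1)"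
    by (intro tendsto_mult tendsto_add LIMSEQ_Suc_n_over_n tendsto_const)
  then have lim: "(\<lambda>n. (real (Suc n) / real n) * ((harm n - ln (real n) + inverse (real (Suc n))) / ln (real n) + 1)) \<longlonglongrightarrow> 1"
    by simp
  have "\<forall>\<^sub>F n in sequentially. ln (real n) > 0"
    using ln_inf by (simp add: filterlim_at_top_dense)
  then have "\<forall>\<^sub>F n in sequentially. (real (Suc n) / real n) * ((harm n - ln (real n) + inverse (real (Suc n))) / ln (real n) + 1)
      = real (n + 1) * harm (n + 1) / (real n * ln (real n))"
  proof (rule eventually_mono)
    fix n :: nat assume "ln (real n) > 0"
    then have "(harm n - ln (real n) + inverse (real (Suc n))) / ln (real n) + 1 = harm (n + 1) / ln (real n)"
      by (simp add: harm_Suc add_divide_distrib diff_divide_distrib)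
    then show "(real (Suc n) / real n) * ((harm n - ln (real n) + inverse (real (Suc n))) / ln (real n) + 1)
      = real (n + 1) * harm (n + 1) / (real n * ln (real n))" by simp
  qed
  from Lim_transform_eventually[OF lim this]
  show "(\<lambda>n. real (n + 1) * harm (n + 1) / (real n * ln (real n))) \<longlonglongrightarrow> 1" .
qed

lemma linear_smallo_harm: "(\<lambda>n. C * real (n + 1)) \<in> o(\<lambda>n. real (n + 1) * harm (n + 1))"
proof (rule landau_o.smallI)
  fix r :: real assume r: "r > 0"
  have "filterlim (\<lambda>n. harm (n + 1) :: real) at_top sequentially"
    using harm_at_top filterlim_sequentially_Suc[of "harm :: nat \<Rightarrow> real" at_top] by simp
  then have "\<forall>\<^sub>F n in at_top. harm (n + 1) \<ge> \<bar>C\<bar> / r" by (simp add: filterlim_at_top)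
  then show "\<forall>\<^sub>F n in at_top. norm (C * real (n + 1)) \<le> r * norm (real (n + 1) * harm (n + 1))"
  proof (rule eventually_mono)
    fix n :: nat assume "harm (n + 1) \<ge> \<bar>C\<bar> / r"
    then have "\<bar>C\<bar> \<le> r * harm (n + 1)" using r by (simp add: field_simps)
    then have "\<bar>C\<bar> * real (n + 1) \<le> r * harm (n + 1) * real (n + 1)" by (rule mult_right_mono) simp
    then show "norm (C * real (n + 1)) \<le> r * norm (real (n + 1) * harm (n + 1))"
      by (simp only: real_norm_def abs_mult abs_harm abs_of_nat mult_ac)
  qed
qed

text \<open>All three rates are comparable to v = p (1 - p), which varies between 0 and 1/4. The
  lower estimate yields positive coefficients, the upper one the smallness of \<open>a_coeff\<close>
  near a unit vector.\<close>

lemma miss_rate_between: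
  assumes "0 \<le> p" "p \<le> 1"
  shows "p * (1 - p) \<le> miss_rate sch p" "miss_rate sch p \<le> 2 * (p * (1 - p))"
proof -
  define v where "v = p * (1 - p)"
  have v: "0 \<le> v" "1 - 2 * v \<ge> 1 / 2" "1 - v \<ge> 3 / 4"
    using assms SC_denom[of p] FC_denom[of p] by (auto simp: v_def mult.assoc)
  have "v \<le> miss_rate sch p \<and> miss_rate sch p \<le> 2 * v"
  proof (cases sch)
    case One_Bit
    then show ?thesis using v by (simp add: v_def mult.assoc)
  next
    case Two_Bit_SC
    have r: "miss_rate Two_Bit_SC p = v / (1 - 2 * v)" by (simp add: v_def mult.assoc)
    have "v * (1 - 2 * v) \<le> v * 1" "v * 1 \<le> v * (2 * (1 - 2 * v))" using v by (intro mult_left_mono; simp)+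
    then show ?thesis unfolding Two_Bit_SC r using v by (simp add: le_divide_eq divide_le_eq algebra_simps)
  next
    case Two_Bit_FC
    have r: "miss_rate Two_Bit_FC p = v * (2 * v + 1) / (1 - v)"
      by (simp add: v_def power2_eq_square algebra_simps)
    have "v * (1 - v) \<le> v * (2 * v + 1)" "v * (2 * v + 1) \<le> v * (2 * (1 - v))"
      using v by (intro mult_left_mono; simp)+
    then show ?thesis unfolding Two_Bit_FC r using v by (simp add: le_divide_eq divide_le_eq algebra_simps)
  qed
  then show "p * (1 - p) \<le> miss_rate sch p" "miss_rate sch p \<le> 2 * (p * (1 - p))" by (simp_all add: v_def)
qed

lemma g_coeff_bounds:
  assumes "a > 0" "b > 0"
  shows "real a * real b / (real (a + b) * real (a + b + 1)) \<le> g_coeff sch a b"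
    and "g_coeff sch a b \<le> 2 * (real a * real b / (real (a + b) * real (a + b + 1)))"
    and "g_coeff sch a b \<le> 1"
proof -
  have v: "beta_avg a b (\<lambda>x. x * ((1 - x) * 1)) = real a * real b / (real (a + b) * real (a + b + 1))"
    using assms by (subst beta_avg_times_x, simp, simp, subst beta_avg_times_1mx, simp, simp) (simp add: add_ac)
  have "beta_avg a b (\<lambda>x. x * ((1 - x) * 1)) \<le> beta_avg a b (miss_rate sch)"
    using miss_rate_between assms by (intro beta_avg_mono continuous_intros) auto
  then show "real a * real b / (real (a + b) * real (a + b + 1)) \<le> g_coeff sch a b"
    using v g_coeff_eq[OF assms] by simp
  have "beta_avg a b (miss_rate sch) \<le> beta_avg a b (\<lambda>x. 2 * (x * ((1 - x) * 1)))"
    using miss_rate_between assms by (intro beta_avg_mono continuous_intros) auto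
  then show "g_coeff sch a b \<le> 2 * (real a * real b / (real (a + b) * real (a + b + 1)))"
    using v g_coeff_eq[OF assms] by (simp only: beta_avg_cmult)
  have "beta_avg a b (miss_rate sch) \<le> beta_avg a b (\<lambda>_. 1)"
    using miss_rate_bounds assms by (intro beta_avg_mono continuous_intros) auto
  then show "g_coeff sch a b \<le> 1" using assms by (simp add: g_coeff_eq)
qed

lemma g_coeff_pos: "a > 0 \<Longrightarrow> b > 0 \<Longrightarrow> g_coeff sch a b > 0"
  by (rule less_le_trans[OF _ g_coeff_bounds(1)]) simp_all

text \<open>Positivity is what turns an error of smaller order than n ln n into an asymptotic
  equivalence.\<close>

lemma a_coeff_pos: "a_coeff alg sch t > 0"
proof (cases alg)
  case YQS
  define a1 a2 a3 where a: "a1 = t 1 + 1" "a2 = t 2 + 1" "a3 = t 3 + 1"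
  have "a1 > 0" "a2 > 0" "a3 > 0" by (auto simp: a)
  then show ?thesis unfolding YQS a_coeff.simps Let_def a[symmetric]
    by (intro add_pos_pos mult_pos_pos divide_pos_pos g_coeff_pos) auto
qed (simp add: g_coeff_pos del: g_coeff.simps)

theorem expected_BM_asymp:
  assumes w: "sample_size alg t \<le> w" and \<sigma>: "range \<sigma> \<subseteq> states sch"
  shows "(\<lambda>n. expected_BM alg sch t w \<sigma> n) \<sim>[at_top] (\<lambda>n. a_coeff alg sch t / \<H> alg t * (real n * ln (real n)))"
proof -
  let ?g = "\<lambda>n. real (n + 1) * harm (n + 1)" and ?K = "key_locs alg"
  let ?E = "expected_BM alg sch t w \<sigma>" and ?L = "\<lambda>x. loc_expectation alg t w x sch (\<sigma> x)"
  define A where "A = a_coeff alg sch t / \<H> alg t"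
  have A: "A > 0" using a_coeff_pos entropy_pos by (simp add: A_def)
  obtain C where C: "\<And>n. \<bar>?E n - (\<Sum>x\<in>?K. ?L x n)\<bar> \<le> C * real (n + 1)"
    using expected_BM_key_locs[OF w \<sigma>] by blast
  have "(\<lambda>n. ?E n - (\<Sum>x\<in>?K. ?L x n)) \<in> O(\<lambda>n. C * real (n + 1))"
    using C by (intro bigoI[of _ 1]) (auto intro!: always_eventually intro: order_trans[OF _ abs_ge_self])
  then have 1: "(\<lambda>n. ?E n - (\<Sum>x\<in>?K. ?L x n)) \<in> o(?g)"
    by (rule landau_o.big_small_trans[OF _ linear_smallo_harm])
  have 2: "(\<lambda>n. \<Sum>x\<in>?K. ?L x n - loc_coeff sch t x / \<H> alg t * ?g n) \<in> o(?g)"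
    using \<sigma> by (intro big_sum_in_smallo loc_expectation_smallo w) auto
  have "(\<lambda>n. ?E n - A * ?g n) = (\<lambda>n. (?E n - (\<Sum>x\<in>?K. ?L x n)) + (\<Sum>x\<in>?K. ?L x n - loc_coeff sch t x / \<H> alg t * ?g n))"
  proof
    fix n
    have "(\<Sum>x\<in>?K. loc_coeff sch t x / \<H> alg t * ?g n) = A * ?g n"
      unfolding sum_distrib_right[symmetric] sum_divide_distrib[symmetric] sum_loc_coeff A_def ..
    then show "?E n - A * ?g n = (?E n - (\<Sum>x\<in>?K. ?L x n)) + (\<Sum>x\<in>?K. ?L x n - loc_coeff sch t x / \<H> alg t * ?g n)"
      by (simp only: sum_subtractf)
  qed
  then have "(\<lambda>n. ?E n - A * ?g n) \<in> o(?g)" using sum_in_smallo(1)[OF 1 2] by simp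
  then have "(\<lambda>n. ?E n - A * ?g n) \<in> o(\<lambda>n. A * ?g n)"
    using A by (subst landau_o.small.cmult) auto
  then have "?E \<sim>[at_top] (\<lambda>n. A * ?g n)" by (simp add: asymp_equiv_altdef)
  also have "\<dots> \<sim>[at_top] (\<lambda>n. A * (real n * ln (real n)))"
    by (intro asymp_equiv_mult asymp_equiv_refl harm_asymp_equiv)
  finally show ?thesis unfolding A_def .
qed

section \<open>Limits for large samples\<close>

text \<open>The rates depend on p only through v = p (1 - p), which is 1-Lipschitz on [0,1]. As
  rational functions of v they have difference quotients of absolute value at most 4.\<close>

lemma miss_rate_lipschitz:
  assumes "0 \<le> p" "p \<le> 1" "0 \<le> r" "r \<le> 1"
  shows "\<bar>miss_rate sch p - miss_rate sch r\<bar> \<le> 4 * \<bar>p - r\<bar>"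
proof -
  define v u where "v = p * (1 - p)" and "u = r * (1 - r)"
  have v: "0 \<le> v" "1 - 2 * v \<ge> 1 / 2" "1 - v \<ge> 3 / 4"
    using assms SC_denom[of p] FC_denom[of p] by (auto simp: v_def mult.assoc)
  have u: "0 \<le> u" "1 - 2 * u \<ge> 1 / 2" "1 - u \<ge> 3 / 4"
    using assms SC_denom[of r] FC_denom[of r] by (auto simp: u_def mult.assoc)
  have "v - u = (p - r) * (1 - p - r)" by (simp add: v_def u_def algebra_simps)
  then have "\<bar>v - u\<bar> = \<bar>p - r\<bar> * \<bar>1 - p - r\<bar>" by (simp only: abs_mult)
  also have "\<dots> \<le> \<bar>p - r\<bar> * 1" using assms by (intro mult_left_mono) auto
  finally have vu: "\<bar>v - u\<bar> \<le> \<bar>p - r\<bar>" by simp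
  have quot: "\<bar>(v - u) * y / d\<bar> \<le> 4 * \<bar>v - u\<bar>" if "\<bar>y\<bar> \<le> 4 * d" "d > 0" for y d :: real
  proof -
    have "\<bar>v - u\<bar> * \<bar>y\<bar> \<le> \<bar>v - u\<bar> * (4 * d)" using that by (intro mult_left_mono) auto
    then show ?thesis using that by (simp add: abs_mult abs_divide divide_le_eq mult_ac)
  qed
  have "\<bar>miss_rate sch p - miss_rate sch r\<bar> \<le> 4 * \<bar>v - u\<bar>"
  proof (cases sch)
    case One_Bit
    have "miss_rate One_Bit p - miss_rate One_Bit r = (v - u) * 2 / 1" by (simp add: v_def u_def algebra_simps)
    then show ?thesis unfolding One_Bit using quot[of 2 1] by simp
  next
    case Two_Bit_SC
    have d: "(1 - 2 * v) * (1 - 2 * u) \<ge> 1 / 2 * (1 / 2)" using v u by (intro mult_mono) auto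
    have "miss_rate Two_Bit_SC p - miss_rate Two_Bit_SC r = v / (1 - 2 * v) - u / (1 - 2 * u)"
      by (simp add: v_def u_def mult.assoc)
    also have "\<dots> = (v - u) * 1 / ((1 - 2 * v) * (1 - 2 * u))"
    proof -
      have "1 - 2 * v \<noteq> 0" "1 - 2 * u \<noteq> 0" using v u by auto
      then show ?thesis by (simp add: diff_frac_eq) (simp add: algebra_simps)
    qed
    finally show ?thesis unfolding Two_Bit_SC using quot[of 1 "(1 - 2 * v) * (1 - 2 * u)"] d by simp
  next
    case Two_Bit_FC
    have d: "(1 - v) * (1 - u) \<ge> 3 / 4 * (3 / 4)" using v u by (intro mult_mono) auto
    have "2 * (v + u) - 2 * (v * u) + 1 = 3 - 2 * ((1 - v) * (1 - u))" by (simp add: algebra_simps)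
    then have y: "\<bar>2 * (v + u) - 2 * (v * u) + 1\<bar> \<le> 4 * ((1 - v) * (1 - u))"
      using d by (simp add: abs_le_iff)
    have "miss_rate Two_Bit_FC p - miss_rate Two_Bit_FC r = (2 * (v * v) + v) / (1 - v) - (2 * (u * u) + u) / (1 - u)"
      by (simp add: v_def u_def power2_eq_square mult_ac)
    also have "\<dots> = (v - u) * (2 * (v + u) - 2 * (v * u) + 1) / ((1 - v) * (1 - u))"
    proof -
      have "1 - v \<noteq> 0" "1 - u \<noteq> 0" using v u by auto
      then show ?thesis by (simp add: diff_frac_eq) (simp add: algebra_simps)
    qed
    finally show ?thesis unfolding Two_Bit_FC using quot[OF y] d by simp
  qed
  also have "\<dots> \<le> 4 * \<bar>p - r\<bar>" using vu by simp
  finally show ?thesis .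
qed

text \<open>Concentration of the Beta law: its variance is at most 1 / (a + b), so the mean
  deviation from \<mu> is at most the square root of this; 4 is the Lipschitz constant of f.\<close>

lemma g_coeff_approx:
  assumes "a > 0" "b > 0"
  shows "\<bar>g_coeff sch a b - miss_rate sch (real a / real (a + b))\<bar> \<le> 4 / sqrt (real (a + b))"
proof -
  define \<mu> where "\<mu> = real a / real (a + b)"
  define r where "r = sqrt (real (a + b))"
  have r: "r > 0" "r * r = real (a + b)" using assms by (auto simp: r_def)
  have \<mu>: "0 \<le> \<mu>" "\<mu> \<le> 1" using assms by (auto simp: \<mu>_def)
  have E1: "beta_avg a b (\<lambda>x. x * 1) = \<mu>"
    using assms by (simp only: beta_avg_times_x) (simp add: \<mu>_def)
  have E2: "beta_avg a b (\<lambda>x. x * (x * 1)) = \<mu> * (real (a + 1) / real (a + b + 1))"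
    using assms by (subst beta_avg_times_x, simp, simp, subst beta_avg_times_x, simp, simp) (simp add: \<mu>_def add_ac)
  have "beta_avg a b (\<lambda>x. (x - \<mu>)\<^sup>2) = beta_avg a b (\<lambda>x. (x * (x * 1) + (- 2 * \<mu>) * (x * 1)) + \<mu>\<^sup>2)"
    by (rule beta_avg_cong) (simp add: power2_eq_square algebra_simps)
  also have "\<dots> = beta_avg a b (\<lambda>x. x * (x * 1) + (- 2 * \<mu>) * (x * 1)) + beta_avg a b (\<lambda>_. \<mu>\<^sup>2)"
    by (intro beta_avg_add continuous_intros)
  also have "beta_avg a b (\<lambda>x. x * (x * 1) + (- 2 * \<mu>) * (x * 1)) = beta_avg a b (\<lambda>x. x * (x * 1)) + beta_avg a b (\<lambda>x. (- 2 * \<mu>) * (x * 1))"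
    by (intro beta_avg_add continuous_intros)
  also have "\<dots> + beta_avg a b (\<lambda>_. \<mu>\<^sup>2) = \<mu> * (real (a + 1) / real (a + b + 1) - \<mu>)"
    unfolding beta_avg_cmult E1 E2 using assms by (simp add: power2_eq_square algebra_simps)
  also have "\<dots> \<le> 1 * (1 / real (a + b))"
  proof -
    have "real (a + 1) / real (a + b + 1) - \<mu> = real b / (real (a + b) * real (a + b + 1))"
      using assms by (simp add: \<mu>_def diff_frac_eq algebra_simps)
    also have "\<dots> \<le> 1 / real (a + b)"
      using assms by (simp add: divide_simps)
    finally have "real (a + 1) / real (a + b + 1) - \<mu> \<le> 1 / real (a + b)" .
    moreover have "0 \<le> real b / (real (a + b) * real (a + b + 1))" by simp
    ultimately show ?thesis
      using \<mu> \<open>real (a + 1) / real (a + b + 1) - \<mu> = _\<close> by (intro mult_mono) auto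
  qed
  finally have var: "beta_avg a b (\<lambda>x. (x - \<mu>)\<^sup>2) \<le> 1 / (r * r)" using r by simp
  have amgm: "\<bar>y\<bar> \<le> r / 2 * y\<^sup>2 + 1 / (2 * r)" for y
  proof -
    have "0 \<le> (r * \<bar>y\<bar> - 1)\<^sup>2" by simp
    then have "2 * r * \<bar>y\<bar> \<le> r * r * y\<^sup>2 + 1" by (simp add: power2_eq_square algebra_simps)
    then have "\<bar>y\<bar> \<le> (r * r * y\<^sup>2 + 1) / (2 * r)" using r by (simp add: le_divide_eq mult_ac)
    also have "\<dots> = r / 2 * y\<^sup>2 + 1 / (2 * r)" using r(1) by (simp add: add_divide_distrib)
    finally show ?thesis .
  qed
  have "\<bar>beta_avg a b (miss_rate sch) - beta_avg a b (\<lambda>_. miss_rate sch \<mu>)\<bar> \<le> beta_avg a b (\<lambda>x. 2 * r * (x - \<mu>)\<^sup>2 + 2 / r)"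
  proof (rule beta_avg_abs_diff_le)
    fix x :: real assume "0 \<le> x" "x \<le> 1"
    then have "\<bar>miss_rate sch x - miss_rate sch \<mu>\<bar> \<le> 4 * \<bar>x - \<mu>\<bar>" using \<mu> by (intro miss_rate_lipschitz)
    also have "\<dots> \<le> 4 * (r / 2 * (x - \<mu>)\<^sup>2 + 1 / (2 * r))" using amgm[of "x - \<mu>"] by simp
    finally show "\<bar>miss_rate sch x - miss_rate sch \<mu>\<bar> \<le> 2 * r * (x - \<mu>)\<^sup>2 + 2 / r" by simp
  qed (use assms in \<open>auto intro!: continuous_intros\<close>)
  also have "\<dots> = 2 * r * beta_avg a b (\<lambda>x. (x - \<mu>)\<^sup>2) + 2 / r"
    using assms by (subst beta_avg_add) (auto intro!: continuous_intros simp: beta_avg_cmult)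
  also have "\<dots> \<le> 2 * r * (1 / (r * r)) + 2 / r" using var r by (intro add_right_mono mult_left_mono) auto
  also have "\<dots> = 4 / r" using r(1) by (simp add: field_simps)
  finally show ?thesis using assms by (simp add: g_coeff_eq \<mu>_def r_def)
qed

text \<open>If both shares vanish in the limit, the mean a / (a + b) need not converge. In that case
  the prefactor tends to 0, and boundedness of g suffices.\<close>

lemma g_coeff_tendsto:
  fixes a b :: "nat \<Rightarrow> nat" and \<kappa> :: "nat \<Rightarrow> real"
  assumes pos: "\<And>j. a j > 0" "\<And>j. b j > 0"
    and \<kappa>: "filterlim \<kappa> at_top sequentially"
    and lim: "(\<lambda>j. real (a j) / \<kappa> j) \<longlonglongrightarrow> A" "(\<lambda>j. real (b j) / \<kappa> j) \<longlonglongrightarrow> B"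
    and C: "C \<longlonglongrightarrow> c" and nz: "c \<noteq> 0 \<Longrightarrow> A + B > 0"
  shows "(\<lambda>j. C j * g_coeff sch (a j) (b j)) \<longlonglongrightarrow> c * miss_rate sch (A / (A + B))"
proof (cases "c = 0")
  case True
  have "\<bar>C j * g_coeff sch (a j) (b j)\<bar> \<le> \<bar>C j\<bar>" for j
  proof -
    have "g_coeff sch (a j) (b j) \<le> 1" "0 < g_coeff sch (a j) (b j)"
      by (intro g_coeff_bounds(3) g_coeff_pos pos)+
    then have "\<bar>C j\<bar> * \<bar>g_coeff sch (a j) (b j)\<bar> \<le> \<bar>C j\<bar> * 1" by (intro mult_left_mono) auto
    then show ?thesis by (simp only: abs_mult mult_1_right)
  qed
  then have "\<forall>\<^sub>F j in sequentially. norm (C j * g_coeff sch (a j) (b j)) \<le> \<bar>C j\<bar>"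
    unfolding real_norm_def by (intro always_eventually allI)
  moreover have "(\<lambda>j. \<bar>C j\<bar>) \<longlonglongrightarrow> 0" using C unfolding True by (rule tendsto_rabs_zero)
  ultimately have "(\<lambda>j. C j * g_coeff sch (a j) (b j)) \<longlonglongrightarrow> 0" by (rule Lim_null_comparison)
  then show ?thesis using True by simp
next
  case False
  then have AB: "A + B > 0" by (rule nz)
  have ev: "\<forall>\<^sub>F j in sequentially. \<kappa> j > 0" using \<kappa> by (simp add: filterlim_at_top_dense)
  have sum: "(\<lambda>j. real (a j) / \<kappa> j + real (b j) / \<kappa> j) \<longlonglongrightarrow> A + B" by (intro tendsto_add lim)
  have "(\<lambda>j. (real (a j) / \<kappa> j) / (real (a j) / \<kappa> j + real (b j) / \<kappa> j)) \<longlonglongrightarrow> A / (A + B)"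
    using AB by (intro tendsto_divide lim sum) auto
  moreover have "\<forall>\<^sub>F j in sequentially. (real (a j) / \<kappa> j) / (real (a j) / \<kappa> j + real (b j) / \<kappa> j) = real (a j) / real (a j + b j)"
    using ev by eventually_elim (simp add: add_divide_distrib[symmetric])
  ultimately have ratio: "(\<lambda>j. real (a j) / real (a j + b j)) \<longlonglongrightarrow> A / (A + B)"
    by (rule Lim_transform_eventually)
  have "filterlim (\<lambda>j. (real (a j) / \<kappa> j + real (b j) / \<kappa> j) * \<kappa> j) at_top sequentially"
    by (rule filterlim_tendsto_pos_mult_at_top[OF sum AB \<kappa>])
  moreover have "\<forall>\<^sub>F j in sequentially. (real (a j) / \<kappa> j + real (b j) / \<kappa> j) * \<kappa> j = real (a j + b j)"
    using ev by eventually_elim (simp add: distrib_right)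
  ultimately have inf: "filterlim (\<lambda>j. real (a j + b j)) at_top sequentially"
    by (simp cong: filterlim_cong)
  have "filterlim (\<lambda>j. sqrt (real (a j + b j))) at_top sequentially"
    by (rule filterlim_compose[OF sqrt_at_top inf])
  then have "(\<lambda>j. 4 / sqrt (real (a j + b j))) \<longlonglongrightarrow> 0"
    by (intro real_tendsto_divide_at_top[OF tendsto_const])
  then have "(\<lambda>j. g_coeff sch (a j) (b j) - miss_rate sch (real (a j) / real (a j + b j))) \<longlonglongrightarrow> 0"
    by (rule Lim_null_comparison[rotated]) (use g_coeff_approx[OF pos] in auto)
  moreover have "(\<lambda>j. miss_rate sch (real (a j) / real (a j + b j))) \<longlonglongrightarrow> miss_rate sch (A / (A + B))"
  proof -
    have "continuous_on UNIV (\<lambda>x. miss_rate sch x)" by (rule continuous_on_miss_rate[OF continuous_on_id])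
    from continuous_on_tendsto_compose[OF this ratio] show ?thesis by simp
  qed
  ultimately have "(\<lambda>j. g_coeff sch (a j) (b j)) \<longlonglongrightarrow> miss_rate sch (A / (A + B))"
    by (rule Lim_transform[rotated])
  then show ?thesis by (intro tendsto_mult C)
qed

lemma harm_diff_le: "0 < m \<Longrightarrow> m \<le> n \<Longrightarrow> harm n - harm m \<le> ln (real n / real m)"
  using euler_mascheroni_sequence_decreasing[of m n] by (simp add: ln_div)

lemma harm_diff_ge: "m \<le> n \<Longrightarrow> ln (real (n + 1) / real (m + 1)) \<le> harm n - harm m"
proof (induction n rule: dec_induct)
  case (step n)
  have "ln (real (Suc n + 1) / real (m + 1)) = ln (real (n + 1) / real (m + 1)) + (ln (real (n + 1) + 1) - ln (real (n + 1)))"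
    by (simp add: ln_div add_ac)
  also have "\<dots> \<le> (harm n - harm m) + 1 / real (n + 1)"
    using ln_diff_le_inverse[of "real (n + 1)"] step.IH by (intro add_mono) (auto simp: less_imp_le)
  finally show ?case by (simp add: harm_Suc inverse_eq_divide)
qed simp

text \<open>For \<tau> > 0 the Euler-Mascheroni constants of both harmonic numbers cancel. For
  \<tau> = 0 the numbers a j may stay bounded, so this expansion is replaced by the estimate x ln (1
  / x) \<le> 2 sqrt x.\<close>

lemma entropy_term_tendsto:
  fixes a K :: "nat \<Rightarrow> nat"
  assumes pos: "\<And>j. a j > 0" and le: "\<And>j. a j \<le> K j"
    and K: "filterlim (\<lambda>j. real (K j)) at_top sequentially"
    and lim: "(\<lambda>j. real (a j) / real (K j)) \<longlonglongrightarrow> \<tau>"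
  shows "(\<lambda>j. real (a j) / real (K j) * (harm (K j) - harm (a j))) \<longlonglongrightarrow> - (\<tau> * ln \<tau>)"
proof -
  have Kpos: "K j > 0" for j using pos[of j] le[of j] by simp
  have \<tau>0: "\<tau> \<ge> 0" using lim by (rule LIMSEQ_le_const) auto
  show ?thesis
  proof (cases "\<tau> = 0")
    case True
    have "\<bar>real (a j) / real (K j) * (harm (K j) - harm (a j))\<bar> \<le> 2 * sqrt (real (a j) / real (K j))" for j
    proof -
      define x where "x = real (a j) / real (K j)"
      have x: "x > 0" using pos Kpos by (simp add: x_def)
      have "harm (K j) - harm (a j) \<le> ln (real (K j) / real (a j))" by (rule harm_diff_le[OF pos le])
      also have "real (K j) / real (a j) = 1 / x" by (simp add: x_def)
      \<comment> \<open>Halving the exponent before applying ln y < y leaves a factor sqrt x after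
        multiplication by x.\<close>
      also have "ln (1 / x) = 2 * ln (1 / sqrt x)" using x by (simp add: ln_div ln_sqrt)
      also have "\<dots> \<le> 2 * (1 / sqrt x)"
        using x ln_less_self[of "1 / sqrt x"] by (intro mult_left_mono less_imp_le) auto
      finally have "x * (harm (K j) - harm (a j)) \<le> x * (2 * (1 / sqrt x))" using x by (intro mult_left_mono) auto
      also have "x * (2 * (1 / sqrt x)) = 2 * (x / sqrt x)" by simp
      also have "x / sqrt x = sqrt x" using x by (intro real_div_sqrt) simp
      finally have "x * (harm (K j) - harm (a j)) \<le> 2 * sqrt x" .
      moreover have "0 \<le> x * (harm (K j) - harm (a j))" using x harm_mono[OF le[of j], where 'a = real] by simp
      ultimately show ?thesis by (simp add: x_def)
    qed
    then have "\<forall>\<^sub>F j in sequentially. norm (real (a j) / real (K j) * (harm (K j) - harm (a j))) \<le> 2 * sqrt (real (a j) / real (K j))"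
      unfolding real_norm_def by (intro always_eventually allI)
    moreover have "(\<lambda>j. 2 * sqrt (real (a j) / real (K j))) \<longlonglongrightarrow> 0"
      using tendsto_mult[OF tendsto_const tendsto_real_sqrt[OF lim], of 2] True by simp
    ultimately have "(\<lambda>j. real (a j) / real (K j) * (harm (K j) - harm (a j))) \<longlonglongrightarrow> 0"
      by (rule Lim_null_comparison)
    then show ?thesis using True by simp
  next
    case False
    then have \<tau>: "\<tau> > 0" using \<tau>0 by simp
    have K': "filterlim K sequentially sequentially"
      using K by (simp add: filterlim_sequentially_iff_filterlim_real)
    have "filterlim (\<lambda>j. real (a j) / real (K j) * real (K j)) at_top sequentially"
      by (rule filterlim_tendsto_pos_mult_at_top[OF lim \<tau> K])
    moreover have "real (a j) / real (K j) * real (K j) = real (a j)" for j using Kpos[of j] by simp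
    ultimately have a': "filterlim a sequentially sequentially"
      by (simp add: filterlim_sequentially_iff_filterlim_real)
    have "(\<lambda>j. (harm (K j) - ln (real (K j))) - (harm (a j) - ln (real (a j))) - ln (real (a j) / real (K j)))
        \<longlonglongrightarrow> euler_mascheroni - euler_mascheroni - ln \<tau>"
      using \<tau> by (intro tendsto_diff tendsto_ln lim
        filterlim_compose[OF euler_mascheroni_LIMSEQ K'] filterlim_compose[OF euler_mascheroni_LIMSEQ a']) auto
    moreover have "(harm (K j) - ln (real (K j))) - (harm (a j) - ln (real (a j))) - ln (real (a j) / real (K j)) = harm (K j) - harm (a j)" for j
      using pos[of j] Kpos[of j] by (simp add: ln_div)
    ultimately have "(\<lambda>j. harm (K j) - harm (a j)) \<longlonglongrightarrow> - ln \<tau>" by simp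
    from tendsto_mult[OF lim this] show ?thesis by simp
  qed
qed

definition urn_frac :: "algorithm \<Rightarrow> (nat \<Rightarrow> nat) \<Rightarrow> nat \<Rightarrow> real" where
  "urn_frac alg t l = real (t l + 1) / real (sample_size alg t + 1)"

lemma sum_urn_frac: "(\<Sum>l\<in>{1..num_parts alg}. urn_frac alg t l) = 1"
proof -
  have "(\<Sum>l\<in>{1..num_parts alg}. t l + 1) = sample_size alg t + 1"
    by (cases alg) (auto simp: sample_size_def eval_nat_numeral)
  then have "(\<Sum>l\<in>{1..num_parts alg}. real (t l + 1)) = real (sample_size alg t + 1)" by (metis of_nat_sum)
  then show ?thesis unfolding urn_frac_def sum_divide_distrib[symmetric] by simp
qed

lemma urn_frac_bounds:
  assumes "l \<in> {1..num_parts alg}"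
  shows "0 < urn_frac alg t l" "urn_frac alg t l \<le> 1"
proof -
  show pos: "0 < urn_frac alg t l" for l by (simp add: urn_frac_def)
  show "urn_frac alg t l \<le> 1"
    unfolding sum_urn_frac[of alg t, symmetric] using assms pos by (intro member_le_sum) (auto intro: less_imp_le)
qed

lemma entropy_eq_urn_frac:
  "\<H> alg t = (\<Sum>l\<in>{1..num_parts alg}. urn_frac alg t l * (harm (sample_size alg t + 1) - harm (t l + 1)))"
  by (simp add: \<H>_def urn_frac_def Let_def)

text \<open>This bound is needed only if \<open>\<tau>\<close> is a unit vector, when numerator and denominator both tend to \<open>0\<close>.\<close>

lemma a_coeff_le:
  assumes l0: "l0 \<in> {1..num_parts alg}"
  shows "a_coeff alg sch t \<le> 24 * (\<Sum>l\<in>{1..num_parts alg} - {l0}. urn_frac alg t l)"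
proof -
  define a1 a2 a3 where a: "a1 = t 1 + 1" "a2 = t 2 + 1" "a3 = t 3 + 1"
  have pos: "a1 > 0" "a2 > 0" "a3 > 0" by (auto simp: a)
  show ?thesis
  proof (cases alg)
    case CQS
    define \<kappa> where "\<kappa> = real (a1 + a2)"
    have k: "real (sample_size CQS t + 1) = \<kappa>"
      by (simp add: sample_size_def \<kappa>_def a eval_nat_numeral)
    define x1 x2 where x: "x1 = real a1 / \<kappa>" "x2 = real a2 / \<kappa>"
    have fr: "urn_frac CQS t 1 = x1" "urn_frac CQS t 2 = x2" unfolding urn_frac_def k x a by simp_all
    have x01: "0 \<le> x1" "x1 \<le> 1" "0 \<le> x2" "x2 \<le> 1" using pos by (auto simp: x \<kappa>_def)
    have "g_coeff sch a1 a2 \<le> 2 * (real a1 * real a2 / (real (a1 + a2) * real (a1 + a2 + 1)))"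
      by (rule g_coeff_bounds(2)[OF pos(1,2)])
    also have "\<dots> \<le> 2 * (real a1 * real a2 / (\<kappa> * \<kappa>))"
      using pos unfolding \<kappa>_def by (intro mult_left_mono divide_left_mono mult_pos_pos) auto
    also have "\<dots> = 2 * (x1 * x2)" by (simp add: x)
    finally have "a_coeff CQS sch t \<le> 2 * (x1 * x2)" by (simp add: a del: g_coeff.simps)
    moreover have "x1 * x2 \<le> x1" "x1 * x2 \<le> x2" using x01 by (auto simp: mult_left_le mult_left_le_one_le)
    moreover have "l0 = 1 \<or> l0 = 2" using l0 CQS by auto
    moreover have "{1..2} - {1::nat} = {2}" "{1..2} - {2::nat} = {1}" by auto
    ultimately have "a_coeff CQS sch t \<le> 2 * (\<Sum>l\<in>{1..2} - {l0}. urn_frac CQS t l)"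
      using fr by (elim disjE) (simp_all del: a_coeff.simps)
    also have "\<dots> \<le> 24 * (\<Sum>l\<in>{1..2} - {l0}. urn_frac CQS t l)"
      using urn_frac_bounds(1)[of _ CQS] by (intro mult_right_mono sum_nonneg) (auto intro: less_imp_le)
    finally show ?thesis by (simp add: CQS del: a_coeff.simps)
  next
    case YQS
    define \<kappa> where "\<kappa> = real (a1 + a2 + a3)"
    have k: "real (sample_size YQS t + 1) = \<kappa>"
      by (simp add: sample_size_def \<kappa>_def a eval_nat_numeral)
    have \<kappa>: "\<kappa> > 0" using pos by (simp add: \<kappa>_def)
    define x1 x2 x3 where x: "x1 = real a1 / \<kappa>" "x2 = real a2 / \<kappa>" "x3 = real a3 / \<kappa>"
    have fr: "urn_frac YQS t 1 = x1" "urn_frac YQS t 2 = x2" "urn_frac YQS t 3 = x3" unfolding urn_frac_def k x a by simp_all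
    have x01: "0 \<le> x1" "x1 \<le> 1" "0 \<le> x2" "x2 \<le> 1" "0 \<le> x3" "x3 \<le> 1" using pos by (auto simp: x \<kappa>_def)
    let ?g = "g_coeff sch"
    \<comment> \<open>These terms carry a single share in front, so the second share has to come
      from the bound on g. In all of them the indices of g sum to \<kappa> + 1.\<close>
    have two: "real c / \<kappa> * ?g a b \<le> 2 * (y / \<kappa> * (z / \<kappa>))"
      if "a > 0" "b > 0" "real a * real b * real c \<le> y * z * (\<kappa> + 1)" "real (a + b) = \<kappa> + 1" for a b c y z
    proof -
      have "real c / \<kappa> * ?g a b \<le> real c / \<kappa> * (2 * (real a * real b / (real (a + b) * real (a + b + 1))))"
        using \<kappa> that by (intro mult_left_mono g_coeff_bounds(2)) auto
      also have "\<dots> \<le> real c / \<kappa> * (2 * (real a * real b / ((\<kappa> + 1) * \<kappa>)))"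
        using \<kappa> that(4) by (intro mult_left_mono divide_left_mono mult_pos_pos mult_mono) auto
      also have "\<dots> = 2 * (real a * real b * real c / (\<kappa> * \<kappa> * (\<kappa> + 1)))" by (simp add: mult_ac)
      also have "\<dots> \<le> 2 * (y * z * (\<kappa> + 1) / (\<kappa> * \<kappa> * (\<kappa> + 1)))"
        using \<kappa> that(3) by (intro mult_left_mono divide_right_mono) auto
      also have "\<dots> = 2 * (y / \<kappa> * (z / \<kappa>))" using \<kappa> by simp
      finally show ?thesis .
    qed
    have one: "real c * real d / (\<kappa> * (\<kappa> + 1)) * ?g a b \<le> real c / \<kappa> * (real d / \<kappa>)" if "a > 0" "b > 0" for a b c d
    proof -
      have "real c * real d / (\<kappa> * (\<kappa> + 1)) * ?g a b \<le> real c * real d / (\<kappa> * (\<kappa> + 1)) * 1"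
        using \<kappa> that by (intro mult_left_mono g_coeff_bounds(3)) auto
      also have "\<dots> \<le> real c * real d / (\<kappa> * \<kappa>)" using \<kappa> by (simp add: divide_left_mono)
      finally show ?thesis by simp
    qed
    have 1: "real a1 / \<kappa> * ?g (a1 + 1) (a2 + a3) \<le> 2 * (real a1 / \<kappa> * ((real a2 + real a3) / \<kappa>))"
    proof (rule two)
      have "real (a1 + 1) * real (a2 + a3) * real a1 \<le> (\<kappa> + 1) * real (a2 + a3) * real a1"
        by (intro mult_right_mono) (auto simp: \<kappa>_def)
      then show "real (a1 + 1) * real (a2 + a3) * real a1 \<le> real a1 * (real a2 + real a3) * (\<kappa> + 1)" by (simp add: mult_ac)
    qed (use pos in \<open>auto simp: \<kappa>_def\<close>)
    have 2: "real a2 / \<kappa> * ?g a1 (a2 + a3 + 1) \<le> 2 * (real a1 / \<kappa> * (real a2 / \<kappa>))"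
    proof (rule two)
      have "real (a2 + a3 + 1) * (real a1 * real a2) \<le> (\<kappa> + 1) * (real a1 * real a2)"
        by (intro mult_right_mono) (auto simp: \<kappa>_def)
      then show "real a1 * real (a2 + a3 + 1) * real a2 \<le> real a1 * real a2 * (\<kappa> + 1)" by (simp only: mult_ac)
    qed (use pos in \<open>auto simp: \<kappa>_def\<close>)
    have 7: "real a3 / \<kappa> * ?g (a1 + a2) (a3 + 1) \<le> 2 * ((real a1 + real a2) / \<kappa> * (real a3 / \<kappa>))"
    proof (rule two)
      have "real (a3 + 1) * (real (a1 + a2) * real a3) \<le> (\<kappa> + 1) * (real (a1 + a2) * real a3)"
        by (intro mult_right_mono) (auto simp: \<kappa>_def)
      then show "real (a1 + a2) * real (a3 + 1) * real a3 \<le> (real a1 + real a2) * real a3 * (\<kappa> + 1)"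
        by (simp only: of_nat_add[of a1 a2] mult_ac)
    qed (use pos in \<open>auto simp: \<kappa>_def\<close>)
    \<comment> \<open>The prefactor does not vanish when the medium class dominates; the share of
      the large class is gained from the second index of g.\<close>
    have 5: "real a2 * real (a2 + 1) / (\<kappa> * (\<kappa> + 1)) * ?g (a2 + 2) a3 \<le> 2 * (real a2 / \<kappa> * (real a3 / \<kappa>))"
    proof -
      have "?g (a2 + 2) a3 \<le> 2 * (real (a2 + 2) * real a3 / (real (a2 + 2 + a3) * real (a2 + 2 + a3 + 1)))"
        using pos by (intro g_coeff_bounds(2)) auto
      also have "\<dots> \<le> 2 * (real (a2 + 2) * real a3 / (real (a2 + 2) * real (a2 + 1)))"
        using pos by (intro mult_left_mono divide_left_mono mult_mono mult_pos_pos) auto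
      also have "\<dots> = 2 * (real a3 / real (a2 + 1))" by simp
      finally have "real a2 * real (a2 + 1) / (\<kappa> * (\<kappa> + 1)) * ?g (a2 + 2) a3 \<le>
          real a2 * real (a2 + 1) / (\<kappa> * (\<kappa> + 1)) * (2 * (real a3 / real (a2 + 1)))"
        using \<kappa> by (intro mult_left_mono) auto
      also have "\<dots> = 2 * (real a2 * real a3) / (\<kappa> * (\<kappa> + 1)) * (real (a2 + 1) / real (a2 + 1))"
        by (simp only: times_divide_eq_right times_divide_eq_left divide_divide_eq_left mult_ac)
      also have "real (a2 + 1) / real (a2 + 1) = 1" by simp
      also have "2 * (real a2 * real a3) / (\<kappa> * (\<kappa> + 1)) * 1 = 2 * (real a2 * real a3) / (\<kappa> * (\<kappa> + 1))" by simp
      also have "\<dots> \<le> 2 * (real a2 * real a3) / (\<kappa> * \<kappa>)" using \<kappa> by (intro divide_left_mono) auto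
      finally show ?thesis by simp
    qed
    \<comment> \<open>Every term is bounded by products of shares of two different classes. Each
      product contains a class other than \<open>l0\<close>, whose share bounds it, so S is at most
      twice the sum of the shares outside \<open>l0\<close>; thus 12 becomes 24.\<close>
    define S where "S = x1 * x2 + x1 * x3 + x2 * x3"
    have p: "0 \<le> x1 * x2" "0 \<le> x1 * x3" "0 \<le> x2 * x3" using x01 by auto
    have "a_coeff YQS sch t = real a1 / \<kappa> * ?g (a1 + 1) (a2 + a3) + real a2 / \<kappa> * ?g a1 (a2 + a3 + 1)
       + real a1 * real a2 / (\<kappa> * (\<kappa> + 1)) * ?g (a2 + 1) a3 + real a1 * real a3 / (\<kappa> * (\<kappa> + 1)) * ?g a2 (a3 + 1)
       + real a2 * real (a2 + 1) / (\<kappa> * (\<kappa> + 1)) * ?g (a2 + 2) a3 + real a2 * real a3 / (\<kappa> * (\<kappa> + 1)) * ?g (a2 + 1) (a3 + 1)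
       + real a3 / \<kappa> * ?g (a1 + a2) (a3 + 1) + real a1 * real a3 / (\<kappa> * (\<kappa> + 1)) * ?g (a1 + 1) a2
       + real a2 * real a3 / (\<kappa> * (\<kappa> + 1)) * ?g a1 (a2 + 1)"
      unfolding a_coeff.simps Let_def a[symmetric] \<kappa>_def[symmetric] by simp
    also have "\<dots> \<le> 2 * (x1 * (x2 + x3)) + 2 * (x1 * x2) + x1 * x2 + x1 * x3 + 2 * (x2 * x3) + x2 * x3
        + 2 * ((x1 + x2) * x3) + x1 * x3 + x2 * x3"
      unfolding x add_divide_distrib[symmetric] using pos by (intro add_mono 1 2 5 7 one) auto
    also have "\<dots> \<le> 12 * S" using p by (simp add: S_def algebra_simps)
    finally have "a_coeff YQS sch t \<le> 12 * S" .
    moreover have "x1 * x2 \<le> x1" "x1 * x2 \<le> x2" "x1 * x3 \<le> x1" "x1 * x3 \<le> x3" "x2 * x3 \<le> x2" "x2 * x3 \<le> x3"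
      using x01 by (auto simp: mult_left_le mult_left_le_one_le)
    moreover have "l0 = 1 \<or> l0 = 2 \<or> l0 = 3" using l0 YQS by auto
    moreover have "{1..3} - {1::nat} = {2, 3}" "{1..3} - {2::nat} = {1, 3}" "{1..3} - {3::nat} = {1, 2}" by auto
    ultimately have "a_coeff YQS sch t \<le> 24 * (\<Sum>l\<in>{1..3} - {l0}. urn_frac YQS t l)"
      using fr p unfolding S_def by (elim disjE) (simp_all del: a_coeff.simps)
    then show ?thesis by (simp add: YQS del: a_coeff.simps)
  qed
qed

section \<open>Limits along a sequence of sampling parameters\<close>

context
  fixes alg :: algorithm and t :: "nat \<Rightarrow> nat \<Rightarrow> nat" and \<tau> :: "nat \<Rightarrow> real"
  assumes k_inf: "filterlim (\<lambda>j. sample_size alg (t j)) at_top sequentially"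
    and t_lim: "\<forall>l\<in>{1..num_parts alg}. (\<lambda>j. real (t j l) / real (sample_size alg (t j))) \<longlonglongrightarrow> \<tau> l"
begin

abbreviation "kap j \<equiv> real (sample_size alg (t j) + 1)"

lemma kap_inf: "filterlim kap at_top sequentially"
proof -
  have "filterlim (\<lambda>j. real (sample_size alg (t j))) at_top sequentially"
    by (rule filterlim_compose[OF filterlim_real_sequentially k_inf])
  then have "filterlim (\<lambda>j. 1 + real (sample_size alg (t j))) at_top sequentially"
    by (rule filterlim_tendsto_add_at_top[OF tendsto_const])
  then show ?thesis by (simp add: add.commute)
qed

lemma inverse_kap: "(\<lambda>j. c / kap j) \<longlonglongrightarrow> 0"
  by (rule real_tendsto_divide_at_top[OF tendsto_const kap_inf])

text \<open>Bounded shifts and the change of the denominator from k to k + 1 disappear in the limit.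
  The constant c is 1 for the weights \<alpha> and 2 for the estimate of harmonic numbers.\<close>

lemma class_tendsto:
  assumes "l \<in> {1..num_parts alg}"
  shows "(\<lambda>j. (real (t j l) + c) / kap j) \<longlonglongrightarrow> \<tau> l"
proof -
  have "(\<lambda>j. (real (t j l) / real (sample_size alg (t j))) * (1 - 1 / kap j) + c / kap j) \<longlonglongrightarrow> \<tau> l * (1 - 0) + 0"
    using t_lim assms by (intro tendsto_intros inverse_kap) auto
  moreover have "\<forall>\<^sub>F j in sequentially. (real (t j l) / real (sample_size alg (t j))) * (1 - 1 / kap j) + c / kap j = (real (t j l) + c) / kap j"
    using eventually_compose_filterlim[OF eventually_gt_at_top[of 0] k_inf]
  proof eventually_elim
    case (elim j)
    then have "1 - 1 / kap j = real (sample_size alg (t j)) / kap j" by (simp add: field_simps)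
    with elim show ?case by (simp add: add_divide_distrib)
  qed
  ultimately show ?thesis using Lim_transform_eventually by fastforce
qed

lemma urn_frac_tendsto: "l \<in> {1..num_parts alg} \<Longrightarrow> (\<lambda>j. urn_frac alg (t j) l) \<longlonglongrightarrow> \<tau> l"
  using class_tendsto[of l 1] by (simp add: urn_frac_def add.commute)

lemma sum_tau: "(\<Sum>l\<in>{1..num_parts alg}. \<tau> l) = 1"
proof -
  have "(\<lambda>j. \<Sum>l\<in>{1..num_parts alg}. urn_frac alg (t j) l) \<longlonglongrightarrow> (\<Sum>l\<in>{1..num_parts alg}. \<tau> l)"
    by (intro tendsto_sum urn_frac_tendsto)
  then show ?thesis unfolding sum_urn_frac by (simp add: LIMSEQ_const_iff)
qed

lemma tau_bounds: "l \<in> {1..num_parts alg} \<Longrightarrow> 0 \<le> \<tau> l \<and> \<tau> l \<le> 1"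
  using urn_frac_tendsto[of l] urn_frac_bounds[of l alg]
  by (auto intro: LIMSEQ_le_const LIMSEQ_le_const2 less_imp_le)

lemma entropy_tendsto: "(\<lambda>j. \<H> alg (t j)) \<longlonglongrightarrow> \<H>_limit alg \<tau>"
proof -
  have "(\<lambda>j. urn_frac alg (t j) l * (harm (sample_size alg (t j) + 1) - harm (t j l + 1))) \<longlonglongrightarrow> - (\<tau> l * ln (\<tau> l))"
    if l: "l \<in> {1..num_parts alg}" for l
    unfolding urn_frac_def
  proof (rule entropy_term_tendsto)
    show "t j l + 1 \<le> sample_size alg (t j) + 1" for j
      using urn_frac_bounds(2)[OF l, of "t j"] by (simp add: urn_frac_def)
    show "filterlim (\<lambda>j. real (sample_size alg (t j) + 1)) at_top sequentially" by (rule kap_inf)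
    show "(\<lambda>j. real (t j l + 1) / real (sample_size alg (t j) + 1)) \<longlonglongrightarrow> \<tau> l"
      using urn_frac_tendsto[OF l] by (simp add: urn_frac_def)
  qed simp
  then have "(\<lambda>j. \<H> alg (t j)) \<longlonglongrightarrow> (\<Sum>l\<in>{1..num_parts alg}. - (\<tau> l * ln (\<tau> l)))"
    unfolding entropy_eq_urn_frac by (intro tendsto_sum)
  then show ?thesis by (simp add: \<H>_limit_def sum_negf)
qed

text \<open>Index shifts of g vanish in the limit, so the terms that belong to one location share
  the same value of f and their prefactors add up. The nine terms collapse to four.\<close>

lemma a_coeff_tendsto: "(\<lambda>j. a_coeff alg sch (t j)) \<longlonglongrightarrow> a_limit alg sch \<tau>"
proof (cases alg)
  case CQS
  have \<tau>: "\<tau> 1 + \<tau> 2 = 1" "0 \<le> \<tau> 1" "\<tau> 1 \<le> 1" using sum_tau tau_bounds[of 1] CQS by (auto simp: eval_nat_numeral)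
  have "(\<lambda>j. 1 * g_coeff sch (t j 1 + 1) (t j 2 + 1)) \<longlonglongrightarrow> 1 * miss_rate sch (\<tau> 1 / (\<tau> 1 + \<tau> 2))"
    using class_tendsto[of 1 1] class_tendsto[of 2 1] CQS \<tau>
    by (intro g_coeff_tendsto[OF _ _ kap_inf] tendsto_const) (auto simp: add.commute)
  then show ?thesis using \<tau> CQS by (simp add: steady_miss_rate_eq)
next
  case YQS
  let ?f = "miss_rate sch" and ?g = "g_coeff sch"
  have sum: "\<tau> 1 + \<tau> 2 + \<tau> 3 = 1" using sum_tau YQS by (simp add: eval_nat_numeral)
  have \<tau>: "0 \<le> \<tau> 1" "0 \<le> \<tau> 2" "0 \<le> \<tau> 3" using tau_bounds[of 1] tau_bounds[of 2] tau_bounds[of 3] YQS by auto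
  define a1 a2 a3 where a: "a1 j = t j 1 + 1" "a2 j = t j 2 + 1" "a3 j = t j 3 + 1" for j
  have pos: "a1 j > 0" "a2 j > 0" "a3 j > 0" for j by (auto simp: a)
  define \<kappa> where "\<kappa> j = real (a1 j + a2 j + a3 j)" for j
  have \<kappa>: "\<kappa> = kap" by (auto simp: \<kappa>_def a YQS sample_size_def eval_nat_numeral fun_eq_iff)
  have \<kappa>pos: "\<kappa> j > 0" for j using pos[of j] by (simp add: \<kappa>_def)
  have L: "(\<lambda>j. real (a1 j) / \<kappa> j) \<longlonglongrightarrow> \<tau> 1" "(\<lambda>j. real (a2 j) / \<kappa> j) \<longlonglongrightarrow> \<tau> 2" "(\<lambda>j. real (a3 j) / \<kappa> j) \<longlonglongrightarrow> \<tau> 3"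
    using class_tendsto[of 1 1] class_tendsto[of 2 1] class_tendsto[of 3 1] YQS unfolding \<kappa> by (simp_all add: a add_ac)
  have inf: "filterlim \<kappa> at_top sequentially" unfolding \<kappa> by (rule kap_inf)
  have one: "(\<lambda>j. \<kappa> j / (\<kappa> j + 1)) \<longlonglongrightarrow> 1"
  proof -
    have "filterlim (\<lambda>j. 1 + \<kappa> j) at_top sequentially"
      by (rule filterlim_tendsto_add_at_top[OF tendsto_const inf])
    then have "(\<lambda>j. 1 - 1 / (1 + \<kappa> j)) \<longlonglongrightarrow> 1 - 0"
      by (intro tendsto_diff tendsto_const real_tendsto_divide_at_top[OF tendsto_const])
    moreover have "1 - 1 / (1 + \<kappa> j) = \<kappa> j / (\<kappa> j + 1)" for j using \<kappa>pos[of j] by (simp add: field_simps)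
    ultimately show ?thesis by simp
  qed
  have CC: "(\<lambda>j. x j * y j / (\<kappa> j * (\<kappa> j + 1))) \<longlonglongrightarrow> X * Y"
    if "(\<lambda>j. x j / \<kappa> j) \<longlonglongrightarrow> X" "(\<lambda>j. y j / \<kappa> j) \<longlonglongrightarrow> Y" for x y X Y
  proof -
    have "(\<lambda>j. (x j / \<kappa> j) * (y j / \<kappa> j) * (\<kappa> j / (\<kappa> j + 1))) \<longlonglongrightarrow> X * Y * 1"
      by (intro tendsto_mult that one)
    moreover have "(x j / \<kappa> j) * (y j / \<kappa> j) * (\<kappa> j / (\<kappa> j + 1)) = x j * y j / (\<kappa> j * (\<kappa> j + 1))" for j
      using \<kappa>pos[of j] by simp
    ultimately show ?thesis by simp
  qed
  have S: "(\<lambda>j. real (x j + y j) / \<kappa> j) \<longlonglongrightarrow> X + Y"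
    if "(\<lambda>j. real (x j) / \<kappa> j) \<longlonglongrightarrow> X" "(\<lambda>j. real (y j) / \<kappa> j) \<longlonglongrightarrow> Y" for x y X Y
    using tendsto_add[OF that] by (simp add: add_divide_distrib)
  have K: "(\<lambda>j. real c / \<kappa> j) \<longlonglongrightarrow> 0" for c using inverse_kap[of "real c"] unfolding \<kappa> .
  note G = g_coeff_tendsto[OF _ _ inf]
  \<comment> \<open>Here and below a summand 0 in the argument of f is the limit of a bounded index
    shift divided by \<kappa>.\<close>
  have t1: "(\<lambda>j. real (a1 j) / \<kappa> j * ?g (a1 j + 1) (a2 j + a3 j)) \<longlonglongrightarrow> \<tau> 1 * ?f ((\<tau> 1 + 0) / (\<tau> 1 + 0 + (\<tau> 2 + \<tau> 3)))"
    by (rule G[OF _ _ S[OF L(1) K[of 1]] S[OF L(2) L(3)] L(1)]) (use pos sum in simp_all)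
  have t2: "(\<lambda>j. real (a2 j) / \<kappa> j * ?g (a1 j) (a2 j + a3 j + 1)) \<longlonglongrightarrow> \<tau> 2 * ?f (\<tau> 1 / (\<tau> 1 + (\<tau> 2 + \<tau> 3 + 0)))"
    by (rule G[OF _ _ L(1) S[OF S[OF L(2) L(3)] K[of 1]] L(2)]) (use pos sum in simp_all)
  have t3: "(\<lambda>j. real (a1 j) * real (a2 j) / (\<kappa> j * (\<kappa> j + 1)) * ?g (a2 j + 1) (a3 j)) \<longlonglongrightarrow> \<tau> 1 * \<tau> 2 * ?f ((\<tau> 2 + 0) / (\<tau> 2 + 0 + \<tau> 3))"
    by (rule G[OF _ _ S[OF L(2) K[of 1]] L(3) CC[OF L(1) L(2)]]) (use pos \<tau> in auto)
  have t4: "(\<lambda>j. real (a1 j) * real (a3 j) / (\<kappa> j * (\<kappa> j + 1)) * ?g (a2 j) (a3 j + 1)) \<longlonglongrightarrow> \<tau> 1 * \<tau> 3 * ?f (\<tau> 2 / (\<tau> 2 + (\<tau> 3 + 0)))"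
    by (rule G[OF _ _ L(2) S[OF L(3) K[of 1]] CC[OF L(1) L(3)]]) (use pos \<tau> in auto)
  have t5: "(\<lambda>j. real (a2 j) * real (a2 j + 1) / (\<kappa> j * (\<kappa> j + 1)) * ?g (a2 j + 2) (a3 j)) \<longlonglongrightarrow> \<tau> 2 * (\<tau> 2 + 0) * ?f ((\<tau> 2 + 0) / (\<tau> 2 + 0 + \<tau> 3))"
    by (rule G[OF _ _ S[OF L(2) K[of 2]] L(3) CC[OF L(2) S[OF L(2) K[of 1]]]]) (use pos \<tau> in auto)
  have t6: "(\<lambda>j. real (a2 j) * real (a3 j) / (\<kappa> j * (\<kappa> j + 1)) * ?g (a2 j + 1) (a3 j + 1)) \<longlonglongrightarrow> \<tau> 2 * \<tau> 3 * ?f ((\<tau> 2 + 0) / (\<tau> 2 + 0 + (\<tau> 3 + 0)))"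
    by (rule G[OF _ _ S[OF L(2) K[of 1]] S[OF L(3) K[of 1]] CC[OF L(2) L(3)]]) (use pos \<tau> in auto)
  have t7: "(\<lambda>j. real (a3 j) / \<kappa> j * ?g (a1 j + a2 j) (a3 j + 1)) \<longlonglongrightarrow> \<tau> 3 * ?f ((\<tau> 1 + \<tau> 2) / (\<tau> 1 + \<tau> 2 + (\<tau> 3 + 0)))"
    by (rule G[OF _ _ S[OF L(1) L(2)] S[OF L(3) K[of 1]] L(3)]) (use pos sum in simp_all)
  have t8: "(\<lambda>j. real (a1 j) * real (a3 j) / (\<kappa> j * (\<kappa> j + 1)) * ?g (a1 j + 1) (a2 j)) \<longlonglongrightarrow> \<tau> 1 * \<tau> 3 * ?f ((\<tau> 1 + 0) / (\<tau> 1 + 0 + \<tau> 2))"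
    by (rule G[OF _ _ S[OF L(1) K[of 1]] L(2) CC[OF L(1) L(3)]]) (use pos \<tau> in auto)
  have t9: "(\<lambda>j. real (a2 j) * real (a3 j) / (\<kappa> j * (\<kappa> j + 1)) * ?g (a1 j) (a2 j + 1)) \<longlonglongrightarrow> \<tau> 2 * \<tau> 3 * ?f (\<tau> 1 / (\<tau> 1 + (\<tau> 2 + 0)))"
    by (rule G[OF _ _ L(1) S[OF L(2) K[of 1]] CC[OF L(2) L(3)]]) (use pos \<tau> in auto)
  define F1 F2 F3 F4 where F: "F1 = ?f (\<tau> 1)" "F2 = ?f (\<tau> 2 / (\<tau> 2 + \<tau> 3))" "F3 = ?f (\<tau> 1 + \<tau> 2)" "F4 = ?f (\<tau> 1 / (\<tau> 1 + \<tau> 2))"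
  have s1: "\<tau> 1 + (\<tau> 2 + \<tau> 3) = 1" using sum by simp
  have "(\<lambda>j. a_coeff YQS sch (t j)) \<longlonglongrightarrow> \<tau> 1 * F1 + \<tau> 2 * F1 + \<tau> 1 * \<tau> 2 * F2 + \<tau> 1 * \<tau> 3 * F2 + \<tau> 2 * \<tau> 2 * F2
      + \<tau> 2 * \<tau> 3 * F2 + \<tau> 3 * F3 + \<tau> 1 * \<tau> 3 * F4 + \<tau> 2 * \<tau> 3 * F4"
  proof -
    have "a_coeff YQS sch (t j) = real (a1 j) / \<kappa> j * ?g (a1 j + 1) (a2 j + a3 j) + real (a2 j) / \<kappa> j * ?g (a1 j) (a2 j + a3 j + 1)
       + real (a1 j) * real (a2 j) / (\<kappa> j * (\<kappa> j + 1)) * ?g (a2 j + 1) (a3 j) + real (a1 j) * real (a3 j) / (\<kappa> j * (\<kappa> j + 1)) * ?g (a2 j) (a3 j + 1)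
       + real (a2 j) * real (a2 j + 1) / (\<kappa> j * (\<kappa> j + 1)) * ?g (a2 j + 2) (a3 j) + real (a2 j) * real (a3 j) / (\<kappa> j * (\<kappa> j + 1)) * ?g (a2 j + 1) (a3 j + 1)
       + real (a3 j) / \<kappa> j * ?g (a1 j + a2 j) (a3 j + 1) + real (a1 j) * real (a3 j) / (\<kappa> j * (\<kappa> j + 1)) * ?g (a1 j + 1) (a2 j)
       + real (a2 j) * real (a3 j) / (\<kappa> j * (\<kappa> j + 1)) * ?g (a1 j) (a2 j + 1)" for j
      unfolding a_coeff.simps Let_def a[symmetric] \<kappa>_def[symmetric] by simp
    then show ?thesis
      using t1 t2 t3 t4 t5 t6 t7 t8 t9 unfolding F
      by (simp only: add_0_right s1 div_by_1 sum) (intro tendsto_add)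
  qed
  moreover have "steady_miss_rate sch (\<tau> 2 + \<tau> 3) = F1"
  proof -
    \<comment> \<open>The stated constant uses the failure probability of the first comparison as
      argument of f; the rate is symmetric in success and failure.\<close>
    have e: "\<tau> 2 + \<tau> 3 = 1 - \<tau> 1" using sum by linarith
    show ?thesis unfolding e F using e \<tau> by (subst steady_miss_rate_eq) (auto simp: miss_rate_sym)
  qed
  moreover have "steady_miss_rate sch (\<tau> 2 / (\<tau> 2 + \<tau> 3)) = F2"
    using \<tau> by (subst steady_miss_rate_eq) (auto simp: F divide_le_eq_1 intro: divide_nonneg_nonneg)
  moreover have "steady_miss_rate sch (\<tau> 1 + \<tau> 2) = F3"
    using \<tau> sum by (subst steady_miss_rate_eq) (auto simp: F)
  moreover have "steady_miss_rate sch (\<tau> 1 / (\<tau> 1 + \<tau> 2)) = F4"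
    using \<tau> by (subst steady_miss_rate_eq) (auto simp: F divide_le_eq_1 intro: divide_nonneg_nonneg)
  ultimately show ?thesis unfolding YQS a_limit.simps Let_def by (simp add: algebra_simps)
qed

text \<open>Both quantities are compared with the total share S of the vanishing classes: the
  numerator is O(S), whereas the entropy weights each such share with a difference of harmonic
  numbers that tends to infinity.\<close>

lemma quotient_tendsto_unit_vector:
  assumes l0: "l0 \<in> {1..num_parts alg}" and \<tau>: "\<And>l. l \<in> {1..num_parts alg} \<Longrightarrow> l \<noteq> l0 \<Longrightarrow> \<tau> l = 0"
  shows "(\<lambda>j. a_coeff alg sch (t j) / \<H> alg (t j)) \<longlonglongrightarrow> 0"
proof (rule LIMSEQ_I)
  fix r :: real assume r: "r > 0"
  \<comment> \<open>The numerator is at most 24 S and the denominator at least M S, so any constant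
    above 24 gives a quotient below r.\<close>
  define M where "M = 25 / r"
  have M: "M > 0" using r by (simp add: M_def)
  let ?D = "{1..num_parts alg} - {l0}"
  have ev: "\<forall>\<^sub>F j in sequentially. M \<le> harm (sample_size alg (t j) + 1) - harm (t j l + 1)" if l: "l \<in> ?D" for l
  proof -
    \<comment> \<open>The shift 2 matches \<open>harm_diff_ge\<close>, which adds one to the index t
      j l + 1 inside the logarithm.\<close>
    have "(\<lambda>j. (real (t j l) + 2) / kap j) \<longlonglongrightarrow> 0" using class_tendsto[of l 2] \<tau>[of l] l by auto
    then have "\<forall>\<^sub>F j in sequentially. (real (t j l) + 2) / kap j < exp (- M)" by (rule order_tendstoD) simp
    then show ?thesis
    proof eventually_elim
      case (elim j)
      have le: "t j l + 1 \<le> sample_size alg (t j) + 1"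
        using urn_frac_bounds(2)[of l alg "t j"] l by (simp add: urn_frac_def)
      have "exp M \<le> kap j / (real (t j l) + 2)"
        using elim by (simp add: exp_minus field_simps)
      then have "M \<le> ln (kap j / (real (t j l) + 2))"
        by (subst ln_ge_iff) (auto intro: less_le_trans[OF exp_gt_zero])
      also have "\<dots> \<le> ln (real (sample_size alg (t j) + 1 + 1) / real (t j l + 1 + 1))"
        by (intro ln_mono divide_right_mono) (auto intro!: divide_pos_pos simp: add_ac divide_right_mono)
      also have "\<dots> \<le> harm (sample_size alg (t j) + 1) - harm (t j l + 1)" by (rule harm_diff_ge[OF le])
      finally show ?case .
    qed
  qed
  have "\<forall>\<^sub>F j in sequentially. \<forall>l\<in>?D. M \<le> harm (sample_size alg (t j) + 1) - harm (t j l + 1)"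
    using ev by (intro eventually_ball_finite) auto
  then have "\<forall>\<^sub>F j in sequentially. norm (a_coeff alg sch (t j) / \<H> alg (t j) - 0) < r"
  proof eventually_elim
    case (elim j)
    define S where "S = (\<Sum>l\<in>?D. urn_frac alg (t j) l)"
    have "?D \<noteq> {}" by (cases alg) (auto simp: set_eq_iff eval_nat_numeral intro: exI[of _ "if l0 = 1 then 2 else 1"])
    then have S: "S > 0" unfolding S_def using urn_frac_bounds(1) by (intro sum_pos) auto
    have "M * S = (\<Sum>l\<in>?D. urn_frac alg (t j) l * M)" by (simp add: S_def sum_distrib_left mult.commute)
    also have "\<dots> \<le> (\<Sum>l\<in>?D. urn_frac alg (t j) l * (harm (sample_size alg (t j) + 1) - harm (t j l + 1)))"
      using elim urn_frac_bounds(1) by (intro sum_mono mult_left_mono) (auto intro: less_imp_le)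
    also have "\<dots> \<le> \<H> alg (t j)"
      unfolding entropy_eq_urn_frac
    proof (rule sum_mono2)
      fix l assume "l \<in> {1..num_parts alg} - ?D"
      then have l: "l \<in> {1..num_parts alg}" by simp
      have "t j l + 1 \<le> sample_size alg (t j) + 1"
        using urn_frac_bounds(2)[OF l, of "t j"] by (simp add: urn_frac_def)
      then have "harm (t j l + 1) \<le> (harm (sample_size alg (t j) + 1) :: real)" by (rule harm_mono)
      then show "0 \<le> urn_frac alg (t j) l * (harm (sample_size alg (t j) + 1) - harm (t j l + 1))"
        using urn_frac_bounds(1)[OF l] by (intro mult_nonneg_nonneg) (auto intro: less_imp_le)
    qed auto
    finally have H: "M * S \<le> \<H> alg (t j)" .
    have "a_coeff alg sch (t j) \<le> 24 * S" unfolding S_def by (rule a_coeff_le[OF l0])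
    also have "24 * S < r * (M * S)" using S r by (simp add: M_def)
    also have "\<dots> \<le> r * \<H> alg (t j)" using H r by (intro mult_left_mono) auto
    finally have "a_coeff alg sch (t j) / \<H> alg (t j) < r"
      using entropy_pos by (simp add: divide_less_eq)
    then show ?case using a_coeff_pos entropy_pos by (simp add: abs_of_pos)
  qed
  then show "\<exists>no. \<forall>n\<ge>no. norm (a_coeff alg sch (t n) / \<H> alg (t n) - 0) < r"
    by (simp add: eventually_sequentially)
qed

text \<open>Each summand of the entropy is nonnegative and vanishes only at 0 and 1; since the
  components sum to 1, exactly one of them equals 1.\<close>

lemma entropy_limit_zero:
  assumes "\<H>_limit alg \<tau> = 0"
  shows "\<exists>l0\<in>{1..num_parts alg}. \<forall>l\<in>{1..num_parts alg}. l \<noteq> l0 \<longrightarrow> \<tau> l = 0"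
proof -
  let ?I = "{1..num_parts alg}"
  have nonneg: "0 \<le> - (\<tau> l * ln (\<tau> l))" if "l \<in> ?I" for l
    using tau_bounds[OF that] by (cases "\<tau> l = 0") (auto simp: mult_le_0_iff)
  have "(\<Sum>l\<in>?I. - (\<tau> l * ln (\<tau> l))) = 0" using assms by (simp add: \<H>_limit_def sum_negf)
  then have "- (\<tau> l * ln (\<tau> l)) = 0" if "l \<in> ?I" for l
    using nonneg that by (subst (asm) sum_nonneg_eq_0_iff) auto
  then have 01: "\<tau> l = 0 \<or> \<tau> l = 1" if "l \<in> ?I" for l
    using tau_bounds[OF that] that by (metis ln_eq_zero_iff less_le mult_eq_0_iff neg_equal_0_iff_equal)
  have "\<exists>l0\<in>?I. \<tau> l0 \<noteq> 0"
  proof (rule ccontr)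
    assume "\<not> (\<exists>l0\<in>?I. \<tau> l0 \<noteq> 0)"
    then have "(\<Sum>l\<in>?I. \<tau> l) = 0" by (intro sum.neutral) auto
    with sum_tau show False by simp
  qed
  then obtain l0 where l0: "l0 \<in> ?I" "\<tau> l0 = 1" using 01 by blast
  have "(\<Sum>l\<in>?I - {l0}. \<tau> l) = 0" using sum_tau l0 sum.remove[of ?I l0 \<tau>] by simp
  then have "\<forall>l\<in>?I - {l0}. \<tau> l = 0"
    using tau_bounds by (subst (asm) sum_nonneg_eq_0_iff) auto
  then show ?thesis using l0 by blast
qed

lemma quotient_tendsto:
  "(\<lambda>j. a_coeff alg sch (t j) / \<H> alg (t j)) \<longlonglongrightarrow> a_limit alg sch \<tau> / \<H>_limit alg \<tau>"
proof (cases "\<H>_limit alg \<tau> = 0")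
  case True
  then obtain l0 where "l0 \<in> {1..num_parts alg}" "\<And>l. l \<in> {1..num_parts alg} \<Longrightarrow> l \<noteq> l0 \<Longrightarrow> \<tau> l = 0"
    using entropy_limit_zero by blast
  from quotient_tendsto_unit_vector[OF this] show ?thesis using True by simp
qed (intro tendsto_divide a_coeff_tendsto entropy_tendsto)

end

theorem theorem5p1:
  fixes alg :: algorithm and sch :: scheme
  shows
    "(\<forall>(t :: nat \<Rightarrow> nat) (w :: nat) (\<sigma> :: location \<Rightarrow> nat).
        sample_size alg t \<le> w \<longrightarrow> range \<sigma> \<subseteq> states sch \<longrightarrow>
        (\<lambda>n. expected_BM alg sch t w \<sigma> n)
          \<sim>[at_top] (\<lambda>n. a_coeff alg sch t / \<H> alg t * (real n * ln (real n))))
   \<and> (\<forall>(t :: nat \<Rightarrow> nat \<Rightarrow> nat) (w :: nat \<Rightarrow> nat) (\<sigma> :: nat \<Rightarrow> location \<Rightarrow> nat) (\<tau> :: nat \<Rightarrow> real).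
        (\<forall>j. sample_size alg (t j) \<le> w j) \<longrightarrow> (\<forall>j. range (\<sigma> j) \<subseteq> states sch) \<longrightarrow>
        (\<forall>l\<in>{1..num_parts alg}. \<tau> l \<in> {0..1}) \<longrightarrow>
        filterlim (\<lambda>j. sample_size alg (t j)) at_top sequentially \<longrightarrow>
        (\<forall>l\<in>{1..num_parts alg}.
           (\<lambda>j. real (t j l) / real (sample_size alg (t j))) \<longlonglongrightarrow> \<tau> l) \<longrightarrow>
        (\<exists>c :: nat \<Rightarrow> real.
           (\<forall>j. (\<lambda>n. expected_BM alg sch (t j) (w j) (\<sigma> j) n)
                  \<sim>[at_top] (\<lambda>n. c j * (real n * ln (real n))))
           \<and> c \<longlonglongrightarrow> a_limit alg sch \<tau> / \<H>_limit alg \<tau>))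
   \<and> (\<forall>p\<in>{0..1}. steady_miss_rate sch p =
        (case sch of
           One_Bit \<Rightarrow> 2 * p * (1 - p)
         | Two_Bit_SC \<Rightarrow> p * (1 - p) / (1 - 2 * p * (1 - p))
         | Two_Bit_FC \<Rightarrow> (2 * p ^ 2 * (1 - p) ^ 2 + p * (1 - p)) / (1 - p * (1 - p))))"
proof (intro conjI allI impI ballI)
  show "(\<lambda>n. expected_BM alg sch t w \<sigma> n)
      \<sim>[at_top] (\<lambda>n. a_coeff alg sch t / \<H> alg t * (real n * ln (real n)))"
    if "sample_size alg t \<le> w" "range \<sigma> \<subseteq> states sch" for t w \<sigma>
    using that by (rule expected_BM_asymp)
next
  fix t :: "nat \<Rightarrow> nat \<Rightarrow> nat" and w :: "nat \<Rightarrow> nat" and \<sigma> :: "nat \<Rightarrow> location \<Rightarrow> nat" and \<tau> :: "nat \<Rightarrow> real"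
  assume w: "\<forall>j. sample_size alg (t j) \<le> w j" and \<sigma>: "\<forall>j. range (\<sigma> j) \<subseteq> states sch"
    and k: "filterlim (\<lambda>j. sample_size alg (t j)) at_top sequentially"
    and \<tau>: "\<forall>l\<in>{1..num_parts alg}. (\<lambda>j. real (t j l) / real (sample_size alg (t j))) \<longlonglongrightarrow> \<tau> l"
  show "\<exists>c :: nat \<Rightarrow> real.
      (\<forall>j. (\<lambda>n. expected_BM alg sch (t j) (w j) (\<sigma> j) n) \<sim>[at_top] (\<lambda>n. c j * (real n * ln (real n))))
      \<and> c \<longlonglongrightarrow> a_limit alg sch \<tau> / \<H>_limit alg \<tau>"
  proof (intro exI conjI allI)
    \<comment> \<open>The limit in n is taken first: c j is the constant of the fixed sampling
      parameter t j, and only then does the sample grow.\<close>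
    show "(\<lambda>j. a_coeff alg sch (t j) / \<H> alg (t j)) \<longlonglongrightarrow> a_limit alg sch \<tau> / \<H>_limit alg \<tau>"
      by (rule quotient_tendsto[OF k \<tau>])
    show "(\<lambda>n. expected_BM alg sch (t j) (w j) (\<sigma> j) n)
        \<sim>[at_top] (\<lambda>n. a_coeff alg sch (t j) / \<H> alg (t j) * (real n * ln (real n)))" for j
      using w \<sigma> by (intro expected_BM_asymp) auto
  qed
next
  fix p :: real assume "p \<in> {0..1}"
  then show "steady_miss_rate sch p =
      (case sch of
         One_Bit \<Rightarrow> 2 * p * (1 - p)
       | Two_Bit_SC \<Rightarrow> p * (1 - p) / (1 - 2 * p * (1 - p))
       | Two_Bit_FC \<Rightarrow> (2 * p ^ 2 * (1 - p) ^ 2 + p * (1 - p)) / (1 - p * (1 - p)))"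
    by (cases sch) (simp_all add: steady_miss_rate_eq)
qed

end
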